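(* Let $f\colon \Sigma\to \mathbf{H}^{3}$ be a weakly complete flat front with ratio of canonical forms $\rho\colon\widetilde\Sigma\to\mathbf{C}\cup\{\infty\}$, where $\widetilde{\Sigma}$ is the universal cover of $\Sigma$. Let $\alpha_{1},\ldots,\alpha_{7}\in\mathbf{C}$ be distinct, and for $\varepsilon>0$ let $D(\alpha_{j},\varepsilon):=\{z\in\mathbf{C}:|z-\alpha_{j}|<\varepsilon\}$ $(1\le j\le 7)$. Then there exists $\varepsilon>0$ such that if $\rho$ has no simple island over any of the disks $D(\alpha_{j},\varepsilon)$, $1\le j\le 7$, then $f$ is congruent to a horosphere or a hyperbolic cylinder.
   Context: Hyperbolic space. $\mathbf{L}^4$ is Lorentz–Minkowski 4-space of signature $(-,+,+,+)$, identified with the $2\times 2$ Hermitian matrices by $(x_0,x_1,x_2,x_3)\leftrightarrow \begin{pmatrix} x_0+x_3 & x_1+ix_2\\ x_1-ix_2 & x_0-x_3\end{pmatrix}$, with $\langle X,X\rangle=-\det X$. Then $\mathbf{H}^3=\{X \text{ Hermitian}: \det X=1,\ \operatorname{trace}X>0\}=\{aa^{*}: a\in SL(2,\mathbf{C})\}$, $a^{*}={}^t\bar a$, with the induced metric (constant curvature $-1$). Fronts. Let $\Sigma$ be a (connected) oriented 2-manifold. A smooth map $f\colon\Sigma\to\mathbf{H}^3$ is a front if there is a Legendrian immersion $L_f\colon\Sigma\to T_1^{*}\mathbf{H}^3$ whose projection is $f$; identifying $T_1^*\mathbf{H}^3$ with $T_1\mathbf{H}^3$, $L_f=(f,n)$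 is an immersion where $n(p)\in T_{f(p)}\mathbf{H}^3$ is a unit vector with $\langle df(p),n(p)\rangle=0$ ($n$ is the unit normal vector field). The parallel front at distance $t$ is $f_t=(\cosh t)f+(\sinh t)n$ with unit normal $n_t=(\cosh t)n+(\sinh t)f$. A front $f$ is flat if for each $p\in\Sigma$ there is $t\in\mathbf{R}$ such that $f_t$ is a flat immersion (zero Gaussian curvature) at $p$. Canonical forms. For a flat front $f$ there exist a unique complex structure on $\Sigma$ and a holomorphic immersion $\mathcal{E}_f\colon\widetilde\Sigma\to SL(2,\mathbf{C})$ on the universal cover $\widetilde\Sigma$ such that $f=\mathcal{E}_f\mathcal{E}_f^{*}$, $n=\mathcal{E}_f e_3\mathcal{E}_f^{*}$ with $e_3=\mathrm{diag}(1,-1)$, and $\mathcal{E}_f$ is Legendrian, i.e. $\mathcal{E}_f^{-1}d\mathcal{E}_f$ is off-diagonal: $\mathcal{E}_f^{-1}d\mathcal{E}_f=\begin{pmatrix}0&\theta\\ \omega&0\end{pmatrix}$ with holomorphic 1-forms $\omega,\theta$ on $\widetilde\Sigma$, called the canonical forms of $f$. The surface $\Sigma$ is always regarded as a Riemann surface with this complex structure. The ratio of canonical forms is the meromorphic function $\rho=\theta/\omega\colon\widetilde\Sigma\to\mathbf{C}\cup\{\infty\}$ ($\rho\equiv\infty$ if $\omega\equiv0$). (The lift $\mathcal{E}_f$ can be changed by right multiplication by $\mathrm{diag}(e^{i\tau},e^{-i\tau})$, $\tau\in\mathbf{R}$, which multiplies $\rho$ by a unit complex constant; fix any choice.) Weak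 completeness. $|\omega|^2$ and $|\theta|^2$ are well defined on $\Sigma$, and $ds^2_{1,1}=|\omega|^2+|\theta|^2=(1+|\rho|^2)|\omega|^2$ is a positive definite conformal metric on $\Sigma$. The flat front $f$ is weakly complete if $ds^2_{1,1}$ is complete. A hyperbolic cylinder is a surface equidistant from a geodesic of $\mathbf{H}^3$ (the set of points at constant distance $r\ge 0$ from the geodesic; the degenerate case $r=0$, in which the image of the front is the geodesic itself, is included). "$f$ is congruent to a horosphere or a hyperbolic cylinder" means that, up to an isometry of $\mathbf{H}^3$, the image of $f$ is such a surface. Islands. Let $S$ be a Riemann surface, $h\colon S\to\mathbf{C}\cup\{\infty\}$ a meromorphic function and $V\subset\mathbf{C}\cup\{\infty\}$ a Jordan domain. A simply connected component $U$ of $h^{-1}(V)$ that is relatively compact in $S$ is called an island of $h$ over $V$. Then $h|_U\colon U\to V$ is a proper map; its degree is the multiplicity of the island, and an island of multiplicity one is called simple. Here this is applied with $S=\widetilde\Sigma$, $h=\rho$. *)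

theory Defs
  imports "HOL-Complex_Analysis.Complex_Analysis"
begin

section \<open>Hyperbolic 3-space in the Hermitian model\<close>

type_synonym mat2 = "complex^2^2"

definition adjoint_mat :: "mat2 \<Rightarrow> mat2" where
  "adjoint_mat A = (\<chi> i j. cnj (A $ j $ i))"

definition L4 :: "mat2 set" where
  "L4 = {X. adjoint_mat X = X}"

text \<open>The polarization of \<open>\<langle>X, X\<rangle> = - det X\<close>, which is real on Hermitian matrices.\<close>
definition lorentz :: "mat2 \<Rightarrow> mat2 \<Rightarrow> real" where
  "lorentz X Y = - Re (det (X + Y) - det X - det Y) / 2"

definition H3 :: "mat2 set" where
  "H3 = {X \<in> L4. det X = 1 \<and> 0 < Re (trace X)}"

definition tangent_H3 :: "mat2 \<Rightarrow> mat2 set" where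
  "tangent_H3 X = {Y \<in> L4. lorentz X Y = 0}"

definition e3 :: mat2 where
  "e3 = (\<chi> i j. if i = j then (if i = 1 then 1 else -1) else 0)"

definition hyp_dist :: "mat2 \<Rightarrow> mat2 \<Rightarrow> real" where
  "hyp_dist X Y = arcosh (- lorentz X Y)"

definition H3_isometry :: "(mat2 \<Rightarrow> mat2) \<Rightarrow> bool" where
  "H3_isometry \<Phi> \<longleftrightarrow> bij_betw \<Phi> H3 H3 \<and>
     (\<forall>X\<in>H3. \<forall>Y\<in>H3. hyp_dist (\<Phi> X) (\<Phi> Y) = hyp_dist X Y)"

definition H3_geodesic :: "mat2 set \<Rightarrow> bool" where
  "H3_geodesic g \<longleftrightarrow> (\<exists>X\<in>H3. \<exists>V\<in>tangent_H3 X. lorentz V V = 1 \<and>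
     g = range (\<lambda>t. cosh t *\<^sub>R X + sinh t *\<^sub>R V))"

text \<open>Horospheres are the sections of the hyperboloid by affine hyperplanes with a lightlike
  normal; \<open>V\<close> represents the centre at infinity, and its scaling selects the horosphere.\<close>
definition horosphere :: "mat2 set \<Rightarrow> bool" where
  "horosphere S \<longleftrightarrow> (\<exists>V\<in>L4. det V = 0 \<and> 0 < Re (trace V) \<and>
     S = {X \<in> H3. lorentz X V = -1})"

definition hyperbolic_cylinder :: "mat2 set \<Rightarrow> bool" where
  "hyperbolic_cylinder S \<longleftrightarrow> (\<exists>g r. H3_geodesic g \<and> 0 \<le> r \<and>
     S = {X \<in> H3. (INF Y\<in>g. hyp_dist X Y) = r})"

definition congruent_to_horosphere_or_cylinder :: "('a \<Rightarrow> mat2) \<Rightarrow> bool" where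
  "congruent_to_horosphere_or_cylinder f \<longleftrightarrow> (\<exists>\<Phi>. H3_isometry \<Phi> \<and>
     (horosphere (\<Phi> ` range f) \<or> hyperbolic_cylinder (\<Phi> ` range f)))"


section \<open>Smooth and complex structures on surfaces\<close>

text \<open>Real coordinates \<open>(u, v)\<close> are written as \<open>u + \<i> v\<close>, so a chart takes values in the complex
  plane in the smooth as well as in the complex case. Only the restriction of the second component
  of a chart to the first is meaningful.\<close>

type_synonym 'a chart = "'a set \<times> ('a \<Rightarrow> complex)"

definition chart_image :: "'a chart \<Rightarrow> complex set" where
  "chart_image c = snd c ` fst c"

definition chart_inv :: "'a chart \<Rightarrow> complex \<Rightarrow> 'a" where
  "chart_inv c = inv_into (fst c) (snd c)"

definition transition :: "'a chart \<Rightarrow> 'a chart \<Rightarrow> complex \<Rightarrow> complex" where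
  "transition c d = snd d \<circ> chart_inv c"

definition surface_atlas :: "'a::topological_space chart set \<Rightarrow> bool" where
  "surface_atlas A \<longleftrightarrow> \<Union> (fst ` A) = UNIV \<and>
     (\<forall>c\<in>A. open (fst c) \<and> open (chart_image c) \<and>
        homeomorphism (fst c) (chart_image c) (snd c) (chart_inv c))"

definition coord_dir :: "2 \<Rightarrow> complex" where
  "coord_dir i = (if i = 1 then 1 else \<i>)"

definition pderiv_dir :: "2 \<Rightarrow> (complex \<Rightarrow> 'v::real_normed_vector) \<Rightarrow> complex \<Rightarrow> 'v" where
  "pderiv_dir i h z = frechet_derivative h (at z) (coord_dir i)"

text \<open>To be used on open sets.\<close>
primrec Ck_on :: "nat \<Rightarrow> complex set \<Rightarrow> (complex \<Rightarrow> 'v::real_normed_vector) \<Rightarrow> bool" where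
  "Ck_on 0 S h \<longleftrightarrow> continuous_on S h"
| "Ck_on (Suc k) S h \<longleftrightarrow> h differentiable_on S \<and> (\<forall>i. Ck_on k S (pderiv_dir i h))"

definition smooth_on :: "complex set \<Rightarrow> (complex \<Rightarrow> 'v::real_normed_vector) \<Rightarrow> bool" where
  "smooth_on S h \<longleftrightarrow> (\<forall>k. Ck_on k S h)"

definition jacobian_det :: "(complex \<Rightarrow> complex) \<Rightarrow> complex \<Rightarrow> real" where
  "jacobian_det h z =
     Re (pderiv_dir 1 h z) * Im (pderiv_dir 2 h z) - Re (pderiv_dir 2 h z) * Im (pderiv_dir 1 h z)"

definition oriented_smooth_atlas :: "'a::topological_space chart set \<Rightarrow> bool" where
  "oriented_smooth_atlas A \<longleftrightarrow> surface_atlas A \<and>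
     (\<forall>c\<in>A. \<forall>d\<in>A. smooth_on (snd c ` (fst c \<inter> fst d)) (transition c d) \<and>
        (\<forall>z\<in>snd c ` (fst c \<inter> fst d). 0 < jacobian_det (transition c d) z))"

text \<open>A complex structure on the smooth surface with atlas \<open>A\<close>. It is not required to induce the
  given orientation: for a flat front, the complex structure, including the orientation that
  comes with it, is determined by the canonical lift below.\<close>
definition complex_structure_on ::
    "'a::topological_space chart set \<Rightarrow> 'a chart set \<Rightarrow> bool" where
  "complex_structure_on A C \<longleftrightarrow> surface_atlas C \<and>
     (\<forall>c\<in>C. \<forall>d\<in>C. transition c d holomorphic_on snd c ` (fst c \<inter> fst d)) \<and>
     (\<forall>c\<in>A. \<forall>d\<in>C. smooth_on (snd c ` (fst c \<inter> fst d)) (transition c d) \<and>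
        smooth_on (snd d ` (fst d \<inter> fst c)) (transition d c))"

definition smooth_map :: "'a chart set \<Rightarrow> ('a \<Rightarrow> 'v::real_normed_vector) \<Rightarrow> bool" where
  "smooth_map A g \<longleftrightarrow> (\<forall>c\<in>A. smooth_on (chart_image c) (g \<circ> chart_inv c))"

definition immersion_at :: "'a chart set \<Rightarrow> ('a \<Rightarrow> 'v::real_normed_vector) \<Rightarrow> 'a \<Rightarrow> bool" where
  "immersion_at A g x \<longleftrightarrow> (\<forall>c\<in>A. x \<in> fst c \<longrightarrow>
     inj (frechet_derivative (g \<circ> chart_inv c) (at (snd c x))))"


section \<open>Gaussian curvature\<close>

definition first_fundamental_form :: "(complex \<Rightarrow> mat2) \<Rightarrow> complex \<Rightarrow> real^2^2" where
  "first_fundamental_form X z = (\<chi> i j. lorentz (pderiv_dir i X z) (pderiv_dir j X z))"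

text \<open>\<open>christoffel g l i j\<close> is \<open>\<Gamma>\<^sup>l\<^sub>i\<^sub>j\<close> of the metric with coefficient matrix \<open>g\<close>.\<close>
definition christoffel :: "(complex \<Rightarrow> real^2^2) \<Rightarrow> 2 \<Rightarrow> 2 \<Rightarrow> 2 \<Rightarrow> complex \<Rightarrow> real" where
  "christoffel g l i j z = (\<Sum>m\<in>UNIV. matrix_inv (g z) $ l $ m *
     (pderiv_dir i (\<lambda>w. g w $ j $ m) z + pderiv_dir j (\<lambda>w. g w $ i $ m) z
       - pderiv_dir m (\<lambda>w. g w $ i $ j) z)) / 2"

text \<open>The \<open>\<partial>\<^sub>l\<close>-component of \<open>R(\<partial>\<^sub>1, \<partial>\<^sub>2)\<partial>\<^sub>2\<close>.\<close>
definition riemann_122 :: "(complex \<Rightarrow> real^2^2) \<Rightarrow> 2 \<Rightarrow> complex \<Rightarrow> real" where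
  "riemann_122 g l z =
     pderiv_dir 1 (christoffel g l 2 2) z - pderiv_dir 2 (christoffel g l 1 2) z
     + (\<Sum>m\<in>UNIV. christoffel g l 1 m z * christoffel g m 2 2 z
                - christoffel g l 2 m z * christoffel g m 1 2 z)"

definition gauss_curvature :: "(complex \<Rightarrow> real^2^2) \<Rightarrow> complex \<Rightarrow> real" where
  "gauss_curvature g z = (\<Sum>l\<in>UNIV. g z $ 1 $ l * riemann_122 g l z) / det (g z)"


section \<open>Flat fronts\<close>

definition front :: "'a chart set \<Rightarrow> ('a \<Rightarrow> mat2) \<Rightarrow> ('a \<Rightarrow> mat2) \<Rightarrow> bool" where
  "front A f n \<longleftrightarrow>
     smooth_map A f \<and> smooth_map A n \<and>
     (\<forall>x. f x \<in> H3 \<and> n x \<in> tangent_H3 (f x) \<and> lorentz (n x) (n x) = 1) \<and>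
     (\<forall>c\<in>A. \<forall>x\<in>fst c. \<forall>v.
        lorentz (frechet_derivative (f \<circ> chart_inv c) (at (snd c x)) v) (n x) = 0) \<and>
     (\<forall>x. immersion_at A (\<lambda>y. (f y, n y)) x)"

definition parallel_front :: "('a \<Rightarrow> mat2) \<Rightarrow> ('a \<Rightarrow> mat2) \<Rightarrow> real \<Rightarrow> 'a \<Rightarrow> mat2" where
  "parallel_front f n t x = cosh t *\<^sub>R f x + sinh t *\<^sub>R n x"

definition flat_immersion_at :: "'a chart set \<Rightarrow> ('a \<Rightarrow> mat2) \<Rightarrow> 'a \<Rightarrow> bool" where
  "flat_immersion_at A g x \<longleftrightarrow> immersion_at A g x \<and>
     (\<forall>c\<in>A. x \<in> fst c \<longrightarrow>
        gauss_curvature (first_fundamental_form (g \<circ> chart_inv c)) (snd c x) = 0)"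

definition flat_front :: "'a chart set \<Rightarrow> ('a \<Rightarrow> mat2) \<Rightarrow> ('a \<Rightarrow> mat2) \<Rightarrow> bool" where
  "flat_front A f n \<longleftrightarrow> front A f n \<and>
     (\<forall>x. \<exists>t. flat_immersion_at A (parallel_front f n t) x)"


section \<open>The universal cover, canonical forms and their ratio\<close>

definition universal_cover :: "('b::topological_space \<Rightarrow> 'a::topological_space) \<Rightarrow> bool" where
  "universal_cover p \<longleftrightarrow>
     covering_space (UNIV::'b set) p (UNIV::'a set) \<and> simply_connected (UNIV::'b set)"

text \<open>The pulled-back complex structure, for which the covering map is a local biholomorphism.\<close>
definition lift_atlas ::
    "'a chart set \<Rightarrow> ('b::topological_space \<Rightarrow> 'a) \<Rightarrow> 'b chart set" where
  "lift_atlas C p = {(V, snd c \<circ> p) | V c. c \<in> C \<and> open V \<and> inj_on p V \<and> p ` V \<subseteq> fst c}"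

definition some_chart :: "'a chart set \<Rightarrow> 'a \<Rightarrow> 'a chart" where
  "some_chart K x = (SOME c. c \<in> K \<and> x \<in> fst c)"

definition coord_deriv :: "('b \<Rightarrow> mat2) \<Rightarrow> 'b chart \<Rightarrow> 'b \<Rightarrow> mat2" where
  "coord_deriv E c x = (\<chi> i j. deriv (\<lambda>w. E (chart_inv c w) $ i $ j) (snd c x))"

text \<open>The coefficient of \<open>dz\<close> in \<open>E\<^sup>-\<^sup>1 dE\<close>, where \<open>z\<close> is the coordinate of the chart \<open>c\<close>.\<close>
definition maurer_cartan :: "('b \<Rightarrow> mat2) \<Rightarrow> 'b chart \<Rightarrow> 'b \<Rightarrow> mat2" where
  "maurer_cartan E c x = matrix_inv (E x) ** coord_deriv E c x"

definition canonical_omega :: "('b \<Rightarrow> mat2) \<Rightarrow> 'b chart \<Rightarrow> 'b \<Rightarrow> complex" where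
  "canonical_omega E c x = maurer_cartan E c x $ 2 $ 1"

definition canonical_theta :: "('b \<Rightarrow> mat2) \<Rightarrow> 'b chart \<Rightarrow> 'b \<Rightarrow> complex" where
  "canonical_theta E c x = maurer_cartan E c x $ 1 $ 2"

definition canonical_lift ::
    "'a chart set \<Rightarrow> ('b::topological_space \<Rightarrow> 'a) \<Rightarrow> ('a \<Rightarrow> mat2) \<Rightarrow> ('a \<Rightarrow> mat2) \<Rightarrow>
     ('b \<Rightarrow> mat2) \<Rightarrow> bool" where
  "canonical_lift C p f n E \<longleftrightarrow>
     (\<forall>x. det (E x) = 1 \<and> f (p x) = E x ** adjoint_mat (E x) \<and>
          n (p x) = E x ** e3 ** adjoint_mat (E x)) \<and>
     (\<forall>c\<in>lift_atlas C p.
        (\<forall>i j. (\<lambda>w. E (chart_inv c w) $ i $ j) holomorphic_on chart_image c) \<and>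
        (\<forall>x\<in>fst c. coord_deriv E c x \<noteq> 0 \<and>
           maurer_cartan E c x $ 1 $ 1 = 0 \<and> maurer_cartan E c x $ 2 $ 2 = 0))"

text \<open>The Riemann sphere is \<^typ>\<open>complex option\<close>, with \<^term>\<open>None\<close> as the point at infinity. As a
  lift \<open>E\<close> is an immersion, the canonical forms have no common zeros, so the meromorphic quotient
  has the value given here at every point; it is independent of the chart.\<close>
definition ratio ::
    "'a chart set \<Rightarrow> ('b::topological_space \<Rightarrow> 'a) \<Rightarrow> ('b \<Rightarrow> mat2) \<Rightarrow> 'b \<Rightarrow> complex option" where
  "ratio C p E x =
     (let c = some_chart (lift_atlas C p) x
      in if canonical_omega E c x = 0 then None
         else Some (canonical_theta E c x / canonical_omega E c x))"


section \<open>Weak completeness\<close>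

text \<open>The conformal factor of \<open>ds\<^sup>2 = \<bar>\<omega>\<bar>\<^sup>2 + \<bar>\<theta>\<bar>\<^sup>2\<close> on the base surface, that is, \<open>ds / \<bar>dz\<bar>\<close> at \<open>q\<close> for
  the coordinate \<open>z\<close> of the chart \<open>c\<close>. It is evaluated at an arbitrary point of the fibre over \<open>q\<close>,
  in the coordinate \<open>z \<circ> p\<close>; for a canonical lift it depends on neither choice, because two
  points of a fibre are related by a change of lift that multiplies \<open>\<omega>\<close> and \<open>\<theta>\<close> by unit
  constants.\<close>
definition ds11 ::
    "('b::topological_space \<Rightarrow> 'a) \<Rightarrow> ('b \<Rightarrow> mat2) \<Rightarrow> 'a chart \<Rightarrow> 'a \<Rightarrow> real" where
  "ds11 p E c q =
     (let x = (SOME x. p x = q); d = some_chart (lift_atlas {c} p) x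
      in sqrt ((cmod (canonical_omega E d x))\<^sup>2 + (cmod (canonical_theta E d x))\<^sup>2))"

text \<open>\<open>joined_with_length C g x y L\<close>: a piecewise continuously differentiable path from \<open>x\<close> to \<open>y\<close> has
  length \<open>L\<close> in the conformal metric \<open>g\<close>. Such a path is a finite chain of
  arcs, each lying in a single chart.\<close>
inductive joined_with_length ::
    "'a chart set \<Rightarrow> ('a chart \<Rightarrow> 'a \<Rightarrow> real) \<Rightarrow> 'a \<Rightarrow> 'a \<Rightarrow> real \<Rightarrow> bool"
  for C g where
  "joined_with_length C g x x 0"
| "\<lbrakk>joined_with_length C g x (chart_inv c (\<gamma> a)) L; c \<in> C; a \<le> b;
    \<gamma> C1_differentiable_on {a..b}; \<gamma> ` {a..b} \<subseteq> chart_image c\<rbrakk>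
   \<Longrightarrow> joined_with_length C g x (chart_inv c (\<gamma> b))
        (L + integral {a..b} (\<lambda>t. g c (chart_inv c (\<gamma> t)) * norm (vector_derivative \<gamma> (at t))))"

definition length_dist :: "'a chart set \<Rightarrow> ('a chart \<Rightarrow> 'a \<Rightarrow> real) \<Rightarrow> 'a \<Rightarrow> 'a \<Rightarrow> real" where
  "length_dist C g x y = Inf {L. joined_with_length C g x y L}"

definition weakly_complete ::
    "'a chart set \<Rightarrow> ('b::topological_space \<Rightarrow> 'a) \<Rightarrow> ('b \<Rightarrow> mat2) \<Rightarrow> bool" where
  "weakly_complete C p E \<longleftrightarrow> Metric_space.mcomplete UNIV (length_dist C (ds11 p E))"


section \<open>Islands\<close>

text \<open>Only finite targets \<open>V\<close> are needed. The condition that \<open>V\<close> is a Jordan domain is left to the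
  user of this definition.\<close>
definition island ::
    "('b::topological_space \<Rightarrow> complex option) \<Rightarrow> complex set \<Rightarrow> 'b set \<Rightarrow> bool" where
  "island h V U \<longleftrightarrow> U \<in> components (h -` (Some ` V)) \<and> simply_connected U \<and> compact (closure U)"

text \<open>The multiplicity with which \<open>h\<close> takes the finite value \<open>h x\<close> at \<open>x\<close>.\<close>
definition value_multiplicity ::
    "'b chart set \<Rightarrow> ('b \<Rightarrow> complex option) \<Rightarrow> 'b \<Rightarrow> nat" where
  "value_multiplicity K h x =
     (let c = some_chart K x
      in nat (zorder (\<lambda>w. the (h (chart_inv c w)) - the (h x)) (snd c x)))"

text \<open>The degree of a proper holomorphic map \<open>U \<rightarrow> V\<close> is the number of preimages, with
  multiplicity, of any point of \<open>V\<close>.\<close>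
definition island_multiplicity ::
    "'b chart set \<Rightarrow> ('b \<Rightarrow> complex option) \<Rightarrow> complex set \<Rightarrow> 'b set \<Rightarrow> nat \<Rightarrow> bool" where
  "island_multiplicity K h V U d \<longleftrightarrow>
     (\<forall>v\<in>V. finite {x \<in> U. h x = Some v} \<and>
        (\<Sum>x\<in>{x \<in> U. h x = Some v}. value_multiplicity K h x) = d)"

definition simple_island ::
    "'b::topological_space chart set \<Rightarrow> ('b \<Rightarrow> complex option) \<Rightarrow> complex set \<Rightarrow> 'b set \<Rightarrow> bool" where
  "simple_island K h V U \<longleftrightarrow> island h V U \<and> island_multiplicity K h V U 1"

end

theory Submission
  imports Defs
begin

text \<open>
  Since \<open>\<epsilon>\<close> may depend on \<open>f\<close>, it suffices that \<open>f\<close> is a horosphere or a cylinder whenever \<open>\<rho>\<close> is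
  totally ramified over \<open>\<alpha>\<^sub>1, \<dots>, \<alpha>\<^sub>7\<close>: an unramified point over some \<open>\<alpha>\<^sub>j\<close> yields a simple island over a
  small enough disk.

  Let \<open>\<rho>\<close> be totally ramified over the \<open>\<alpha>\<^sub>j\<close> and suppose that it is not constant. In a local coordinate
  write \<open>\<theta> = a dz\<close>, \<open>\<omega> = b dz\<close>, \<open>l\<^sub>j = a - \<alpha>\<^sub>j b\<close> and \<open>W = a' b - a b'\<close>. Total ramification makes
  \<open>h = W\<^sup>2 / (l\<^sub>1 \<dots> l\<^sub>7)\<close> holomorphic, and counting weights (\<open>a\<close> and \<open>b\<close> have weight 1, \<open>W\<close> has weight 3)
  shows that \<open>h d/dz\<close> is a globally defined holomorphic vector field. In its flow time \<open>\<zeta>\<close> one has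
  \<open>W\<^sup>2 = l\<^sub>1 \<dots> l\<^sub>7\<close>, and then \<open>T = \<bar>l\<^sub>1\<bar> + \<dots> + \<bar>l\<^sub>7\<bar>\<close> satisfies \<open>\<Delta> log T \<ge> c T\<^sup>3\<close>. The Ahlfors-Schwarz argument
  bounds \<open>T\<close> on a disk of radius \<open>R\<close> by a multiple of \<open>(R / (R\<^sup>2 - \<bar>\<zeta>\<bar>\<^sup>2))\<close> to the power \<open>2/3\<close>. This is integrable
  along radii, so by completeness every flow disk can be enlarged (a zero of the field is not reached
  in finite time), and the flow is entire. Letting \<open>R\<close> tend to infinity gives \<open>T = 0\<close>, a contradiction.

  If \<open>\<rho>\<close> is constant, both forms are constant in a suitable coordinate \<open>\<zeta>\<close>, which by completeness ranges
  over the whole plane. Hence the lift is \<open>E\<^sub>0 exp (\<zeta> N)\<close> with a constant off-diagonal matrix \<open>N\<close>. It yields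
  a horosphere if \<open>N\<close> is nilpotent and a cylinder otherwise.
\<close>

text \<open>The number seven makes the weights fit: W^2 has weight 6, so its quotient by k linear
  forms is a vector field exactly when k = 7.

  The inequality for log T rests on square roots. Where W^2 equals the product of the forms, every
  l_j has a local holomorphic square root m_j, because at a zero of l_j the other six forms do not
  vanish. Hence T is a sum of squared moduli, and Lagrange's identity computes the Laplacian of log
  T from the minors m_i m_j' - m_j m_i'. Four times the square of such a minor is (\<alpha>_j -
  \<alpha>_i)^2 times the product of the remaining five forms. With the smallest form in the pair
  this is comparable to T^5, and division by T^2 leaves T^3.

  The conformal type of the universal cover is not known beforehand. The flow parameter takes the
  place of uniformization: the surface is seen only through curves defined on plane domains, whose
  holomorphy is tested by the entries of the lift.

  Completeness concerns the base surface, while the flow lives on the cover. So limits are found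
  below and lifted through the covering.\<close>

no_notation fps_nth (infixl "$" 75)

section \<open>Forms normalized by their Wronskian\<close>

text \<open>If \<open>D\<close> were positive, \<open>g'\<close> would be positive on an interval to
  the right of its zero at \<open>0\<close>, and \<open>g\<close> would increase there. The second
  derivative is asked for at \<open>0\<close> alone, which is all that \<open>laplace_ln_max\<close>
  computes.\<close>

lemma second_deriv_local_max_le_0:
  fixes g g' :: "real \<Rightarrow> real"
  assumes "d > 0" and g: "\<And>t. \<bar>t\<bar> < d \<Longrightarrow> (g has_real_derivative g' t) (at t)"
    and D: "(g' has_real_derivative D) (at 0)"
    and max: "\<And>t. \<bar>t\<bar> < d \<Longrightarrow> g t \<le> g 0"
  shows "D \<le> 0"
proof (rule ccontr)
  assume "\<not> D \<le> 0"
  then have "D > 0" by simp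
  have g0: "g' 0 = 0"
    using DERIV_local_max[OF g[of 0] \<open>d > 0\<close>] max \<open>d > 0\<close> by auto
  obtain e where e: "e > 0" "\<And>h. \<lbrakk>h > 0; h < e\<rbrakk> \<Longrightarrow> g' 0 < g' (0 + h)"
    using DERIV_pos_inc_right[OF D \<open>D > 0\<close>] by blast
  define s where "s = min d e / 2"
  have s: "0 < s" "s < d" "s < e" using \<open>d > 0\<close> e(1) by (auto simp: s_def)
  obtain z where z: "0 < z" "z < s" "g s - g 0 = (s - 0) * g' z"
    using MVT2[of 0 s g g'] s g by (smt (verit))
  have "g' z > 0" using e(2)[of z] z s g0 by simp
  then have "g s > g 0" using z s by (smt (verit) mult_pos_pos)
  then show False using max[of s] s by simp
qed

text \<open>By Lagrange's identity the right-hand side is the sum of the squared moduli of all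
  minors of the two rows \<open>m\<close> and \<open>m'\<close>; one of them is kept. For
  holomorphic \<open>m k\<close> with derivatives \<open>m' k\<close> and T the sum of the squared
  moduli of the \<open>m k\<close>, the right-hand side is T^2 / 4 times the Laplacian of log
  T.\<close>

lemma lagrange_pair_le:
  fixes m m' :: "'i \<Rightarrow> complex"
  assumes "finite I" "i \<in> I" "j \<in> I" "i \<noteq> j"
  shows "(cmod (m i * m' j - m j * m' i))\<^sup>2
     \<le> (\<Sum>k\<in>I. (cmod (m k))\<^sup>2) * (\<Sum>k\<in>I. (cmod (m' k))\<^sup>2) - (cmod (\<Sum>k\<in>I. cnj (m k) * m' k))\<^sup>2"
proof -
  let ?D = "\<lambda>k l. (cmod (m k * m' l - m l * m' k))\<^sup>2"
  let ?Z = "\<Sum>k\<in>I. cnj (m k) * m' k"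
  have ex: "?D k l = (cmod (m k))\<^sup>2 * (cmod (m' l))\<^sup>2 + (cmod (m l))\<^sup>2 * (cmod (m' k))\<^sup>2
      - 2 * Re (cnj (cnj (m k) * m' k) * (cnj (m l) * m' l))" for k l
    by (simp only: cmod_power2) (simp add: power2_eq_square algebra_simps)
  have "(\<Sum>k\<in>I. \<Sum>l\<in>I. ?D k l) = 2 * ((\<Sum>k\<in>I. (cmod (m k))\<^sup>2) * (\<Sum>k\<in>I. (cmod (m' k))\<^sup>2))
      - 2 * Re (cnj ?Z * ?Z)"
    unfolding ex sum_subtractf sum.distrib sum_distrib_left[symmetric]
    by (simp add: sum_product sum_distrib_left sum_distrib_right
        mult.commute sum.swap[of "\<lambda>k l. (cmod (m l))\<^sup>2 * (cmod (m' k))\<^sup>2"] algebra_simps)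
  also have "Re (cnj ?Z * ?Z) = (cmod ?Z)\<^sup>2"
    using sum_negf[of "\<lambda>x. Re (m x) * Im (m' x) - Im (m x) * Re (m' x)" I]
    unfolding cmod_power2 by (simp add: power2_eq_square)
  finally have tot: "(\<Sum>k\<in>I. \<Sum>l\<in>I. ?D k l) = 2 * ((\<Sum>k\<in>I. (cmod (m k))\<^sup>2) * (\<Sum>k\<in>I. (cmod (m' k))\<^sup>2)
      - (cmod ?Z)\<^sup>2)" by simp
  have "(\<Sum>k\<in>I. \<Sum>l\<in>I. ?D k l) = (\<Sum>p\<in>I\<times>I. ?D (fst p) (snd p))"
    by (simp add: sum.cartesian_product case_prod_unfold)
  \<comment> \<open>Each minor occurs twice in the double sum, as (i, j) and as (j, i), which
    matches the factor 2 in \<open>tot\<close>.\<close>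
  also have "\<dots> \<ge> (\<Sum>p\<in>{(i,j),(j,i)}. ?D (fst p) (snd p))"
    using assms by (intro sum_mono2) auto
  also have "(\<Sum>p\<in>{(i,j),(j,i)}. ?D (fst p) (snd p)) = 2 * ?D i j"
    using assms by (simp add: norm_minus_commute)
  finally show ?thesis using tot by simp
qed

lemma has_vector_derivative_along_line:
  assumes "(m has_field_derivative m') (at (z0 + of_real t * e))"
  shows "((\<lambda>t. m (z0 + of_real t * e)) has_vector_derivative m' * e) (at t)"
proof -
  have "((\<lambda>t. z0 + of_real t * e) has_vector_derivative e) (at t)"
    by (auto intro!: derivative_eq_intros has_vector_derivative_real_field)
  then show ?thesis
    using field_vector_diff_chain_at[of "\<lambda>t. z0 + of_real t * e" e t m m'] assms
    by (simp add: o_def mult.commute)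
qed

text \<open>The weights 3 and 2 are those of T^3 q^2 with q = r^2 - |z|^2, the quantity to be
  maximized: T^3 behaves like the area density of a metric of negative curvature and is compared
  with that of the disk, a multiple of 1 / q^2.\<close>

lemma DERIV_ln_combination:
  fixes f k :: "real \<Rightarrow> real"
  assumes "(f has_real_derivative A) (at t)" "(k has_real_derivative B) (at t)" "0 < f t" "0 < k t"
  shows "((\<lambda>t. 3 * ln (f t) + 2 * ln (k t)) has_real_derivative 3 * (A / f t) + 2 * (B / k t)) (at t)"
  using assms by (auto intro!: derivative_eq_intros simp: mult.commute)

lemma DERIV_log_derivative_combination:
  fixes f k :: "real \<Rightarrow> real"
  assumes "(f has_real_derivative f' t) (at t)" "(k has_real_derivative k' t) (at t)"
    "(f' has_real_derivative A) (at t)" "(k' has_real_derivative B) (at t)" "f t \<noteq> 0" "k t \<noteq> 0"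
  shows "((\<lambda>t. 3 * (f' t / f t) + 2 * (k' t / k t)) has_real_derivative
    3 * ((A * f t - (f' t)\<^sup>2) / (f t)\<^sup>2) + 2 * ((B * k t - (k' t)\<^sup>2) / (k t)\<^sup>2)) (at t)"
  using assms by (auto intro!: derivative_eq_intros simp: power2_eq_square mult_ac)

text \<open>At a maximum of 3 ln T + 2 ln q with q = r^2 - |z|^2 the second derivatives in the
  directions \<open>1\<close> and \<open>\<i>\<close> are not positive, and neither is their sum,
  the Laplacian. The Laplacian of ln T is 4 (T S - |Z|^2) / T^2 with the two sums S and Z of the
  claim, that of ln q is - 4 r^2 / q^2; the claim is the resulting inequality without
  denominators.\<close>

lemma laplace_ln_max:
  fixes m :: "'i \<Rightarrow> complex \<Rightarrow> complex"
  assumes fin: "finite I" and d: "0 < d" and sub: "ball z0 d \<subseteq> ball 0 r"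
    and hol: "\<And>j. j \<in> I \<Longrightarrow> m j holomorphic_on ball z0 d"
  defines "T \<equiv> \<lambda>z. \<Sum>j\<in>I. (cmod (m j z))\<^sup>2"
  assumes Tpos: "\<And>z. z \<in> ball z0 d \<Longrightarrow> 0 < T z"
    and max: "\<And>z. z \<in> ball z0 d \<Longrightarrow> T z ^ 3 * (r\<^sup>2 - (cmod z)\<^sup>2)\<^sup>2 \<le> T z0 ^ 3 * (r\<^sup>2 - (cmod z0)\<^sup>2)\<^sup>2"
  shows "3 * (T z0 * (\<Sum>j\<in>I. (cmod (deriv (m j) z0))\<^sup>2)
       - (cmod (\<Sum>j\<in>I. cnj (m j z0) * deriv (m j) z0))\<^sup>2) * (r\<^sup>2 - (cmod z0)\<^sup>2)\<^sup>2 \<le> 2 * r\<^sup>2 * (T z0)\<^sup>2"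
proof -
  define q where "q z = r\<^sup>2 - (cmod z)\<^sup>2" for z :: complex
  have qpos: "0 < q z" if "z \<in> ball z0 d" for z
  proof -
    have "cmod z < r" using sub that by auto
    then show ?thesis unfolding q_def by (simp add: power_strict_mono)
  qed
  have z0: "z0 \<in> ball z0 d" using d by simp
  let ?dT = "\<lambda>e z. \<Sum>j\<in>I. 2 * Re (cnj (m j z) * (deriv (m j) z * e))"
  let ?ddT = "\<lambda>e. \<Sum>j\<in>I. 2 * (cmod (deriv (m j) z0 * e))\<^sup>2 + 2 * Re (cnj (m j z0) * (deriv (deriv (m j)) z0 * e * e))"
  \<comment> \<open>Restriction to a real line through \<open>z0\<close> reduces the maximum to one
    variable. The direction is a unit vector, so that \<open>q\<close> has second derivative -2
    along it.\<close>
  have ineq: "3 * ((?ddT e * T z0 - (?dT e z0)\<^sup>2) / (T z0)\<^sup>2)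
       + 2 * ((- 2 * q z0 - (- 2 * Re (cnj z0 * e))\<^sup>2) / (q z0)\<^sup>2) \<le> 0" (is "?DD \<le> 0") if e: "cmod e = 1" for e
  proof -
    define g where "g t = 3 * ln (T (z0 + of_real t * e)) + 2 * ln (q (z0 + of_real t * e))" for t :: real
    define g' where "g' t = 3 * (?dT e (z0 + of_real t * e) / T (z0 + of_real t * e))
        + 2 * (- 2 * Re (cnj (z0 + of_real t * e) * e) / q (z0 + of_real t * e))" for t :: real
    have inb: "z0 + of_real t * e \<in> ball z0 d" if "\<bar>t\<bar> < d" for t
      using that e by (simp add: dist_norm norm_mult)
    have mder: "(m j has_field_derivative deriv (m j) z) (at z)"
      and m'der: "(deriv (m j) has_field_derivative deriv (deriv (m j)) z) (at z)"
      if "j \<in> I" "z \<in> ball z0 d" for j z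
      using holomorphic_derivI[OF hol[OF that(1)] _ that(2)]
        holomorphic_derivI[OF holomorphic_deriv[OF hol[OF that(1)]] _ that(2)] by auto
    have sq: "(cmod w)\<^sup>2 = Re (cnj w * w)" for w
      unfolding cmod_power2 by (simp add: power2_eq_square)
    have Tder: "((\<lambda>t. T (z0 + of_real t * e)) has_real_derivative ?dT e (z0 + of_real t * e)) (at t)"
      if t: "\<bar>t\<bar> < d" for t
      unfolding T_def
    proof (rule DERIV_sum)
      fix j assume j: "j \<in> I"
      have v: "((\<lambda>t. m j (z0 + of_real t * e)) has_vector_derivative deriv (m j) (z0 + of_real t * e) * e) (at t)"
        by (rule has_vector_derivative_along_line[OF mder[OF j inb[OF t]]])
      have "((\<lambda>t. Re (cnj (m j (z0 + of_real t * e)) * m j (z0 + of_real t * e))) has_vector_derivative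
          Re (cnj (m j (z0 + of_real t * e)) * (deriv (m j) (z0 + of_real t * e) * e) + cnj (deriv (m j) (z0 + of_real t * e) * e) * m j (z0 + of_real t * e))) (at t)"
        by (intro bounded_linear.has_vector_derivative[OF bounded_linear_Re]
            has_vector_derivative_mult has_vector_derivative_cnj v)
      then show "((\<lambda>t. (cmod (m j (z0 + of_real t * e)))\<^sup>2) has_real_derivative
          2 * Re (cnj (m j (z0 + of_real t * e)) * (deriv (m j) (z0 + of_real t * e) * e))) (at t)"
        unfolding sq has_real_derivative_iff_has_vector_derivative
        by (simp add: algebra_simps)
    qed
    have qder: "((\<lambda>t. q (z0 + of_real t * e)) has_real_derivative - 2 * Re (cnj (z0 + of_real t * e) * e)) (at t)" for t
    proof -
      have v: "((\<lambda>t. z0 + of_real t * e) has_vector_derivative 1 * e) (at t)"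
        by (rule has_vector_derivative_along_line[of "\<lambda>z. z"]) (rule DERIV_ident)
      have "((\<lambda>t. r\<^sup>2 - Re (cnj (z0 + of_real t * e) * (z0 + of_real t * e))) has_vector_derivative
          0 - Re (cnj (z0 + of_real t * e) * (1 * e) + cnj (1 * e) * (z0 + of_real t * e))) (at t)"
        by (intro has_vector_derivative_diff has_vector_derivative_const bounded_linear.has_vector_derivative[OF bounded_linear_Re]
            has_vector_derivative_mult has_vector_derivative_cnj v)
      then show ?thesis
        unfolding q_def sq has_real_derivative_iff_has_vector_derivative
        by (simp add: algebra_simps)
    qed
    have gder: "(g has_real_derivative g' t) (at t)" if t: "\<bar>t\<bar> < d" for t
      unfolding g_def[abs_def] g'_def
      by (rule DERIV_ln_combination[OF Tder[OF t] qder Tpos[OF inb[OF t]] qpos[OF inb[OF t]]])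
    have dTder: "((\<lambda>t. ?dT e (z0 + of_real t * e)) has_real_derivative ?ddT e) (at 0)"
    proof (rule DERIV_sum)
      fix j assume j: "j \<in> I"
      have v: "((\<lambda>t. m j (z0 + of_real t * e)) has_vector_derivative deriv (m j) (z0 + of_real 0 * e) * e) (at 0)"
        by (rule has_vector_derivative_along_line, rule mder[OF j]) (use z0 in simp)
      have v': "((\<lambda>t. deriv (m j) (z0 + of_real t * e)) has_vector_derivative deriv (deriv (m j)) (z0 + of_real 0 * e) * e) (at 0)"
        by (rule has_vector_derivative_along_line, rule m'der[OF j]) (use z0 in simp)
      have "((\<lambda>t. 2 * Re (cnj (m j (z0 + of_real t * e)) * (deriv (m j) (z0 + of_real t * e) * e))) has_vector_derivative
          2 * Re (cnj (m j (z0 + of_real 0 * e)) * (deriv (deriv (m j)) (z0 + of_real 0 * e) * e * e)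
            + cnj (deriv (m j) (z0 + of_real 0 * e) * e) * (deriv (m j) (z0 + of_real 0 * e) * e))) (at 0)"
        by (intro bounded_linear.has_vector_derivative[OF bounded_linear_Re]
            bounded_linear.has_vector_derivative[OF bounded_linear_mult_right]
            has_vector_derivative_mult has_vector_derivative_cnj v
            bounded_linear.has_vector_derivative[OF bounded_linear_mult_left] v')
      then show "((\<lambda>t. 2 * Re (cnj (m j (z0 + of_real t * e)) * (deriv (m j) (z0 + of_real t * e) * e))) has_real_derivative
          2 * (cmod (deriv (m j) z0 * e))\<^sup>2 + 2 * Re (cnj (m j z0) * (deriv (deriv (m j)) z0 * e * e))) (at 0)"
        unfolding sq has_real_derivative_iff_has_vector_derivative
        by (simp add: algebra_simps)
    qed
    have dqder: "((\<lambda>t. - 2 * Re (cnj (z0 + of_real t * e) * e)) has_real_derivative - 2) (at 0)"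
    proof -
      have v: "((\<lambda>t. z0 + of_real t * e) has_vector_derivative 1 * e) (at 0)"
        by (rule has_vector_derivative_along_line[of "\<lambda>z. z"]) (rule DERIV_ident)
      have "((\<lambda>t. - 2 * Re (cnj (z0 + of_real t * e) * e)) has_vector_derivative
          - 2 * Re (cnj (1 * e) * e)) (at 0)"
        by (intro bounded_linear.has_vector_derivative[OF bounded_linear_Re]
            bounded_linear.has_vector_derivative[OF bounded_linear_mult_right]
            has_vector_derivative_cnj v
            bounded_linear.has_vector_derivative[OF bounded_linear_mult_left])
      moreover have "- 2 * Re (cnj (1 * e) * e) = - 2"
        using e sq[of e] by simp
      ultimately show ?thesis
        unfolding has_real_derivative_iff_has_vector_derivative by (simp only:)
    qed
    have "(g' has_real_derivative ?DD) (at 0)"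
      unfolding g'_def[abs_def]
      using DERIV_log_derivative_combination[OF Tder[of 0] qder[of 0] dTder dqder]
        Tpos[OF z0] qpos[OF z0] d
      by (simp only: of_real_0 mult_zero_left add_0_right abs_zero less_irrefl)
    moreover have "g t \<le> g 0" if t: "\<bar>t\<bar> < d" for t
    proof -
      have *: "3 * ln (T z) + 2 * ln (q z) = ln (T z ^ 3 * (q z)\<^sup>2)" if "z \<in> ball z0 d" for z
        using Tpos[OF that] qpos[OF that] by (simp add: ln_mult ln_realpow)
      have "T (z0 + of_real t * e) ^ 3 * (q (z0 + of_real t * e))\<^sup>2 \<le> T z0 ^ 3 * (q z0)\<^sup>2"
        using max[OF inb[OF t]] by (simp add: q_def)
      then show ?thesis
        unfolding g_def using Tpos[OF inb[OF t]] qpos[OF inb[OF t]] Tpos[OF z0] qpos[OF z0]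
        by (simp add: *[OF inb[OF t]] *[OF z0] del: ln_mult)
    qed
    ultimately show ?thesis
      using second_deriv_local_max_le_0[OF d gder] by blast
  qed
  define Z where "Z = (\<Sum>j\<in>I. cnj (m j z0) * deriv (m j) z0)"
  define S' where "S' = (\<Sum>j\<in>I. (cmod (deriv (m j) z0))\<^sup>2)"
  \<comment> \<open>The terms with the second derivatives of the \<open>m j\<close> cancel because
    1^2 + \<i>^2 = 0.\<close>
  have dd: "?ddT 1 + ?ddT \<i> = 4 * S'"
    unfolding S'_def sum.distrib[symmetric] sum_distrib_left by (intro sum.cong refl) (simp add: norm_mult)
  have d1: "?dT 1 z0 = 2 * Re Z"
    unfolding Z_def Re_sum sum_distrib_left by simp
  have d2: "?dT \<i> z0 = - 2 * Im Z"
    unfolding Z_def Im_sum sum_distrib_left by (intro sum.cong refl) (simp add: algebra_simps)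
  have q1: "(- 2 * Re (cnj z0 * 1))\<^sup>2 + (- 2 * Re (cnj z0 * \<i>))\<^sup>2 = 4 * (cmod z0)\<^sup>2"
    by (simp add: cmod_power2 power_mult_distrib)
  have Zn: "(?dT 1 z0)\<^sup>2 + (?dT \<i> z0)\<^sup>2 = 4 * (cmod Z)\<^sup>2"
    unfolding d1 d2 by (simp add: cmod_power2 power_mult_distrib)
  have "3 * (((?ddT 1 + ?ddT \<i>) * T z0 - ((?dT 1 z0)\<^sup>2 + (?dT \<i> z0)\<^sup>2)) / (T z0)\<^sup>2)
       + 2 * ((- 4 * q z0 - ((- 2 * Re (cnj z0 * 1))\<^sup>2 + (- 2 * Re (cnj z0 * \<i>))\<^sup>2)) / (q z0)\<^sup>2) \<le> 0"
    using add_mono[OF ineq[of 1] ineq[of \<i>]]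
    by (simp add: add_divide_distrib diff_divide_distrib algebra_simps)
  then have "3 * ((4 * S' * T z0 - 4 * (cmod Z)\<^sup>2) / (T z0)\<^sup>2)
       + 2 * ((- 4 * q z0 - 4 * (cmod z0)\<^sup>2) / (q z0)\<^sup>2) \<le> 0"
    unfolding dd Zn q1 .
  moreover have "- 4 * q z0 - 4 * (cmod z0)\<^sup>2 = - 4 * r\<^sup>2" by (simp add: q_def)
  ultimately have "3 * ((S' * T z0 - (cmod Z)\<^sup>2) / (T z0)\<^sup>2) \<le> 2 * r\<^sup>2 / (q z0)\<^sup>2"
  proof -
    assume *: "3 * ((4 * S' * T z0 - 4 * (cmod Z)\<^sup>2) / (T z0)\<^sup>2)
       + 2 * ((- 4 * q z0 - 4 * (cmod z0)\<^sup>2) / (q z0)\<^sup>2) \<le> 0"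
      and **: "- 4 * q z0 - 4 * (cmod z0)\<^sup>2 = - 4 * r\<^sup>2"
    have "(4 * S' * T z0 - 4 * (cmod Z)\<^sup>2) / (T z0)\<^sup>2 = 4 * ((S' * T z0 - (cmod Z)\<^sup>2) / (T z0)\<^sup>2)"
      by (simp add: diff_divide_distrib)
    with *[unfolded **] show ?thesis by (simp only:)
  qed
  then show ?thesis
    using Tpos[OF z0] qpos[OF z0] unfolding Z_def[symmetric] S'_def[symmetric] q_def[symmetric]
    by (simp add: divide_simps mult_ac)
qed

section \<open>The Ahlfors-Schwarz bound for normalized forms\<close>

text \<open>Two forms with different \<alpha> determine \<open>a\<close> and \<open>b\<close> by
  Cramer's rule, so any two of them control the pair. Finiteness of \<open>I\<close> allows one
  constant for all indices.\<close>

lemma linear_forms_comparable: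
  fixes \<alpha> :: "nat \<Rightarrow> complex"
  assumes fin: "finite I" and inj: "inj_on \<alpha> I"
  obtains C where "C \<ge> 1" "\<And>j a b. j \<in> I \<Longrightarrow> cmod (a - \<alpha> j * b) \<le> C * (cmod a + cmod b)"
    "\<And>i j a b. \<lbrakk>i \<in> I; j \<in> I; i \<noteq> j\<rbrakk> \<Longrightarrow> cmod a + cmod b \<le> C * (cmod (a - \<alpha> i * b) + cmod (a - \<alpha> j * b))"
    "\<And>i j. \<lbrakk>i \<in> I; j \<in> I; i \<noteq> j\<rbrakk> \<Longrightarrow> 1 \<le> C * cmod (\<alpha> i - \<alpha> j)"
proof -
  \<comment> \<open>Solving for \<open>b\<close> and then for \<open>a\<close> costs the factor 1 +
    (1 + |\<alpha>_i|) / |\<alpha>_i - \<alpha>_j|. \<open>Q i j\<close> dominates it and also 1 /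
    |\<alpha>_i - \<alpha>_j|.\<close>
  define Q where "Q i j = 1 + (2 + cmod (\<alpha> i)) / cmod (\<alpha> i - \<alpha> j)" for i j
  define C where "C = 1 + (\<Sum>j\<in>I. 1 + cmod (\<alpha> j)) + (\<Sum>i\<in>I. \<Sum>j\<in>I. Q i j)"
  have Q0: "0 \<le> Q i j" for i j by (simp add: Q_def)
  have Q1: "0 \<le> (\<Sum>i\<in>I. \<Sum>j\<in>I. Q i j)" by (intro sum_nonneg Q0)
  have S0: "0 \<le> (\<Sum>j\<in>I. 1 + cmod (\<alpha> j))" by (intro sum_nonneg) simp
  have QC: "Q i j \<le> C" if "i \<in> I" "j \<in> I" for i j
  proof -
    have "Q i j \<le> (\<Sum>j\<in>I. Q i j)" using that fin Q0 by (intro member_le_sum) auto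
    also have "\<dots> \<le> (\<Sum>i\<in>I. \<Sum>j\<in>I. Q i j)"
      using that fin Q0 by (intro member_le_sum[of i I "\<lambda>i. \<Sum>j\<in>I. Q i j"] sum_nonneg) auto
    finally show ?thesis using S0 by (simp add: C_def)
  qed
  have aC: "1 + cmod (\<alpha> j) \<le> C" if "j \<in> I" for j
  proof -
    have "1 + cmod (\<alpha> j) \<le> (\<Sum>j\<in>I. 1 + cmod (\<alpha> j))"
      using that fin by (intro member_le_sum) auto
    then show ?thesis using Q1 by (simp add: C_def)
  qed
  show thesis
  proof
    show "C \<ge> 1" using Q1 S0 by (simp add: C_def)
    show "cmod (a - \<alpha> j * b) \<le> C * (cmod a + cmod b)" if "j \<in> I" for j a b
    proof -
      have "cmod (a - \<alpha> j * b) \<le> cmod a + cmod (\<alpha> j) * cmod b"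
        by (metis norm_mult norm_triangle_ineq4)
      also have "\<dots> \<le> (1 + cmod (\<alpha> j)) * (cmod a + cmod b)" by (simp add: algebra_simps)
      also have "\<dots> \<le> C * (cmod a + cmod b)" by (intro mult_right_mono aC that) simp
      finally show ?thesis .
    qed
    show "cmod a + cmod b \<le> C * (cmod (a - \<alpha> i * b) + cmod (a - \<alpha> j * b))"
      if ij: "i \<in> I" "j \<in> I" "i \<noteq> j" for i j a b
    proof -
      let ?N = "cmod (a - \<alpha> i * b) + cmod (a - \<alpha> j * b)"
      have ne: "0 < cmod (\<alpha> i - \<alpha> j)" using inj ij by (auto simp: inj_on_def)
      have "cmod ((\<alpha> i - \<alpha> j) * b) = cmod ((a - \<alpha> j * b) - (a - \<alpha> i * b))" by (simp add: algebra_simps)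
      also have "\<dots> \<le> ?N" using norm_triangle_ineq4 by (smt (verit))
      finally have b: "cmod b \<le> ?N / cmod (\<alpha> i - \<alpha> j)"
        using ne by (simp only: norm_mult pos_le_divide_eq mult.commute)
      have "cmod a = cmod ((a - \<alpha> i * b) + \<alpha> i * b)" by simp
      also have "\<dots> \<le> cmod (a - \<alpha> i * b) + cmod (\<alpha> i) * cmod b" by (metis norm_mult norm_triangle_ineq)
      also have "\<dots> \<le> ?N + cmod (\<alpha> i) * (?N / cmod (\<alpha> i - \<alpha> j))"
        using b by (intro add_mono mult_left_mono) auto
      finally have "cmod a + cmod b \<le> ?N * (1 + (1 + cmod (\<alpha> i)) / cmod (\<alpha> i - \<alpha> j))"
        using b by (simp add: algebra_simps add_divide_distrib)
      also have "\<dots> \<le> ?N * Q i j" unfolding Q_def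
        by (intro mult_left_mono add_mono divide_right_mono) auto
      also have "\<dots> \<le> ?N * C" by (intro mult_left_mono QC ij) simp
      finally show ?thesis by (simp add: mult.commute)
    qed
    show "1 \<le> C * cmod (\<alpha> i - \<alpha> j)" if ij: "i \<in> I" "j \<in> I" "i \<noteq> j" for i j
    proof -
      have ne: "0 < cmod (\<alpha> i - \<alpha> j)" using inj ij by (auto simp: inj_on_def)
      have "1 / cmod (\<alpha> i - \<alpha> j) \<le> Q i j" unfolding Q_def
        using ne by (simp add: field_simps)
      then have "1 / cmod (\<alpha> i - \<alpha> j) \<le> C" using QC[OF ij(1,2)] by linarith
      then show ?thesis using ne by (simp add: field_simps)
    qed
  qed
qed

text \<open>Near \<open>z0\<close> the quotient f / f(z0) stays within distance 1 of 1, hence off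
  the nonpositive real axis, where \<open>csqrt\<close> is holomorphic.\<close>

lemma holomorphic_local_sqrt:
  assumes f: "f holomorphic_on S" and S: "open S" "z0 \<in> S" and nz: "f z0 \<noteq> 0"
  obtains d s where "d > 0" "ball z0 d \<subseteq> S" "s holomorphic_on ball z0 d"
    "\<And>z. z \<in> ball z0 d \<Longrightarrow> (s z)\<^sup>2 = f z \<and> s z \<noteq> 0"
proof -
  have "continuous_on S f" using f by (rule holomorphic_on_imp_continuous_on)
  then obtain d where d: "d > 0" "ball z0 d \<subseteq> S" "\<And>z. z \<in> ball z0 d \<Longrightarrow> dist (f z) (f z0) < cmod (f z0)"
  proof -
    have "isCont f z0" using \<open>continuous_on S f\<close> S continuous_on_eq_continuous_at by blast
    then obtain d1 where d1: "d1 > 0" "\<And>z. dist z z0 < d1 \<Longrightarrow> dist (f z) (f z0) < cmod (f z0)"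
      using nz unfolding continuous_at_eps_delta by (metis zero_less_norm_iff)
    obtain d2 where d2: "d2 > 0" "ball z0 d2 \<subseteq> S" using S open_contains_ball by blast
    show thesis
      by (rule that[of "min d1 d2"]) (use d1 d2 in \<open>auto simp: dist_commute subset_iff\<close>)
  qed
  have nn: "f z / f z0 \<notin> \<real>\<^sub>\<le>\<^sub>0" if "z \<in> ball z0 d" for z
  proof
    assume "f z / f z0 \<in> \<real>\<^sub>\<le>\<^sub>0"
    then have "Re (f z / f z0) \<le> 0" by (simp add: complex_nonpos_Reals_iff)
    then have "1 \<le> cmod (f z / f z0 - 1)" using complex_Re_le_cmod[of "1 - f z / f z0"] by (simp add: norm_minus_commute)
    moreover have "f z / f z0 - 1 = (f z - f z0) / f z0" using nz by (simp add: field_simps)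
    ultimately show False using d(3)[OF that] nz by (simp add: dist_norm norm_divide field_simps)
  qed
  show thesis
  proof
    show "d > 0" "ball z0 d \<subseteq> S" by fact+
    show "(\<lambda>z. csqrt (f z0) * csqrt (f z / f z0)) holomorphic_on ball z0 d"
      using holomorphic_on_subset[OF f d(2)] nn nz by (intro holomorphic_intros) auto
    fix z assume z: "z \<in> ball z0 d"
    have "f z \<noteq> 0" using d(3)[OF z] by auto
    then show "(csqrt (f z0) * csqrt (f z / f z0))\<^sup>2 = f z \<and> csqrt (f z0) * csqrt (f z / f z0) \<noteq> 0"
      using nz by (simp add: power_mult_distrib)
  qed
qed

text \<open>The Ahlfors argument at the maximum point \<open>z0\<close>.
  \<open>laplace_ln_max\<close> bounds the minors of the square roots of the forms from above. The
  equation \<open>eq\<close> expresses one minor by a product of five forms, each comparable to T,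
  and so bounds it from below. Together they compare T^5 with T^2.\<close>

lemma wronskian_max_estimate:
  fixes \<alpha> :: "nat \<Rightarrow> complex" and a b :: "complex \<Rightarrow> complex" and r :: real
  defines "I \<equiv> {1..7::nat}"
  defines "l \<equiv> \<lambda>j z. a z - \<alpha> j * b z"
  defines "W \<equiv> \<lambda>z. deriv a z * b z - a z * deriv b z"
  defines "T \<equiv> \<lambda>z. \<Sum>j\<in>I. cmod (l j z)"
  assumes C: "C \<ge> 1" "\<And>j a b. j \<in> I \<Longrightarrow> cmod (a - \<alpha> j * b) \<le> C * (cmod a + cmod b)"
    "\<And>i j a b. \<lbrakk>i \<in> I; j \<in> I; i \<noteq> j\<rbrakk> \<Longrightarrow> cmod a + cmod b \<le> C * (cmod (a - \<alpha> i * b) + cmod (a - \<alpha> j * b))"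
    "\<And>i j. \<lbrakk>i \<in> I; j \<in> I; i \<noteq> j\<rbrakk> \<Longrightarrow> 1 \<le> C * cmod (\<alpha> i - \<alpha> j)"
  assumes hol: "a holomorphic_on ball 0 r" "b holomorphic_on ball 0 r"
    and nz: "\<And>z. z \<in> ball 0 r \<Longrightarrow> a z \<noteq> 0 \<or> b z \<noteq> 0"
    and eq: "\<And>z. z \<in> ball 0 r \<Longrightarrow> (W z)\<^sup>2 = (\<Prod>j\<in>I. l j z)"
    and nd: "\<And>U. \<lbrakk>open U; U \<noteq> {}; U \<subseteq> ball 0 r\<rbrakk> \<Longrightarrow> \<exists>z\<in>U. W z \<noteq> 0"
    and z0: "z0 \<in> ball 0 r"
    and max: "\<And>z. z \<in> ball 0 r \<Longrightarrow> T z ^ 3 * (r\<^sup>2 - (cmod z)\<^sup>2)\<^sup>2 \<le> T z0 ^ 3 * (r\<^sup>2 - (cmod z0)\<^sup>2)\<^sup>2"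
  shows "T z0 ^ 3 * (r\<^sup>2 - (cmod z0)\<^sup>2)\<^sup>2 \<le> (8 * C\<^sup>2 * (14 * C\<^sup>2) ^ 5) * r\<^sup>2"
proof -
  have I: "finite I" "card I = 7" "I \<noteq> {}" by (auto simp: I_def)
  have Npos: "0 < cmod (a z) + cmod (b z)" if "z \<in> ball 0 r" for z
    using nz[OF that] by (auto intro: add_pos_nonneg add_nonneg_pos)
  have lhol: "l j holomorphic_on ball 0 r" for j
    unfolding l_def[abs_def] by (intro holomorphic_intros hol)
  have Whol: "W holomorphic_on ball 0 r"
    unfolding W_def[abs_def] by (intro holomorphic_intros hol) auto
  have two: "0 < cmod (l i z) + cmod (l j z)" if "i \<in> I" "j \<in> I" "i \<noteq> j" "z \<in> ball 0 r" for i j z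
  proof -
    have "0 < C * (cmod (l i z) + cmod (l j z))"
      using C(3)[OF that(1-3), of "a z" "b z"] Npos[OF that(4)] by (simp add: l_def)
    then show ?thesis using C(1) by (simp add: zero_less_mult_iff)
  qed
  \<comment> \<open>If \<open>l j\<close> vanishes at \<open>z0\<close>, the other six forms do not.
    Their product has a root \<open>s\<close> there, and by \<open>eq\<close> the quotient
    \<open>W / s\<close> is a root of \<open>l j\<close>.\<close>
  have "\<exists>d m. d > 0 \<and> ball z0 d \<subseteq> ball 0 r \<and> m holomorphic_on ball z0 d \<and> (\<forall>z\<in>ball z0 d. (m z)\<^sup>2 = l j z)"
    if j: "j \<in> I" for j
  proof (cases "l j z0 = 0")
    case False
    obtain d s where "d > 0" "ball z0 d \<subseteq> ball 0 r" "s holomorphic_on ball z0 d"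
      "\<And>z. z \<in> ball z0 d \<Longrightarrow> (s z)\<^sup>2 = l j z \<and> s z \<noteq> 0"
      using holomorphic_local_sqrt[OF lhol _ z0 False] by blast
    then show ?thesis by blast
  next
    case True
    let ?v = "\<lambda>z. \<Prod>k\<in>I - {j}. l k z"
    have v0: "?v z0 \<noteq> 0"
      using two[OF j _ _ z0] True I by (auto simp: prod_zero_iff)
    have vhol: "?v holomorphic_on ball 0 r" by (intro holomorphic_intros lhol)
    obtain d s where d: "d > 0" "ball z0 d \<subseteq> ball 0 r" "s holomorphic_on ball z0 d"
      "\<And>z. z \<in> ball z0 d \<Longrightarrow> (s z)\<^sup>2 = ?v z \<and> s z \<noteq> 0"
      using holomorphic_local_sqrt[OF vhol _ z0 v0] by blast
    have "(\<lambda>z. W z / s z) holomorphic_on ball z0 d"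
      using d holomorphic_on_subset[OF Whol d(2)] by (intro holomorphic_intros) auto
    moreover have "(W z / s z)\<^sup>2 = l j z" if z: "z \<in> ball z0 d" for z
    proof -
      have "(W z)\<^sup>2 = l j z * ?v z" using eq[of z] d(2) z j I by (auto simp: prod.remove)
      moreover have "?v z \<noteq> 0" using d(4)[OF z] by (metis zero_eq_power2)
      ultimately show ?thesis using d(4)[OF z] by (simp add: power_divide)
    qed
    ultimately show ?thesis using d by blast
  qed
  then obtain d0 m where m: "\<And>j. j \<in> I \<Longrightarrow> 0 < d0 j \<and> ball z0 (d0 j) \<subseteq> ball 0 r \<and> m j holomorphic_on ball z0 (d0 j)
      \<and> (\<forall>z\<in>ball z0 (d0 j). (m j z)\<^sup>2 = l j z)" by metis
  define d where "d = Min (d0 ` I)"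
  have d: "0 < d" using I m by (auto simp: d_def)
  have dle: "ball z0 d \<subseteq> ball z0 (d0 j)" if "j \<in> I" for j
    using I that by (intro subset_ball) (auto simp: d_def)
  have dsub: "ball z0 d \<subseteq> ball 0 r" using dle m[of 1] by (force simp: I_def)
  have mhol: "m j holomorphic_on ball z0 d" if "j \<in> I" for j
    using m[OF that] dle[OF that] holomorphic_on_subset by blast
  have msq: "(m j z)\<^sup>2 = l j z" if "j \<in> I" "z \<in> ball z0 d" for j z
    using m[OF that(1)] dle[OF that(1)] that(2) by blast
  have z0d: "z0 \<in> ball z0 d" using d by simp
  have TT: "T z = (\<Sum>j\<in>I. (cmod (m j z))\<^sup>2)" if "z \<in> ball z0 d" for z
    unfolding T_def using msq that by (intro sum.cong refl) (simp flip: norm_power)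
  have Tpos: "0 < T z" if "z \<in> ball 0 r" for z
  proof -
    have "0 < cmod (l 1 z) + cmod (l 2 z)" using two[OF _ _ _ that, of 1 2] by (simp add: I_def)
    also have "\<dots> = (\<Sum>j\<in>{1,2}. cmod (l j z))" by simp
    also have "\<dots> \<le> T z" unfolding T_def by (intro sum_mono2) (auto simp: I_def)
    finally show ?thesis .
  qed
  let ?q = "(r\<^sup>2 - (cmod z0)\<^sup>2)\<^sup>2"
  let ?G = "T z0 * (\<Sum>j\<in>I. (cmod (deriv (m j) z0))\<^sup>2) - (cmod (\<Sum>j\<in>I. cnj (m j z0) * deriv (m j) z0))\<^sup>2"
  have lap: "3 * ?G * ?q \<le> 2 * r\<^sup>2 * (T z0)\<^sup>2"
  proof -
    have "(\<Sum>j\<in>I. (cmod (m j z))\<^sup>2) ^ 3 * (r\<^sup>2 - (cmod z)\<^sup>2)\<^sup>2 \<le> (\<Sum>j\<in>I. (cmod (m j z0))\<^sup>2) ^ 3 * (r\<^sup>2 - (cmod z0)\<^sup>2)\<^sup>2"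
      if "z \<in> ball z0 d" for z
      using max[of z] TT[OF that] TT[OF z0d] dsub that by auto
    moreover have "0 < (\<Sum>j\<in>I. (cmod (m j z))\<^sup>2)" if "z \<in> ball z0 d" for z
      using Tpos[of z] TT[OF that] dsub that by auto
    ultimately show ?thesis
      using laplace_ln_max[OF I(1) d dsub mhol] TT[OF z0d] by simp
  qed
  \<comment> \<open>The smallest form, which may vanish, is put into the pair (i, j), so that the
    five forms left over are all large. The constant in \<open>big\<close> is 14 = 7 * 2: each of
    the seven forms is at most C (|a| + |b|), and |a| + |b| is at most 2 C |l_k|.\<close>
  obtain i where i: "i \<in> I" and imin: "\<And>k. k \<in> I \<Longrightarrow> cmod (l i z0) \<le> cmod (l k z0)"
    using ex_is_arg_min_if_finite[OF I(1,3), of "\<lambda>k. cmod (l k z0)"]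
    by (auto simp: is_arg_min_linorder)
  obtain j where j: "j \<in> I" "i \<noteq> j"
    using i that[of 1] that[of 2] by (cases "i = 1") (auto simp: I_def)
  have big: "T z0 \<le> 14 * C\<^sup>2 * cmod (l k z0)" if k: "k \<in> I" "k \<noteq> i" for k
  proof -
    have "cmod (a z0) + cmod (b z0) \<le> C * (cmod (l i z0) + cmod (l k z0))"
      using C(3)[of i k "a z0" "b z0"] i k by (simp add: l_def)
    also have "\<dots> \<le> C * (2 * cmod (l k z0))" using C(1) imin[OF k(1)] by (intro mult_left_mono) auto
    finally have N: "cmod (a z0) + cmod (b z0) \<le> C * (2 * cmod (l k z0))" .
    have "T z0 \<le> (\<Sum>j\<in>I. C * (cmod (a z0) + cmod (b z0)))"
      unfolding T_def l_def by (intro sum_mono C(2))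
    also have "\<dots> = 7 * C * (cmod (a z0) + cmod (b z0))" using I by simp
    also have "\<dots> \<le> 7 * C * (C * (2 * cmod (l k z0)))" using C(1) N by (intro mult_left_mono) auto
    finally show ?thesis by (simp add: power2_eq_square)
  qed
  \<comment> \<open>\<open>D\<close> is the Wronskian of the roots \<open>m i\<close> and
    \<open>m j\<close>. Since l = m^2, one has 2 m_i m_j D = (\<alpha>_j - \<alpha>_i) W. Squaring
    and inserting \<open>eq\<close> gives \<open>\<Psi> = 0\<close> up to the factor l_i
    l_j.\<close>
  define D where "D z = m i z * deriv (m j) z - m j z * deriv (m i) z" for z
  define \<Psi> where "\<Psi> z = 4 * (D z)\<^sup>2 - (\<alpha> j - \<alpha> i)\<^sup>2 * (\<Prod>k\<in>I - {i, j}. l k z)" for z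
  have Psi: "l i z * l j z * \<Psi> z = 0" if z: "z \<in> ball z0 d" for z
  proof -
    have ld: "deriv (l k) z = deriv a z - \<alpha> k * deriv b z" for k
    proof -
      have zr: "z \<in> ball 0 r" using z dsub by blast
      show ?thesis unfolding l_def[abs_def]
        by (rule DERIV_imp_deriv)
          (auto intro!: derivative_eq_intros holomorphic_derivI[OF hol(1) open_ball zr] holomorphic_derivI[OF hol(2) open_ball zr])
    qed
    have lm: "deriv (l k) z = 2 * m k z * deriv (m k) z" if k: "k \<in> I" for k
    proof -
      have "((\<lambda>z. (m k z)\<^sup>2) has_field_derivative 2 * m k z * deriv (m k) z) (at z)"
        using z by (auto intro!: derivative_eq_intros holomorphic_derivI[OF mhol[OF k]])
      then have "(l k has_field_derivative 2 * m k z * deriv (m k) z) (at z)"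
        by (rule has_field_derivative_transform_within_open[of _ _ _ "ball z0 d"]) (use z msq[OF k] in auto)
      then show ?thesis by (rule DERIV_imp_deriv)
    qed
    have "2 * m i z * m j z * D z = (m i z)\<^sup>2 * (2 * m j z * deriv (m j) z) - (m j z)\<^sup>2 * (2 * m i z * deriv (m i) z)"
      by (simp add: D_def power2_eq_square algebra_simps)
    also have "\<dots> = l i z * (deriv a z - \<alpha> j * deriv b z) - l j z * (deriv a z - \<alpha> i * deriv b z)"
      using lm[OF i] lm[OF j(1)] ld msq[OF i z] msq[OF j(1) z] by simp
    also have "\<dots> = (\<alpha> j - \<alpha> i) * W z" by (simp add: l_def W_def algebra_simps)
    finally have "(2 * m i z * m j z * D z)\<^sup>2 = (\<alpha> j - \<alpha> i)\<^sup>2 * (W z)\<^sup>2" by (simp add: power_mult_distrib)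
    also have "(W z)\<^sup>2 = l i z * (l j z * (\<Prod>k\<in>I - {i, j}. l k z))"
    proof -
      have "(W z)\<^sup>2 = (\<Prod>k\<in>I. l k z)" using eq z dsub by blast
      also have "\<dots> = l i z * (\<Prod>k\<in>I - {i}. l k z)" using I i by (simp add: prod.remove)
      also have "(\<Prod>k\<in>I - {i}. l k z) = l j z * (\<Prod>k\<in>I - {i} - {j}. l k z)"
        using I j by (intro prod.remove) auto
      also have "I - {i} - {j} = I - {i, j}" by auto
      finally show ?thesis .
    qed
    finally show ?thesis using msq[OF i z] msq[OF j(1) z]
      by (simp add: \<Psi>_def power_mult_distrib algebra_simps)
  qed
  \<comment> \<open>The factor l_i l_j can be cancelled only where it is not zero. Such points are
    dense: by \<open>nd\<close> every open set contains a point with W \<noteq> 0, and there no form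
    vanishes. Continuity gives the identity at \<open>z0\<close> itself.\<close>
  have "\<Psi> z0 = 0"
  proof (rule ccontr)
    assume ne: "\<Psi> z0 \<noteq> 0"
    have "\<Psi> holomorphic_on ball z0 d"
      unfolding \<Psi>_def[abs_def] D_def[abs_def]
      by (intro holomorphic_intros mhol i j holomorphic_on_subset[OF lhol dsub]) auto
    then have cont: "continuous_on (ball z0 d) \<Psi>" by (rule holomorphic_on_imp_continuous_on)
    define U where "U = ball z0 d \<inter> \<Psi> -` (- {0})"
    have "open U" unfolding U_def by (rule continuous_open_preimage[OF cont]) auto
    moreover have "z0 \<in> U" using ne z0d by (simp add: U_def)
    moreover have "U \<subseteq> ball 0 r" using dsub by (auto simp: U_def)
    ultimately obtain z where z: "z \<in> U" "W z \<noteq> 0" using nd[of U] by blast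
    then have "l i z * l j z = 0" using Psi[of z] by (auto simp: U_def)
    then have "(\<Prod>k\<in>I. l k z) = 0" using i j I by (auto simp: prod_zero_iff)
    then show False using eq[of z] z dsub by (auto simp: U_def)
  qed
  then have Deq: "4 * (D z0)\<^sup>2 = (\<alpha> j - \<alpha> i)\<^sup>2 * (\<Prod>k\<in>I - {i, j}. l k z0)" by (simp add: \<Psi>_def)
  have "4 * (cmod (D z0))\<^sup>2 = cmod (4 * (D z0)\<^sup>2)" by (simp add: norm_mult norm_power)
  also have "\<dots> = (cmod (\<alpha> j - \<alpha> i))\<^sup>2 * (\<Prod>k\<in>I - {i, j}. cmod (l k z0))"
    unfolding Deq by (simp add: norm_mult norm_power prod_norm)
  finally have Dn: "4 * (cmod (D z0))\<^sup>2 = (cmod (\<alpha> j - \<alpha> i))\<^sup>2 * (\<Prod>k\<in>I - {i, j}. cmod (l k z0))" .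
  have T0: "0 < T z0" using Tpos z0 by blast
  have "T z0 ^ 5 = (\<Prod>k\<in>I - {i, j}. T z0)" using I i j by (simp add: card_Diff_subset)
  also have "\<dots> \<le> (\<Prod>k\<in>I - {i, j}. 14 * C\<^sup>2 * cmod (l k z0))"
    using big T0 by (intro prod_mono) auto
  also have "\<dots> = (14 * C\<^sup>2) ^ 5 * (\<Prod>k\<in>I - {i, j}. cmod (l k z0))"
    using I i j by (simp add: prod.distrib card_Diff_subset)
  finally have T5: "T z0 ^ 5 \<le> (14 * C\<^sup>2) ^ 5 * (\<Prod>k\<in>I - {i, j}. cmod (l k z0))" .
  have "1 \<le> (C * cmod (\<alpha> j - \<alpha> i))\<^sup>2" using C(4)[OF j(1) i] j by simp
  then have "1 * (\<Prod>k\<in>I - {i, j}. cmod (l k z0)) \<le> (C * cmod (\<alpha> j - \<alpha> i))\<^sup>2 * (\<Prod>k\<in>I - {i, j}. cmod (l k z0))"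
    by (intro mult_right_mono prod_nonneg) auto
  also have "\<dots> = 4 * C\<^sup>2 * (cmod (D z0))\<^sup>2" using Dn by (simp add: power_mult_distrib)
  also have "\<dots> \<le> 4 * C\<^sup>2 * ?G"
    using lagrange_pair_le[OF I(1) i j, of "\<lambda>k. m k z0" "\<lambda>k. deriv (m k) z0"] TT[OF z0d]
    by (intro mult_left_mono) (auto simp: D_def)
  finally have G: "(\<Prod>k\<in>I - {i, j}. cmod (l k z0)) \<le> 4 * C\<^sup>2 * ?G" by simp
  have G0: "0 \<le> ?G"
    unfolding TT[OF z0d]
    by (rule order_trans[OF zero_le_power2 lagrange_pair_le[OF I(1) i j, of "\<lambda>k. m k z0" "\<lambda>k. deriv (m k) z0"]])
  \<comment> \<open>Arithmetic for t = T, P the product of the five forms and G the Lagrange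
    difference. The power (14 C^2)^5 comes from \<open>T5\<close>, the factor 4 C^2 from the lower
    bound for the minor and 2 r^2 t^2 from \<open>lap\<close>, whose factor 3 is given away.\<close>
  have final: "t ^ 3 * q \<le> 8 * C\<^sup>2 * (14 * C\<^sup>2) ^ 5 * r\<^sup>2"
    if t: "0 < t" "t ^ 5 \<le> (14 * C\<^sup>2) ^ 5 * P" and P: "P \<le> 4 * C\<^sup>2 * G"
      and q: "0 \<le> q" and G: "0 \<le> G" "3 * G * q \<le> 2 * r\<^sup>2 * t\<^sup>2" for t P G q :: real
  proof -
    define B where "B = (14 * C\<^sup>2) ^ 5"
    have B: "0 \<le> B" by (simp add: B_def)
    have "t ^ 5 \<le> B * (4 * C\<^sup>2 * G)"
      using t(2) mult_left_mono[OF P B] unfolding B_def[symmetric] by linarith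
    then have "t ^ 5 * q \<le> B * (4 * C\<^sup>2 * G) * q" using q by (rule mult_right_mono)
    also have "\<dots> = (4 * C\<^sup>2 * B) * (G * q)" by (simp only: mult_ac)
    also have "\<dots> \<le> (4 * C\<^sup>2 * B) * (2 * r\<^sup>2 * t\<^sup>2)"
    proof (rule mult_left_mono)
      have "0 \<le> G * q" using G(1) q by (rule mult_nonneg_nonneg)
      then show "G * q \<le> 2 * r\<^sup>2 * t\<^sup>2" using G(2) by linarith
      show "0 \<le> 4 * C\<^sup>2 * B" using B by simp
    qed
    also have "\<dots> = t\<^sup>2 * (8 * C\<^sup>2 * B * r\<^sup>2)" by simp
    finally have "t\<^sup>2 * (t ^ 3 * q) \<le> t\<^sup>2 * (8 * C\<^sup>2 * B * r\<^sup>2)"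
      by (simp add: mult.assoc flip: power_add)
    moreover have "0 < t\<^sup>2" using t(1) by simp
    ultimately show ?thesis unfolding B_def by (simp only: mult_le_cancel_left_pos)
  qed
  show ?thesis
    by (rule final[OF T0 T5 G _ G0 lap]) simp
qed

text \<open>What matters is that \<open>K\<close> is uniform in \<open>R\<close>, \<open>a\<close>
  and \<open>b\<close>: the same bound serves a fixed disk and disks of growing radius. The forms
  may be unbounded near the rim, so the maximum is taken over a closed disk of radius r < R, where
  the factor vanishes on the boundary circle; then r tends to R.\<close>

proposition wronskian_schwarz:
  fixes \<alpha> :: "nat \<Rightarrow> complex"
  assumes inj: "inj_on \<alpha> {1..7}"
  obtains K where "K > 0" "\<And>R a b z. \<lbrakk>a holomorphic_on ball 0 R; b holomorphic_on ball 0 R;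
      \<And>z. z \<in> ball 0 R \<Longrightarrow> a z \<noteq> 0 \<or> b z \<noteq> 0;
      \<And>z. z \<in> ball 0 R \<Longrightarrow> (deriv a z * b z - a z * deriv b z)\<^sup>2 = (\<Prod>j\<in>{1..7}. a z - \<alpha> j * b z);
      \<And>U. \<lbrakk>open U; U \<noteq> {}; U \<subseteq> ball 0 R\<rbrakk> \<Longrightarrow> \<exists>z\<in>U. deriv a z * b z - a z * deriv b z \<noteq> 0;
      z \<in> ball 0 R\<rbrakk> \<Longrightarrow> (cmod (a z) + cmod (b z)) ^ 3 * (R\<^sup>2 - (cmod z)\<^sup>2)\<^sup>2 \<le> K * R\<^sup>2"
proof -
  obtain C where C: "C \<ge> 1" "\<And>j a b. j \<in> {1..7} \<Longrightarrow> cmod (a - \<alpha> j * b) \<le> C * (cmod a + cmod b)"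
    "\<And>i j a b. \<lbrakk>i \<in> {1..7}; j \<in> {1..7}; i \<noteq> j\<rbrakk> \<Longrightarrow> cmod a + cmod b \<le> C * (cmod (a - \<alpha> i * b) + cmod (a - \<alpha> j * b))"
    "\<And>i j. \<lbrakk>i \<in> {1..7}; j \<in> {1..7}; i \<noteq> j\<rbrakk> \<Longrightarrow> 1 \<le> C * cmod (\<alpha> i - \<alpha> j)"
    using linear_forms_comparable[OF _ inj] by auto
  define K0 where "K0 = 8 * C\<^sup>2 * (14 * C\<^sup>2) ^ 5"
  have K0: "0 < K0" using C(1) by (simp add: K0_def)
  show thesis
  proof (rule that[of "C ^ 3 * K0"])
    show "0 < C ^ 3 * K0" using C(1) K0 by simp
    fix R :: real and a b :: "complex \<Rightarrow> complex" and z :: complex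
    assume hol: "a holomorphic_on ball 0 R" "b holomorphic_on ball 0 R"
      and nz: "\<And>z. z \<in> ball 0 R \<Longrightarrow> a z \<noteq> 0 \<or> b z \<noteq> 0"
      and eq: "\<And>z. z \<in> ball 0 R \<Longrightarrow> (deriv a z * b z - a z * deriv b z)\<^sup>2 = (\<Prod>j\<in>{1..7}. a z - \<alpha> j * b z)"
      and nd: "\<And>U. \<lbrakk>open U; U \<noteq> {}; U \<subseteq> ball 0 R\<rbrakk> \<Longrightarrow> \<exists>z\<in>U. deriv a z * b z - a z * deriv b z \<noteq> 0"
      and z: "z \<in> ball 0 R"
    define T where "T z = (\<Sum>j\<in>{1..7}. cmod (a z - \<alpha> j * b z))" for z
    have T0: "0 \<le> T z" for z by (simp add: T_def sum_nonneg)
    have le: "T z ^ 3 * (r\<^sup>2 - (cmod z)\<^sup>2)\<^sup>2 \<le> K0 * R\<^sup>2" if r: "cmod z < r" "r < R" for r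
    proof -
      define F where "F w = T w ^ 3 * (r\<^sup>2 - (cmod w)\<^sup>2)\<^sup>2" for w
      have sub: "cball 0 r \<subseteq> ball (0::complex) R" and sub': "ball 0 r \<subseteq> ball (0::complex) R" using r by auto
      have Fcont: "continuous_on (cball 0 r) F"
        unfolding F_def[abs_def] T_def[abs_def]
        by (intro continuous_intros holomorphic_on_imp_continuous_on holomorphic_on_subset[OF hol(1) sub]
            holomorphic_on_subset[OF hol(2) sub])
      have ne: "cball (0::complex) r \<noteq> {}" using r norm_ge_zero[of z] by (simp add: not_less del: norm_ge_zero)
      obtain w where w: "w \<in> cball 0 r" "\<And>v. v \<in> cball 0 r \<Longrightarrow> F v \<le> F w"
        using continuous_attains_sup[OF compact_cball ne Fcont] by blast
      have "F w \<le> K0 * r\<^sup>2"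
      proof (cases "cmod w < r")
        case True
        have nd': "\<exists>z\<in>U. deriv a z * b z - a z * deriv b z \<noteq> 0" if "open U" "U \<noteq> {}" "U \<subseteq> ball 0 r" for U
          using nd[of U] that sub' by blast
        show ?thesis unfolding F_def T_def K0_def
          by (rule wronskian_max_estimate[OF C(1) C(2) C(3) C(4) holomorphic_on_subset[OF hol(1) sub']
                holomorphic_on_subset[OF hol(2) sub'] nz eq nd'])
             (use True w(2) r in \<open>auto simp: F_def T_def\<close>)
      next
        case False
        then have "F w = 0" using w(1) by (simp add: F_def)
        then show ?thesis using K0 by simp
      qed
      also have "\<dots> \<le> K0 * R\<^sup>2" using K0 r by (intro mult_left_mono power_mono) (use r norm_ge_zero[of z] in linarith)+
      finally have "F w \<le> K0 * R\<^sup>2" .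
      moreover have "F z \<le> F w" using w(2)[of z] r by simp
      ultimately show ?thesis by (simp add: F_def)
    qed
    have "((\<lambda>r. T z ^ 3 * (r\<^sup>2 - (cmod z)\<^sup>2)\<^sup>2) \<longlongrightarrow> T z ^ 3 * (R\<^sup>2 - (cmod z)\<^sup>2)\<^sup>2) (at_left R)"
      by (intro tendsto_intros)
    moreover have "eventually (\<lambda>r. T z ^ 3 * (r\<^sup>2 - (cmod z)\<^sup>2)\<^sup>2 \<le> K0 * R\<^sup>2) (at_left R)"
      by (rule eventually_mono[OF eventually_at_left_real[of "cmod z" R]]) (use z le in auto)
    ultimately have lim: "T z ^ 3 * (R\<^sup>2 - (cmod z)\<^sup>2)\<^sup>2 \<le> K0 * R\<^sup>2"
      by (rule tendsto_upperbound) simp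
    have "cmod (a z) + cmod (b z) \<le> C * (cmod (a z - \<alpha> 1 * b z) + cmod (a z - \<alpha> 2 * b z))"
      by (rule C(3)) auto
    also have "\<dots> = C * (\<Sum>j\<in>{1,2}. cmod (a z - \<alpha> j * b z))" by simp
    also have "\<dots> \<le> C * T z" unfolding T_def using C(1) by (intro mult_left_mono sum_mono2) auto
    finally have "(cmod (a z) + cmod (b z)) ^ 3 \<le> (C * T z) ^ 3" by (intro power_mono) auto
    then have "(cmod (a z) + cmod (b z)) ^ 3 * (R\<^sup>2 - (cmod z)\<^sup>2)\<^sup>2 \<le> (C * T z) ^ 3 * (R\<^sup>2 - (cmod z)\<^sup>2)\<^sup>2"
      by (rule mult_right_mono) simp
    also have "\<dots> = C ^ 3 * (T z ^ 3 * (R\<^sup>2 - (cmod z)\<^sup>2)\<^sup>2)" by (simp add: power_mult_distrib)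
    also have "\<dots> \<le> C ^ 3 * (K0 * R\<^sup>2)" using C(1) lim by (intro mult_left_mono) auto
    finally show "(cmod (a z) + cmod (b z)) ^ 3 * (R\<^sup>2 - (cmod z)\<^sup>2)\<^sup>2 \<le> C ^ 3 * K0 * R\<^sup>2" by simp
  qed
qed

section \<open>Legendrian curves and complete flows\<close>

text \<open>Strict convexity of the ball: the open chord between two boundary points lies inside. In
  \<open>maximal_disc\<close> it shows that two overlapping extensions also meet inside the
  disk.\<close>

lemma norm_convex_combination_less:
  fixes u v :: "'v::real_inner"
  assumes "norm u = R" "norm v = R" "u \<noteq> v" "0 < s" "s < 1" "0 < R"
  shows "norm (u + s *\<^sub>R (v - u)) < R"
proof -
  have "(norm (u + s *\<^sub>R (v - u)))\<^sup>2 = R\<^sup>2 - s * (1 - s) * (norm (v - u))\<^sup>2"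
  proof -
    have uu: "u \<bullet> u = R\<^sup>2" "v \<bullet> v = R\<^sup>2" using assms(1,2) by (auto simp: power2_norm_eq_inner[symmetric])
    show ?thesis
      unfolding power2_norm_eq_inner inner_add_left inner_add_right inner_diff_left inner_diff_right
        inner_scaleR_left inner_scaleR_right uu inner_commute[of v u]
      by (simp add: algebra_simps)
  qed
  moreover have "0 < s * (1 - s) * (norm (v - u))\<^sup>2" using assms by simp
  ultimately have "(norm (u + s *\<^sub>R (v - u)))\<^sup>2 < R\<^sup>2" by simp
  then show ?thesis using assms(6) by (simp add: power_less_imp_less_base)
qed

text \<open>Solutions on concentric disks agree by uniqueness and glue to one on the disk whose
  radius R is the supremum. If R is finite, the local extensions around the boundary circle agree
  with each other and, by compactness, cover a larger disk. \<open>Sol\<close> is left abstract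
  because two different flows are continued in this way.\<close>

lemma maximal_disc:
  fixes Sol :: "(complex \<Rightarrow> 'b) \<Rightarrow> complex set \<Rightarrow> bool"
  assumes mono: "\<And>\<phi> U V. \<lbrakk>Sol \<phi> U; open V; V \<subseteq> U\<rbrakk> \<Longrightarrow> Sol \<phi> V"
    and glue: "\<And>\<phi> U. \<lbrakk>open U; \<And>z. z \<in> U \<Longrightarrow> \<exists>V. z \<in> V \<and> open V \<and> Sol \<phi> V\<rbrakk> \<Longrightarrow> Sol \<phi> U"
    and cong: "\<And>\<phi> \<psi> U. \<lbrakk>Sol \<phi> U; \<And>z. z \<in> U \<Longrightarrow> \<phi> z = \<psi> z\<rbrakk> \<Longrightarrow> Sol \<psi> U"
    and uniq: "\<And>\<phi> \<psi> U z w. \<lbrakk>Sol \<phi> U; Sol \<psi> U; connected U; z \<in> U; \<phi> z = \<psi> z; w \<in> U\<rbrakk> \<Longrightarrow> \<phi> w = \<psi> w"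
    and ext: "\<And>\<phi> R e. \<lbrakk>0 < R; Sol \<phi> (ball 0 R); \<phi> 0 = x; cmod e = 1\<rbrakk> \<Longrightarrow>
       \<exists>\<psi> d. 0 < d \<and> Sol \<psi> (ball (R *\<^sub>R e) d) \<and> (\<forall>z\<in>ball (R *\<^sub>R e) d \<inter> ball 0 R. \<psi> z = \<phi> z)"
    and start: "0 < r0" "Sol \<phi>0 (ball 0 r0)" "\<phi>0 0 = x"
  shows "\<exists>\<phi>. Sol \<phi> UNIV \<and> \<phi> 0 = x"
proof -
  define S where "S = {r. 0 < r \<and> (\<exists>\<phi>. Sol \<phi> (ball 0 r) \<and> \<phi> 0 = x)}"
  have "r0 \<in> S" using start by (auto simp: S_def)
  have "\<forall>r\<in>S. \<exists>\<phi>. Sol \<phi> (ball 0 r) \<and> \<phi> 0 = x" by (simp add: S_def)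
  then obtain F where F: "\<And>r. r \<in> S \<Longrightarrow> Sol (F r) (ball 0 r) \<and> F r 0 = x"
    using bchoice[of S "\<lambda>r \<phi>. Sol \<phi> (ball 0 r) \<and> \<phi> 0 = x"] by blast
  have pos: "0 < r" if "r \<in> S" for r using that by (simp add: S_def)
  have agree: "F r z = F s z" if rs: "r \<in> S" "s \<in> S" "cmod z < r" "cmod z < s" for r s z
  proof -
    have "Sol (F r) (ball 0 (min r s))" "Sol (F s) (ball 0 (min r s))"
      using F[OF rs(1)] F[OF rs(2)] by (auto intro: mono)
    then show ?thesis
      by (rule uniq[where z = 0]) (use F[OF rs(1)] F[OF rs(2)] pos rs in auto)
  qed
  \<comment> \<open>By \<open>agree\<close> the chosen radius does not influence the value.\<close>
  define \<Phi> where "\<Phi> z = F (SOME r. r \<in> S \<and> cmod z < r) z" for z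
  have Phi: "\<Phi> z = F r z" if "r \<in> S" "cmod z < r" for r z
    unfolding \<Phi>_def
    by (rule agree) (use someI[of "\<lambda>r. r \<in> S \<and> cmod z < r" r] that in auto)
  have PhiSol: "Sol \<Phi> (ball 0 r)" if "r \<in> S" for r
    by (rule cong[of "F r"]) (use F[OF that] Phi[OF that] in auto)
  have Phi0: "\<Phi> 0 = x" using Phi[OF \<open>r0 \<in> S\<close>, of 0] F[OF \<open>r0 \<in> S\<close>] start(1) by simp
  show ?thesis
  proof (cases "bdd_above S")
    case False
    have "Sol \<Phi> UNIV"
    proof (rule glue)
      fix z :: complex
      obtain r where "r \<in> S" "cmod z < r" using False by (auto simp: bdd_above_def not_le)
      then show "\<exists>V. z \<in> V \<and> open V \<and> Sol \<Phi> V" using PhiSol by (intro exI[of _ "ball 0 r"]) auto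
    qed auto
    then show ?thesis using Phi0 by blast
  next
    case True
    define R where "R = Sup S"
    have R: "0 < R" using cSup_upper[OF \<open>r0 \<in> S\<close> True] start(1) by (simp add: R_def)
    have "Sol \<Phi> (ball 0 R)"
    proof (rule glue)
      fix z :: complex
      assume "z \<in> ball 0 R"
      then obtain r where "r \<in> S" "cmod z < r"
        using less_cSup_iff[OF _ True, of "cmod z"] \<open>r0 \<in> S\<close> by (auto simp: R_def)
      then show "\<exists>V. z \<in> V \<and> open V \<and> Sol \<Phi> V" using PhiSol by (intro exI[of _ "ball 0 r"]) auto
    qed auto
    note PR = this
    obtain \<psi> d where \<psi>: "\<And>e. cmod e = 1 \<Longrightarrow> 0 < d e \<and> Sol (\<psi> e) (ball (R *\<^sub>R e) (d e)) \<and>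
        (\<forall>z\<in>ball (R *\<^sub>R e) (d e) \<inter> ball 0 R. \<psi> e z = \<Phi> z)"
    proof -
      define Q where "Q e p \<longleftrightarrow> (cmod e = 1 \<longrightarrow> 0 < snd p \<and> Sol (fst p) (ball (R *\<^sub>R e) (snd p)) \<and>
        (\<forall>z\<in>ball (R *\<^sub>R e) (snd p) \<inter> ball 0 R. fst p z = \<Phi> z))" for e and p :: "(complex \<Rightarrow> 'b) \<times> real"
      have "\<exists>p. Q e p" for e
      proof (cases "cmod e = 1")
        case True
        then obtain \<psi> d where "0 < d" "Sol \<psi> (ball (R *\<^sub>R e) d)"
          "\<forall>z\<in>ball (R *\<^sub>R e) d \<inter> ball 0 R. \<psi> z = \<Phi> z"
          using ext[OF R PR Phi0 True] by blast
        then show ?thesis by (intro exI[of _ "(\<psi>, d)"]) (simp add: Q_def)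
      qed (simp add: Q_def)
      then obtain p where "\<And>e. Q e (p e)" using choice[of Q] by auto
      then show thesis using that[of "\<lambda>e. snd (p e)" "\<lambda>e. fst (p e)"] by (simp add: Q_def)
    qed
    let ?B = "\<lambda>e. ball (R *\<^sub>R e) (d e)"
    \<comment> \<open>Two extension disks that meet have centres closer than the sum of their radii.
      The point \<open>w\<close> that divides the chord of the centres in the ratio of the radii
      lies in both disks and, by strict convexity, in the open disk of radius R, where both
      extensions equal \<open>\<Phi>\<close>. Uniqueness on the convex intersection does the
      rest.\<close>
    have agr: "\<psi> e z = \<psi> e' z" if e: "cmod e = 1" "cmod e' = 1" and z: "z \<in> ?B e" "z \<in> ?B e'" for e e' z
    proof (cases "e = e'")
      case False
      have d: "0 < d e" "0 < d e'" using \<psi> e by auto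
      define s where "s = d e / (d e + d e')"
      define w where "w = R *\<^sub>R e + s *\<^sub>R (R *\<^sub>R e' - R *\<^sub>R e)"
      have s: "0 < s" "s < 1" "1 - s = d e' / (d e + d e')" using d by (auto simp: s_def field_simps)
      have D: "norm (R *\<^sub>R e' - R *\<^sub>R e) < d e + d e'"
        using z dist_triangle[of "R *\<^sub>R e'" "R *\<^sub>R e" z] by (auto simp: dist_norm norm_minus_commute)
      have "dist (R *\<^sub>R e) w = s * norm (R *\<^sub>R e' - R *\<^sub>R e)"
        using s by (simp add: w_def dist_norm)
      also have "\<dots> < s * (d e + d e')" using s D by (intro mult_strict_left_mono)
      also have "\<dots> = d e" using d by (simp add: s_def)
      finally have w1: "w \<in> ?B e" by simp
      have "R *\<^sub>R e' - w = (1 - s) *\<^sub>R (R *\<^sub>R e' - R *\<^sub>R e)" by (simp add: w_def algebra_simps)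
      then have "dist (R *\<^sub>R e') w = (1 - s) * norm (R *\<^sub>R e' - R *\<^sub>R e)"
        using s d by (simp add: dist_norm)
      also have "\<dots> < (1 - s) * (d e + d e')" using s D by (intro mult_strict_left_mono) auto
      also have "\<dots> = d e'" using d s(3) by simp
      finally have w2: "w \<in> ?B e'" by simp
      have w3: "w \<in> ball 0 R"
        using norm_convex_combination_less[of "R *\<^sub>R e" R "R *\<^sub>R e'" s] R e s False by (simp add: w_def)
      have "Sol (\<psi> e) (?B e \<inter> ?B e')" "Sol (\<psi> e') (?B e \<inter> ?B e')"
        using \<psi>[OF e(1)] \<psi>[OF e(2)] by (auto intro: mono)
      moreover have "connected (?B e \<inter> ?B e')" by (intro convex_connected convex_Int) auto
      moreover have "w \<in> ?B e \<inter> ?B e'" using w1 w2 by blast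
      moreover have "\<psi> e w = \<psi> e' w" using \<psi>[OF e(1)] \<psi>[OF e(2)] w1 w2 w3 by auto
      ultimately show ?thesis
        by (rule uniq) (use z in auto)
    qed simp
    define \<Omega> where "\<Omega> = ball 0 R \<union> (\<Union>e\<in>sphere 0 1. ?B e)"
    define \<Phi>' where "\<Phi>' z = (if cmod z < R then \<Phi> z else \<psi> (SOME e. cmod e = 1 \<and> z \<in> ?B e) z)" for z
    have P1: "\<Phi>' z = \<psi> e z" if "cmod e = 1" "z \<in> ?B e" for e z
    proof (cases "cmod z < R")
      case True
      then show ?thesis using \<psi>[OF that(1)] that by (auto simp: \<Phi>'_def)
    next
      case False
      define e' where "e' = (SOME e. cmod e = 1 \<and> z \<in> ?B e)"
      have "cmod e' = 1 \<and> z \<in> ?B e'"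
        unfolding e'_def by (rule someI[of _ e]) (use that in auto)
      then have "\<psi> e' z = \<psi> e z" using agr that by blast
      then show ?thesis using False by (simp add: \<Phi>'_def e'_def)
    qed
    have "open \<Omega>" by (auto simp: \<Omega>_def)
    have OSol: "Sol \<Phi>' \<Omega>"
    proof (rule glue[OF \<open>open \<Omega>\<close>])
      fix z assume z: "z \<in> \<Omega>"
      show "\<exists>V. z \<in> V \<and> open V \<and> Sol \<Phi>' V"
      proof (cases "cmod z < R")
        case True
        have "Sol \<Phi>' (ball 0 R)" by (rule cong[OF PR]) (simp add: \<Phi>'_def)
        then show ?thesis using True by (intro exI[of _ "ball 0 R"]) auto
      next
        case False
        then obtain e where e: "cmod e = 1" "z \<in> ?B e" using z by (auto simp: \<Omega>_def)
        have "Sol \<Phi>' (?B e)" by (rule cong[of "\<psi> e"]) (use \<psi>[OF e(1)] P1[OF e(1)] in auto)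
        then show ?thesis using e by (intro exI[of _ "?B e"]) auto
      qed
    qed
    have "cball 0 R \<subseteq> \<Omega>"
    proof
      fix z :: complex assume z: "z \<in> cball 0 R"
      show "z \<in> \<Omega>"
      proof (cases "cmod z < R")
        case False
        then have zR: "cmod z = R" using z by simp
        define e where "e = z /\<^sub>R R"
        have e: "cmod e = 1" "R *\<^sub>R e = z" using R zR by (auto simp: e_def)
        then have "z \<in> ?B e" using \<psi>[of e] by simp
        then show ?thesis using e(1) by (auto simp: \<Omega>_def)
      qed (auto simp: \<Omega>_def)
    qed
    \<comment> \<open>The closed disk is compact, so \<open>\<Omega>\<close> contains a
      neighbourhood of uniform width and thus a disk of radius beyond the supremum.\<close>
    then obtain \<epsilon> where \<epsilon>: "0 < \<epsilon>" "(\<Union>z\<in>cball 0 R. ball z \<epsilon>) \<subseteq> \<Omega>"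
      using compact_subset_open_imp_ball_epsilon_subset[OF compact_cball \<open>open \<Omega>\<close>] by metis
    have "ball 0 (R + \<epsilon>) \<subseteq> \<Omega>"
    proof
      fix z :: complex assume z: "z \<in> ball 0 (R + \<epsilon>)"
      show "z \<in> \<Omega>"
      proof (cases "cmod z < R")
        case False
        then have z0: "0 < cmod z" using R by linarith
        define w where "w = (R / cmod z) *\<^sub>R z"
        have "w - z = (R / cmod z - 1) *\<^sub>R z" by (simp add: w_def scaleR_diff_left)
        then have "dist w z = \<bar>R / cmod z - 1\<bar> * cmod z" by (simp add: dist_norm)
        also have "\<dots> = \<bar>R - cmod z\<bar>"
        proof -
          have "R - cmod z = (R / cmod z - 1) * cmod z" using z0 by (simp add: field_simps)
          then show ?thesis using z0 by (simp only: abs_mult abs_norm_cancel)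
        qed
        also have "\<dots> < \<epsilon>" using False z by simp
        finally have "z \<in> ball w \<epsilon>" by simp
        moreover have "w \<in> cball 0 R" using z0 R by (simp add: w_def)
        ultimately show ?thesis using \<epsilon>(2) by blast
      qed (auto simp: \<Omega>_def)
    qed
    then have "Sol \<Phi>' (ball 0 (R + \<epsilon>))" by (intro mono[OF OSol]) auto
    moreover have "\<Phi>' 0 = x" using R Phi0 by (simp add: \<Phi>'_def)
    ultimately have "R + \<epsilon> \<in> S" using R \<epsilon>(1) by (auto simp: S_def)
    then have "R + \<epsilon> \<le> R" unfolding R_def using True by (rule cSup_upper)
    then show ?thesis using \<epsilon>(1) by simp
  qed
qed

section \<open>Parametrized curves in the surface and their forms\<close>

text \<open>\<open>thf\<close> and \<open>omf\<close> are the coefficients of the pullbacks of \<open>\<theta>\<close> and \<open>\<omega>\<close> under a parametrized curve \<open>\<phi>\<close>, with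
  \<open>E\<^sup>-\<^sup>1\<close> replaced by the adjugate because \<open>det E = 1\<close>.\<close>
definition thf :: "('b \<Rightarrow> mat2) \<Rightarrow> (complex \<Rightarrow> 'b) \<Rightarrow> complex \<Rightarrow> complex" where
  "thf E \<phi> z = E (\<phi> z) $ 2 $ 2 * deriv (\<lambda>w. E (\<phi> w) $ 1 $ 2) z - E (\<phi> z) $ 1 $ 2 * deriv (\<lambda>w. E (\<phi> w) $ 2 $ 2) z"

definition omf :: "('b \<Rightarrow> mat2) \<Rightarrow> (complex \<Rightarrow> 'b) \<Rightarrow> complex \<Rightarrow> complex" where
  "omf E \<phi> z = E (\<phi> z) $ 1 $ 1 * deriv (\<lambda>w. E (\<phi> w) $ 2 $ 1) z - E (\<phi> z) $ 2 $ 1 * deriv (\<lambda>w. E (\<phi> w) $ 1 $ 1) z"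

text \<open>Holomorphy of a map into the surface is tested on the entries of \<open>E\<close>. As
  the lift is an immersion, this together with continuity makes charts of the surface dispensable in
  the definition.\<close>

definition holm :: "('b::topological_space \<Rightarrow> mat2) \<Rightarrow> (complex \<Rightarrow> 'b) \<Rightarrow> complex set \<Rightarrow> bool" where
  "holm E \<phi> U \<longleftrightarrow> open U \<and> continuous_on U \<phi> \<and> (\<forall>i j. (\<lambda>w. E (\<phi> w) $ i $ j) holomorphic_on U)"

text \<open>The pulled-back forms are those of a chart times the derivative of the coordinate
  expression of \<phi>, and the forms of a chart have no common zero. So the condition says that
  this derivative does not vanish.\<close>

definition imm :: "('b::topological_space \<Rightarrow> mat2) \<Rightarrow> (complex \<Rightarrow> 'b) \<Rightarrow> complex set \<Rightarrow> bool" where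
  "imm E \<phi> U \<longleftrightarrow> holm E \<phi> U \<and> (\<forall>z\<in>U. thf E \<phi> z \<noteq> 0 \<or> omf E \<phi> z \<noteq> 0)"

lemma holmD:
  assumes "holm E \<phi> U"
  shows "open U" "continuous_on U \<phi>" "(\<lambda>w. E (\<phi> w) $ i $ j) holomorphic_on U"
  using assms by (auto simp: holm_def)

lemma holm_subset: "\<lbrakk>holm E \<phi> U; open V; V \<subseteq> U\<rbrakk> \<Longrightarrow> holm E \<phi> V"
  unfolding holm_def by (auto intro: continuous_on_subset holomorphic_on_subset)

lemma imm_subset: "\<lbrakk>imm E \<phi> U; open V; V \<subseteq> U\<rbrakk> \<Longrightarrow> imm E \<phi> V"
  unfolding imm_def using holm_subset by blast

lemma thf_omf_cong_ev:
  assumes "\<forall>\<^sub>F w in nhds z. \<phi> w = \<psi> w"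
  shows "thf E \<phi> z = thf E \<psi> z" "omf E \<phi> z = omf E \<psi> z"
proof -
  have z: "\<phi> z = \<psi> z" using eventually_nhds_x_imp_x[OF assms] .
  have "deriv (\<lambda>w. E (\<phi> w) $ i $ j) z = deriv (\<lambda>w. E (\<psi> w) $ i $ j) z" for i j
    by (rule deriv_cong_ev) (use assms in \<open>auto elim: eventually_mono\<close>)
  then show "thf E \<phi> z = thf E \<psi> z" "omf E \<phi> z = omf E \<psi> z"
    by (simp_all add: thf_def omf_def z)
qed

lemma thf_omf_cong:
  assumes "open U" "z \<in> U" "\<And>w. w \<in> U \<Longrightarrow> \<phi> w = \<psi> w"
  shows "thf E \<phi> z = thf E \<psi> z" "omf E \<phi> z = omf E \<psi> z"
proof -
  have "\<forall>\<^sub>F w in nhds z. \<phi> w = \<psi> w"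
    using eventually_nhds_in_open[OF assms(1,2)] by (rule eventually_mono) (rule assms(3))
  then show "thf E \<phi> z = thf E \<psi> z" "omf E \<phi> z = omf E \<psi> z"
    by (rule thf_omf_cong_ev)+
qed

lemma holm_cong:
  assumes "holm E \<phi> U" "\<And>w. w \<in> U \<Longrightarrow> \<phi> w = \<psi> w"
  shows "holm E \<psi> U"
  unfolding holm_def
proof (intro conjI allI)
  show "open U" by (rule holmD[OF assms(1)])
  show "continuous_on U \<psi>"
    by (rule continuous_on_eq[OF holmD(2)[OF assms(1)]]) (rule assms(2))
  show "(\<lambda>w. E (\<psi> w) $ i $ j) holomorphic_on U" for i j
    by (rule holomorphic_transform[OF holmD(3)[OF assms(1)]]) (simp add: assms(2))
qed

lemma imm_cong:
  assumes "imm E \<phi> U" "\<And>w. w \<in> U \<Longrightarrow> \<phi> w = \<psi> w"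
  shows "imm E \<psi> U"
proof -
  have U: "open U" using assms(1) by (simp add: imm_def holm_def)
  show ?thesis
    using assms(1) holm_cong[OF _ assms(2), of E] thf_omf_cong[OF U _ assms(2), where E = E]
    unfolding imm_def by simp
qed

lemma imm_glue:
  assumes "open U" "\<And>z. z \<in> U \<Longrightarrow> \<exists>V. z \<in> V \<and> open V \<and> imm E \<phi> V"
  shows "imm E \<phi> U"
proof -
  have *: "(\<lambda>w. E (\<phi> w) $ i $ j) field_differentiable at z \<and> isCont \<phi> z" if "z \<in> U" for i j z
  proof -
    obtain V where V: "z \<in> V" "open V" "imm E \<phi> V" using assms(2)[OF \<open>z \<in> U\<close>] by blast
    have h: "holm E \<phi> V" using V(3) by (simp add: imm_def)
    show ?thesis
      using holomorphic_on_imp_differentiable_at[OF holmD(3)[OF h] V(2,1)]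
        continuous_on_eq_continuous_at[OF V(2)] holmD(2)[OF h] V(1) by blast
  qed
  then have "(\<lambda>w. E (\<phi> w) $ i $ j) holomorphic_on U" for i j
    using assms(1) by (simp add: holomorphic_on_open field_differentiable_def)
  moreover have "continuous_on U \<phi>"
    using * continuous_on_eq_continuous_at[OF assms(1)] by blast
  moreover have "thf E \<phi> z \<noteq> 0 \<or> omf E \<phi> z \<noteq> 0" if "z \<in> U" for z
    using assms(2)[OF that] unfolding imm_def by blast
  ultimately show ?thesis using assms(1) by (simp add: imm_def holm_def)
qed

lemma holomorphic_thf_omf:
  assumes "holm E \<phi> U"
  shows "thf E \<phi> holomorphic_on U" "omf E \<phi> holomorphic_on U"
  unfolding thf_def[abs_def] omf_def[abs_def]
  by (intro holomorphic_intros holmD[OF assms])+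

text \<open>The chain rule for pulled-back forms; this is the weight 1 of \<open>thf\<close> and
  \<open>omf\<close>.\<close>

lemma holm_comp:
  assumes \<sigma>: "holm E \<sigma> V" and T: "T holomorphic_on B" "open B" "T ` B \<subseteq> V"
    and eq: "\<And>z. z \<in> B \<Longrightarrow> \<phi> z = \<sigma> (T z)"
  shows "holm E \<phi> B" "\<And>z i j. z \<in> B \<Longrightarrow> deriv (\<lambda>w. E (\<phi> w) $ i $ j) z = deriv (\<lambda>w. E (\<sigma> w) $ i $ j) (T z) * deriv T z"
    "\<And>z. z \<in> B \<Longrightarrow> thf E \<phi> z = thf E \<sigma> (T z) * deriv T z"
    "\<And>z. z \<in> B \<Longrightarrow> omf E \<phi> z = omf E \<sigma> (T z) * deriv T z"
proof -
  have "holm E (\<lambda>z. \<sigma> (T z)) B"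
    unfolding holm_def
  proof (intro conjI allI)
    show "continuous_on B (\<lambda>z. \<sigma> (T z))"
      using continuous_on_compose2[OF holmD(2)[OF \<sigma>] holomorphic_on_imp_continuous_on[OF T(1)] T(3)] .
    fix i j
    have "((\<lambda>w. E (\<sigma> w) $ i $ j) \<circ> T) holomorphic_on B"
      by (rule holomorphic_on_compose_gen[OF T(1) holmD(3)[OF \<sigma>] T(3)])
    then show "(\<lambda>z. E (\<sigma> (T z)) $ i $ j) holomorphic_on B" by (simp add: o_def)
  qed (rule T(2))
  then show "holm E \<phi> B" by (rule holm_cong) (simp add: eq)
  show d: "deriv (\<lambda>w. E (\<phi> w) $ i $ j) z = deriv (\<lambda>w. E (\<sigma> w) $ i $ j) (T z) * deriv T z"
    if z: "z \<in> B" for z i j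
  proof -
    have "deriv (\<lambda>w. E (\<phi> w) $ i $ j) z = deriv ((\<lambda>w. E (\<sigma> w) $ i $ j) \<circ> T) z"
      by (rule deriv_cong_ev) (use eventually_nhds_in_open[OF T(2) z] in \<open>auto elim!: eventually_mono simp: eq\<close>)
    also have "\<dots> = deriv (\<lambda>w. E (\<sigma> w) $ i $ j) (T z) * deriv T z"
      using holomorphic_on_imp_differentiable_at[OF T(1,2) z]
        holomorphic_on_imp_differentiable_at[OF holmD(3)[OF \<sigma>] holmD(1)[OF \<sigma>], of "T z"] z T(3)
      by (intro deriv_chain) auto
    finally show ?thesis .
  qed
  show "thf E \<phi> z = thf E \<sigma> (T z) * deriv T z" "omf E \<phi> z = omf E \<sigma> (T z) * deriv T z" if z: "z \<in> B" for z
    by (simp_all add: thf_def omf_def d[OF z] eq[OF z] algebra_simps)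
qed

section \<open>Coordinates and reparametrizations on a Legendrian surface\<close>

text \<open>The Riemann surface is present only through the coordinates \<open>\<sigma>\<close>. The
  two equations at the end say that the diagonal of E^{-1} dE vanishes, with the adjugate in place
  of the inverse.\<close>

locale legendrian =
  fixes E :: "'b::t2_space \<Rightarrow> mat2"
  assumes det1: "\<And>x. det (E x) = 1"
    and conn: "connected (UNIV :: 'b set)"
    and coord: "\<And>x. \<exists>\<sigma> d. 0 < d \<and> imm E \<sigma> (ball 0 d) \<and> \<sigma> 0 = x \<and> inj_on \<sigma> (ball 0 d) \<and>
      (\<forall>V. open V \<and> V \<subseteq> ball 0 d \<longrightarrow> open (\<sigma> ` V)) \<and>
      (\<forall>z\<in>ball 0 d. E (\<sigma> z) $ 2 $ 2 * deriv (\<lambda>w. E (\<sigma> w) $ 1 $ 1) z - E (\<sigma> z) $ 1 $ 2 * deriv (\<lambda>w. E (\<sigma> w) $ 2 $ 1) z = 0 \<and>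
        E (\<sigma> z) $ 1 $ 1 * deriv (\<lambda>w. E (\<sigma> w) $ 2 $ 2) z - E (\<sigma> z) $ 2 $ 1 * deriv (\<lambda>w. E (\<sigma> w) $ 1 $ 2) z = 0)"
begin

definition chart_at :: "(complex \<Rightarrow> 'b) \<Rightarrow> real \<Rightarrow> bool" where
  "chart_at \<sigma> d \<longleftrightarrow> 0 < d \<and> imm E \<sigma> (ball 0 d) \<and> inj_on \<sigma> (ball 0 d) \<and>
      (\<forall>V. open V \<and> V \<subseteq> ball 0 d \<longrightarrow> open (\<sigma> ` V)) \<and>
      (\<forall>z\<in>ball 0 d. E (\<sigma> z) $ 2 $ 2 * deriv (\<lambda>w. E (\<sigma> w) $ 1 $ 1) z - E (\<sigma> z) $ 1 $ 2 * deriv (\<lambda>w. E (\<sigma> w) $ 2 $ 1) z = 0 \<and>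
        E (\<sigma> z) $ 1 $ 1 * deriv (\<lambda>w. E (\<sigma> w) $ 2 $ 2) z - E (\<sigma> z) $ 2 $ 1 * deriv (\<lambda>w. E (\<sigma> w) $ 1 $ 2) z = 0)"

lemma chart_at_ex: obtains \<sigma> d where "chart_at \<sigma> d" "\<sigma> 0 = x"
  using coord[of x] unfolding chart_at_def by blast

text \<open>Some entry of \<open>E\<close> along \<open>\<sigma>\<close> has nonzero derivative at
  \<open>0\<close> and is a local coordinate. Its local inverse, applied to the same entry of
  \<open>E\<close> along \<open>\<phi>\<close>, expresses \<open>\<phi>\<close> in the coordinate
  \<open>\<sigma>\<close>.\<close>

lemma holm_lift:
  assumes \<phi>: "holm E \<phi> U" "\<zeta> \<in> U" and \<sigma>: "chart_at \<sigma> d" "\<sigma> 0 = \<phi> \<zeta>"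
  obtains \<delta> T where "0 < \<delta>" "ball \<zeta> \<delta> \<subseteq> U" "T holomorphic_on ball \<zeta> \<delta>" "T \<zeta> = 0" "T ` ball \<zeta> \<delta> \<subseteq> ball 0 d"
    "\<And>z. z \<in> ball \<zeta> \<delta> \<Longrightarrow> \<phi> z = \<sigma> (T z)"
proof -
  have d: "0 < d" and s: "imm E \<sigma> (ball 0 d)" "holm E \<sigma> (ball 0 d)" "inj_on \<sigma> (ball 0 d)"
    and op: "\<And>V. \<lbrakk>open V; V \<subseteq> ball 0 d\<rbrakk> \<Longrightarrow> open (\<sigma> ` V)"
    using \<sigma> by (auto simp: chart_at_def imm_def)
  have "\<exists>i j. deriv (\<lambda>w. E (\<sigma> w) $ i $ j) 0 \<noteq> 0"
  proof (rule ccontr)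
    assume "\<not> ?thesis"
    then have "thf E \<sigma> 0 = 0" "omf E \<sigma> 0 = 0" by (auto simp: thf_def omf_def)
    then show False using s(1) d by (auto simp: imm_def)
  qed
  then obtain i j where ij: "deriv (\<lambda>w. E (\<sigma> w) $ i $ j) 0 \<noteq> 0" by blast
  define e where "e w = E (\<sigma> w) $ i $ j" for w
  have ehol: "e holomorphic_on ball 0 d" unfolding e_def[abs_def] by (rule holmD[OF s(2)])
  have edz: "deriv e 0 \<noteq> 0" using ij by (simp add: e_def[abs_def])
  obtain r where r: "0 < r" "ball 0 r \<subseteq> ball (0::complex) d" "open (e ` ball 0 r)" "inj_on e (ball 0 r)"
    by (rule has_complex_derivative_locally_invertible[OF ehol centre_in_ball[THEN iffD2, OF d] open_ball edz]) (erule that, (assumption | blast)+)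
  obtain g where g: "g holomorphic_on (e ` ball 0 r)" "\<And>z. z \<in> ball 0 r \<Longrightarrow> g (e z) = z"
    using holomorphic_has_inverse[OF holomorphic_on_subset[OF ehol r(2)] open_ball r(4)] by metis
  \<comment> \<open>One matrix entry does not determine a point of the surface. Continuity of
    \<open>\<phi>\<close> keeps the curve inside the image of the ball on which the entry is
    injective.\<close>
  define N where "N = U \<inter> \<phi> -` (\<sigma> ` ball 0 r)"
  have "open N" unfolding N_def
    by (rule continuous_open_preimage[OF holmD(2)[OF \<phi>(1)] holmD(1)[OF \<phi>(1)]]) (use op r in auto)
  moreover have "\<zeta> \<in> N" using \<phi>(2) \<sigma>(2) r(1) by (auto simp: N_def intro!: image_eqI[of _ _ 0])
  ultimately obtain \<delta> where \<delta>: "0 < \<delta>" "ball \<zeta> \<delta> \<subseteq> N" using open_contains_ball by blast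
  define T where "T z = g (E (\<phi> z) $ i $ j)" for z
  have T: "T z \<in> ball 0 r" "\<phi> z = \<sigma> (T z)" "E (\<phi> z) $ i $ j \<in> e ` ball 0 r" if "z \<in> N" for z
  proof -
    from that obtain w where w: "w \<in> ball 0 r" "\<phi> z = \<sigma> w" by (auto simp: N_def)
    then have "T z = w" using g(2)[OF w(1)] by (simp add: T_def e_def)
    then show "T z \<in> ball 0 r" "\<phi> z = \<sigma> (T z)" using w by auto
    show "E (\<phi> z) $ i $ j \<in> e ` ball 0 r" using w by (auto simp: e_def)
  qed
  show thesis
  proof
    show "ball \<zeta> \<delta> \<subseteq> U" using \<delta> by (auto simp: N_def)
    have "(\<lambda>z. E (\<phi> z) $ i $ j) holomorphic_on ball \<zeta> \<delta>"
      using holomorphic_on_subset[OF holmD(3)[OF \<phi>(1)] \<open>ball \<zeta> \<delta> \<subseteq> U\<close>] .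
    then have "(g \<circ> (\<lambda>z. E (\<phi> z) $ i $ j)) holomorphic_on ball \<zeta> \<delta>"
      by (rule holomorphic_on_compose_gen[OF _ g(1)]) (use T(3) \<delta>(2) in blast)
    then show "T holomorphic_on ball \<zeta> \<delta>" by (simp add: T_def[abs_def] o_def)
    have "\<sigma> (T \<zeta>) = \<sigma> 0" using T(2)[OF \<open>\<zeta> \<in> N\<close>] \<sigma>(2) by simp
    moreover have "T \<zeta> \<in> ball 0 d" "0 \<in> ball 0 d" using T(1)[OF \<open>\<zeta> \<in> N\<close>] r(2) d by auto
    ultimately show "T \<zeta> = 0" using s(3) by (auto dest: inj_onD)
    show "T ` ball \<zeta> \<delta> \<subseteq> ball 0 d" using T(1) \<delta>(2) r(2) by blast
    show "\<phi> z = \<sigma> (T z)" if "z \<in> ball \<zeta> \<delta>" for z using T(2) \<delta>(2) that by blast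
  qed (rule \<delta>(1))
qed

text \<open>Both curves are written in one coordinate, as \<sigma> after \<open>T1\<close> and as
  \<sigma> after \<open>T2\<close>. The immersion condition on \<psi> makes \<open>T2\<close>
  invertible near \<xi>, and T is the inverse of \<open>T2\<close> after \<open>T1\<close>. This is
  the basic means of comparing two curves through a common point.\<close>

lemma holm_reparametrization:
  assumes \<phi>: "holm E \<phi> U" "\<zeta> \<in> U" and \<psi>: "imm E \<psi> V" "\<xi> \<in> V" and eq: "\<phi> \<zeta> = \<psi> \<xi>"
  obtains \<delta> T where "0 < \<delta>" "ball \<zeta> \<delta> \<subseteq> U" "T holomorphic_on ball \<zeta> \<delta>" "T \<zeta> = \<xi>" "T ` ball \<zeta> \<delta> \<subseteq> V"
    "\<And>z. z \<in> ball \<zeta> \<delta> \<Longrightarrow> \<phi> z = \<psi> (T z)"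
proof -
  have \<psi>': "holm E \<psi> V" using \<psi> by (simp add: imm_def)
  obtain \<sigma> d where \<sigma>: "chart_at \<sigma> d" "\<sigma> 0 = \<phi> \<zeta>" using chart_at_ex .
  have \<sigma>': "\<sigma> 0 = \<psi> \<xi>" using \<sigma> eq by simp
  have s: "holm E \<sigma> (ball 0 d)" using \<sigma> by (auto simp: chart_at_def imm_def)
  obtain d1 T1 where T1: "0 < d1" "ball \<zeta> d1 \<subseteq> U" "T1 holomorphic_on ball \<zeta> d1" "T1 \<zeta> = 0" "T1 ` ball \<zeta> d1 \<subseteq> ball 0 d"
    "\<And>z. z \<in> ball \<zeta> d1 \<Longrightarrow> \<phi> z = \<sigma> (T1 z)" by (rule holm_lift[OF \<phi> \<sigma>]) (erule that, (assumption | blast)+)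
  obtain d2 T2 where T2: "0 < d2" "ball \<xi> d2 \<subseteq> V" "T2 holomorphic_on ball \<xi> d2" "T2 \<xi> = 0" "T2 ` ball \<xi> d2 \<subseteq> ball 0 d"
    "\<And>z. z \<in> ball \<xi> d2 \<Longrightarrow> \<psi> z = \<sigma> (T2 z)" by (rule holm_lift[OF \<psi>' \<psi>(2) \<sigma>(1) \<sigma>']) (erule that, (assumption | blast)+)
  have xi: "\<xi> \<in> ball \<xi> d2" using T2(1) by simp
  have "deriv T2 \<xi> \<noteq> 0"
  proof
    assume "deriv T2 \<xi> = 0"
    then have "thf E \<psi> \<xi> = 0" "omf E \<psi> \<xi> = 0"
      using holm_comp(3,4)[OF s T2(3) open_ball T2(5) T2(6) xi] by auto
    then show False using \<psi> by (auto simp: imm_def)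
  qed
  then obtain r where r: "0 < r" "ball \<xi> r \<subseteq> ball \<xi> d2" "open (T2 ` ball \<xi> r)" "inj_on T2 (ball \<xi> r)"
    by (rule has_complex_derivative_locally_invertible[OF T2(3) xi open_ball]) (erule that, (assumption | blast)+)
  obtain g where g: "g holomorphic_on (T2 ` ball \<xi> r)" "\<And>z. z \<in> ball \<xi> r \<Longrightarrow> g (T2 z) = z"
    using holomorphic_has_inverse[OF holomorphic_on_subset[OF T2(3) r(2)] open_ball r(4)] by metis
  define N where "N = ball \<zeta> d1 \<inter> T1 -` (T2 ` ball \<xi> r)"
  have "open N" unfolding N_def
    by (rule continuous_open_preimage[OF holomorphic_on_imp_continuous_on[OF T1(3)] open_ball r(3)])
  moreover have "\<zeta> \<in> N" using T1(1,4) T2(4) r(1) by (auto simp: N_def intro!: image_eqI[of _ _ \<xi>])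
  ultimately obtain \<delta> where \<delta>: "0 < \<delta>" "ball \<zeta> \<delta> \<subseteq> N" using open_contains_ball by blast
  have N: "g (T1 z) \<in> ball \<xi> r" "T2 (g (T1 z)) = T1 z" if "z \<in> N" for z
    using that g(2) by (auto simp: N_def)
  show thesis
  proof
    show "ball \<zeta> \<delta> \<subseteq> U" using \<delta>(2) T1(2) by (auto simp: N_def)
    have "(g \<circ> T1) holomorphic_on ball \<zeta> \<delta>"
      by (rule holomorphic_on_compose_gen[OF holomorphic_on_subset[OF T1(3)] g(1)]) (use \<delta>(2) in \<open>auto simp: N_def\<close>)
    then show "(\<lambda>z. g (T1 z)) holomorphic_on ball \<zeta> \<delta>" by (simp add: o_def)
    show "g (T1 \<zeta>) = \<xi>" using g(2)[of \<xi>] r(1) T1(4) T2(4) by simp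
    show "(\<lambda>z. g (T1 z)) ` ball \<zeta> \<delta> \<subseteq> V" using N(1) \<delta>(2) r(2) T2(2) by blast
    show "\<phi> z = \<psi> (g (T1 z))" if z: "z \<in> ball \<zeta> \<delta>" for z
    proof -
      have zN: "z \<in> N" using z \<delta>(2) by blast
      then have "\<phi> z = \<sigma> (T1 z)" using T1(6) by (auto simp: N_def)
      also have "\<dots> = \<psi> (g (T1 z))" using T2(6)[of "g (T1 z)"] N[OF zN] r(2) by auto
      finally show ?thesis .
    qed
  qed (rule \<delta>(1))
qed

text \<open>A coordinate \<sigma> at a point of the image factors near \<open>0\<close> as \<phi>
  after a map into V, so the open set covered by \<sigma> on a small ball lies in the image of
  V.\<close>

lemma imm_open_map:
  assumes \<phi>: "imm E \<phi> U" and V: "open V" "V \<subseteq> U"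
  shows "open (\<phi> ` V)"
proof (subst open_subopen, intro ballI)
  fix x assume "x \<in> \<phi> ` V"
  then obtain \<zeta> where \<zeta>: "\<zeta> \<in> V" "x = \<phi> \<zeta>" by blast
  obtain \<sigma> d where \<sigma>: "chart_at \<sigma> d" "\<sigma> 0 = \<phi> \<zeta>" using chart_at_ex .
  have s: "imm E \<sigma> (ball 0 d)" "0 < d" "\<And>V. \<lbrakk>open V; V \<subseteq> ball 0 d\<rbrakk> \<Longrightarrow> open (\<sigma> ` V)" using \<sigma> by (auto simp: chart_at_def)
  have phV: "holm E \<phi> V" using imm_subset[OF \<phi> V] by (simp add: imm_def)
  obtain \<delta> T where T: "0 < \<delta>" "ball 0 \<delta> \<subseteq> ball (0::complex) d" "T holomorphic_on ball 0 \<delta>" "T 0 = \<zeta>" "T ` ball 0 \<delta> \<subseteq> V"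
    "\<And>z. z \<in> ball 0 \<delta> \<Longrightarrow> \<sigma> z = \<phi> (T z)"
  proof -
    have "holm E \<sigma> (ball 0 d)" "0 \<in> ball (0::complex) d" using s by (auto simp: imm_def)
    then show thesis
      by (rule holm_reparametrization[of \<sigma> "ball 0 d" 0 \<phi> V \<zeta>, OF _ _ imm_subset[OF \<phi> V] \<zeta>(1) \<sigma>(2)])
        (erule that, (assumption | blast)+)
  qed
  have "open (\<sigma> ` ball 0 \<delta>)" by (rule s(3)) (use T in auto)
  moreover have "x \<in> \<sigma> ` ball 0 \<delta>" using \<zeta>(2) \<sigma>(2) T(1) by (auto intro!: image_eqI[of _ _ 0])
  moreover have "\<sigma> ` ball 0 \<delta> \<subseteq> \<phi> ` V" using T(5,6) by auto
  ultimately show "\<exists>T. open T \<and> x \<in> T \<and> T \<subseteq> \<phi> ` V" by blast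
qed

text \<open>This is dE = E N with N off-diagonal, read along \<phi>. The definitions of
  \<open>omf\<close> and \<open>thf\<close> and the vanishing diagonal form linear systems for the
  derivatives of the columns, whose determinant is that of \<open>E\<close>.\<close>

lemma legendrian_derivatives:
  assumes \<phi>: "holm E \<phi> U" and z: "z \<in> U"
  shows "deriv (\<lambda>w. E (\<phi> w) $ i $ 1) z = E (\<phi> z) $ i $ 2 * omf E \<phi> z"
    "deriv (\<lambda>w. E (\<phi> w) $ i $ 2) z = E (\<phi> z) $ i $ 1 * thf E \<phi> z"
proof -
  obtain \<sigma> d where \<sigma>: "chart_at \<sigma> d" "\<sigma> 0 = \<phi> z" by (rule chart_at_ex)
  obtain \<delta> T where T: "0 < \<delta>" "ball z \<delta> \<subseteq> U" "T holomorphic_on ball z \<delta>" "T z = 0" "T ` ball z \<delta> \<subseteq> ball 0 d"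
    "\<And>w. w \<in> ball z \<delta> \<Longrightarrow> \<phi> w = \<sigma> (T w)" by (rule holm_lift[OF \<phi> z \<sigma>]) (erule that, (assumption | blast)+)
  have s: "holm E \<sigma> (ball 0 d)" and d: "0 \<in> ball 0 d" using \<sigma>(1) by (auto simp: chart_at_def imm_def)
  have zb: "z \<in> ball z \<delta>" using T(1) by simp
  have D: "deriv (\<lambda>w. E (\<phi> w) $ i $ j) z = deriv (\<lambda>w. E (\<sigma> w) $ i $ j) 0 * deriv T z" for i j
    using holm_comp(2)[OF s T(3) open_ball T(5,6) zb] T(4) by simp
  have L: "E (\<phi> z) $ 2 $ 2 * deriv (\<lambda>w. E (\<sigma> w) $ 1 $ 1) 0 = E (\<phi> z) $ 1 $ 2 * deriv (\<lambda>w. E (\<sigma> w) $ 2 $ 1) 0"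
    "E (\<phi> z) $ 1 $ 1 * deriv (\<lambda>w. E (\<sigma> w) $ 2 $ 2) 0 = E (\<phi> z) $ 2 $ 1 * deriv (\<lambda>w. E (\<sigma> w) $ 1 $ 2) 0"
    using \<sigma> d unfolding chart_at_def by (auto simp flip: \<sigma>(2))
  let ?x = "\<lambda>i j. E (\<phi> z) $ i $ j" and ?d = "\<lambda>i j. deriv (\<lambda>w. E (\<phi> w) $ i $ j) z"
  have l1: "?x 2 2 * ?d 1 1 = ?x 1 2 * ?d 2 1" unfolding D by (simp only: L(1) flip: mult.assoc)
  have l2: "?x 1 1 * ?d 2 2 = ?x 2 1 * ?d 1 2" unfolding D by (simp only: L(2) flip: mult.assoc)
  have det: "?x 1 1 * ?x 2 2 - ?x 1 2 * ?x 2 1 = 1" using det1[of "\<phi> z"] by (simp add: det_2)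
  have o: "omf E \<phi> z = ?x 1 1 * ?d 2 1 - ?x 2 1 * ?d 1 1" and t: "thf E \<phi> z = ?x 2 2 * ?d 1 2 - ?x 1 2 * ?d 2 2"
    by (simp_all add: omf_def thf_def)
  have "?d 1 1 = ?x 1 2 * omf E \<phi> z" unfolding o using l1 det by algebra
  moreover have "?d 2 1 = ?x 2 2 * omf E \<phi> z" unfolding o using l1 det by algebra
  ultimately show "?d i 1 = ?x i 2 * omf E \<phi> z" using exhaust_2[of i] by auto
  have "?d 1 2 = ?x 1 1 * thf E \<phi> z" unfolding t using l2 det by algebra
  moreover have "?d 2 2 = ?x 2 1 * thf E \<phi> z" unfolding t using l2 det by algebra
  ultimately show "?d i 2 = ?x i 1 * thf E \<phi> z" using exhaust_2[of i] by auto
qed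

end

section \<open>Holomorphic flows and their global solutions\<close>

text \<open>An autonomous flow described without its vector field: solutions may be shifted in time,
  and a change of parameter between two solutions has derivative 1. The analysis is concentrated in
  \<open>Sol_limit\<close>: a solution on a disk has a limit along each radius, and a flow box
  exists at that limit. The instances are \<open>constant_sol\<close> and
  \<open>normalized_sol\<close>.\<close>

locale flow = legendrian E for E :: "'b::t2_space \<Rightarrow> mat2" +
  fixes Sol :: "(complex \<Rightarrow> 'b) \<Rightarrow> complex set \<Rightarrow> bool"
  assumes Sol_imm: "Sol \<phi> U \<Longrightarrow> imm E \<phi> U"
    and Sol_mono: "\<lbrakk>Sol \<phi> U; open V; V \<subseteq> U\<rbrakk> \<Longrightarrow> Sol \<phi> V"
    and Sol_glue: "\<lbrakk>open U; \<And>z. z \<in> U \<Longrightarrow> \<exists>V. z \<in> V \<and> open V \<and> Sol \<phi> V\<rbrakk> \<Longrightarrow> Sol \<phi> U"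
    and Sol_cong: "\<lbrakk>Sol \<phi> U; \<And>z. z \<in> U \<Longrightarrow> \<phi> z = \<psi> z\<rbrakk> \<Longrightarrow> Sol \<psi> U"
    and Sol_shift: "Sol \<phi> (ball a r) \<Longrightarrow> Sol (\<lambda>z. \<phi> (z + c)) (ball (a - c) r)"
    and Sol_reparam: "\<lbrakk>Sol \<phi> (ball \<zeta> \<delta>); Sol \<psi> V; T holomorphic_on ball \<zeta> \<delta>; T ` ball \<zeta> \<delta> \<subseteq> V;
        \<And>z. z \<in> ball \<zeta> \<delta> \<Longrightarrow> \<phi> z = \<psi> (T z); z \<in> ball \<zeta> \<delta>\<rbrakk> \<Longrightarrow> deriv T z = 1"
    and Sol_limit: "\<lbrakk>0 < R; Sol \<phi> (ball 0 R); cmod e = 1\<rbrakk> \<Longrightarrow>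
        \<exists>y \<sigma> d. ((\<lambda>t. \<phi> (t *\<^sub>R e)) \<longlongrightarrow> y) (at_left R) \<and> 0 < d \<and> Sol \<sigma> (ball 0 d) \<and> \<sigma> 0 = y"
begin

lemma Sol_open: "Sol \<phi> U \<Longrightarrow> open U"
  using Sol_imm by (auto simp: imm_def holm_def)

text \<open>The reparametrization between two solutions has derivative 1, hence is a
  translation.\<close>

lemma Sol_translate:
  assumes \<phi>: "Sol \<phi> U" "\<zeta> \<in> U" and \<psi>: "Sol \<psi> V" "\<xi> \<in> V" and eq: "\<phi> \<zeta> = \<psi> \<xi>"
  shows "\<exists>\<delta>>0. ball \<zeta> \<delta> \<subseteq> U \<and> (\<forall>z\<in>ball \<zeta> \<delta>. z - \<zeta> + \<xi> \<in> V \<and> \<phi> z = \<psi> (z - \<zeta> + \<xi>))"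
proof -
  have h: "holm E \<phi> U" using Sol_imm[OF \<phi>(1)] by (simp add: imm_def)
  obtain \<delta> T where T: "0 < \<delta>" "ball \<zeta> \<delta> \<subseteq> U" "T holomorphic_on ball \<zeta> \<delta>" "T \<zeta> = \<xi>" "T ` ball \<zeta> \<delta> \<subseteq> V"
    "\<And>z. z \<in> ball \<zeta> \<delta> \<Longrightarrow> \<phi> z = \<psi> (T z)"
    by (rule holm_reparametrization[OF h \<phi>(2) Sol_imm[OF \<psi>(1)] \<psi>(2) eq]) (erule that, (assumption | blast)+)
  have d1: "deriv T z = 1" if "z \<in> ball \<zeta> \<delta>" for z
    by (rule Sol_reparam[OF Sol_mono[OF \<phi>(1) open_ball T(2)] \<psi>(1) T(3) T(5) _ that]) (rule T(6))
  have Teq: "T z = z - \<zeta> + \<xi>" if z: "z \<in> ball \<zeta> \<delta>" for z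
  proof -
    have "((\<lambda>z. T z - z) has_field_derivative 0) (at w within ball \<zeta> \<delta>)" if w: "w \<in> ball \<zeta> \<delta>" for w
    proof -
      have "((\<lambda>z. T z - z) has_field_derivative deriv T w - 1) (at w)"
        using holomorphic_derivI[OF T(3) open_ball w] by (auto intro!: derivative_eq_intros)
      then show ?thesis using d1[OF w] has_field_derivative_at_within by simp blast
    qed
    then obtain c where "\<And>w. w \<in> ball \<zeta> \<delta> \<Longrightarrow> T w - w = c"
      using has_field_derivative_zero_constant[OF convex_ball, of \<zeta> \<delta> "\<lambda>z. T z - z"] by blast
    from this[OF z] this[of \<zeta>] T(1,4) show ?thesis by (simp add: algebra_simps)
  qed
  show ?thesis
    using T Teq by (intro exI[of _ \<delta>]) (auto simp: image_subset_iff)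
qed

text \<open>The agreement set is open by \<open>Sol_translate\<close> and closed in \<open>U\<close>
  because the surface is Hausdorff.\<close>

lemma Sol_unique:
  assumes \<phi>: "Sol \<phi> U" and \<psi>: "Sol \<psi> U" and U: "connected U" "z \<in> U" "\<phi> z = \<psi> z" "w \<in> U"
  shows "\<phi> w = \<psi> w"
proof (rule ccontr)
  assume ne: "\<phi> w \<noteq> \<psi> w"
  define A where "A = {w\<in>U. \<phi> w = \<psi> w}"
  define B where "B = {w\<in>U. \<phi> w \<noteq> \<psi> w}"
  have "open A"
  proof (subst open_contains_ball, intro ballI)
    fix a assume a: "a \<in> A"
    then obtain \<delta> where "0 < \<delta>" "ball a \<delta> \<subseteq> U" "\<forall>z\<in>ball a \<delta>. z - a + a \<in> U \<and> \<phi> z = \<psi> (z - a + a)"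
      using Sol_translate[OF \<phi> _ \<psi>, of a a] by (auto simp: A_def)
    then show "\<exists>e>0. ball a e \<subseteq> A" by (intro exI[of _ \<delta>]) (auto simp: A_def)
  qed
  moreover have "open B"
  proof (subst open_subopen, intro ballI)
    fix b assume b: "b \<in> B"
    then obtain P Q where PQ: "open P" "open Q" "\<phi> b \<in> P" "\<psi> b \<in> Q" "P \<inter> Q = {}"
      using hausdorff[of "\<phi> b" "\<psi> b"] by (auto simp: B_def)
    have "continuous_on U \<phi>" "continuous_on U \<psi>"
      using Sol_imm[OF \<phi>] Sol_imm[OF \<psi>] by (auto simp: imm_def holm_def)
    then have "open ((U \<inter> \<phi> -` P) \<inter> (U \<inter> \<psi> -` Q))"
      using Sol_open[OF \<phi>] PQ by (intro open_Int continuous_open_preimage)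
    moreover have "b \<in> (U \<inter> \<phi> -` P) \<inter> (U \<inter> \<psi> -` Q)" using b PQ by (auto simp: B_def)
    moreover have "(U \<inter> \<phi> -` P) \<inter> (U \<inter> \<psi> -` Q) \<subseteq> B" using PQ(5) by (auto simp: B_def)
    ultimately show "\<exists>T. open T \<and> b \<in> T \<and> T \<subseteq> B" by blast
  qed
  ultimately show False
    using connectedD[OF U(1), of A B] U ne by (auto simp: A_def B_def)
qed

text \<open>The continuation is a flow box at the radial limit \<open>y\<close>, shifted in time so
  that it fits the solution at one point near the end of the radius.\<close>

lemma Sol_extend:
  assumes R: "0 < R" "Sol \<phi> (ball 0 R)" "cmod e = 1"
  shows "\<exists>\<psi> d. 0 < d \<and> Sol \<psi> (ball (R *\<^sub>R e) d) \<and> (\<forall>z\<in>ball (R *\<^sub>R e) d \<inter> ball 0 R. \<psi> z = \<phi> z)"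
proof -
  obtain y \<sigma> d where y: "((\<lambda>t. \<phi> (t *\<^sub>R e)) \<longlongrightarrow> y) (at_left R)" and d: "0 < d" "Sol \<sigma> (ball 0 d)" "\<sigma> 0 = y"
    using Sol_limit[OF R] by blast
  \<comment> \<open>One quarter of \<open>d\<close> is allowed for the position \<xi> in the flow
    box and one for the remaining time R - t. Together they stay below d / 2, so the shifted box of
    radius d contains the disk of radius d / 2 about the end point.\<close>
  have "open (\<sigma> ` ball 0 (d / 4))"
    by (rule imm_open_map[OF Sol_imm[OF d(2)]]) (use d(1) in auto)
  moreover have "y \<in> \<sigma> ` ball 0 (d / 4)" using d by (auto intro!: image_eqI[of _ _ 0])
  ultimately have "\<forall>\<^sub>F t in at_left R. \<phi> (t *\<^sub>R e) \<in> \<sigma> ` ball 0 (d / 4)"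
    using y topological_tendstoD by blast
  moreover have "\<forall>\<^sub>F t in at_left R. t \<in> {max 0 (R - d / 4)<..<R}"
    by (rule eventually_at_left_real) (use R d in auto)
  ultimately have "\<forall>\<^sub>F t in at_left R. \<phi> (t *\<^sub>R e) \<in> \<sigma> ` ball 0 (d / 4) \<and> t \<in> {max 0 (R - d / 4)<..<R}"
    by (rule eventually_conj)
  then obtain t where t: "\<phi> (t *\<^sub>R e) \<in> \<sigma> ` ball 0 (d / 4)" "t \<in> {max 0 (R - d / 4)<..<R}"
    using eventually_happens'[OF trivial_limit_at_left_real] by blast
  then obtain \<xi> where \<xi>: "\<phi> (t *\<^sub>R e) = \<sigma> \<xi>" "cmod \<xi> < d / 4" by auto
  define c where "c = \<xi> - t *\<^sub>R e"
  define \<psi> where "\<psi> z = \<sigma> (z + c)" for z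
  have \<psi>: "Sol \<psi> (ball (- c) d)" using Sol_shift[OF d(2), of c] by (simp add: \<psi>_def[abs_def])
  have "dist (R *\<^sub>R e) (- c) = norm ((R - t) *\<^sub>R e + \<xi>)"
    by (simp add: dist_norm c_def algebra_simps)
  also have "\<dots> \<le> (R - t) + cmod \<xi>" using norm_triangle_ineq[of "(R - t) *\<^sub>R e" \<xi>] R(3) t(2) by simp
  also have "\<dots> < d / 2" using \<xi>(2) t(2) by simp
  finally have dc: "dist (R *\<^sub>R e) (- c) < d / 2" .
  have sub: "ball (R *\<^sub>R e) (d / 2) \<subseteq> ball (- c) d"
  proof
    fix z assume "z \<in> ball (R *\<^sub>R e) (d / 2)"
    then show "z \<in> ball (- c) d" using dc dist_triangle[of "- c" z "R *\<^sub>R e"] by (simp add: dist_commute)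
  qed
  let ?I = "ball (- c) d \<inter> ball 0 R"
  have te: "t *\<^sub>R e \<in> ?I" using \<xi>(2) t(2) R(3) d(1) by (auto simp: c_def dist_norm)
  have "\<psi> z = \<phi> z" if z: "z \<in> ?I" for z
  proof (rule Sol_unique[OF _ _ _ te _ z])
    show "Sol \<psi> ?I" by (rule Sol_mono[OF \<psi>]) auto
    show "Sol \<phi> ?I" by (rule Sol_mono[OF R(2)]) auto
    show "connected ?I" by (intro convex_connected convex_Int) auto
    show "\<psi> (t *\<^sub>R e) = \<phi> (t *\<^sub>R e)" using \<xi>(1) by (simp add: \<psi>_def c_def)
  qed
  then show ?thesis
    using Sol_mono[OF \<psi> open_ball sub] d(1) sub by (intro exI[of _ \<psi>] exI[of _ "d / 2"]) auto
qed

lemma Sol_global: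
  assumes "0 < r" "Sol \<phi>\<^sub>0 (ball 0 r)"
  obtains \<phi> where "Sol \<phi> UNIV" "\<phi> 0 = \<phi>\<^sub>0 0"
proof -
  have "\<exists>\<phi>. Sol \<phi> UNIV \<and> \<phi> 0 = \<phi>\<^sub>0 0"
  proof (rule maximal_disc)
    fix \<phi> \<psi> :: "complex \<Rightarrow> 'b" and U V :: "complex set" and z w e :: complex and R :: real
    show "Sol \<phi> V" if "Sol \<phi> U" "open V" "V \<subseteq> U"
      using that by (rule Sol_mono)
    show "Sol \<phi> U" if "open U" "\<And>z. z \<in> U \<Longrightarrow> \<exists>V. z \<in> V \<and> open V \<and> Sol \<phi> V"
      using that by (rule Sol_glue)
    show "Sol \<psi> U" if "Sol \<phi> U" "\<And>z. z \<in> U \<Longrightarrow> \<phi> z = \<psi> z"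
      using that by (rule Sol_cong)
    show "\<phi> w = \<psi> w" if "Sol \<phi> U" "Sol \<psi> U" "connected U" "z \<in> U" "\<phi> z = \<psi> z" "w \<in> U"
      using that by (rule Sol_unique)
    show "\<exists>\<psi> d. 0 < d \<and> Sol \<psi> (ball (R *\<^sub>R e) d) \<and> (\<forall>z\<in>ball (R *\<^sub>R e) d \<inter> ball 0 R. \<psi> z = \<phi> z)"
      if "0 < R" "Sol \<phi> (ball 0 R)" "cmod e = 1"
      using that by (rule Sol_extend)
  qed (use assms in auto)
  then show thesis using that by blast
qed

text \<open>The image is open as \<phi> is an open map. It is also closed: if a flow box meets it, a
  shift of \<phi> agrees with the box at the common point, hence on the whole box, and so its centre
  lies in the image.\<close>

lemma Sol_surj:
  assumes \<phi>: "Sol \<phi> UNIV" and box: "\<And>y. \<exists>\<sigma> d. 0 < d \<and> Sol \<sigma> (ball 0 d) \<and> \<sigma> 0 = y"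
  shows "surj \<phi>"
proof -
  have op: "open (range \<phi>)" by (rule imm_open_map[OF Sol_imm[OF \<phi>]]) auto
  have "open (- range \<phi>)"
  proof (subst open_subopen, intro ballI)
    fix y assume y: "y \<in> - range \<phi>"
    obtain \<sigma> d where \<sigma>: "0 < d" "Sol \<sigma> (ball 0 d)" "\<sigma> 0 = y" using box by blast
    have "open (\<sigma> ` ball 0 d)" by (rule imm_open_map[OF Sol_imm[OF \<sigma>(2)]]) auto
    moreover have "y \<in> \<sigma> ` ball 0 d" using \<sigma> by (auto intro!: image_eqI[of _ _ 0])
    moreover have "\<sigma> ` ball 0 d \<subseteq> - range \<phi>"
    proof
      fix v assume v: "v \<in> \<sigma> ` ball 0 d"
      show "v \<in> - range \<phi>"
      proof
        assume "v \<in> range \<phi>"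
        then obtain \<zeta> \<xi> where z: "\<phi> \<zeta> = \<sigma> \<xi>" "\<xi> \<in> ball 0 d" using v by auto
        define \<psi> where "\<psi> z = \<phi> (z + (\<zeta> - \<xi>))" for z
        have "Sol \<psi> (ball 0 d)"
          using Sol_shift[OF Sol_mono[OF \<phi>], of "\<zeta> - \<xi>" d "\<zeta> - \<xi>"] by (simp add: \<psi>_def[abs_def])
        moreover have "\<psi> \<xi> = \<sigma> \<xi>" using z by (simp add: \<psi>_def)
        ultimately have "\<psi> 0 = \<sigma> 0"
          using Sol_unique[OF _ \<sigma>(2) connected_ball z(2), of \<psi> 0] \<sigma>(1) by simp
        then show False using y \<sigma>(3) by (auto simp: \<psi>_def)
      qed
    qed
    ultimately show "\<exists>T. open T \<and> y \<in> T \<and> T \<subseteq> - range \<phi>" by blast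
  qed
  then show ?thesis using connectedD[OF conn op] by auto
qed

end

section \<open>Holomorphic vector fields in the plane\<close>

text \<open>Separation of variables: \<open>k\<close> is the local inverse of the primitive of 1 / h
  that vanishes at \<open>w0\<close>.\<close>

lemma holomorphic_autonomous_ode:
  assumes h: "h holomorphic_on V" "open V" "w0 \<in> V" and nz: "h w0 \<noteq> 0"
  obtains d k where "0 < d" "k holomorphic_on ball 0 d" "k ` ball 0 d \<subseteq> V" "k 0 = w0"
    "\<And>z. z \<in> ball 0 d \<Longrightarrow> deriv k z = h (k z) \<and> h (k z) \<noteq> 0"
proof -
  have "continuous_on V h" using h(1) by (rule holomorphic_on_imp_continuous_on)
  then have "open (V \<inter> h -` (- {0}))" using h(2) by (intro continuous_open_preimage) auto
  then obtain r where r: "0 < r" "ball w0 r \<subseteq> V \<inter> h -` (- {0})"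
    using open_contains_ball h(3) nz by (metis ComplI IntI singletonD vimageI)
  have hr: "h holomorphic_on ball w0 r" using holomorphic_on_subset[OF h(1)] r by auto
  have hnz: "h z \<noteq> 0" if "z \<in> ball w0 r" for z using r that by auto
  obtain G0 where G0: "\<And>z. z \<in> ball w0 r \<Longrightarrow> (G0 has_field_derivative 1 / h z) (at z within ball w0 r)"
  proof -
    have "(\<lambda>z. 1 / h z) holomorphic_on ball w0 r" using hr hnz by (intro holomorphic_intros)
    then show thesis by (rule holomorphic_convex_primitive'[OF convex_ball open_ball]) (rule that)
  qed
  define G where "G z = G0 z - G0 w0" for z
  have G: "(G has_field_derivative 1 / h z) (at z)" if "z \<in> ball w0 r" for z
    unfolding G_def using G0[OF that] at_within_open[OF that open_ball]
    by (auto intro!: derivative_eq_intros)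
  have Ghol: "G holomorphic_on ball w0 r"
    unfolding holomorphic_on_open[OF open_ball] using G by blast
  have w0: "w0 \<in> ball w0 r" using r(1) by simp
  have "deriv G w0 \<noteq> 0" using DERIV_imp_deriv[OF G[OF w0]] hnz[OF w0] by simp
  then obtain s where s: "0 < s" "ball w0 s \<subseteq> ball w0 r" "open (G ` ball w0 s)" "inj_on G (ball w0 s)"
    by (rule has_complex_derivative_locally_invertible[OF Ghol w0 open_ball]) (erule that, (assumption | blast)+)
  obtain k where k: "k holomorphic_on (G ` ball w0 s)" "\<And>z. z \<in> ball w0 s \<Longrightarrow> deriv G z * deriv k (G z) = 1"
    "\<And>z. z \<in> ball w0 s \<Longrightarrow> k (G z) = z"
    using holomorphic_has_inverse[OF holomorphic_on_subset[OF Ghol s(2)] open_ball s(4)] by metis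
  have "0 \<in> G ` ball w0 s" using s(1) by (auto simp: G_def intro!: image_eqI[of _ _ w0])
  then obtain d where d: "0 < d" "ball 0 d \<subseteq> G ` ball w0 s" using s(3) open_contains_ball by blast
  show thesis
  proof
    show "0 < d" by fact
    show "k holomorphic_on ball 0 d" using k(1) d(2) holomorphic_on_subset by blast
    show "k ` ball 0 d \<subseteq> V" using d(2) k(3) s(2) r(2) by fastforce
    show "k 0 = w0" using k(3)[of w0] s(1) by (simp add: G_def)
    fix z :: complex assume "z \<in> ball 0 d"
    then obtain w where w: "w \<in> ball w0 s" "z = G w" using d(2) by blast
    have wr: "w \<in> ball w0 r" using w s by blast
    show "deriv k z = h (k z) \<and> h (k z) \<noteq> 0"
      using k(2)[OF w(1)] DERIV_imp_deriv[OF G[OF wr]] hnz[OF wr] k(3)[OF w(1)] w(2) by (simp add: field_simps)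
  qed
qed

text \<open>Near a zero of h one has |h(w)| \<le> C |w - w0|. So ln |w - w0|^2 decreases at a rate
  of at most 2 C and cannot tend to minus infinity in finite time.\<close>

lemma holomorphic_ode_zero_unreachable:
  fixes w :: "real \<Rightarrow> complex"
  assumes h: "h holomorphic_on V" "open V" "w0 \<in> V" "h w0 = 0" and t0: "t0 < R"
    and der: "\<And>t. \<lbrakk>t0 < t; t < R\<rbrakk> \<Longrightarrow> (w has_vector_derivative h (w t) * e) (at t)"
    and lim: "(w \<longlongrightarrow> w0) (at_left R)" and ne: "\<And>t. \<lbrakk>t0 < t; t < R\<rbrakk> \<Longrightarrow> w t \<noteq> w0" and e: "cmod e = 1"
  shows False
proof -
  have "(h has_field_derivative deriv h w0) (at w0)" by (rule holomorphic_derivI[OF h(1-3)])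
  then have "((\<lambda>z. (h z - h w0) / (z - w0)) \<longlongrightarrow> deriv h w0) (at w0)"
    by (simp add: has_field_derivative_iff)
  then have "\<forall>\<^sub>F z in at w0. dist ((h z - h w0) / (z - w0)) (deriv h w0) < 1"
    by (rule tendstoD) simp
  then obtain d where d: "0 < d" "\<And>z. \<lbrakk>z \<noteq> w0; dist z w0 < d\<rbrakk> \<Longrightarrow> dist ((h z) / (z - w0)) (deriv h w0) < 1"
    unfolding eventually_at using h(4) by auto
  define C where "C = cmod (deriv h w0) + 1"
  have hC: "cmod (h z) \<le> C * cmod (z - w0)" if z: "z \<noteq> w0" "dist z w0 < d" for z
  proof -
    have "cmod (h z / (z - w0)) \<le> C"
      using d(2)[OF z] norm_triangle_sub[of "h z / (z - w0)" "deriv h w0"] by (simp add: C_def dist_norm)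
    then show ?thesis using z by (simp add: norm_divide field_simps)
  qed
  have "\<forall>\<^sub>F t in at_left R. dist (w t) w0 < d" using tendstoD[OF lim d(1)] .
  then obtain t1' where t1': "t1' < R" "\<And>t. \<lbrakk>t1' < t; t < R\<rbrakk> \<Longrightarrow> dist (w t) w0 < d"
    using eventually_at_left[OF t0] by auto
  define t1 where "t1 = (max t0 t1' + R) / 2"
  have t1: "t0 < t1" "t1 < R" "t1' < t1" using t0 t1' by (auto simp: t1_def)
  define u where "u t = (cmod (w t - w0))\<^sup>2" for t
  have upos: "0 < u t" if "t0 < t" "t < R" for t using ne[OF that] by (simp add: u_def)
  have ueq: "u t = Re (cnj (w t - w0) * (w t - w0))" for t
    unfolding u_def cmod_power2 by (simp add: power2_eq_square algebra_simps)
  have uder: "(u has_real_derivative 2 * Re (cnj (w t - w0) * (h (w t) * e))) (at t)" if t: "t0 < t" "t < R" for t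
  proof -
    have v: "((\<lambda>t. w t - w0) has_vector_derivative h (w t) * e) (at t)"
      using has_vector_derivative_diff[OF der[OF t] has_vector_derivative_const[of w0]] by simp
    have "((\<lambda>t. Re (cnj (w t - w0) * (w t - w0))) has_vector_derivative
        Re (cnj (w t - w0) * (h (w t) * e) + cnj (h (w t) * e) * (w t - w0))) (at t)"
      by (intro bounded_linear.has_vector_derivative[OF bounded_linear_Re] has_vector_derivative_mult has_vector_derivative_cnj v)
    then show ?thesis
      unfolding ueq[abs_def] has_real_derivative_iff_has_vector_derivative by (simp add: algebra_simps)
  qed
  have mono: "ln (u t1) + 2 * C * t1 \<le> ln (u t) + 2 * C * t" if t: "t1 \<le> t" "t < R" for t
  proof (rule DERIV_nonneg_imp_nondecreasing[OF t(1), of "\<lambda>t. ln (u t) + 2 * C * t"])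
    fix x assume x: "t1 \<le> x" "x \<le> t"
    then have xx: "t0 < x" "x < R" "dist (w x) w0 < d" using t t1 t1' by auto
    have "\<bar>Re (cnj (w x - w0) * (h (w x) * e))\<bar> \<le> cmod (w x - w0) * cmod (h (w x))"
      using abs_Re_le_cmod[of "cnj (w x - w0) * (h (w x) * e)"] e by (simp only: norm_mult complex_mod_cnj mult_1_right)
    also have "\<dots> \<le> cmod (w x - w0) * (C * cmod (w x - w0))"
      using hC[OF ne[OF xx(1,2)] xx(3)] by (intro mult_left_mono) auto
    also have "\<dots> = C * u x" by (simp add: u_def power2_eq_square)
    finally have "- (C * u x) \<le> Re (cnj (w x - w0) * (h (w x) * e))" by linarith
    then have "0 \<le> 2 * Re (cnj (w x - w0) * (h (w x) * e)) / u x + 2 * C"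
      using upos[OF xx(1,2)] by (simp add: field_simps)
    moreover have "((\<lambda>t. ln (u t) + 2 * C * t) has_real_derivative 2 * Re (cnj (w x - w0) * (h (w x) * e)) / u x + 2 * C) (at x)"
      using upos[OF xx(1,2)] by (auto intro!: derivative_eq_intros uder[OF xx(1,2)])
    ultimately show "\<exists>y. ((\<lambda>t. ln (u t) + 2 * C * t) has_real_derivative y) (at x) \<and> 0 \<le> y" by blast
  qed
  have C0: "0 < C" by (simp add: C_def add_nonneg_pos)
  have low: "exp (ln (u t1) + 2 * C * t1 - 2 * C * R) \<le> u t" if t: "t1 \<le> t" "t < R" for t
  proof -
    have "C * t \<le> C * R" using t C0 by simp
    then have "ln (u t1) + 2 * C * t1 - 2 * C * R \<le> ln (u t)" using mono[OF t] by linarith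
    then show ?thesis using upos[of t] t t1 by (metis dual_order.strict_trans1 ln_ge_iff)
  qed
  have "(u \<longlongrightarrow> (cmod (w0 - w0))\<^sup>2) (at_left R)" unfolding u_def by (intro tendsto_intros lim)
  moreover have "\<forall>\<^sub>F t in at_left R. exp (ln (u t1) + 2 * C * t1 - 2 * C * R) \<le> u t"
    by (rule eventually_mono[OF eventually_at_left_real[OF t1(2)]]) (use low in auto)
  ultimately have "exp (ln (u t1) + 2 * C * t1 - 2 * C * R) \<le> (cmod (w0 - w0))\<^sup>2"
    by (rule tendsto_lowerbound) simp
  then show False using exp_gt_zero by (simp add: not_le)
qed

section \<open>Divisibility of the Wronskian and its change of parameter\<close>

text \<open>At a zero of order n of l_j the Wronskian vanishes to order at least n - 1, and its
  square to order at least 2 n - 2, which is at least n once n \<ge> 2. Hypothesis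
  \<open>ram\<close> excludes n = 1, \<open>nd\<close> makes the order finite, and the other forms
  do not vanish at this point.\<close>

lemma ramified_wronskian_divisible:
  fixes \<alpha> :: "nat \<Rightarrow> complex"
  assumes hol: "a holomorphic_on ball w0 r" "b holomorphic_on ball w0 r" and r: "0 < r"
    and fin: "finite I" and inj: "inj_on \<alpha> I" and nz: "a w0 \<noteq> 0 \<or> b w0 \<noteq> 0"
    and ram: "\<And>j. \<lbrakk>j \<in> I; a w0 - \<alpha> j * b w0 = 0\<rbrakk> \<Longrightarrow> deriv a w0 - \<alpha> j * deriv b w0 = 0"
    and nd: "\<And>s j. \<lbrakk>0 < s; s \<le> r; j \<in> I\<rbrakk> \<Longrightarrow> \<exists>z\<in>ball w0 s. a z - \<alpha> j * b z \<noteq> 0"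
  obtains s h where "0 < s" "s \<le> r" "h holomorphic_on ball w0 s"
    "\<And>z. z \<in> ball w0 s \<Longrightarrow> (deriv a z * b z - a z * deriv b z)\<^sup>2 = h z * (\<Prod>j\<in>I. a z - \<alpha> j * b z)"
proof -
  define l where "l j z = a z - \<alpha> j * b z" for j z
  define W where "W z = deriv a z * b z - a z * deriv b z" for z
  have w0: "w0 \<in> ball w0 r" using r by simp
  have lhol: "l j holomorphic_on ball w0 r" for j unfolding l_def[abs_def] by (intro holomorphic_intros hol)
  have Whol: "W holomorphic_on ball w0 r" unfolding W_def[abs_def] by (intro holomorphic_intros hol) auto
  have two: False if "i \<in> I" "j \<in> I" "i \<noteq> j" "l i w0 = 0" "l j w0 = 0" for i j
  proof -
    have "(\<alpha> i - \<alpha> j) * b w0 = 0" using that by (simp add: l_def algebra_simps)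
    moreover have "\<alpha> i \<noteq> \<alpha> j" using inj that by (auto simp: inj_on_def)
    ultimately have "b w0 = 0" by simp
    then show False using that nz by (simp add: l_def)
  qed
  have *: "\<exists>s h. 0 < s \<and> s \<le> r \<and> h holomorphic_on ball w0 s \<and> (\<forall>z\<in>ball w0 s. (W z)\<^sup>2 = h z * (\<Prod>j\<in>I. l j z))"
  proof -
    \<comment> \<open>Division by a factor that is nonzero at \<open>w0\<close>, on a smaller
      disk.\<close>
    have divide: "\<exists>s h. 0 < s \<and> s \<le> r \<and> h holomorphic_on ball w0 s \<and> (\<forall>z\<in>ball w0 s. f z = h z * v z)"
      if f: "f holomorphic_on ball w0 t" and v: "v holomorphic_on ball w0 r" "v w0 \<noteq> 0" and t: "0 < t" "t \<le> r" for f v t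
    proof -
      have "open (ball w0 t \<inter> v -` (- {0}))"
        using holomorphic_on_subset[OF v(1) subset_ball[OF t(2)]]
        by (intro continuous_open_preimage holomorphic_on_imp_continuous_on) auto
      moreover have "w0 \<in> ball w0 t \<inter> v -` (- {0})" using t v by auto
      ultimately obtain s where s: "0 < s" "ball w0 s \<subseteq> ball w0 t \<inter> v -` (- {0})"
        using open_contains_ball by blast
      define s' where "s' = min s t"
      have s': "0 < s'" "s' \<le> r" "ball w0 s' \<subseteq> ball w0 t" "ball w0 s' \<subseteq> ball w0 s" using s t by (auto simp: s'_def)
      have vnz: "v z \<noteq> 0" if "z \<in> ball w0 s'" for z using s s'(4) that by blast
      have "(\<lambda>z. f z / v z) holomorphic_on ball w0 s'"
        using holomorphic_on_subset[OF f s'(3)] holomorphic_on_subset[OF v(1) subset_ball[OF s'(2)]] vnz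
        by (intro holomorphic_intros) auto
      then show ?thesis using s' vnz by (intro exI[of _ s'] exI[of _ "\<lambda>z. f z / v z"]) auto
    qed
    show ?thesis
    proof (cases "\<exists>j\<in>I. l j w0 = 0")
      case False
      then have "(\<Prod>j\<in>I. l j w0) \<noteq> 0" using fin by (simp add: prod_zero_iff)
      moreover have "(\<lambda>z. \<Prod>j\<in>I. l j z) holomorphic_on ball w0 r" by (intro holomorphic_intros lhol)
      moreover have "(\<lambda>z. (W z)\<^sup>2) holomorphic_on ball w0 r" by (intro holomorphic_intros Whol)
      ultimately show ?thesis using divide[of "\<lambda>z. (W z)\<^sup>2" r "\<lambda>z. \<Prod>j\<in>I. l j z"] r by simp
    next
      case True
      then obtain j where j: "j \<in> I" "l j w0 = 0" by blast
      let ?v = "\<lambda>z. \<Prod>k\<in>I - {j}. l k z"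
      have v: "?v holomorphic_on ball w0 r" "?v w0 \<noteq> 0"
        using two[OF j(1) _ _ j(2)] fin by (auto intro!: holomorphic_intros lhol simp: prod_zero_iff)
      have "\<not> l j constant_on ball w0 r"
      proof
        assume "l j constant_on ball w0 r"
        then have "l j z = 0" if "z \<in> ball w0 r" for z using j(2) w0 that unfolding constant_on_def by metis
        then show False using nd[OF r _ j(1)] by (auto simp: l_def)
      qed
      then obtain g s n where g: "0 < n" "0 < s" "ball w0 s \<subseteq> ball w0 r" "g holomorphic_on ball w0 s"
        "\<And>z. z \<in> ball w0 s \<Longrightarrow> l j z = (z - w0) ^ n * g z" "\<And>z. z \<in> ball w0 s \<Longrightarrow> g z \<noteq> 0"
        using holomorphic_factor_zero_nonconstant[OF lhol open_ball connected_ball w0 j(2)] by metis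
      have sr: "s \<le> r" using g(2,3) by (simp add: ball_subset_ball_iff)
      have ws: "w0 \<in> ball w0 s" using g(2) by simp
      have ld: "deriv (l j) z = deriv a z - \<alpha> j * deriv b z" if z: "z \<in> ball w0 r" for z
        unfolding l_def[abs_def]
        by (rule DERIV_imp_deriv)
          (auto intro!: derivative_eq_intros holomorphic_derivI[OF hol(1) open_ball z] holomorphic_derivI[OF hol(2) open_ball z])
      have ld': "deriv (l j) z = of_nat n * (z - w0) ^ (n - 1) * g z + (z - w0) ^ n * deriv g z" if z: "z \<in> ball w0 s" for z
      proof -
        have "((\<lambda>z. (z - w0) ^ n * g z) has_field_derivative of_nat n * (z - w0) ^ (n - 1) * g z + (z - w0) ^ n * deriv g z) (at z)"
          by (auto intro!: derivative_eq_intros holomorphic_derivI[OF g(4) open_ball z])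
        then have "(l j has_field_derivative of_nat n * (z - w0) ^ (n - 1) * g z + (z - w0) ^ n * deriv g z) (at z)"
          by (rule has_field_derivative_transform_within_open[of _ _ _ "ball w0 s"]) (use z g(5) in auto)
        then show ?thesis by (rule DERIV_imp_deriv)
      qed
      have "n \<noteq> 1"
      proof
        assume "n = 1"
        then have "deriv (l j) w0 = g w0" using ld'[OF ws] by simp
        moreover have "deriv (l j) w0 = 0" using ld[OF w0] ram[OF j(1)] j(2) by (simp add: l_def)
        ultimately show False using g(6)[OF ws] by simp
      qed
      \<comment> \<open>With m = n - 2 one has 2 (n - 1) = n + m, so that (z - w0)^m is left over
        after division by l_j.\<close>
      then obtain m where m: "n = m + 2" using g(1) that[of "n - 2"] by simp
      \<comment> \<open>Replacing a by a - \<alpha>_j b does not change the Wronskian, so W = l_j' b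
        - l_j b'. \<open>q\<close> is what remains of this after (z - w0)^(n - 1) has been taken
        out.\<close>
      define q where "q z = of_nat n * g z * b z + (z - w0) * (deriv g z * b z - g z * deriv b z)" for z
      have qhol: "q holomorphic_on ball w0 s"
        unfolding q_def[abs_def]
        by (intro holomorphic_intros g(4) holomorphic_on_subset[OF hol(2) g(3)]
            holomorphic_on_subset[OF holomorphic_deriv[OF hol(2) open_ball] g(3)]) auto
      have Wq: "W z = (z - w0) ^ (n - 1) * q z" if z: "z \<in> ball w0 s" for z
      proof -
        have zr: "z \<in> ball w0 r" using z g(3) by blast
        have pw: "(z - w0) ^ n = (z - w0) ^ (n - 1) * (z - w0)" using m by simp
        have "W z = deriv (l j) z * b z - l j z * deriv b z"
          by (simp add: ld[OF zr] W_def l_def algebra_simps)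
        also have "\<dots> = (z - w0) ^ (n - 1) * q z"
          by (simp add: ld'[OF z] g(5)[OF z] pw q_def algebra_simps)
        finally show ?thesis .
      qed
      have "(\<lambda>z. (z - w0) ^ m * (q z)\<^sup>2 / g z) holomorphic_on ball w0 s"
        using g(6) by (intro holomorphic_intros qhol g(4))
      from divide[OF this v g(2) sr] obtain s' h where s': "0 < s'" "s' \<le> r" "h holomorphic_on ball w0 s'"
        "\<forall>z\<in>ball w0 s'. (z - w0) ^ m * (q z)\<^sup>2 / g z = h z * ?v z" by blast
      define t where "t = min s s'"
      have "(W z)\<^sup>2 = h z * (\<Prod>j\<in>I. l j z)" if z: "z \<in> ball w0 t" for z
      proof -
        have zs: "z \<in> ball w0 s" "z \<in> ball w0 s'" using z by (auto simp: t_def)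
        have "(W z)\<^sup>2 = (z - w0) ^ n * ((z - w0) ^ m * (q z)\<^sup>2)"
          by (simp add: Wq[OF zs(1)] m power2_eq_square power_add mult_ac)
        also have "(z - w0) ^ m * (q z)\<^sup>2 = g z * (h z * ?v z)"
        proof -
          have "(z - w0) ^ m * (q z)\<^sup>2 / g z = h z * ?v z" using s'(4) zs(2) by blast
          then show ?thesis using g(6)[OF zs(1)] by (simp add: nonzero_divide_eq_eq mult_ac)
        qed
        also have "(z - w0) ^ n * (g z * (h z * ?v z)) = h z * (l j z * ?v z)"
          by (simp add: g(5)[OF zs(1)] mult_ac)
        also have "l j z * ?v z = (\<Prod>j\<in>I. l j z)" using fin j(1) by (simp add: prod.remove)
        finally show ?thesis .
      qed
      moreover have "h holomorphic_on ball w0 t" using s'(3) by (rule holomorphic_on_subset) (auto simp: t_def)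
      ultimately show ?thesis using g(2) s' sr by (intro exI[of _ t] exI[of _ h]) (auto simp: t_def)
    qed
  qed
  then obtain s h where sh: "0 < s" "s \<le> r" "h holomorphic_on ball w0 s" "\<forall>z\<in>ball w0 s. (W z)\<^sup>2 = h z * (\<Prod>j\<in>I. l j z)"
    by blast
  show thesis by (rule that[OF sh(1-3)]) (use sh(4) in \<open>auto simp: W_def l_def\<close>)
qed

definition wronskian_along :: "('b \<Rightarrow> mat2) \<Rightarrow> (complex \<Rightarrow> 'b) \<Rightarrow> complex \<Rightarrow> complex" where
  "wronskian_along E \<phi> z = deriv (thf E \<phi>) z * omf E \<phi> z - thf E \<phi> z * deriv (omf E \<phi>) z"

lemma wronskian_along_cong:
  assumes "open U" "z \<in> U" "\<And>w. w \<in> U \<Longrightarrow> \<phi> w = \<psi> w"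
  shows "wronskian_along E \<phi> z = wronskian_along E \<psi> z"
proof -
  note c = thf_omf_cong[OF assms(1) _ assms(3), where E = E]
  have ev: "\<forall>\<^sub>F w in nhds z. w \<in> U" using assms by (intro eventually_nhds_in_open)
  have "deriv (thf E \<phi>) z = deriv (thf E \<psi>) z" "deriv (omf E \<phi>) z = deriv (omf E \<psi>) z"
    by (rule deriv_cong_ev, rule eventually_mono[OF ev], simp add: c, simp)+
  then show ?thesis using c[OF assms(2)] by (simp add: wronskian_along_def)
qed

text \<open>The terms with the second derivative of \<open>T\<close> cancel. This leaves weight 3:
  one from each form and one from the differentiation.\<close>

lemma wronskian_along_comp:
  assumes \<sigma>: "holm E \<sigma> V" and T: "T holomorphic_on B" "open B" "T ` B \<subseteq> V"
    and eq: "\<And>z. z \<in> B \<Longrightarrow> \<phi> z = \<sigma> (T z)" and z: "z \<in> B"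
  shows "wronskian_along E \<phi> z = wronskian_along E \<sigma> (T z) * deriv T z ^ 3"
proof -
  have Tz: "T z \<in> V" using T z by blast
  have dT: "(T has_field_derivative deriv T z) (at z)" "(deriv T has_field_derivative deriv (deriv T) z) (at z)"
    using holomorphic_derivI[OF T(1,2) z] holomorphic_derivI[OF holomorphic_deriv[OF T(1,2)] T(2) z] by auto
  have main: "deriv F z = deriv G (T z) * (deriv T z)\<^sup>2 + G (T z) * deriv (deriv T) z"
    if G: "G holomorphic_on V" and FG: "\<And>z. z \<in> B \<Longrightarrow> F z = G (T z) * deriv T z" for F G
  proof -
    have "((\<lambda>z. G (T z) * deriv T z) has_field_derivative deriv G (T z) * (deriv T z)\<^sup>2 + G (T z) * deriv (deriv T) z) (at z)"
      using DERIV_chain2[OF holomorphic_derivI[OF G holmD(1)[OF \<sigma>] Tz] dT(1)]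
      by (auto intro!: derivative_eq_intros dT simp: power2_eq_square algebra_simps)
    then have "(F has_field_derivative deriv G (T z) * (deriv T z)\<^sup>2 + G (T z) * deriv (deriv T) z) (at z)"
      by (rule has_field_derivative_transform_within_open[OF _ T(2) z]) (simp add: FG)
    then show ?thesis by (rule DERIV_imp_deriv)
  qed
  have c: "\<And>z. z \<in> B \<Longrightarrow> thf E \<phi> z = thf E \<sigma> (T z) * deriv T z"
    "\<And>z. z \<in> B \<Longrightarrow> omf E \<phi> z = omf E \<sigma> (T z) * deriv T z"
    using holm_comp(3,4)[OF \<sigma> T eq] by auto
  have "deriv (thf E \<phi>) z = deriv (thf E \<sigma>) (T z) * (deriv T z)\<^sup>2 + thf E \<sigma> (T z) * deriv (deriv T) z"
    by (rule main[OF holomorphic_thf_omf(1)[OF \<sigma>] c(1)])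
  moreover have "deriv (omf E \<phi>) z = deriv (omf E \<sigma>) (T z) * (deriv T z)\<^sup>2 + omf E \<sigma> (T z) * deriv (deriv T) z"
    by (rule main[OF holomorphic_thf_omf(2)[OF \<sigma>] c(2)])
  ultimately show ?thesis
    by (simp add: wronskian_along_def c[OF z] power2_eq_square power3_eq_cube algebra_simps)
qed

lemma imm_comp:
  assumes \<sigma>: "imm E \<sigma> V" and T: "T holomorphic_on B" "open B" "T ` B \<subseteq> V"
    and eq: "\<And>z. z \<in> B \<Longrightarrow> \<phi> z = \<sigma> (T z)" and nz: "\<And>z. z \<in> B \<Longrightarrow> deriv T z \<noteq> 0"
  shows "imm E \<phi> B"
proof -
  have h: "holm E \<sigma> V" using \<sigma> by (simp add: imm_def)
  show ?thesis
    unfolding imm_def using holm_comp(1)[OF h T eq] holm_comp(3,4)[OF h T eq] nz \<sigma> T(3)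
    by (auto simp: imm_def)
qed

lemma imm_reparam_deriv_nz:
  assumes \<phi>: "imm E \<phi> B" and \<sigma>: "holm E \<sigma> V" and T: "T holomorphic_on B" "open B" "T ` B \<subseteq> V"
    and eq: "\<And>z. z \<in> B \<Longrightarrow> \<phi> z = \<sigma> (T z)" and z: "z \<in> B"
  shows "deriv T z \<noteq> 0"
  using \<phi> holm_comp(3,4)[OF \<sigma> T eq z] z by (auto simp: imm_def)

lemma imm_shift:
  assumes "imm E \<phi> (ball a r)"
  shows "imm E (\<lambda>z. \<phi> (z + c)) (ball (a - c) r)"
    "\<And>z. z \<in> ball (a - c) r \<Longrightarrow> thf E (\<lambda>z. \<phi> (z + c)) z = thf E \<phi> (z + c)"
    "\<And>z. z \<in> ball (a - c) r \<Longrightarrow> omf E (\<lambda>z. \<phi> (z + c)) z = omf E \<phi> (z + c)"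
    "\<And>z. z \<in> ball (a - c) r \<Longrightarrow> wronskian_along E (\<lambda>z. \<phi> (z + c)) z = wronskian_along E \<phi> (z + c)"
proof -
  let ?B = "ball (a - c) r"
  have T: "(\<lambda>z. z + c) holomorphic_on ?B" "(\<lambda>z. z + c) ` ?B \<subseteq> ball a r"
    by (auto intro!: holomorphic_intros simp: dist_norm algebra_simps)
  have d: "deriv (\<lambda>z. z + c) z = 1" for z
    by (rule DERIV_imp_deriv) (auto intro!: derivative_eq_intros)
  have h: "holm E \<phi> (ball a r)" using assms by (simp add: imm_def)
  show "imm E (\<lambda>z. \<phi> (z + c)) ?B"
    by (rule imm_comp[OF assms T(1) open_ball T(2)]) (simp_all add: d)
  fix z assume z: "z \<in> ?B"
  show "thf E (\<lambda>z. \<phi> (z + c)) z = thf E \<phi> (z + c)" "omf E (\<lambda>z. \<phi> (z + c)) z = omf E \<phi> (z + c)"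
    using holm_comp(3,4)[OF h T(1) open_ball T(2) _ z, of "\<lambda>z. \<phi> (z + c)"] by (simp_all add: d)
  show "wronskian_along E (\<lambda>z. \<phi> (z + c)) z = wronskian_along E \<phi> (z + c)"
    using wronskian_along_comp[OF h T(1) open_ball T(2) _ z, of "\<lambda>z. \<phi> (z + c)"] by (simp add: d)
qed

text \<open>Completeness is only needed along radii on which the metric is \<open>O((R - t) powr (-2/3))\<close>, hence of finite
  length.\<close>
locale complete_legendrian = legendrian E for E :: "'b::t2_space \<Rightarrow> mat2" +
  assumes complete: "\<lbrakk>0 < R; imm E \<phi> (ball 0 R); cmod e = 1;
     \<And>t. \<lbrakk>0 \<le> t; t < R\<rbrakk> \<Longrightarrow> (cmod (thf E \<phi> (t *\<^sub>R e)) + cmod (omf E \<phi> (t *\<^sub>R e))) ^ 3 * (R - t)\<^sup>2 \<le> K\<rbrakk>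
     \<Longrightarrow> \<exists>y. ((\<lambda>t. \<phi> (t *\<^sub>R e)) \<longlongrightarrow> y) (at_left R)"
begin

section \<open>Flows on a complete Legendrian surface\<close>

text \<open>Restricting a curve to smaller open sets shows that the zeros of its Wronskian have no
  interior point. In the opposite case the Wronskian vanishes on some open piece, and
  \<open>degenerate_imp_constant_ratio\<close> spreads the consequence over the whole
  surface.\<close>

definition nondegenerate :: bool where
  "nondegenerate \<longleftrightarrow> (\<forall>\<sigma> U. imm E \<sigma> U \<and> U \<noteq> {} \<longrightarrow> (\<exists>z\<in>U. wronskian_along E \<sigma> z \<noteq> 0))"

lemma wronskian_zero_imp_proportional:
  fixes f g :: "complex \<Rightarrow> complex"
  assumes hol: "f holomorphic_on U" "g holomorphic_on U" "open U" "z0 \<in> U"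
    and W: "\<And>z. z \<in> U \<Longrightarrow> deriv f z * g z - f z * deriv g z = 0" and nz: "g z0 \<noteq> 0"
  shows "\<exists>r>0. ball z0 r \<subseteq> U \<and> (\<forall>z\<in>ball z0 r. f z * g z0 = g z * f z0)"
proof -
  have "open (U \<inter> g -` (- {0}))"
    using hol(2,3) by (intro continuous_open_preimage holomorphic_on_imp_continuous_on) auto
  moreover have "z0 \<in> U \<inter> g -` (- {0})" using hol nz by auto
  ultimately obtain r where r: "0 < r" "ball z0 r \<subseteq> U \<inter> g -` (- {0})" using open_contains_ball by blast
  have "((\<lambda>z. f z / g z) has_field_derivative 0) (at z within ball z0 r)" if z: "z \<in> ball z0 r" for z
  proof -
    have zU: "z \<in> U" "g z \<noteq> 0" using z r by auto
    have "((\<lambda>z. f z / g z) has_field_derivative (deriv f z * g z - f z * deriv g z) / (g z * g z)) (at z)"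
      by (rule DERIV_divide[OF holomorphic_derivI[OF hol(1,3) zU(1)] holomorphic_derivI[OF hol(2,3) zU(1)] zU(2)])
    then show ?thesis using W[OF zU(1)] by (simp add: has_field_derivative_at_within)
  qed
  then obtain c where c: "\<And>z. z \<in> ball z0 r \<Longrightarrow> f z / g z = c"
    using has_field_derivative_zero_constant[OF convex_ball, of z0 r "\<lambda>z. f z / g z"] by blast
  have "f z * g z0 = g z * f z0" if z: "z \<in> ball z0 r" for z
  proof -
    have "g z \<noteq> 0" using z r by auto
    then show ?thesis using c[OF z] c[of z0] r(1) nz by (simp add: field_simps)
  qed
  then show ?thesis using r by blast
qed

text \<open>The points near which the forms are proportional to a fixed pair make an open and closed
  set: the identity theorem carries the relation across every coordinate disk that meets this set.
  Connectedness gives the whole surface.\<close>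

lemma degenerate_imp_constant_ratio:
  assumes "\<not> nondegenerate"
  obtains a0 b0 where "a0 \<noteq> 0 \<or> b0 \<noteq> 0"
    "\<And>\<phi> U z. \<lbrakk>holm E \<phi> U; z \<in> U\<rbrakk> \<Longrightarrow> thf E \<phi> z * b0 = omf E \<phi> z * a0"
proof -
  obtain \<sigma> U where \<sigma>: "imm E \<sigma> U" "U \<noteq> {}" "\<And>z. z \<in> U \<Longrightarrow> wronskian_along E \<sigma> z = 0"
    using assms by (auto simp: nondegenerate_def)
  have h: "holm E \<sigma> U" using \<sigma> by (simp add: imm_def)
  obtain z0 where z0: "z0 \<in> U" using \<sigma> by blast
  define a0 b0 where "a0 = thf E \<sigma> z0" and "b0 = omf E \<sigma> z0"
  have ne: "a0 \<noteq> 0 \<or> b0 \<noteq> 0" using \<sigma>(1) z0 by (auto simp: imm_def a0_def b0_def)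
  \<comment> \<open>The quotient needs a denominator that is nonzero at \<open>z0\<close>, so the
    two forms exchange their roles when \<open>b0 = 0\<close>.\<close>
  have "\<exists>r>0. ball z0 r \<subseteq> U \<and> (\<forall>z\<in>ball z0 r. thf E \<sigma> z * b0 = omf E \<sigma> z * a0)"
  proof (cases "b0 = 0")
    case False
    then show ?thesis
      using wronskian_zero_imp_proportional[OF holomorphic_thf_omf[OF h] holmD(1)[OF h] z0] \<sigma>(3)
      by (auto simp: wronskian_along_def a0_def b0_def)
  next
    case True
    then have "a0 \<noteq> 0" using ne by simp
    moreover have "deriv (omf E \<sigma>) z * thf E \<sigma> z - omf E \<sigma> z * deriv (thf E \<sigma>) z = 0" if "z \<in> U" for z
      using \<sigma>(3)[OF that] by (simp add: wronskian_along_def algebra_simps)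
    ultimately obtain r where "r > 0" "ball z0 r \<subseteq> U" "\<forall>z\<in>ball z0 r. omf E \<sigma> z * thf E \<sigma> z0 = thf E \<sigma> z * omf E \<sigma> z0"
      using wronskian_zero_imp_proportional[OF holomorphic_thf_omf(2,1)[OF h] holmD(1)[OF h] z0] by (auto simp: a0_def)
    then show ?thesis unfolding a0_def b0_def by metis
  qed
  then obtain r where r: "0 < r" "ball z0 r \<subseteq> U" "\<And>z. z \<in> ball z0 r \<Longrightarrow> thf E \<sigma> z * b0 = omf E \<sigma> z * a0" by blast
  define Z where "Z = {x. \<exists>\<sigma> U \<zeta>. imm E \<sigma> U \<and> \<zeta> \<in> U \<and> \<sigma> \<zeta> = x \<and> (\<forall>z\<in>U. thf E \<sigma> z * b0 = omf E \<sigma> z * a0)}"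
  have "\<sigma> z0 \<in> Z"
    unfolding Z_def using imm_subset[OF \<sigma>(1) open_ball r(2)] r
    by (intro CollectI exI[of _ \<sigma>] exI[of _ "ball z0 r"] exI[of _ z0]) auto
  have opZ: "open Z"
  proof (subst open_subopen, intro ballI)
    fix x assume "x \<in> Z"
    then obtain \<tau> V \<zeta> where t: "imm E \<tau> V" "\<zeta> \<in> V" "\<tau> \<zeta> = x" "\<forall>z\<in>V. thf E \<tau> z * b0 = omf E \<tau> z * a0"
      by (auto simp: Z_def)
    have "open V" using t(1) by (simp add: imm_def holm_def)
    then have "open (\<tau> ` V)" by (rule imm_open_map[OF t(1)]) auto
    moreover have "\<tau> ` V \<subseteq> Z" using t by (auto simp: Z_def)
    ultimately show "\<exists>T. open T \<and> x \<in> T \<and> T \<subseteq> Z" using t by blast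
  qed
  have "open (- Z)"
  proof (subst open_subopen, intro ballI)
    fix y assume y: "y \<in> - Z"
    obtain \<tau> d where t: "chart_at \<tau> d" "\<tau> 0 = y" using chart_at_ex .
    have ti: "imm E \<tau> (ball 0 d)" "holm E \<tau> (ball 0 d)" "0 < d" using t by (auto simp: chart_at_def imm_def)
    have "\<tau> ` ball 0 d \<subseteq> - Z"
    proof
      fix v assume "v \<in> \<tau> ` ball 0 d"
      then obtain \<xi> where xi: "\<xi> \<in> ball 0 d" "v = \<tau> \<xi>" by blast
      show "v \<in> - Z"
      proof
        assume "v \<in> Z"
        then obtain \<psi> V \<zeta> where p: "imm E \<psi> V" "\<zeta> \<in> V" "\<psi> \<zeta> = v" "\<forall>z\<in>V. thf E \<psi> z * b0 = omf E \<psi> z * a0"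
          by (auto simp: Z_def)
        have ph: "holm E \<psi> V" using p by (simp add: imm_def)
        have eq: "\<tau> \<xi> = \<psi> \<zeta>" using xi p by simp
        obtain \<delta> T where T: "0 < \<delta>" "ball \<xi> \<delta> \<subseteq> ball 0 d" "T holomorphic_on ball \<xi> \<delta>" "T \<xi> = \<zeta>" "T ` ball \<xi> \<delta> \<subseteq> V"
          "\<And>z. z \<in> ball \<xi> \<delta> \<Longrightarrow> \<tau> z = \<psi> (T z)"
          by (rule holm_reparametrization[OF ti(2) xi(1) p(1,2) eq]) (erule that, (assumption | blast)+)
        define g where "g z = thf E \<tau> z * b0 - omf E \<tau> z * a0" for z
        have ghol: "g holomorphic_on ball 0 d"
          unfolding g_def[abs_def] by (intro holomorphic_intros holomorphic_thf_omf[OF ti(2)])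
        have g0: "g z = 0" if z: "z \<in> ball \<xi> \<delta>" for z
        proof -
          have "T z \<in> V" using T(5) z by blast
          then have "thf E \<psi> (T z) * b0 = omf E \<psi> (T z) * a0" using p(4) by blast
          moreover have "g z = (thf E \<psi> (T z) * b0 - omf E \<psi> (T z) * a0) * deriv T z"
            using holm_comp(3,4)[OF ph T(3) open_ball T(5) T(6) z] by (simp add: g_def algebra_simps)
          ultimately show ?thesis by simp
        qed
        have "g z = 0" if "z \<in> ball 0 d" for z
        proof (rule analytic_continuation[OF ghol open_ball connected_ball T(2) xi(1) _ g0 that])
          show "\<xi> islimpt ball \<xi> \<delta>" using T(1) by (simp add: islimpt_ball)
        qed
        then have "y \<in> Z" unfolding Z_def g_def using ti t(2)
          by (intro CollectI exI[of _ \<tau>] exI[of _ "ball 0 d"] exI[of _ 0]) auto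
        then show False using y by simp
      qed
    qed
    moreover have "open (\<tau> ` ball 0 d)" by (rule imm_open_map[OF ti(1)]) auto
    moreover have "y \<in> \<tau> ` ball 0 d" using t(2) ti(3) by (auto intro!: image_eqI[of _ _ 0])
    ultimately show "\<exists>T. open T \<and> y \<in> T \<and> T \<subseteq> - Z" by blast
  qed
  then have "Z = UNIV" using connectedD[OF conn opZ] \<open>\<sigma> z0 \<in> Z\<close> by auto
  show thesis
  proof (rule that[OF ne])
    fix \<phi> U z assume ph: "holm E \<phi> U" "z \<in> U"
    obtain \<psi> V \<zeta> where p: "imm E \<psi> V" "\<zeta> \<in> V" "\<psi> \<zeta> = \<phi> z" "\<forall>z\<in>V. thf E \<psi> z * b0 = omf E \<psi> z * a0"
    proof -
      have "\<phi> z \<in> Z" by (simp add: \<open>Z = UNIV\<close>)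
      then show thesis using that unfolding Z_def by blast
    qed
    have ph': "holm E \<psi> V" using p by (simp add: imm_def)
    obtain \<delta> T where T: "0 < \<delta>" "ball z \<delta> \<subseteq> U" "T holomorphic_on ball z \<delta>" "T z = \<zeta>" "T ` ball z \<delta> \<subseteq> V"
      "\<And>w. w \<in> ball z \<delta> \<Longrightarrow> \<phi> w = \<psi> (T w)"
      by (rule holm_reparametrization[OF ph p(1,2) p(3)[symmetric]]) (erule that, (assumption | blast)+)
    have "z \<in> ball z \<delta>" using T(1) by simp
    from holm_comp(3,4)[OF ph' T(3) open_ball T(5) T(6) this]
    have "thf E \<phi> z = thf E \<psi> \<zeta> * deriv T z" "omf E \<phi> z = omf E \<psi> \<zeta> * deriv T z"
      using T(4) by auto
    moreover have "thf E \<psi> \<zeta> * b0 = omf E \<psi> \<zeta> * a0" using p by blast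
    ultimately show "thf E \<phi> z * b0 = omf E \<phi> z * a0"
      by (simp add: mult.commute mult.left_commute)
  qed
qed

text \<open>A flow box of the field h d/dz. The chain rule turns the weights 1, 1 and 3 of the forms
  and of the Wronskian into powers of h.\<close>

lemma ode_box:
  assumes \<sigma>: "imm E \<sigma> V" and B: "open B" "B \<subseteq> V" "w0 \<in> B" and h: "h holomorphic_on B" "h w0 \<noteq> 0"
  obtains d k where "0 < d" "imm E (\<lambda>z. \<sigma> (k z)) (ball 0 d)" "k 0 = w0" "k ` ball 0 d \<subseteq> B"
    "\<And>z. z \<in> ball 0 d \<Longrightarrow> thf E (\<lambda>z. \<sigma> (k z)) z = thf E \<sigma> (k z) * h (k z)"
    "\<And>z. z \<in> ball 0 d \<Longrightarrow> omf E (\<lambda>z. \<sigma> (k z)) z = omf E \<sigma> (k z) * h (k z)"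
    "\<And>z. z \<in> ball 0 d \<Longrightarrow> wronskian_along E (\<lambda>z. \<sigma> (k z)) z = wronskian_along E \<sigma> (k z) * h (k z) ^ 3"
proof -
  obtain d k where k: "0 < d" "k holomorphic_on ball 0 d" "k ` ball 0 d \<subseteq> B" "k 0 = w0"
    "\<And>z. z \<in> ball 0 d \<Longrightarrow> deriv k z = h (k z) \<and> h (k z) \<noteq> 0"
    by (rule holomorphic_autonomous_ode[OF h(1) B(1,3) h(2)]) (erule that, (assumption | blast)+)
  have kV: "k ` ball 0 d \<subseteq> V" using k(3) B(2) by blast
  have sh: "holm E \<sigma> V" using \<sigma> by (simp add: imm_def)
  show thesis
  proof (rule that[OF k(1) _ k(4,3)])
    show "imm E (\<lambda>z. \<sigma> (k z)) (ball 0 d)"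
      by (rule imm_comp[OF \<sigma> k(2) open_ball kV refl]) (simp add: k(5))
    fix z :: complex assume z: "z \<in> ball 0 d"
    show "thf E (\<lambda>z. \<sigma> (k z)) z = thf E \<sigma> (k z) * h (k z)" "omf E (\<lambda>z. \<sigma> (k z)) z = omf E \<sigma> (k z) * h (k z)"
      using holm_comp(3,4)[OF sh k(2) open_ball kV _ z, of "\<lambda>z. \<sigma> (k z)"] k(5)[OF z] by simp_all
    show "wronskian_along E (\<lambda>z. \<sigma> (k z)) z = wronskian_along E \<sigma> (k z) * h (k z) ^ 3"
      using wronskian_along_comp[OF sh k(2) open_ball kV _ z, of "\<lambda>z. \<sigma> (k z)"] k(5)[OF z] by simp
  qed
qed

definition constant_sol :: "complex \<Rightarrow> complex \<Rightarrow> (complex \<Rightarrow> 'b) \<Rightarrow> complex set \<Rightarrow> bool" where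
  "constant_sol a0 b0 \<phi> U \<longleftrightarrow> imm E \<phi> U \<and> (\<forall>z\<in>U. thf E \<phi> z = a0 \<and> omf E \<phi> z = b0)"

text \<open>In a coordinate the forms are l a0 and l b0 with a common factor l without zeros, and
  the flow of (1 / l) d/dz normalizes them to the constants. Constant forms have bounded speed, so
  every radius has finite length; the flow is entire and, having a box at every point,
  surjective.\<close>

lemma constant_ratio_entire:
  assumes ab: "a0 \<noteq> 0 \<or> b0 \<noteq> 0"
    and ratio: "\<And>\<phi> U z. \<lbrakk>holm E \<phi> U; z \<in> U\<rbrakk> \<Longrightarrow> thf E \<phi> z * b0 = omf E \<phi> z * a0"
  shows "\<exists>\<phi>. surj \<phi> \<and> imm E \<phi> UNIV \<and> (\<forall>z. thf E \<phi> z = a0 \<and> omf E \<phi> z = b0)"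
proof -
  have box: "\<exists>\<sigma> d. 0 < d \<and> constant_sol a0 b0 \<sigma> (ball 0 d) \<and> \<sigma> 0 = y" for y
  proof -
    obtain \<tau> d where t: "chart_at \<tau> d" "\<tau> 0 = y" using chart_at_ex .
    have ti: "imm E \<tau> (ball 0 d)" "holm E \<tau> (ball 0 d)" "0 < d" using t by (auto simp: chart_at_def imm_def)
    define l where "l z = (if b0 \<noteq> 0 then omf E \<tau> z / b0 else thf E \<tau> z / a0)" for z
    have lhol: "l holomorphic_on ball 0 d"
      unfolding l_def[abs_def] using ab
      by (cases "b0 = 0") (auto intro!: holomorphic_intros holomorphic_thf_omf[OF ti(2)])
    have l: "thf E \<tau> z = l z * a0" "omf E \<tau> z = l z * b0" if z: "z \<in> ball 0 d" for z
      using ratio[OF ti(2) z] ab by (auto simp: l_def field_simps)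
    have lnz: "l z \<noteq> 0" if "z \<in> ball 0 d" for z
      using ti(1) l[OF that] that by (auto simp: imm_def)
    have ih: "(\<lambda>z. 1 / l z) holomorphic_on ball 0 d" using lnz by (intro holomorphic_intros lhol)
    have z0: "0 \<in> ball (0::complex) d" using ti by simp
    have i0: "1 / l 0 \<noteq> 0" using lnz[OF z0] by simp
    obtain r k where k: "0 < r" "imm E (\<lambda>z. \<tau> (k z)) (ball 0 r)" "k 0 = 0" "k ` ball 0 r \<subseteq> ball 0 d"
      "\<And>z. z \<in> ball 0 r \<Longrightarrow> thf E (\<lambda>z. \<tau> (k z)) z = thf E \<tau> (k z) * (1 / l (k z))"
      "\<And>z. z \<in> ball 0 r \<Longrightarrow> omf E (\<lambda>z. \<tau> (k z)) z = omf E \<tau> (k z) * (1 / l (k z))"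
      by (rule ode_box[OF ti(1) open_ball subset_refl z0 ih i0]) (erule that, (assumption | blast)+)
    have "constant_sol a0 b0 (\<lambda>z. \<tau> (k z)) (ball 0 r)"
      unfolding constant_sol_def
    proof (intro conjI k(2) ballI)
      fix z :: complex assume z: "z \<in> ball 0 r"
      have kz: "k z \<in> ball 0 d" using k(4) z by blast
      show "thf E (\<lambda>z. \<tau> (k z)) z = a0" "omf E (\<lambda>z. \<tau> (k z)) z = b0"
        using k(5,6)[OF z] l[OF kz] lnz[OF kz] by simp_all
    qed
    then show ?thesis using k(1,3) t(2) by (intro exI[of _ "\<lambda>z. \<tau> (k z)"] exI[of _ r]) simp
  qed
  interpret flow E "constant_sol a0 b0"
  proof unfold_locales
    show "imm E \<phi> U" if "constant_sol a0 b0 \<phi> U" for \<phi> U using that by (simp add: constant_sol_def)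
    show "constant_sol a0 b0 \<phi> V" if "constant_sol a0 b0 \<phi> U" "open V" "V \<subseteq> U" for \<phi> U V
      using that imm_subset by (auto simp: constant_sol_def)
    show "constant_sol a0 b0 \<phi> U" if "open U" "\<And>z. z \<in> U \<Longrightarrow> \<exists>V. z \<in> V \<and> open V \<and> constant_sol a0 b0 \<phi> V" for \<phi> U
      using that imm_glue[OF that(1), of E \<phi>] unfolding constant_sol_def by blast
    show "constant_sol a0 b0 \<psi> U" if "constant_sol a0 b0 \<phi> U" "\<And>z. z \<in> U \<Longrightarrow> \<phi> z = \<psi> z" for \<phi> \<psi> U
    proof -
      have o: "open U" using that by (simp add: constant_sol_def imm_def holm_def)
      show ?thesis
        using that(1) imm_cong[OF _ that(2)] thf_omf_cong[OF o _ that(2), where E = E] by (simp add: constant_sol_def)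
    qed
    show "constant_sol a0 b0 (\<lambda>z. \<phi> (z + c)) (ball (a - c) r)" if "constant_sol a0 b0 \<phi> (ball a r)" for \<phi> a r c
    proof -
      have i: "imm E \<phi> (ball a r)" using that by (simp add: constant_sol_def)
      have b: "z + c \<in> ball a r" if "z \<in> ball (a - c) r" for z
        using that by (simp add: dist_norm diff_diff_eq add.commute)
      show ?thesis
        unfolding constant_sol_def
        using imm_shift(1)[OF i, of c] imm_shift(2-4)[OF i, of _ c] that b by (auto simp: constant_sol_def simp del: mem_ball)
    qed
    show "deriv T z = 1" if "constant_sol a0 b0 \<phi> (ball \<zeta> \<delta>)" "constant_sol a0 b0 \<psi> V" "T holomorphic_on ball \<zeta> \<delta>" "T ` ball \<zeta> \<delta> \<subseteq> V"
        "\<And>z. z \<in> ball \<zeta> \<delta> \<Longrightarrow> \<phi> z = \<psi> (T z)" "z \<in> ball \<zeta> \<delta>" for \<phi> \<zeta> \<delta> \<psi> V T z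
    proof -
      have ph: "holm E \<psi> V" using that(2) by (simp add: constant_sol_def imm_def)
      have "T z \<in> V" using that(4,6) by blast
      then have "a0 = a0 * deriv T z" "b0 = b0 * deriv T z"
        using holm_comp(3,4)[OF ph that(3) open_ball that(4,5,6)] that(1,2,6) by (simp_all add: constant_sol_def)
      then show ?thesis using ab by auto
    qed
    show "\<exists>y \<sigma> d. ((\<lambda>t. \<phi> (t *\<^sub>R e)) \<longlongrightarrow> y) (at_left R) \<and> 0 < d \<and> constant_sol a0 b0 \<sigma> (ball 0 d) \<and> \<sigma> 0 = y"
      if R: "0 < R" and S: "constant_sol a0 b0 \<phi> (ball 0 R)" and e: "cmod e = 1" for R \<phi> e
    proof -
      have "\<exists>y. ((\<lambda>t. \<phi> (t *\<^sub>R e)) \<longlongrightarrow> y) (at_left R)"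
      proof (rule complete[OF R _ e])
        show "imm E \<phi> (ball 0 R)" using S by (simp add: constant_sol_def)
        fix t assume t: "0 \<le> t" "t < R"
        then have "t *\<^sub>R e \<in> ball 0 R" using e by simp
        then have "thf E \<phi> (t *\<^sub>R e) = a0" "omf E \<phi> (t *\<^sub>R e) = b0" using S by (auto simp: constant_sol_def)
        moreover have "(cmod a0 + cmod b0) ^ 3 * (R - t)\<^sup>2 \<le> (cmod a0 + cmod b0) ^ 3 * R\<^sup>2"
          using t by (intro mult_left_mono power_mono) auto
        ultimately show "(cmod (thf E \<phi> (t *\<^sub>R e)) + cmod (omf E \<phi> (t *\<^sub>R e))) ^ 3 * (R - t)\<^sup>2 \<le> (cmod a0 + cmod b0) ^ 3 * R\<^sup>2"
          by simp
      qed
      then show ?thesis using box by metis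
    qed
  qed
  obtain \<sigma> d where s: "0 < d" "constant_sol a0 b0 \<sigma> (ball 0 d)" using box by blast
  obtain \<phi> where "constant_sol a0 b0 \<phi> UNIV" by (rule Sol_global[OF s])
  moreover from this have "surj \<phi>" by (rule Sol_surj[OF _ box])
  ultimately show ?thesis unfolding constant_sol_def by blast
qed

definition forms_prod :: "(nat \<Rightarrow> complex) \<Rightarrow> (complex \<Rightarrow> 'b) \<Rightarrow> complex \<Rightarrow> complex" where
  "forms_prod \<alpha> \<phi> z = (\<Prod>j\<in>{1..7}. thf E \<phi> z - \<alpha> j * omf E \<phi> z)"

lemma forms_prod_scale:
  assumes "thf E \<phi> z = thf E \<sigma> w * c" "omf E \<phi> z = omf E \<sigma> w * c"
  shows "forms_prod \<alpha> \<phi> z = forms_prod \<alpha> \<sigma> w * c ^ 7"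
proof -
  have "thf E \<phi> z - \<alpha> j * omf E \<phi> z = (thf E \<sigma> w - \<alpha> j * omf E \<sigma> w) * c" for j
    using assms by (simp add: algebra_simps)
  then show ?thesis by (simp add: forms_prod_def prod.distrib)
qed

text \<open>Under a change of parameter with derivative h the left side gains h^6 and the right side
  h^7. The equation therefore fixes the parameter as the flow time of h d/dz, where h is the
  quotient of the squared Wronskian by the product of the forms in a coordinate.\<close>

definition normalized_sol :: "(nat \<Rightarrow> complex) \<Rightarrow> (complex \<Rightarrow> 'b) \<Rightarrow> complex set \<Rightarrow> bool" where
  "normalized_sol \<alpha> \<phi> U \<longleftrightarrow> imm E \<phi> U \<and> (\<forall>z\<in>U. (wronskian_along E \<phi> z)\<^sup>2 = forms_prod \<alpha> \<phi> z)"

lemma nondegenerateD: "\<lbrakk>nondegenerate; imm E \<sigma> U; U \<noteq> {}\<rbrakk> \<Longrightarrow> \<exists>z\<in>U. wronskian_along E \<sigma> z \<noteq> 0"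
  by (auto simp: nondegenerate_def)

text \<open>With P the product of the forms along \<sigma>, comparison of the weights 6 and 7 gives
  P T'^6 (T' - h(T)) = 0. On the open set where T' differs from h(T) the Wronskian of \<phi> would
  vanish, against nondegeneracy.\<close>

lemma normalized_sol_reparam:
  assumes nd: nondegenerate and \<phi>: "normalized_sol \<alpha> \<phi> B" and \<sigma>: "imm E \<sigma> V"
    and h: "h holomorphic_on V" "\<And>w. w \<in> V \<Longrightarrow> (wronskian_along E \<sigma> w)\<^sup>2 = h w * forms_prod \<alpha> \<sigma> w"
    and T: "T holomorphic_on B" "T ` B \<subseteq> V" and eq: "\<And>z. z \<in> B \<Longrightarrow> \<phi> z = \<sigma> (T z)" and z: "z \<in> B"
  shows "deriv T z = h (T z)"
proof (rule ccontr)
  assume ne: "deriv T z \<noteq> h (T z)"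
  have ph: "imm E \<phi> B" and B: "open B" using \<phi> by (auto simp: normalized_sol_def imm_def holm_def)
  have sh: "holm E \<sigma> V" using \<sigma> by (simp add: imm_def)
  define N where "N = B \<inter> (\<lambda>w. deriv T w - h (T w)) -` (- {0})"
  have "(h \<circ> T) holomorphic_on B" by (rule holomorphic_on_compose_gen[OF T(1) h(1) T(2)])
  then have "(\<lambda>w. deriv T w - h (T w)) holomorphic_on B"
    by (intro holomorphic_intros T(1) B) (simp add: o_def)
  then have "open N" unfolding N_def
    using B by (intro continuous_open_preimage holomorphic_on_imp_continuous_on) auto
  have zN: "z \<in> N" using ne z by (simp add: N_def)
  have "imm E \<phi> N" by (rule imm_subset[OF ph \<open>open N\<close>]) (auto simp: N_def)
  then obtain w where w: "w \<in> N" "wronskian_along E \<phi> w \<noteq> 0" using nondegenerateD[OF nd, of \<phi> N] zN by blast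
  have wB: "w \<in> B" using w by (simp add: N_def)
  have TV: "T w \<in> V" using T(2) wB by blast
  have "(wronskian_along E \<phi> w)\<^sup>2 = (wronskian_along E \<sigma> (T w))\<^sup>2 * deriv T w ^ 6"
    using wronskian_along_comp[OF sh T(1) B T(2) eq wB] by (simp add: power_mult_distrib flip: power_mult)
  also have "\<dots> = h (T w) * forms_prod \<alpha> \<sigma> (T w) * deriv T w ^ 6" using h(2)[OF TV] by simp
  finally have 1: "(wronskian_along E \<phi> w)\<^sup>2 = h (T w) * forms_prod \<alpha> \<sigma> (T w) * deriv T w ^ 6" .
  have "(wronskian_along E \<phi> w)\<^sup>2 = forms_prod \<alpha> \<phi> w" using \<phi> wB by (simp add: normalized_sol_def)
  also have "\<dots> = forms_prod \<alpha> \<sigma> (T w) * deriv T w ^ 7"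
    by (rule forms_prod_scale[OF holm_comp(3,4)[OF sh T(1) B T(2) eq wB]])
  finally have 2: "(wronskian_along E \<phi> w)\<^sup>2 = forms_prod \<alpha> \<sigma> (T w) * deriv T w ^ 6 * deriv T w"
    by (simp add: eval_nat_numeral)
  have "forms_prod \<alpha> \<sigma> (T w) * deriv T w ^ 6 * (deriv T w - h (T w)) = 0"
    using 1 2 by (simp add: algebra_simps)
  moreover have "deriv T w - h (T w) \<noteq> 0" using w(1) by (simp add: N_def)
  ultimately have "forms_prod \<alpha> \<sigma> (T w) * deriv T w ^ 6 = 0" by simp
  then have "(wronskian_along E \<phi> w)\<^sup>2 = 0" using 2 by simp
  then show False using w(2) by simp
qed

text \<open>In the flow box of h the squared Wronskian becomes h P h^6 = P h^7, where P is the
  product of the forms along \<sigma>; this is the product of the transformed forms.\<close>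

lemma normalized_sol_local_solution:
  assumes \<sigma>: "imm E \<sigma> V" and B: "open B" "B \<subseteq> V" "w0 \<in> B" and h: "h holomorphic_on B" "h w0 \<noteq> 0"
    and W: "\<And>w. w \<in> B \<Longrightarrow> (wronskian_along E \<sigma> w)\<^sup>2 = h w * forms_prod \<alpha> \<sigma> w"
  shows "\<exists>\<tau> d. 0 < d \<and> normalized_sol \<alpha> \<tau> (ball 0 d) \<and> \<tau> 0 = \<sigma> w0"
proof -
  obtain d k where k: "0 < d" "imm E (\<lambda>z. \<sigma> (k z)) (ball 0 d)" "k 0 = w0" "k ` ball 0 d \<subseteq> B"
    "\<And>z. z \<in> ball 0 d \<Longrightarrow> thf E (\<lambda>z. \<sigma> (k z)) z = thf E \<sigma> (k z) * h (k z)"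
    "\<And>z. z \<in> ball 0 d \<Longrightarrow> omf E (\<lambda>z. \<sigma> (k z)) z = omf E \<sigma> (k z) * h (k z)"
    "\<And>z. z \<in> ball 0 d \<Longrightarrow> wronskian_along E (\<lambda>z. \<sigma> (k z)) z = wronskian_along E \<sigma> (k z) * h (k z) ^ 3"
    by (rule ode_box[OF \<sigma> B h]) (erule that, (assumption | blast)+)
  have "normalized_sol \<alpha> (\<lambda>z. \<sigma> (k z)) (ball 0 d)"
    unfolding normalized_sol_def
  proof (intro conjI k(2) ballI)
    fix z :: complex assume z: "z \<in> ball 0 d"
    have kz: "k z \<in> B" using k(4) z by blast
    have "(wronskian_along E (\<lambda>z. \<sigma> (k z)) z)\<^sup>2 = h (k z) * forms_prod \<alpha> \<sigma> (k z) * h (k z) ^ 6"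
      using k(7)[OF z] W[OF kz] by (simp add: power_mult_distrib flip: power_mult)
    also have "\<dots> = forms_prod \<alpha> (\<lambda>z. \<sigma> (k z)) z"
      unfolding forms_prod_scale[of "\<lambda>z. \<sigma> (k z)" z \<sigma> "k z", OF k(5,6)[OF z]] by (simp add: eval_nat_numeral)
    finally show "(wronskian_along E (\<lambda>z. \<sigma> (k z)) z)\<^sup>2 = forms_prod \<alpha> (\<lambda>z. \<sigma> (k z)) z" .
  qed
  then show ?thesis using k(1,3) by (intro exI[of _ "\<lambda>z. \<sigma> (k z)"] exI[of _ d]) simp
qed

theorem totally_ramified_imp_degenerate:
  fixes \<alpha> :: "nat \<Rightarrow> complex"
  assumes inj: "inj_on \<alpha> {1..7}"
    and ram: "\<And>\<sigma> U z j. \<lbrakk>imm E \<sigma> U; z \<in> U; j \<in> {1..7}; thf E \<sigma> z - \<alpha> j * omf E \<sigma> z = 0\<rbrakk>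
       \<Longrightarrow> deriv (thf E \<sigma>) z - \<alpha> j * deriv (omf E \<sigma>) z = 0"
  shows "\<not> nondegenerate"
proof
  assume nd: nondegenerate
  \<comment> \<open>The local quotient \<open>h\<close>. No form vanishes identically on a disk,
    because the Wronskian would then vanish there too.\<close>
  have factor: "\<exists>s h. 0 < s \<and> s \<le> r \<and> h holomorphic_on ball w0 s \<and> (\<forall>z\<in>ball w0 s. (wronskian_along E \<sigma> z)\<^sup>2 = h z * forms_prod \<alpha> \<sigma> z)"
    if s: "imm E \<sigma> (ball w0 r)" and r: "0 < r" for \<sigma> w0 r
  proof -
    have sh: "holm E \<sigma> (ball w0 r)" using s by (simp add: imm_def)
    have w0: "w0 \<in> ball w0 r" using r by simp
    have ndz: "\<exists>z\<in>ball w0 t. thf E \<sigma> z - \<alpha> j * omf E \<sigma> z \<noteq> 0" if t: "0 < t" "t \<le> r" "j \<in> {1..7}" for t j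
    proof (rule ccontr)
      assume "\<not> ?thesis"
      then have z0: "thf E \<sigma> z = \<alpha> j * omf E \<sigma> z" if "z \<in> ball w0 t" for z using that by auto
      have st: "imm E \<sigma> (ball w0 t)" by (rule imm_subset[OF s]) (use t in auto)
      have "wronskian_along E \<sigma> z = 0" if z: "z \<in> ball w0 t" for z
      proof -
        have zr: "z \<in> ball w0 r" using z t by auto
        have "((\<lambda>z. \<alpha> j * omf E \<sigma> z) has_field_derivative \<alpha> j * deriv (omf E \<sigma>) z) (at z)"
          by (auto intro!: derivative_eq_intros holomorphic_derivI[OF holomorphic_thf_omf(2)[OF sh] open_ball zr])
        then have "(thf E \<sigma> has_field_derivative \<alpha> j * deriv (omf E \<sigma>) z) (at z)"
          by (rule has_field_derivative_transform_within_open[OF _ open_ball z]) (simp add: z0)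
        then show ?thesis by (simp add: wronskian_along_def DERIV_imp_deriv z0[OF z])
      qed
      moreover have "ball w0 t \<noteq> {}" using t by simp
      ultimately show False using nondegenerateD[OF nd st] by blast
    qed
    have nz0: "thf E \<sigma> w0 \<noteq> 0 \<or> omf E \<sigma> w0 \<noteq> 0" using s w0 by (auto simp: imm_def)
    obtain t h where "0 < t" "t \<le> r" "h holomorphic_on ball w0 t"
      "\<And>z. z \<in> ball w0 t \<Longrightarrow> (deriv (thf E \<sigma>) z * omf E \<sigma> z - thf E \<sigma> z * deriv (omf E \<sigma>) z)\<^sup>2
          = h z * (\<Prod>j\<in>{1..7}. thf E \<sigma> z - \<alpha> j * omf E \<sigma> z)"
      by (rule ramified_wronskian_divisible[OF holomorphic_thf_omf[OF sh] r finite_atLeastAtMost inj nz0 ram[OF s w0] ndz])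
        (assumption | erule that, (assumption | blast)+)+
    then show ?thesis by (intro exI[of _ t] exI[of _ h]) (auto simp: wronskian_along_def forms_prod_def)
  qed
  obtain K where K: "K > 0" "\<And>R a b z. \<lbrakk>a holomorphic_on ball 0 R; b holomorphic_on ball 0 R;
      \<And>z. z \<in> ball 0 R \<Longrightarrow> a z \<noteq> 0 \<or> b z \<noteq> 0;
      \<And>z. z \<in> ball 0 R \<Longrightarrow> (deriv a z * b z - a z * deriv b z)\<^sup>2 = (\<Prod>j\<in>{1..7}. a z - \<alpha> j * b z);
      \<And>U. \<lbrakk>open U; U \<noteq> {}; U \<subseteq> ball 0 R\<rbrakk> \<Longrightarrow> \<exists>z\<in>U. deriv a z * b z - a z * deriv b z \<noteq> 0;
      z \<in> ball 0 R\<rbrakk> \<Longrightarrow> (cmod (a z) + cmod (b z)) ^ 3 * (R\<^sup>2 - (cmod z)\<^sup>2)\<^sup>2 \<le> K * R\<^sup>2"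
    using wronskian_schwarz[OF inj] by blast
  have bound: "(cmod (thf E \<phi> z) + cmod (omf E \<phi> z)) ^ 3 * (R\<^sup>2 - (cmod z)\<^sup>2)\<^sup>2 \<le> K * R\<^sup>2"
    if S: "normalized_sol \<alpha> \<phi> (ball 0 R)" and z: "z \<in> ball 0 R" for \<phi> R z
  proof -
    have i: "imm E \<phi> (ball 0 R)" "holm E \<phi> (ball 0 R)" using S by (auto simp: normalized_sol_def imm_def)
    show ?thesis
    proof (rule K(2)[OF holomorphic_thf_omf[OF i(2)] _ _ _ z])
      fix w :: complex assume w: "w \<in> ball 0 R"
      show "thf E \<phi> w \<noteq> 0 \<or> omf E \<phi> w \<noteq> 0" using i(1) w by (simp add: imm_def)
      show "(deriv (thf E \<phi>) w * omf E \<phi> w - thf E \<phi> w * deriv (omf E \<phi>) w)\<^sup>2 = (\<Prod>j\<in>{1..7}. thf E \<phi> w - \<alpha> j * omf E \<phi> w)"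
        using S w by (simp add: normalized_sol_def wronskian_along_def forms_prod_def)
    next
      fix U :: "complex set" assume U: "open U" "U \<noteq> {}" "U \<subseteq> ball 0 R"
      show "\<exists>z\<in>U. deriv (thf E \<phi>) z * omf E \<phi> z - thf E \<phi> z * deriv (omf E \<phi>) z \<noteq> 0"
        using nondegenerateD[OF nd imm_subset[OF i(1) U(1,3)] U(2)] by (simp add: wronskian_along_def)
    qed
  qed
  interpret flow E "normalized_sol \<alpha>"
  proof unfold_locales
    show "imm E \<phi> U" if "normalized_sol \<alpha> \<phi> U" for \<phi> U using that by (simp add: normalized_sol_def)
    show "normalized_sol \<alpha> \<phi> V" if "normalized_sol \<alpha> \<phi> U" "open V" "V \<subseteq> U" for \<phi> U V
      using that imm_subset by (auto simp: normalized_sol_def)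
    show "normalized_sol \<alpha> \<phi> U" if "open U" "\<And>z. z \<in> U \<Longrightarrow> \<exists>V. z \<in> V \<and> open V \<and> normalized_sol \<alpha> \<phi> V" for \<phi> U
      using that imm_glue[OF that(1), of E \<phi>] unfolding normalized_sol_def by blast
    show "normalized_sol \<alpha> \<psi> U" if "normalized_sol \<alpha> \<phi> U" "\<And>z. z \<in> U \<Longrightarrow> \<phi> z = \<psi> z" for \<phi> \<psi> U
    proof -
      have o: "open U" using that by (simp add: normalized_sol_def imm_def holm_def)
      show ?thesis
        using that(1) imm_cong[OF _ that(2)] thf_omf_cong[OF o _ that(2), where E = E] wronskian_along_cong[OF o _ that(2), where E = E]
        by (simp add: normalized_sol_def forms_prod_def)
    qed
    show "normalized_sol \<alpha> (\<lambda>z. \<phi> (z + c)) (ball (a - c) r)" if "normalized_sol \<alpha> \<phi> (ball a r)" for \<phi> a r c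
    proof -
      have i: "imm E \<phi> (ball a r)" using that by (simp add: normalized_sol_def)
      have b: "z + c \<in> ball a r" if "z \<in> ball (a - c) r" for z
        using that by (simp add: dist_norm diff_diff_eq add.commute)
      show ?thesis
        unfolding normalized_sol_def
        using imm_shift(1)[OF i, of c] imm_shift(2-4)[OF i, of _ c] that b by (auto simp: normalized_sol_def forms_prod_def simp del: mem_ball)
    qed
    show "deriv T z = 1" if "normalized_sol \<alpha> \<phi> (ball \<zeta> \<delta>)" "normalized_sol \<alpha> \<psi> V" "T holomorphic_on ball \<zeta> \<delta>" "T ` ball \<zeta> \<delta> \<subseteq> V"
        "\<And>z. z \<in> ball \<zeta> \<delta> \<Longrightarrow> \<phi> z = \<psi> (T z)" "z \<in> ball \<zeta> \<delta>" for \<phi> \<zeta> \<delta> \<psi> V T z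
      using normalized_sol_reparam[OF nd that(1) _ _ _ that(3,4,5,6), of "\<lambda>_. 1"] that(2) by (simp add: normalized_sol_def)
    \<comment> \<open>Two things have to be shown: the radius has a limit \<open>y\<close>, by the
      Schwarz bound and completeness, and the field does not vanish at \<open>y\<close>, so that a
      flow box exists there.\<close>
    show "\<exists>y \<sigma> d. ((\<lambda>t. \<phi> (t *\<^sub>R e)) \<longlongrightarrow> y) (at_left R) \<and> 0 < d \<and> normalized_sol \<alpha> \<sigma> (ball 0 d) \<and> \<sigma> 0 = y"
      if R: "0 < R" and S: "normalized_sol \<alpha> \<phi> (ball 0 R)" and e: "cmod e = 1" for R \<phi> e
    proof -
      have i: "imm E \<phi> (ball 0 R)" "holm E \<phi> (ball 0 R)" using S by (auto simp: normalized_sol_def imm_def)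
      have "\<exists>y. ((\<lambda>t. \<phi> (t *\<^sub>R e)) \<longlongrightarrow> y) (at_left R)"
      proof (rule complete[OF R i(1) e])
        fix t assume t: "0 \<le> t" "t < R"
        let ?N = "(cmod (thf E \<phi> (t *\<^sub>R e)) + cmod (omf E \<phi> (t *\<^sub>R e))) ^ 3"
        have "?N * (R\<^sup>2 - t\<^sup>2)\<^sup>2 \<le> K * R\<^sup>2" using bound[OF S, of "t *\<^sub>R e"] t e by simp
        \<comment> \<open>The factorization R^2 - t^2 = (R + t) (R - t) turns the Schwarz bound K
          R^2 / (R^2 - t^2)^2 into K / (R - t)^2, the form that \<open>complete\<close> asks
          for.\<close>
        moreover have "R * (R - t) \<le> R\<^sup>2 - t\<^sup>2"
          using t mult_nonneg_nonneg[of t "R - t"] by (simp add: power2_eq_square algebra_simps)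
        then have "(R * (R - t))\<^sup>2 \<le> (R\<^sup>2 - t\<^sup>2)\<^sup>2" using R t by (intro power_mono) auto
        then have "?N * (R * (R - t))\<^sup>2 \<le> ?N * (R\<^sup>2 - t\<^sup>2)\<^sup>2" by (rule mult_left_mono) simp
        ultimately have "R\<^sup>2 * (?N * (R - t)\<^sup>2) \<le> R\<^sup>2 * K" by (simp add: power_mult_distrib mult_ac)
        then show "?N * (R - t)\<^sup>2 \<le> K" using R by simp
      qed
      then obtain y where y: "((\<lambda>t. \<phi> (t *\<^sub>R e)) \<longlongrightarrow> y) (at_left R)" by blast
      obtain \<sigma> d where s: "chart_at \<sigma> d" "\<sigma> 0 = y" using chart_at_ex .
      have si: "imm E \<sigma> (ball 0 d)" "0 < d" "inj_on \<sigma> (ball 0 d)" "\<And>V. \<lbrakk>open V; V \<subseteq> ball 0 d\<rbrakk> \<Longrightarrow> open (\<sigma> ` V)"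
        using s by (auto simp: chart_at_def)
      obtain r h where r: "0 < r" "r \<le> d" "h holomorphic_on ball 0 r" "\<forall>z\<in>ball 0 r. (wronskian_along E \<sigma> z)\<^sup>2 = h z * forms_prod \<alpha> \<sigma> z"
        using factor[OF si(1,2)] by blast
      have sub: "ball 0 r \<subseteq> ball (0::complex) d" using r by auto
      have sr: "imm E \<sigma> (ball 0 r)" by (rule imm_subset[OF si(1) open_ball sub])
      have inj: "inj_on \<sigma> (ball 0 r)" using inj_on_subset[OF si(3) sub] .
      have z0: "0 \<in> ball (0::complex) r" using r by simp
      \<comment> \<open>In the coordinate \<sigma> the end of the radius is a solution
        \<open>w\<close> of w' = h(w) e that tends to 0. If h(0) = 0, then \<open>w\<close> never
        takes the value 0, as h(w) is the nonzero derivative of a reparametrization, and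
        \<open>holomorphic_ode_zero_unreachable\<close> applies.\<close>
      have "h 0 \<noteq> 0"
      proof
        assume h0: "h 0 = 0"
        define w where "w t = inv_into (ball 0 r) \<sigma> (\<phi> (t *\<^sub>R e))" for t
        have evV: "\<forall>\<^sub>F t in at_left R. \<phi> (t *\<^sub>R e) \<in> \<sigma> ` ball 0 \<epsilon>" if "0 < \<epsilon>" "\<epsilon> \<le> r" for \<epsilon>
        proof (rule topological_tendstoD[OF y])
          show "open (\<sigma> ` ball 0 \<epsilon>)" by (rule si(4)) (use that r in auto)
          show "y \<in> \<sigma> ` ball 0 \<epsilon>" using s(2) that by (auto intro!: image_eqI[of _ _ 0])
        qed
        have "\<forall>\<^sub>F t in at_left R. \<phi> (t *\<^sub>R e) \<in> \<sigma> ` ball 0 r" using evV r by simp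
        then obtain t0' where t0': "t0' < R" "\<And>t. \<lbrakk>t0' < t; t < R\<rbrakk> \<Longrightarrow> \<phi> (t *\<^sub>R e) \<in> \<sigma> ` ball 0 r"
          using eventually_at_left[OF R] by auto
        define t0 where "t0 = max 0 t0'"
        have t0: "t0 < R" using t0' R by (simp add: t0_def)
        have wb: "w t \<in> ball 0 r" "\<sigma> (w t) = \<phi> (t *\<^sub>R e)" if "t0 < t" "t < R" for t
        proof -
          have "\<phi> (t *\<^sub>R e) \<in> \<sigma> ` ball 0 r" using t0'(2)[of t] that by (simp add: t0_def)
          then show "w t \<in> ball 0 r" "\<sigma> (w t) = \<phi> (t *\<^sub>R e)"
            unfolding w_def by (rule inv_into_into, rule f_inv_into_f)
        qed
        have wder: "(w has_vector_derivative h (w t) * e) (at t)" and wnz: "h (w t) \<noteq> 0" if t: "t0 < t" "t < R" for t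
        proof -
          have te: "t *\<^sub>R e \<in> ball 0 R" using t e by (simp add: t0_def)
          obtain \<delta> T where T: "0 < \<delta>" "ball (t *\<^sub>R e) \<delta> \<subseteq> ball 0 R" "T holomorphic_on ball (t *\<^sub>R e) \<delta>" "T (t *\<^sub>R e) = w t"
            "T ` ball (t *\<^sub>R e) \<delta> \<subseteq> ball 0 r" "\<And>z. z \<in> ball (t *\<^sub>R e) \<delta> \<Longrightarrow> \<phi> z = \<sigma> (T z)"
            by (rule holm_reparametrization[OF i(2) te sr wb(1)[OF t] wb(2)[OF t, symmetric]]) (erule that, (assumption | blast)+)
          have tb: "t *\<^sub>R e \<in> ball (t *\<^sub>R e) \<delta>" using T(1) by simp
          have SB: "normalized_sol \<alpha> \<phi> (ball (t *\<^sub>R e) \<delta>)" using S imm_subset[OF i(1) open_ball T(2)] T(2) by (auto simp: normalized_sol_def)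
          have dT: "deriv T (t *\<^sub>R e) = h (w t)"
            using normalized_sol_reparam[OF nd SB sr r(3) _ T(3) T(5) T(6) tb] r(4) T(4) by simp
          have "deriv T (t *\<^sub>R e) \<noteq> 0"
            using imm_reparam_deriv_nz[OF imm_subset[OF i(1) open_ball T(2)] _ T(3) open_ball T(5) T(6) tb] sr by (simp add: imm_def)
          then show "h (w t) \<noteq> 0" using dT by simp
          have "(T has_field_derivative h (w t)) (at (0 + of_real t * e))"
            using holomorphic_derivI[OF T(3) open_ball tb] dT by (simp add: scaleR_conv_of_real)
          then have v: "((\<lambda>t. T (0 + of_real t * e)) has_vector_derivative h (w t) * e) (at t)"
            by (rule has_vector_derivative_along_line)
          show "(w has_vector_derivative h (w t) * e) (at t)"
          proof (rule has_vector_derivative_transform_within_open[OF v, of "ball t \<delta>"])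
            fix t' assume t': "t' \<in> ball t \<delta>"
            have "dist (t *\<^sub>R e) (t' *\<^sub>R e) = \<bar>t - t'\<bar> * cmod e" by (simp add: dist_norm flip: scaleR_diff_left)
            then have b: "t' *\<^sub>R e \<in> ball (t *\<^sub>R e) \<delta>" using t' e by (simp add: dist_real_def)
            have "w t' = T (t' *\<^sub>R e)"
              unfolding w_def T(6)[OF b] by (rule inv_into_f_f[OF inj]) (use T(5) b in blast)
            then show "T (0 + of_real t' * e) = w t'" by (simp add: scaleR_conv_of_real)
          qed (use T(1) in auto)
        qed
        have wlim: "(w \<longlongrightarrow> 0) (at_left R)"
        proof (rule tendstoI)
          fix \<epsilon> :: real assume \<epsilon>: "0 < \<epsilon>"
          have "\<forall>\<^sub>F t in at_left R. \<phi> (t *\<^sub>R e) \<in> \<sigma> ` ball 0 (min \<epsilon> r)" using evV \<epsilon> r by simp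
          then show "\<forall>\<^sub>F t in at_left R. dist (w t) 0 < \<epsilon>"
          proof (rule eventually_mono)
            fix t assume "\<phi> (t *\<^sub>R e) \<in> \<sigma> ` ball 0 (min \<epsilon> r)"
            then obtain v where v: "v \<in> ball 0 (min \<epsilon> r)" "\<phi> (t *\<^sub>R e) = \<sigma> v" by blast
            then have "w t = v" unfolding w_def using inv_into_f_f[OF inj, of v] by simp
            then show "dist (w t) 0 < \<epsilon>" using v(1) by simp
          qed
        qed
        have w0: "w t \<noteq> 0" if "t0 < t" "t < R" for t
        proof
          assume "w t = 0"
          then show False using wnz[OF that] h0 by simp
        qed
        show False
          by (rule holomorphic_ode_zero_unreachable[OF r(3) open_ball z0 h0 t0 wder wlim w0 e])
      qed
      then have "\<exists>\<tau> d. 0 < d \<and> normalized_sol \<alpha> \<tau> (ball 0 d) \<and> \<tau> 0 = \<sigma> 0"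
        using normalized_sol_local_solution[OF sr open_ball subset_refl z0 r(3)] r(4) by blast
      then show ?thesis using y s(2) by blast
    qed
  qed
  \<comment> \<open>The flow starts at a point with nonzero Wronskian, where \<open>h\<close> cannot
    vanish.\<close>
  obtain \<sigma> d where s: "chart_at \<sigma> d" using chart_at_ex by blast
  have si: "imm E \<sigma> (ball 0 d)" "0 < d" using s by (auto simp: chart_at_def)
  then obtain \<xi> where xi: "\<xi> \<in> ball 0 d" "wronskian_along E \<sigma> \<xi> \<noteq> 0" using nondegenerateD[OF nd si(1)] by auto
  obtain r where r: "0 < r" "ball \<xi> r \<subseteq> ball 0 d"
    using open_ball[of "0::complex" d] xi(1) unfolding open_contains_ball by blast
  have sx: "imm E \<sigma> (ball \<xi> r)" by (rule imm_subset[OF si(1) open_ball r(2)])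
  obtain t h where t: "0 < t" "t \<le> r" "h holomorphic_on ball \<xi> t" "\<forall>z\<in>ball \<xi> t. (wronskian_along E \<sigma> z)\<^sup>2 = h z * forms_prod \<alpha> \<sigma> z"
    using factor[OF sx r(1)] by blast
  have xt: "\<xi> \<in> ball \<xi> t" using t by simp
  have "h \<xi> \<noteq> 0" using t(4) xt xi(2) by (metis mult_zero_left zero_eq_power2)
  then obtain \<tau> \<delta> where "0 < \<delta>" "normalized_sol \<alpha> \<tau> (ball 0 \<delta>)"
    using normalized_sol_local_solution[OF sx open_ball subset_ball[OF t(2)] xt t(3)] t(4) by blast
  then obtain \<phi> where ph: "normalized_sol \<alpha> \<phi> UNIV" using Sol_global by blast
  define N where "N = (cmod (thf E \<phi> 0) + cmod (omf E \<phi> 0)) ^ 3"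
  have "0 < cmod (thf E \<phi> 0) + cmod (omf E \<phi> 0)"
  proof -
    have "thf E \<phi> 0 \<noteq> 0 \<or> omf E \<phi> 0 \<noteq> 0" using ph by (simp add: normalized_sol_def imm_def)
    then show ?thesis by (auto intro: add_pos_nonneg add_nonneg_pos)
  qed
  then have N: "0 < N" by (simp add: N_def)
  \<comment> \<open>The bound at the origin amounts to N R^2 \<le> K, whereas this radius gives N
    R^2 = K + N.\<close>
  define R where "R = sqrt (K / N + 1)"
  have R: "0 < R" "R\<^sup>2 = K / N + 1" using K(1) N by (auto simp: R_def add_pos_pos)
  have "normalized_sol \<alpha> \<phi> (ball 0 R)" by (rule Sol_mono[OF ph]) auto
  then have "N * (R\<^sup>2)\<^sup>2 \<le> K * R\<^sup>2" using bound[of \<phi> R 0] R(1) by (simp add: N_def)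
  then have "R\<^sup>2 * (N * R\<^sup>2) \<le> R\<^sup>2 * K" by (simp add: power2_eq_square mult_ac)
  then have "N * R\<^sup>2 \<le> K" using R(1) by simp
  then show False using N unfolding R(2) by (simp add: algebra_simps)
qed

end

section \<open>Fronts with constant forms\<close>

definition mk2 :: "complex \<Rightarrow> complex \<Rightarrow> complex \<Rightarrow> complex \<Rightarrow> mat2" where
  "mk2 a b c d = (\<chi> i j. if i = 1 then (if j = 1 then a else b) else (if j = 1 then c else d))"

lemma mk2_nth [simp]: "mk2 a b c d $ 1 $ 1 = a" "mk2 a b c d $ 1 $ 2 = b" "mk2 a b c d $ 2 $ 1 = c" "mk2 a b c d $ 2 $ 2 = d"
  by (simp_all add: mk2_def)

lemma mat2_eq_iff: "(A::mat2) = B \<longleftrightarrow> A $ 1 $ 1 = B $ 1 $ 1 \<and> A $ 1 $ 2 = B $ 1 $ 2 \<and> A $ 2 $ 1 = B $ 2 $ 1 \<and> A $ 2 $ 2 = B $ 2 $ 2"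
  by (auto simp: vec_eq_iff forall_2)

lemma mat2_mult_nth: "((A::mat2) ** B) $ i $ j = A $ i $ 1 * B $ 1 $ j + A $ i $ 2 * B $ 2 $ j"
  by (simp add: matrix_matrix_mult_def sum_2)

lemma adjoint_nth [simp]: "adjoint_mat A $ i $ j = cnj (A $ j $ i)"
  by (simp add: adjoint_mat_def)

lemma adjoint_mult: "adjoint_mat (A ** B) = adjoint_mat B ** adjoint_mat A"
  by (simp add: mat2_eq_iff mat2_mult_nth mult.commute)

lemma det_adjoint: "det (adjoint_mat A) = cnj (det A)"
  by (simp add: det_2 mult.commute)

lemma trace_mat2: "trace (A::mat2) = A $ 1 $ 1 + A $ 2 $ 2"
  by (simp add: trace_def sum_2)

lemma L4_iff: "X \<in> L4 \<longleftrightarrow> Im (X $ 1 $ 1) = 0 \<and> Im (X $ 2 $ 2) = 0 \<and> X $ 2 $ 1 = cnj (X $ 1 $ 2)"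
  by (auto simp: L4_def mat2_eq_iff complex_eq_iff)

text \<open>The determinant condition makes the product of the diagonal entries at least 1, so they
  have the same sign, and the trace decides that it is positive.\<close>

lemma H3_iff: "X \<in> H3 \<longleftrightarrow> Im (X $ 1 $ 1) = 0 \<and> Im (X $ 2 $ 2) = 0 \<and> X $ 2 $ 1 = cnj (X $ 1 $ 2) \<and>
   Re (X $ 1 $ 1) * Re (X $ 2 $ 2) = 1 + (cmod (X $ 1 $ 2))\<^sup>2 \<and> 0 < Re (X $ 1 $ 1) \<and> 0 < Re (X $ 2 $ 2)"
proof (cases "X \<in> L4")
  case True
  then have L: "Im (X $ 1 $ 1) = 0" "Im (X $ 2 $ 2) = 0" "X $ 2 $ 1 = cnj (X $ 1 $ 2)" by (auto simp: L4_iff)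
  have d: "det X = of_real (Re (X $ 1 $ 1) * Re (X $ 2 $ 2) - (cmod (X $ 1 $ 2))\<^sup>2)"
    unfolding det_2 L(3) cmod_power2 using L(1,2) by (simp add: complex_eq_iff power2_eq_square)
  have "det X = 1 \<longleftrightarrow> Re (X $ 1 $ 1) * Re (X $ 2 $ 2) - (cmod (X $ 1 $ 2))\<^sup>2 = 1"
    unfolding d by (metis of_real_eq_1_iff)
  then have d1: "det X = 1 \<longleftrightarrow> Re (X $ 1 $ 1) * Re (X $ 2 $ 2) = 1 + (cmod (X $ 1 $ 2))\<^sup>2" by auto
  have pos: "0 < x \<and> 0 < y" if "x * y = 1 + m\<^sup>2" "0 < x + y" for x y m :: real
  proof -
    have "0 < 1 + m\<^sup>2" by (simp add: add_pos_nonneg)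
    then have "0 < x * y" using that(1) by simp
    then show ?thesis using that(2) by (auto simp: zero_less_mult_iff)
  qed
  show ?thesis
    using L True pos[of "Re (X $ 1 $ 1)" "Re (X $ 2 $ 2)" "cmod (X $ 1 $ 2)"]
    by (auto simp: H3_def d1 trace_mat2)
next
  case False
  then show ?thesis by (auto simp: H3_def L4_iff)
qed

text \<open>A Cholesky factorization: the factor is lower triangular with diagonal s and 1 / s,
  where s^2 is the upper left entry of \<open>X\<close>.\<close>

lemma H3_factor:
  assumes "X \<in> H3"
  obtains a where "det a = 1" "X = a ** adjoint_mat a"
proof -
  define s where "s = sqrt (Re (X $ 1 $ 1))"
  have X: "Im (X $ 1 $ 1) = 0" "Im (X $ 2 $ 2) = 0" "X $ 2 $ 1 = cnj (X $ 1 $ 2)" "0 < Re (X $ 1 $ 1)"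
    "Re (X $ 1 $ 1) * Re (X $ 2 $ 2) = 1 + (cmod (X $ 1 $ 2))\<^sup>2" using assms by (auto simp: H3_iff)
  have s: "0 < s" "s * s = Re (X $ 1 $ 1)" using X(4) by (auto simp: s_def)
  have s11: "X $ 1 $ 1 = of_real s * of_real s" using X(1) s(2) by (simp add: complex_eq_iff)
  define a where "a = mk2 (of_real s) 0 (X $ 2 $ 1 / of_real s) (1 / of_real s)"
  have "Re (X $ 2 $ 2) = (1 + (cmod (X $ 1 $ 2))\<^sup>2) / (s * s)" using X(4,5) s(2) by (simp add: field_simps)
  then have x22: "X $ 2 $ 2 = (1 + X $ 1 $ 2 * cnj (X $ 1 $ 2)) / (of_real s * of_real s)"
  proof -
    have n: "(of_real (cmod w))\<^sup>2 = w * cnj w" for w by (metis complex_norm_square of_real_power)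
    have "X $ 2 $ 2 = of_real (Re (X $ 2 $ 2))" using X(2) by (simp add: complex_eq_iff)
    also have "\<dots> = of_real ((1 + (cmod (X $ 1 $ 2))\<^sup>2) / (s * s))"
      using \<open>Re (X $ 2 $ 2) = _\<close> by simp
    finally show ?thesis by (simp add: n)
  qed
  show thesis
  proof (rule that[of a])
    show "det a = 1" using s by (simp add: a_def det_2)
    show "X = a ** adjoint_mat a"
      using s by (simp add: mat2_eq_iff mat2_mult_nth a_def s11 x22 X(3) add_divide_distrib mult.commute)
  qed
qed

lemma factor_H3:
  assumes "det a = 1"
  shows "a ** adjoint_mat a \<in> H3"
proof -
  let ?X = "a ** adjoint_mat a"
  have "adjoint_mat ?X = ?X" by (simp add: mat2_eq_iff mat2_mult_nth mult.commute)
  moreover have "det ?X = 1" using assms by (simp add: det_mul det_adjoint)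
  moreover have "Re (trace ?X) = (cmod (a $ 1 $ 1))\<^sup>2 + (cmod (a $ 1 $ 2))\<^sup>2 + (cmod (a $ 2 $ 1))\<^sup>2 + (cmod (a $ 2 $ 2))\<^sup>2"
    unfolding cmod_power2 by (simp add: trace_mat2 mat2_mult_nth power2_eq_square)
  moreover have "a $ 1 $ 1 \<noteq> 0 \<or> a $ 1 $ 2 \<noteq> 0" using assms by (auto simp: det_2)
  then have "0 < (cmod (a $ 1 $ 1))\<^sup>2 + (cmod (a $ 1 $ 2))\<^sup>2" by (subst sum_power2_gt_zero_iff) simp
  then have "0 < (cmod (a $ 1 $ 1))\<^sup>2 + (cmod (a $ 1 $ 2))\<^sup>2 + (cmod (a $ 2 $ 1))\<^sup>2 + (cmod (a $ 2 $ 2))\<^sup>2"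
    by (rule add_pos_nonneg[OF add_pos_nonneg]) auto
  ultimately show ?thesis by (simp add: H3_def L4_def)
qed

text \<open>\<open>matrix_inv\<close> is defined by choice; its properties follow once the adjugate
  is seen to be an inverse.\<close>

lemma det1_inverse:
  assumes "det (A::mat2) = 1"
  shows "matrix_inv A ** A = mat 1" "A ** matrix_inv A = mat 1" "det (matrix_inv A) = 1"
proof -
  have "\<exists>B. A ** B = mat 1 \<and> B ** A = mat 1"
  proof (rule exI[of _ "mk2 (A $ 2 $ 2) (- A $ 1 $ 2) (- A $ 2 $ 1) (A $ 1 $ 1)"])
    show "A ** mk2 (A $ 2 $ 2) (- A $ 1 $ 2) (- A $ 2 $ 1) (A $ 1 $ 1) = mat 1 \<and>
        mk2 (A $ 2 $ 2) (- A $ 1 $ 2) (- A $ 2 $ 1) (A $ 1 $ 1) ** A = mat 1"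
      using assms by (simp add: mat2_eq_iff mat2_mult_nth mat_def det_2 algebra_simps)
  qed
  then have "A ** matrix_inv A = mat 1 \<and> matrix_inv A ** A = mat 1"
    unfolding matrix_inv_def by (rule someI_ex)
  then show 1: "matrix_inv A ** A = mat 1" "A ** matrix_inv A = mat 1" by auto
  have "det (matrix_inv A) * det A = 1" using 1(1) det_mul[of "matrix_inv A" A] by simp
  then show "det (matrix_inv A) = 1" using assms by simp
qed

lemma congruence_H3:
  assumes "det B = 1" "X \<in> H3"
  shows "B ** X ** adjoint_mat B \<in> H3"
proof -
  obtain a where a: "det a = 1" "X = a ** adjoint_mat a" using H3_factor[OF assms(2)] .
  have "B ** X ** adjoint_mat B = (B ** a) ** adjoint_mat (B ** a)"
    by (simp add: a(2) adjoint_mult matrix_mul_assoc)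
  then show ?thesis using factor_H3[of "B ** a"] a(1) assms(1) by (simp add: det_mul)
qed

text \<open>The action of SL(2,C) on Hermitian matrices is additive and preserves determinants.
  \<open>lorentz\<close> is the polarization of the determinant, so it is preserved as well, and
  with it the distance.\<close>

lemma congruence_isometry:
  assumes B: "det B = 1"
  shows "H3_isometry (\<lambda>X. B ** X ** adjoint_mat B)"
proof -
  let ?\<Phi> = "\<lambda>B X. B ** X ** adjoint_mat B"
  note inv = det1_inverse[OF B]
  have cancel: "?\<Phi> C (?\<Phi> D X) = X" if "C ** D = mat 1" for C D X
  proof -
    have "?\<Phi> C (?\<Phi> D X) = (C ** D) ** X ** adjoint_mat (C ** D)"
      by (simp add: adjoint_mult matrix_mul_assoc)
    moreover have "adjoint_mat (mat 1) = mat 1" by (simp add: mat2_eq_iff mat_def)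
    ultimately show ?thesis using that by simp
  qed
  have det: "det (?\<Phi> B X) = det X" for X using B by (simp add: det_mul det_adjoint)
  have add: "?\<Phi> B (X + Y) = ?\<Phi> B X + ?\<Phi> B Y" for X Y
    by (simp add: mat2_eq_iff mat2_mult_nth algebra_simps)
  have lor: "lorentz (?\<Phi> B X) (?\<Phi> B Y) = lorentz X Y" for X Y
    unfolding lorentz_def add[symmetric] det ..
  have "bij_betw (?\<Phi> B) H3 H3"
    by (rule bij_betw_byWitness[where f' = "?\<Phi> (matrix_inv B)"])
      (use cancel[OF inv(1)] cancel[OF inv(2)] congruence_H3[OF B] congruence_H3[OF inv(3)] in auto)
  then show ?thesis by (simp add: H3_isometry_def hyp_dist_def lor)
qed

lemma lorentz_entries:
  "lorentz X Y = - Re (X $ 1 $ 1 * Y $ 2 $ 2 + Y $ 1 $ 1 * X $ 2 $ 2 - X $ 1 $ 2 * Y $ 2 $ 1 - Y $ 1 $ 2 * X $ 2 $ 1) / 2"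
  by (simp add: lorentz_def det_2 algebra_simps)

text \<open>For the null vector diag(2, 0) the value of \<open>lorentz X V\<close> is minus the real
  part of the lower right entry of \<open>X\<close>.\<close>

lemma horosphere_22: "horosphere {X \<in> H3. X $ 2 $ 2 = 1}"
  unfolding horosphere_def
proof (rule bexI[of _ "mk2 2 0 0 0"], intro conjI)
  show "{X \<in> H3. X $ 2 $ 2 = 1} = {X \<in> H3. lorentz X (mk2 2 0 0 0) = - 1}"
    by (auto simp: lorentz_entries H3_iff complex_eq_iff)
qed (auto simp: det_2 trace_mat2 L4_iff)

lemma horosphere_11: "horosphere {X \<in> H3. X $ 1 $ 1 = 1}"
  unfolding horosphere_def
proof (rule bexI[of _ "mk2 0 0 0 2"], intro conjI)
  show "{X \<in> H3. X $ 1 $ 1 = 1} = {X \<in> H3. lorentz X (mk2 0 0 0 2) = - 1}"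
    by (auto simp: lorentz_entries H3_iff complex_eq_iff)
qed (auto simp: det_2 trace_mat2 L4_iff)

text \<open>The axis consists of the matrices diag(e^t, e^-t). If x and y are the diagonal entries
  of \<open>X\<close>, the hyperbolic cosine of the distance to such a point is (x e^-t + y e^t) /
  2, and the inequality of arithmetic and geometric means gives the minimum sqrt (x y).\<close>

lemma dist_to_axis:
  assumes X: "X \<in> H3"
  shows "(INF Y\<in>range (\<lambda>t. cosh t *\<^sub>R (mat 1 :: mat2) + sinh t *\<^sub>R e3). hyp_dist X Y)
    = arcosh (sqrt (Re (X $ 1 $ 1) * Re (X $ 2 $ 2)))" (is "?I = ?r")
proof -
  let ?x = "Re (X $ 1 $ 1)" and ?y = "Re (X $ 2 $ 2)"
  have p: "0 < ?x" "0 < ?y" "?x * ?y = 1 + (cmod (X $ 1 $ 2))\<^sup>2" "Im (X $ 1 $ 1) = 0" "Im (X $ 2 $ 2) = 0"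
    using X by (auto simp: H3_iff)
  have ge1: "1 \<le> sqrt (?x * ?y)" using p by simp
  define D where "D t = arcosh ((?x * exp (- t) + ?y * exp t) / 2)" for t
  have half: "(u * (4 * a) + v * (4 * b)) / 8 = (u * a + v * b) / 2" for a b u v :: real by simp
  have dist: "hyp_dist X (cosh t *\<^sub>R (mat 1 :: mat2) + sinh t *\<^sub>R e3) = D t" for t
    unfolding hyp_dist_def lorentz_entries D_def
    by (simp add: mat_def e3_def cosh_def sinh_def field_simps half)
  have lower: "sqrt (?x * ?y) \<le> (?x * exp (- t) + ?y * exp t) / 2" for t
  proof -
    have "sqrt (?x * ?y) = sqrt ((?x * exp (- t)) * (?y * exp t))" by (simp add: exp_minus field_simps)
    also have "\<dots> \<le> (?x * exp (- t) + ?y * exp t) / 2" using p by (intro arith_geo_mean_sqrt) auto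
    finally show ?thesis .
  qed
  \<comment> \<open>Here x e^-t = y e^t, the case of equality between the two means.\<close>
  define t0 where "t0 = ln (?x / ?y) / 2"
  have "(?x * exp (- t0) + ?y * exp t0) / 2 = sqrt (?x * ?y)"
  proof -
    have "exp t0 = sqrt (?x / ?y)" using p by (simp add: t0_def flip: ln_sqrt)
    then have e: "exp t0 = sqrt ?x / sqrt ?y" "exp (- t0) = sqrt ?y / sqrt ?x"
      by (simp_all add: real_sqrt_divide exp_minus)
    have "u\<^sup>2 * (v / u) + v\<^sup>2 * (u / v) = 2 * (u * v)" if "u > 0" "v > 0" for u v :: real
      using that by (simp add: power2_eq_square)
    from this[of "sqrt ?x" "sqrt ?y"] show ?thesis using p(1,2) unfolding e by (simp add: real_sqrt_mult)
  qed
  then have D0: "D t0 = ?r" by (simp add: D_def)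
  have Dge: "?r \<le> D t" for t
  proof (cases "sqrt (?x * ?y) = (?x * exp (- t) + ?y * exp t) / 2")
    case False
    then have "arcosh (sqrt (?x * ?y)) < arcosh ((?x * exp (- t) + ?y * exp t) / 2)"
      using lower[of t] by (intro arcosh_real_strict_mono[OF ge1]) linarith
    then show ?thesis by (simp add: D_def)
  next
    case True
    then have "D t = ?r" by (simp only: D_def)
    then show ?thesis by simp
  qed
  have "(INF t. D t) = ?r"
  proof (rule cInf_eq_minimum)
    show "?r \<in> range D" using D0[symmetric] by (rule range_eqI)
  qed (use Dge in auto)
  then show ?thesis by (simp add: image_image dist)
qed

lemma e3_entries: "e3 $ 1 $ 1 = 1" "e3 $ 1 $ 2 = 0" "e3 $ 2 $ 1 = 0" "e3 $ 2 $ 2 = - 1"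
  by (simp_all add: e3_def)

text \<open>By \<open>dist_to_axis\<close> the product of the diagonal entries is the square of the
  hyperbolic cosine of the distance to the axis. The value k = 1 gives the degenerate cylinder, the
  axis itself.\<close>

lemma cylinder_about_axis:
  assumes k: "1 \<le> k"
  shows "hyperbolic_cylinder {X \<in> H3. Re (X $ 1 $ 1) * Re (X $ 2 $ 2) = k}"
proof -
  let ?g = "range (\<lambda>t. cosh t *\<^sub>R (mat 1 :: mat2) + sinh t *\<^sub>R e3)"
  have m: "(mat 1 :: mat2) \<in> H3" by (simp add: H3_iff mat_def)
  have e: "e3 \<in> tangent_H3 (mat 1)" "lorentz e3 e3 = 1"
    by (simp_all add: tangent_H3_def L4_iff lorentz_entries e3_entries mat_def)
  have "H3_geodesic ?g" unfolding H3_geodesic_def using m e by blast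
  moreover have "0 \<le> arcosh (sqrt k)" using k by simp
  moreover have "arcosh (sqrt (Re (X $ 1 $ 1) * Re (X $ 2 $ 2))) = arcosh (sqrt k) \<longleftrightarrow> Re (X $ 1 $ 1) * Re (X $ 2 $ 2) = k"
    if "X \<in> H3" for X
  proof
    assume eq: "arcosh (sqrt (Re (X $ 1 $ 1) * Re (X $ 2 $ 2))) = arcosh (sqrt k)"
    have "1 \<le> sqrt (Re (X $ 1 $ 1) * Re (X $ 2 $ 2))" using that by (simp add: H3_iff)
    then have "sqrt (Re (X $ 1 $ 1) * Re (X $ 2 $ 2)) = sqrt k"
      using arg_cong[OF eq, of cosh] k by (simp add: cosh_arcosh_real)
    then show "Re (X $ 1 $ 1) * Re (X $ 2 $ 2) = k" by (simp only: real_sqrt_eq_iff)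
  qed simp
  then have "{X \<in> H3. Re (X $ 1 $ 1) * Re (X $ 2 $ 2) = k} = {X \<in> H3. (INF Y\<in>?g. hyp_dist X Y) = arcosh (sqrt k)}"
    using dist_to_axis by auto
  ultimately show ?thesis unfolding hyperbolic_cylinder_def by blast
qed

text \<open>diag(e^s, e^-s) scales the diagonal entries by e^(2 Re s) and its inverse and rotates
  the upper right entry by the angle 2 Im s. Conversely Re s adjusts the first diagonal entry, the
  product then fixes the second one and the modulus of the off-diagonal entry, and Im s adjusts its
  argument.\<close>

lemma diagonal_orbit:
  assumes Y: "Y \<in> H3"
  shows "range (\<lambda>s. mk2 (exp s) 0 0 (exp (- s)) ** Y ** adjoint_mat (mk2 (exp s) 0 0 (exp (- s))))
     = {X \<in> H3. Re (X $ 1 $ 1) * Re (X $ 2 $ 2) = Re (Y $ 1 $ 1) * Re (Y $ 2 $ 2)}" (is "range ?F = ?S")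
proof (intro equalityI subsetI)
  have Yp: "Im (Y $ 1 $ 1) = 0" "Im (Y $ 2 $ 2) = 0" "Y $ 2 $ 1 = cnj (Y $ 1 $ 2)" "0 < Re (Y $ 1 $ 1)" "0 < Re (Y $ 2 $ 2)"
    "Re (Y $ 1 $ 1) * Re (Y $ 2 $ 2) = 1 + (cmod (Y $ 1 $ 2))\<^sup>2"
    using Y by (auto simp: H3_iff)
  have Y1: "Y $ 1 $ 1 = of_real (Re (Y $ 1 $ 1))" "Y $ 2 $ 2 = of_real (Re (Y $ 2 $ 2))"
    using Yp by (simp_all add: complex_eq_iff)
  have ec: "exp s * cnj (exp s) = of_real (exp (2 * Re s))" for s :: complex
  proof -
    have "exp s * cnj (exp s) = exp (of_real (2 * Re s))"
      by (simp add: exp_cnj complex_add_cnj flip: exp_add)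
    then show ?thesis by (simp only: exp_of_real)
  qed
  have F: "?F s $ 1 $ 1 = of_real (exp (2 * Re s)) * Y $ 1 $ 1" "?F s $ 1 $ 2 = exp (s - cnj s) * Y $ 1 $ 2"
    "?F s $ 2 $ 1 = cnj (exp (s - cnj s)) * Y $ 2 $ 1"
    "?F s $ 2 $ 2 = of_real (exp (- (2 * Re s))) * Y $ 2 $ 2" for s
    using ec[of s] ec[of "- s"]
    by (simp_all add: mat2_mult_nth exp_cnj exp_diff exp_minus field_simps)
  {
    fix X assume "X \<in> range ?F"
    then obtain s where s: "X = ?F s" by blast
    have "det (mk2 (exp s) 0 0 (exp (- s))) = 1" by (simp add: det_2 exp_minus)
    then have "X \<in> H3" unfolding s by (rule congruence_H3[OF _ Y])
    moreover have "Re (X $ 1 $ 1) * Re (X $ 2 $ 2) = Re (Y $ 1 $ 1) * Re (Y $ 2 $ 2)"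
      unfolding s F using Yp(1,2) by (simp add: exp_minus power2_eq_square)
    ultimately show "X \<in> ?S" by simp
  next
    fix X assume X: "X \<in> ?S"
    then have Xp: "Im (X $ 1 $ 1) = 0" "Im (X $ 2 $ 2) = 0" "X $ 2 $ 1 = cnj (X $ 1 $ 2)" "0 < Re (X $ 1 $ 1)" "0 < Re (X $ 2 $ 2)"
      "Re (X $ 1 $ 1) * Re (X $ 2 $ 2) = 1 + (cmod (X $ 1 $ 2))\<^sup>2" "Re (X $ 1 $ 1) * Re (X $ 2 $ 2) = Re (Y $ 1 $ 1) * Re (Y $ 2 $ 2)"
      by (auto simp: H3_iff)
    have "(cmod (X $ 1 $ 2))\<^sup>2 = (cmod (Y $ 1 $ 2))\<^sup>2" using Xp(6,7) Yp(6) by linarith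
    then have nn: "cmod (X $ 1 $ 2) = cmod (Y $ 1 $ 2)" by (simp add: power2_eq_iff_nonneg)
    obtain \<theta> where \<theta>: "X $ 1 $ 2 = exp (\<i> * of_real \<theta>) * Y $ 1 $ 2"
    proof (cases "Y $ 1 $ 2 = 0")
      case True
      then show thesis using nn that[of 0] by simp
    next
      case False
      have "X $ 1 $ 2 / Y $ 1 $ 2 = of_real (cmod (X $ 1 $ 2 / Y $ 1 $ 2)) * exp (\<i> * of_real (Arg (X $ 1 $ 2 / Y $ 1 $ 2)))"
        by (cases "X $ 1 $ 2 / Y $ 1 $ 2 = 0") (auto intro: Arg_eq)
      also have "cmod (X $ 1 $ 2 / Y $ 1 $ 2) = 1" using False nn by (simp add: norm_divide)
      finally show thesis using that[of "Arg (X $ 1 $ 2 / Y $ 1 $ 2)"] False by (simp add: field_simps)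
    qed
    define s where "s = of_real (ln (Re (X $ 1 $ 1) / Re (Y $ 1 $ 1)) / 2) + \<i> * of_real (\<theta> / 2)"
    have s1: "exp (2 * Re s) = Re (X $ 1 $ 1) / Re (Y $ 1 $ 1)" using Xp(4) Yp(4) by (simp add: s_def)
    have s2: "s - cnj s = \<i> * of_real \<theta>" by (simp add: s_def complex_eq_iff)
    have x22: "Re (X $ 2 $ 2) = Re (Y $ 1 $ 1) / Re (X $ 1 $ 1) * Re (Y $ 2 $ 2)"
      using Xp(4,7) by (simp add: field_simps)
    have "X = ?F s"
    proof -
      have s1': "exp (- (2 * Re s)) = Re (Y $ 1 $ 1) / Re (X $ 1 $ 1)" by (simp add: exp_minus s1)
      have "X $ 1 $ 1 = ?F s $ 1 $ 1" "X $ 2 $ 2 = ?F s $ 2 $ 2"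
        unfolding F s1 s1' using Xp(1,2,4) Yp(1,2,4) x22 by (simp_all add: complex_eq_iff)
      moreover have "X $ 1 $ 2 = ?F s $ 1 $ 2" unfolding F s2 by (rule \<theta>)
      moreover have "X $ 2 $ 1 = ?F s $ 2 $ 1" unfolding F s2 Xp(3) Yp(3) \<theta> by simp
      ultimately show ?thesis by (simp only: mat2_eq_iff)
    qed
    then show "X \<in> range ?F" by blast
  }
qed

section \<open>The lift with constant forms\<close>

text \<open>\<open>c\<close> and \<open>s\<close> stand for cosh (\<mu> z) and sinh (\<mu> z) /
  \<mu> with \<mu>^2 = a b, or for 1 and z if a b = 0. The inverse of the fundamental matrix,
  applied to the solution, is constant: these are the facts \<open>2\<close> and \<open>3\<close>,
  and \<open>1\<close> says that the determinant is 1.\<close>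

lemma linear_system_solution:
  fixes x y c s :: "complex \<Rightarrow> complex"
  assumes x: "\<And>z. (x has_field_derivative y z * b) (at z)" and y: "\<And>z. (y has_field_derivative x z * a) (at z)"
    and c: "\<And>z. (c has_field_derivative a * b * s z) (at z)" and s: "\<And>z. (s has_field_derivative c z) (at z)"
    and 0: "c 0 = 1" "s 0 = 0"
  shows "x z = x 0 * c z + y 0 * (b * s z)" "y z = x 0 * (a * s z) + y 0 * c z"
proof -
  have const: "F z = F 0" if "\<And>z. (F has_field_derivative 0) (at z)" for F :: "complex \<Rightarrow> complex" and z
    using has_field_derivative_zero_constant[of UNIV F] that by auto
  have 1: "c z * c z - a * b * (s z * s z) = 1" for z
  proof -
    have "((\<lambda>z. c z * c z - a * b * (s z * s z)) has_field_derivative 0) (at z)" for z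
      by (auto intro!: derivative_eq_intros c s simp: algebra_simps)
    from const[of "\<lambda>z. c z * c z - a * b * (s z * s z)" z, OF this] show ?thesis using 0 by simp
  qed
  have 2: "x z * c z - y z * (b * s z) = x 0" for z
  proof -
    have "((\<lambda>z. x z * c z - y z * (b * s z)) has_field_derivative 0) (at z)" for z
      by (auto intro!: derivative_eq_intros x y c s simp: algebra_simps)
    from const[of "\<lambda>z. x z * c z - y z * (b * s z)" z, OF this] show ?thesis using 0 by simp
  qed
  have 3: "y z * c z - x z * (a * s z) = y 0" for z
  proof -
    have "((\<lambda>z. y z * c z - x z * (a * s z)) has_field_derivative 0) (at z)" for z
      by (auto intro!: derivative_eq_intros x y c s simp: algebra_simps)
    from const[of "\<lambda>z. y z * c z - x z * (a * s z)" z, OF this] show ?thesis using 0 by simp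
  qed
  have "x 0 * c z + y 0 * (b * s z) = x z * (c z * c z - a * b * (s z * s z))"
    unfolding 2[of z, symmetric] 3[of z, symmetric] by (simp add: algebra_simps)
  then show "x z = x 0 * c z + y 0 * (b * s z)" using 1 by simp
  have "x 0 * (a * s z) + y 0 * c z = y z * (c z * c z - a * b * (s z * s z))"
    unfolding 2[of z, symmetric] 3[of z, symmetric] by (simp add: algebra_simps)
  then show "y z = x 0 * (a * s z) + y 0 * c z" using 1 by simp
qed

lemma congruence_image:
  assumes A: "det A = 1" and f: "range f = range (\<lambda>z. A ** g z ** adjoint_mat A)"
    and S: "horosphere (range g) \<or> hyperbolic_cylinder (range g)"
  shows "congruent_to_horosphere_or_cylinder f"
proof -
  let ?B = "matrix_inv A"
  note inv = det1_inverse[OF A]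
  have "?B ** (A ** X ** adjoint_mat A) ** adjoint_mat ?B = X" for X
  proof -
    have "?B ** (A ** X ** adjoint_mat A) ** adjoint_mat ?B = (?B ** A) ** X ** adjoint_mat (?B ** A)"
      by (simp add: adjoint_mult matrix_mul_assoc)
    moreover have "adjoint_mat (mat 1) = mat 1" by (simp add: mat2_eq_iff mat_def)
    ultimately show ?thesis using inv by simp
  qed
  then have "(\<lambda>X. ?B ** X ** adjoint_mat ?B) ` range f = range g"
    unfolding f by (simp add: image_image)
  then show ?thesis
    unfolding congruent_to_horosphere_or_cylinder_def
    using congruence_isometry[OF inv(3)] S by (intro exI[of _ "\<lambda>X. ?B ** X ** adjoint_mat ?B"]) simp
qed

theorem congruent_of_constant_forms:
  fixes e :: "complex \<Rightarrow> mat2"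
  assumes det: "\<And>z. det (e z) = 1" and ab: "a \<noteq> 0 \<or> b \<noteq> 0"
    and der: "\<And>z i. ((\<lambda>z. e z $ i $ 1) has_field_derivative e z $ i $ 2 * b) (at z)"
      "\<And>z i. ((\<lambda>z. e z $ i $ 2) has_field_derivative e z $ i $ 1 * a) (at z)"
    and f: "range f = range (\<lambda>z. e z ** adjoint_mat (e z))"
  shows "congruent_to_horosphere_or_cylinder f"
proof -
  \<comment> \<open>The last factor is the exponential of z N, where N is off-diagonal with upper
    right entry a and lower left entry b. Each row of \<open>e\<close> solves the linear
    system.\<close>
  have sol: "e z = e 0 ** mk2 (c z) (a * s z) (b * s z) (c z)"
    if "\<And>z. (c has_field_derivative a * b * s z) (at z)" "\<And>z. (s has_field_derivative c z) (at z)" "c 0 = 1" "s 0 = 0"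
    for c s z
    using linear_system_solution[of "\<lambda>z. e z $ 1 $ 1" "\<lambda>z. e z $ 1 $ 2" b a c s z, OF der(1) der(2) that]
      linear_system_solution[of "\<lambda>z. e z $ 2 $ 1" "\<lambda>z. e z $ 2 $ 2" b a c s z, OF der(1) der(2) that]
    by (simp add: mat2_eq_iff mat2_mult_nth)
  have fac: "(A ** M) ** adjoint_mat (A ** M) = A ** (M ** adjoint_mat M) ** adjoint_mat A" for A M
    by (simp add: adjoint_mult matrix_mul_assoc)
  show ?thesis
  proof (cases "a * b = 0")
    case True
    have e: "e z = e 0 ** mk2 1 (a * z) (b * z) 1" for z
      using sol[of "\<lambda>_. 1" "\<lambda>z. z" z] True by (auto intro!: derivative_eq_intros)
    have f': "range f = range (\<lambda>z. e 0 ** (mk2 1 (a * z) (b * z) 1 ** adjoint_mat (mk2 1 (a * z) (b * z) 1)) ** adjoint_mat (e 0))"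
    proof -
      have "e z ** adjoint_mat (e z) = e 0 ** (mk2 1 (a * z) (b * z) 1 ** adjoint_mat (mk2 1 (a * z) (b * z) 1)) ** adjoint_mat (e 0)" for z
        unfolding e[of z] by (rule fac)
      then show ?thesis unfolding f by simp
    qed
    have H: "mk2 1 (a * z) (b * z) 1 ** adjoint_mat (mk2 1 (a * z) (b * z) 1) \<in> H3" for z
      by (rule factor_H3) (use True in \<open>auto simp: det_2\<close>)
    have sq: "w * cnj w = of_real ((cmod w)\<^sup>2)" for w by (simp only: complex_norm_square)
    \<comment> \<open>One of a and b is zero, and the orbit is the horosphere on which the lower
      right (if b = 0) or upper left diagonal entry equals 1. The off-diagonal entry of a given
      point of the horosphere determines z.\<close>
    have "horosphere (range (\<lambda>z. mk2 1 (a * z) (b * z) 1 ** adjoint_mat (mk2 1 (a * z) (b * z) 1)))"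
    proof (cases "b = 0")
      case True
      have "range (\<lambda>z. mk2 1 (a * z) (b * z) 1 ** adjoint_mat (mk2 1 (a * z) (b * z) 1)) = {X \<in> H3. X $ 2 $ 2 = 1}"
      proof (intro equalityI subsetI)
        fix X assume X: "X \<in> {X \<in> H3. X $ 2 $ 2 = 1}"
        then have "X $ 1 $ 1 = 1 + X $ 1 $ 2 * cnj (X $ 1 $ 2)" "X $ 2 $ 1 = cnj (X $ 1 $ 2)"
          unfolding sq by (auto simp: H3_iff complex_eq_iff)
        then have "X = mk2 1 (a * (X $ 1 $ 2 / a)) (b * (X $ 1 $ 2 / a)) 1 ** adjoint_mat (mk2 1 (a * (X $ 1 $ 2 / a)) (b * (X $ 1 $ 2 / a)) 1)"
          using X True ab by (simp add: mat2_eq_iff mat2_mult_nth)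
        then show "X \<in> range (\<lambda>z. mk2 1 (a * z) (b * z) 1 ** adjoint_mat (mk2 1 (a * z) (b * z) 1))" by (rule range_eqI)
      qed (use H True in \<open>auto simp: mat2_mult_nth\<close>)
      then show ?thesis using horosphere_22 by simp
    next
      case False
      then have a: "a = 0" using True by simp
      have "range (\<lambda>z. mk2 1 (a * z) (b * z) 1 ** adjoint_mat (mk2 1 (a * z) (b * z) 1)) = {X \<in> H3. X $ 1 $ 1 = 1}"
      proof (intro equalityI subsetI)
        fix X assume X: "X \<in> {X \<in> H3. X $ 1 $ 1 = 1}"
        have n: "cmod (X $ 1 $ 2) = cmod (X $ 2 $ 1)" using X by (simp add: H3_iff)
        from X have x: "X $ 2 $ 2 = 1 + X $ 2 $ 1 * cnj (X $ 2 $ 1)" "X $ 1 $ 2 = cnj (X $ 2 $ 1)"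
          unfolding sq n[symmetric] by (auto simp: H3_iff complex_eq_iff)
        then have "X = mk2 1 (a * (X $ 2 $ 1 / b)) (b * (X $ 2 $ 1 / b)) 1 ** adjoint_mat (mk2 1 (a * (X $ 2 $ 1 / b)) (b * (X $ 2 $ 1 / b)) 1)"
          using X a False by (simp add: mat2_eq_iff mat2_mult_nth)
        then show "X \<in> range (\<lambda>z. mk2 1 (a * z) (b * z) 1 ** adjoint_mat (mk2 1 (a * z) (b * z) 1))" by (rule range_eqI)
      qed (use H a in \<open>auto simp: mat2_mult_nth\<close>)
      then show ?thesis using horosphere_11 by simp
    qed
    then show ?thesis using congruence_image[OF det f'] by blast
  next
    case False
    define \<mu> where "\<mu> = csqrt (a * b)"
    have mu: "\<mu> \<noteq> 0" "\<mu> * \<mu> = a * b" using False by (auto simp: \<mu>_def simp flip: power2_eq_square)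
    have e: "e z = e 0 ** mk2 (cosh (\<mu> * z)) (a * (sinh (\<mu> * z) / \<mu>)) (b * (sinh (\<mu> * z) / \<mu>)) (cosh (\<mu> * z))" for z
      by (rule sol) (use mu(1) in \<open>auto intro!: derivative_eq_intros simp: mu(2)[symmetric]\<close>)
    \<comment> \<open>N has the eigenvectors (\<tau>, 1) and (- \<tau>, 1) for the eigenvalues \<mu>
      and - \<mu>. They are the columns of \<open>P\<close>, divided by \<open>\<kappa>\<close> to
      make the determinant 1.\<close>
    define \<tau> \<kappa> where "\<tau> = a / \<mu>" and "\<kappa> = csqrt (2 * \<tau>)"
    have t: "\<tau> \<noteq> 0" "a / \<mu> = \<tau>" "b / \<mu> = 1 / \<tau>" using False mu by (auto simp: \<tau>_def field_simps)
    have k: "\<kappa> \<noteq> 0" "\<kappa> * \<kappa> = 2 * \<tau>" using t by (auto simp: \<kappa>_def simp flip: power2_eq_square)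
    define P where "P = mk2 (\<tau> / \<kappa>) (- \<tau> / \<kappa>) (1 / \<kappa>) (1 / \<kappa>)"
    have dP: "det P = 1" using k t by (simp add: P_def det_2 field_simps)
    let ?D = "\<lambda>s. mk2 (exp s) 0 0 (exp (- s))"
    let ?Q = "matrix_inv P"
    note inv = det1_inverse[OF dP]
    have M: "mk2 (cosh s) (a * (sinh s / \<mu>)) (b * (sinh s / \<mu>)) (cosh s) = P ** ?D s ** ?Q" for s
    proof -
      have "a * (sinh s / \<mu>) = (a / \<mu>) * sinh s" "b * (sinh s / \<mu>) = (b / \<mu>) * sinh s" by simp_all
      then have eqs: "a * (sinh s / \<mu>) = \<tau> * sinh s" "b * (sinh s / \<mu>) = sinh s / \<tau>" unfolding t by simp_all
      have "mk2 (cosh s) (\<tau> * sinh s) (sinh s / \<tau>) (cosh s) ** P = P ** ?D s"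
        using t(1) k(1) by (simp add: mat2_eq_iff mat2_mult_nth P_def cosh_def sinh_def field_simps scaleR_conv_of_real)
      then have "mk2 (cosh s) (a * (sinh s / \<mu>)) (b * (sinh s / \<mu>)) (cosh s) ** P = P ** ?D s"
        unfolding eqs .
      then have "mk2 (cosh s) (a * (sinh s / \<mu>)) (b * (sinh s / \<mu>)) (cosh s) ** P ** ?Q = P ** ?D s ** ?Q" by simp
      then show ?thesis using inv(2) by (simp add: matrix_mul_assoc[symmetric])
    qed
    \<comment> \<open>Up to the congruence by \<open>e 0 ** P\<close> the front is the orbit of the
      point \<open>Y\<close> under the diagonal group, as \<mu> z runs through the whole
      plane.\<close>
    define Y where "Y = ?Q ** adjoint_mat ?Q"
    have YH: "Y \<in> H3" unfolding Y_def by (rule factor_H3[OF inv(3)])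
    define G where "G s = ?D s ** Y ** adjoint_mat (?D s)" for s
    have ee: "e z ** adjoint_mat (e z) = (e 0 ** P) ** G (\<mu> * z) ** adjoint_mat (e 0 ** P)" for z
      unfolding e[of z] M G_def Y_def by (simp add: adjoint_mult matrix_mul_assoc)
    have "range f = range (\<lambda>s. (e 0 ** P) ** G s ** adjoint_mat (e 0 ** P))"
    proof -
      have "(\<lambda>s. (e 0 ** P) ** G s ** adjoint_mat (e 0 ** P)) ` range (\<lambda>z. \<mu> * z) = range f"
        unfolding f ee by (simp add: image_image)
      moreover have "range (\<lambda>z. \<mu> * z) = UNIV"
        using mu(1) by (auto intro: range_eqI[of _ _ "_ / \<mu>"])
      ultimately show ?thesis by simp
    qed
    moreover have "det (e 0 ** P) = 1" using det dP by (simp add: det_mul)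
    moreover have "hyperbolic_cylinder (range G)"
    proof -
      have "1 \<le> Re (Y $ 1 $ 1) * Re (Y $ 2 $ 2)" using YH by (simp add: H3_iff)
      then show ?thesis
        using cylinder_about_axis diagonal_orbit[OF YH] by (simp add: G_def[abs_def])
    qed
    ultimately show ?thesis using congruence_image by blast
  qed
qed

section \<open>The lift of a flat front\<close>

text \<open>Simple connectedness means free homotopy of any two loops. A homotopy between the
  constant loops at x and y traces a path from x to y.\<close>

lemma simply_connected_UNIV_imp_connected:
  assumes "simply_connected (UNIV :: 'b::topological_space set)"
  shows "connected (UNIV :: 'b set)"
proof -
  have "path_connected (UNIV :: 'b set)"
    unfolding path_connected_def
  proof (intro ballI)
    fix x y :: 'b
    have "homotopic_loops UNIV (\<lambda>_. x) (\<lambda>_. y)"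
      using assms unfolding simply_connected_def
      by (auto simp: path_def pathfinish_def pathstart_def intro!: continuous_on_const)
    then obtain h :: "real \<times> real \<Rightarrow> 'b" where h: "continuous_on ({0..1} \<times> {0..1}) h"
      "\<forall>t\<in>{0..1}. h (0, t) = x" "\<forall>t\<in>{0..1}. h (1, t) = y"
      unfolding homotopic_loops by blast
    have "continuous_on {0..1::real} (\<lambda>t. h (t, 0))"
      by (rule continuous_on_compose2[OF h(1)]) (auto intro!: continuous_intros)
    then show "\<exists>g. path g \<and> path_image g \<subseteq> UNIV \<and> pathstart g = x \<and> pathfinish g = y"
      using h(2,3) by (intro exI[of _ "\<lambda>t. h (t, 0)"]) (auto simp: path_def pathstart_def pathfinish_def)
  qed
  then show ?thesis by (rule path_connected_imp_connected)
qed

lemma covering_open_map: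
  assumes p: "covering_space (UNIV::'b::topological_space set) p (UNIV::'a::topological_space set)" and W: "open W"
  shows "open (p ` W)"
proof (subst open_subopen, intro ballI)
  fix y assume "y \<in> p ` W"
  then obtain x where x: "x \<in> W" "y = p x" by blast
  obtain T u q where T: "x \<in> T" "openin (top_of_set UNIV) T" "p x \<in> u" "openin (top_of_set UNIV) u" "homeomorphism T u p q"
    by (rule covering_space_local_homeomorphism[OF p UNIV_I[of x]])
  have o: "open T" "open u" using T(2,4) by simp_all
  have "openin (top_of_set T) (T \<inter> W)" using W by (simp add: openin_open_Int)
  then have "openin (top_of_set u) (p ` (T \<inter> W))" by (rule homeomorphism_imp_open_map[OF T(5)])
  then have "open (p ` (T \<inter> W))" using o(2) openin_open_trans by blast
  then show "\<exists>T. open T \<and> y \<in> T \<and> T \<subseteq> p ` W" using x T(1) by blast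
qed

lemma inverse_mat2:
  fixes A :: mat2
  assumes "det A = 1"
  shows "matrix_inv A = mk2 (A $ 2 $ 2) (- A $ 1 $ 2) (- A $ 2 $ 1) (A $ 1 $ 1)"
proof -
  let ?B = "mk2 (A $ 2 $ 2) (- A $ 1 $ 2) (- A $ 2 $ 1) (A $ 1 $ 1)"
  have "A ** ?B = mat 1" using assms by (simp add: mat2_eq_iff mat2_mult_nth mat_def det_2 algebra_simps)
  then have "matrix_inv A ** (A ** ?B) = matrix_inv A" by simp
  then show ?thesis using det1_inverse(1)[OF assms] by (simp add: matrix_mul_assoc)
qed

locale canonical_front =
  fixes C :: "'a::t2_space chart set" and p :: "'b::t2_space \<Rightarrow> 'a" and f n :: "'a \<Rightarrow> mat2" and E :: "'b \<Rightarrow> mat2"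
  assumes conn_base: "connected (UNIV :: 'a set)"
    and cover: "universal_cover p"
    and atlas: "surface_atlas C"
    and holo: "\<And>c d. \<lbrakk>c \<in> C; d \<in> C\<rbrakk> \<Longrightarrow> transition c d holomorphic_on snd c ` (fst c \<inter> fst d)"
    and lift: "canonical_lift C p f n E"
begin

lemma p_covering: "covering_space UNIV p UNIV" using cover by (simp add: universal_cover_def)
lemma p_cont: "continuous_on S p" using covering_space_imp_continuous[OF p_covering] continuous_on_subset by blast
lemma p_surj: "surj p" using covering_space_imp_surjective[OF p_covering] .
lemma p_open: "open W \<Longrightarrow> open (p ` W)" using covering_open_map[OF p_covering] .

lemma base_chart:
  assumes c: "c \<in> C"
  shows "open (fst c)" "open (chart_image c)" "continuous_on (fst c) (snd c)" "continuous_on (chart_image c) (chart_inv c)"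
    "\<And>x. x \<in> fst c \<Longrightarrow> chart_inv c (snd c x) = x" "\<And>w. w \<in> chart_image c \<Longrightarrow> snd c (chart_inv c w) = w"
    "\<And>w. w \<in> chart_image c \<Longrightarrow> chart_inv c w \<in> fst c" "\<And>x. x \<in> fst c \<Longrightarrow> snd c x \<in> chart_image c"
    "\<And>W. \<lbrakk>open W; W \<subseteq> fst c\<rbrakk> \<Longrightarrow> open (snd c ` W)"
proof -
  have h: "homeomorphism (fst c) (chart_image c) (snd c) (chart_inv c)" and o: "open (fst c)" "open (chart_image c)"
    using atlas c by (auto simp: surface_atlas_def)
  show "open (fst c)" "open (chart_image c)" by fact+
  show "continuous_on (fst c) (snd c)" "continuous_on (chart_image c) (chart_inv c)"
    "\<And>x. x \<in> fst c \<Longrightarrow> chart_inv c (snd c x) = x" "\<And>w. w \<in> chart_image c \<Longrightarrow> snd c (chart_inv c w) = w"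
    "\<And>w. w \<in> chart_image c \<Longrightarrow> chart_inv c w \<in> fst c" "\<And>x. x \<in> fst c \<Longrightarrow> snd c x \<in> chart_image c"
    using h by (auto simp: homeomorphism_def)
  show "open (snd c ` W)" if W: "open W" "W \<subseteq> fst c" for W
  proof -
    have "openin (top_of_set (fst c)) W" using W by (simp add: open_subset)
    then show ?thesis using homeomorphism_imp_open_map[OF h] o(2) openin_open_trans by blast
  qed
qed

lemma base_chart_ex: "\<exists>c\<in>C. q \<in> fst c"
  using atlas by (auto simp: surface_atlas_def)

lemma lift_atlas_iff: "d \<in> lift_atlas D p \<longleftrightarrow> (\<exists>c\<in>D. snd d = snd c \<circ> p \<and> open (fst d) \<and> inj_on p (fst d) \<and> p ` fst d \<subseteq> fst c)"
proof
  assume "d \<in> lift_atlas D p"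
  then obtain V c where "d = (V, snd c \<circ> p)" "c \<in> D" "open V" "inj_on p V" "p ` V \<subseteq> fst c"
    unfolding lift_atlas_def by blast
  then show "\<exists>c\<in>D. snd d = snd c \<circ> p \<and> open (fst d) \<and> inj_on p (fst d) \<and> p ` fst d \<subseteq> fst c"
    by (intro bexI[of _ c]) simp_all
next
  assume "\<exists>c\<in>D. snd d = snd c \<circ> p \<and> open (fst d) \<and> inj_on p (fst d) \<and> p ` fst d \<subseteq> fst c"
  then obtain c where c: "c \<in> D" "snd d = snd c \<circ> p" "open (fst d)" "inj_on p (fst d)" "p ` fst d \<subseteq> fst c" by blast
  have "d = (fst d, snd c \<circ> p)" using c(2) by (metis prod.collapse)
  then show "d \<in> lift_atlas D p" unfolding lift_atlas_def using c by blast
qed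

lemma lift_atlas_mono: "D \<subseteq> D' \<Longrightarrow> lift_atlas D p \<subseteq> lift_atlas D' p"
  unfolding lift_atlas_def by blast

text \<open>A sheet around x, cut down to the preimage of the chart domain.\<close>

lemma lift_chart_ex:
  assumes "c \<in> C" "p x \<in> fst c"
  shows "\<exists>d\<in>lift_atlas {c} p. x \<in> fst d"
proof -
  obtain T u q where T: "x \<in> T" "openin (top_of_set UNIV) T" "homeomorphism T u p q"
    by (rule covering_space_local_homeomorphism[OF p_covering UNIV_I[of x]])
  let ?V = "T \<inter> p -` fst c"
  have "open T" using T(2) by simp
  then have "open ?V" by (rule continuous_open_preimage[OF p_cont _ base_chart(1)[OF assms(1)]])
  moreover have "inj_on p ?V" by (rule inj_on_inverseI[of _ q]) (use T(3) in \<open>auto simp: homeomorphism_def\<close>)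
  ultimately show ?thesis
    using assms T(1) by (intro bexI[of _ "(?V, snd c \<circ> p)"]) (auto simp: lift_atlas_iff)
qed

lemma lift_chart:
  assumes d: "d \<in> lift_atlas C p"
  shows "open (fst d)" "open (chart_image d)" "inj_on (snd d) (fst d)" "continuous_on (chart_image d) (chart_inv d)"
    "\<And>x. x \<in> fst d \<Longrightarrow> chart_inv d (snd d x) = x" "\<And>w. w \<in> chart_image d \<Longrightarrow> snd d (chart_inv d w) = w"
    "\<And>w. w \<in> chart_image d \<Longrightarrow> chart_inv d w \<in> fst d" "\<And>x. x \<in> fst d \<Longrightarrow> snd d x \<in> chart_image d"
    "\<And>W. \<lbrakk>open W; W \<subseteq> chart_image d\<rbrakk> \<Longrightarrow> open (chart_inv d ` W)"
    "continuous_on (fst d) (snd d)"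
proof -
  obtain c where c: "c \<in> C" "snd d = snd c \<circ> p" "open (fst d)" "inj_on p (fst d)" "p ` fst d \<subseteq> fst c"
    using d by (auto simp: lift_atlas_iff)
  note b = base_chart[OF c(1)]
  show "open (fst d)" by fact
  have op: "open (snd d ` W)" if W: "open W" "W \<subseteq> fst d" for W
  proof -
    have "p ` W \<subseteq> fst c" using W(2) c(5) by blast
    then show ?thesis using b(9)[OF p_open[OF W(1)]] unfolding c(2) by (simp add: image_comp)
  qed
  show "open (chart_image d)" unfolding chart_image_def by (rule op[OF c(3)]) simp
  have "inj_on (snd c) (fst c)" using b(5) by (rule inj_on_inverseI)
  then show inj: "inj_on (snd d) (fst d)"
    unfolding c(2) by (rule comp_inj_on[OF c(4) inj_on_subset[OF _ c(5)]])
  show 5: "chart_inv d (snd d x) = x" if "x \<in> fst d" for x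
    unfolding chart_inv_def using inj that by simp
  show 6: "snd d (chart_inv d w) = w" if "w \<in> chart_image d" for w
    using that unfolding chart_inv_def chart_image_def by (rule f_inv_into_f)
  show 7: "chart_inv d w \<in> fst d" if "w \<in> chart_image d" for w
    using that unfolding chart_inv_def chart_image_def by (rule inv_into_into)
  show "snd d x \<in> chart_image d" if "x \<in> fst d" for x using that by (simp add: chart_image_def)
  show co: "continuous_on (fst d) (snd d)"
    unfolding c(2) by (rule continuous_on_compose[OF p_cont continuous_on_subset[OF b(3) c(5)]])
  show "continuous_on (chart_image d) (chart_inv d)"
  proof (subst continuous_on_open_vimage)
    show "open (chart_image d)" by fact
    show "\<forall>B. open B \<longrightarrow> open (chart_inv d -` B \<inter> chart_image d)"
    proof (intro allI impI)
      fix B :: "'b set" assume "open B"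
      have "chart_inv d -` B \<inter> chart_image d = snd d ` (B \<inter> fst d)"
        using 5 6 7 by (auto simp: chart_image_def)
      then show "open (chart_inv d -` B \<inter> chart_image d)"
        using op[of "B \<inter> fst d"] \<open>open B\<close> c(3) by auto
    qed
  qed
  show "open (chart_inv d ` W)" if W: "open W" "W \<subseteq> chart_image d" for W
  proof -
    have "chart_inv d ` W = fst d \<inter> snd d -` W"
    proof (intro equalityI subsetI)
      fix x assume "x \<in> fst d \<inter> snd d -` W"
      then show "x \<in> chart_inv d ` W" using 5 by (intro image_eqI[of _ _ "snd d x"]) auto
    qed (use W(2) 6 7 in \<open>auto simp: subset_iff\<close>)
    then show ?thesis using continuous_open_preimage[OF co c(3) W(1)] by simp
  qed
qed

lemma E_det: "det (E x) = 1" and f_eq: "f (p x) = E x ** adjoint_mat (E x)" and n_eq: "n (p x) = E x ** e3 ** adjoint_mat (E x)"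
  using lift unfolding canonical_lift_def by simp_all

lemma canonical_forms_eq:
  assumes d: "d \<in> lift_atlas C p" "x \<in> fst d"
  shows "canonical_theta E d x = thf E (chart_inv d) (snd d x)" "canonical_omega E d x = omf E (chart_inv d) (snd d x)"
    "maurer_cartan E d x $ 1 $ 1 = E x $ 2 $ 2 * deriv (\<lambda>w. E (chart_inv d w) $ 1 $ 1) (snd d x) - E x $ 1 $ 2 * deriv (\<lambda>w. E (chart_inv d w) $ 2 $ 1) (snd d x)"
    "maurer_cartan E d x $ 2 $ 2 = E x $ 1 $ 1 * deriv (\<lambda>w. E (chart_inv d w) $ 2 $ 2) (snd d x) - E x $ 2 $ 1 * deriv (\<lambda>w. E (chart_inv d w) $ 1 $ 2) (snd d x)"
proof -
  have x: "chart_inv d (snd d x) = x" using lift_chart(5)[OF d] .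
  show "canonical_theta E d x = thf E (chart_inv d) (snd d x)" "canonical_omega E d x = omf E (chart_inv d) (snd d x)"
    "maurer_cartan E d x $ 1 $ 1 = E x $ 2 $ 2 * deriv (\<lambda>w. E (chart_inv d w) $ 1 $ 1) (snd d x) - E x $ 1 $ 2 * deriv (\<lambda>w. E (chart_inv d w) $ 2 $ 1) (snd d x)"
    "maurer_cartan E d x $ 2 $ 2 = E x $ 1 $ 1 * deriv (\<lambda>w. E (chart_inv d w) $ 2 $ 2) (snd d x) - E x $ 2 $ 1 * deriv (\<lambda>w. E (chart_inv d w) $ 1 $ 2) (snd d x)"
    by (simp_all add: canonical_theta_def canonical_omega_def maurer_cartan_def inverse_mat2[OF E_det] mat2_mult_nth
        thf_def omf_def coord_deriv_def x)
qed

text \<open>If both forms vanished at a point, all of E^{-1} dE would vanish there and so would dE,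
  against the immersion condition in \<open>canonical_lift\<close>.\<close>

lemma lift_chart_imm:
  assumes d: "d \<in> lift_atlas C p"
  shows "imm E (chart_inv d) (chart_image d)"
    "\<And>z. z \<in> chart_image d \<Longrightarrow> E (chart_inv d z) $ 2 $ 2 * deriv (\<lambda>w. E (chart_inv d w) $ 1 $ 1) z - E (chart_inv d z) $ 1 $ 2 * deriv (\<lambda>w. E (chart_inv d w) $ 2 $ 1) z = 0 \<and>
        E (chart_inv d z) $ 1 $ 1 * deriv (\<lambda>w. E (chart_inv d w) $ 2 $ 2) z - E (chart_inv d z) $ 2 $ 1 * deriv (\<lambda>w. E (chart_inv d w) $ 1 $ 2) z = 0"
proof -
  note l = lift_chart[OF d]
  have L: "(\<lambda>w. E (chart_inv d w) $ i $ j) holomorphic_on chart_image d" "\<And>x. x \<in> fst d \<Longrightarrow> coord_deriv E d x \<noteq> 0"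
    "\<And>x. x \<in> fst d \<Longrightarrow> maurer_cartan E d x $ 1 $ 1 = 0 \<and> maurer_cartan E d x $ 2 $ 2 = 0" for i j
    using lift d unfolding canonical_lift_def by blast+
  show diag: "E (chart_inv d z) $ 2 $ 2 * deriv (\<lambda>w. E (chart_inv d w) $ 1 $ 1) z - E (chart_inv d z) $ 1 $ 2 * deriv (\<lambda>w. E (chart_inv d w) $ 2 $ 1) z = 0 \<and>
        E (chart_inv d z) $ 1 $ 1 * deriv (\<lambda>w. E (chart_inv d w) $ 2 $ 2) z - E (chart_inv d z) $ 2 $ 1 * deriv (\<lambda>w. E (chart_inv d w) $ 1 $ 2) z = 0"
    if z: "z \<in> chart_image d" for z
    using L(3)[OF l(7)[OF z]] canonical_forms_eq(3,4)[OF d l(7)[OF z]] l(6)[OF z] by simp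
  have nz: "thf E (chart_inv d) z \<noteq> 0 \<or> omf E (chart_inv d) z \<noteq> 0" if z: "z \<in> chart_image d" for z
  proof (rule ccontr)
    let ?x = "chart_inv d z"
    have x: "?x \<in> fst d" "snd d ?x = z" using l(6,7)[OF z] by auto
    assume "\<not> ?thesis"
    then have "maurer_cartan E d ?x = 0"
      using L(3)[OF x(1)] canonical_forms_eq(1,2)[OF d x(1)] x(2)
      by (simp add: mat2_eq_iff canonical_theta_def canonical_omega_def)
    then have "E ?x ** (matrix_inv (E ?x) ** coord_deriv E d ?x) = 0"
      by (simp add: maurer_cartan_def)
    then have "coord_deriv E d ?x = 0" using det1_inverse(2)[OF E_det[of ?x]] by (simp add: matrix_mul_assoc)
    then show False using L(2)[OF x(1)] by simp
  qed
  show "imm E (chart_inv d) (chart_image d)"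
    unfolding imm_def holm_def using L(1) l(2,4) nz by blast
qed

text \<open>A chart of the universal cover around x, translated so that x has coordinate
  \<open>0\<close>, serves as the required coordinate.\<close>

sublocale legendrian E
proof
  show "det (E x) = 1" for x by (rule E_det)
  show "connected (UNIV :: 'b set)"
    using cover by (auto simp: universal_cover_def intro: simply_connected_UNIV_imp_connected)
  fix x
  obtain c where c: "c \<in> C" "p x \<in> fst c" using base_chart_ex by blast
  then obtain d where d: "d \<in> lift_atlas C p" "x \<in> fst d"
    using lift_chart_ex[OF c] lift_atlas_mono[of "{c}" C] by blast
  note l = lift_chart[OF d(1)]
  define z0 where "z0 = snd d x"
  obtain r where r: "0 < r" "ball z0 r \<subseteq> chart_image d"
    using l(2) l(8)[OF d(2)] unfolding open_contains_ball z0_def by blast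
  define \<sigma> where "\<sigma> w = chart_inv d (w + z0)" for w
  have sub: "w + z0 \<in> chart_image d" if "w \<in> ball 0 r" for w
    using r(2) that by (auto simp: subset_iff dist_norm norm_minus_commute)
  have i: "imm E (chart_inv d) (ball z0 r)" by (rule imm_subset[OF lift_chart_imm(1)[OF d(1)] open_ball r(2)])
  have der: "deriv (\<lambda>w. E (\<sigma> w) $ i $ j) z = deriv (\<lambda>w. E (chart_inv d w) $ i $ j) (z + z0)" for z i j
  proof -
    have "deriv (\<lambda>w. E (\<sigma> w) $ i $ j) z = deriv ((\<lambda>w. E (\<sigma> w) $ i $ j) \<circ> (\<lambda>x. z + x)) 0" by (rule deriv_shift_0)
    also have "(\<lambda>w. E (\<sigma> w) $ i $ j) \<circ> (\<lambda>x. z + x) = (\<lambda>w. E (chart_inv d w) $ i $ j) \<circ> (\<lambda>x. z + z0 + x)"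
      by (simp add: fun_eq_iff \<sigma>_def add_ac)
    also have "deriv \<dots> 0 = deriv (\<lambda>w. E (chart_inv d w) $ i $ j) (z + z0)" by (rule deriv_shift_0[symmetric])
    finally show ?thesis .
  qed
  show "\<exists>\<sigma> d. 0 < d \<and> imm E \<sigma> (ball 0 d) \<and> \<sigma> 0 = x \<and> inj_on \<sigma> (ball 0 d) \<and>
      (\<forall>V. open V \<and> V \<subseteq> ball 0 d \<longrightarrow> open (\<sigma> ` V)) \<and>
      (\<forall>z\<in>ball 0 d. E (\<sigma> z) $ 2 $ 2 * deriv (\<lambda>w. E (\<sigma> w) $ 1 $ 1) z - E (\<sigma> z) $ 1 $ 2 * deriv (\<lambda>w. E (\<sigma> w) $ 2 $ 1) z = 0 \<and>
        E (\<sigma> z) $ 1 $ 1 * deriv (\<lambda>w. E (\<sigma> w) $ 2 $ 2) z - E (\<sigma> z) $ 2 $ 1 * deriv (\<lambda>w. E (\<sigma> w) $ 1 $ 2) z = 0)"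
  proof (intro exI[of _ \<sigma>] exI[of _ r] conjI ballI allI impI)
    show "imm E \<sigma> (ball 0 r)" using imm_shift(1)[OF i, of z0] by (simp add: \<sigma>_def[abs_def])
    show "\<sigma> 0 = x" using l(5)[OF d(2)] by (simp add: \<sigma>_def z0_def)
    show "inj_on \<sigma> (ball 0 r)"
      by (rule inj_on_inverseI[of _ "\<lambda>x. snd d x - z0"]) (use sub l(6) in \<open>simp add: \<sigma>_def\<close>)
    show "open (\<sigma> ` V)" if "open V \<and> V \<subseteq> ball 0 r" for V
    proof -
      have "open ((\<lambda>w. w + z0) ` V)" using that open_translation[of V z0] by (simp add: add.commute)
      then have "open (chart_inv d ` (\<lambda>w. w + z0) ` V)" by (rule l(9)) (use that sub in auto)
      then show ?thesis by (simp add: image_image \<sigma>_def)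
    qed
    fix z :: complex assume z: "z \<in> ball 0 r"
    show "E (\<sigma> z) $ 2 $ 2 * deriv (\<lambda>w. E (\<sigma> w) $ 1 $ 1) z - E (\<sigma> z) $ 1 $ 2 * deriv (\<lambda>w. E (\<sigma> w) $ 2 $ 1) z = 0"
      "E (\<sigma> z) $ 1 $ 1 * deriv (\<lambda>w. E (\<sigma> w) $ 2 $ 2) z - E (\<sigma> z) $ 2 $ 1 * deriv (\<lambda>w. E (\<sigma> w) $ 1 $ 2) z = 0"
      unfolding der using lift_chart_imm(2)[OF d(1) sub[OF z]] by (simp_all add: \<sigma>_def)
  qed (rule r(1))
qed

lemma some_lift_chart: "some_chart (lift_atlas C p) x \<in> lift_atlas C p" "x \<in> fst (some_chart (lift_atlas C p) x)"
proof -
  obtain c where c: "c \<in> C" "p x \<in> fst c" using base_chart_ex by blast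
  then have "\<exists>d. d \<in> lift_atlas C p \<and> x \<in> fst d"
    using lift_chart_ex[OF c] lift_atlas_mono[of "{c}" C] by blast
  then have "some_chart (lift_atlas C p) x \<in> lift_atlas C p \<and> x \<in> fst (some_chart (lift_atlas C p) x)"
    unfolding some_chart_def by (rule someI_ex)
  then show "some_chart (lift_atlas C p) x \<in> lift_atlas C p" "x \<in> fst (some_chart (lift_atlas C p) x)" by auto
qed

section \<open>The ratio of the forms and its simple islands\<close>

text \<open>\<open>ratio\<close> is computed in a chosen chart. Passing to any immersed curve
  multiplies both forms by the same nonzero derivative, which cancels.\<close>

lemma ratio_eq:
  assumes s: "imm E \<sigma> U" "z \<in> U"
  shows "ratio C p E (\<sigma> z) = (if omf E \<sigma> z = 0 then None else Some (thf E \<sigma> z / omf E \<sigma> z))"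
proof -
  define d where "d = some_chart (lift_atlas C p) (\<sigma> z)"
  have d: "d \<in> lift_atlas C p" "\<sigma> z \<in> fst d" using some_lift_chart by (auto simp: d_def)
  note l = lift_chart[OF d(1)]
  have h: "holm E \<sigma> U" using s by (simp add: imm_def)
  have ci: "imm E (chart_inv d) (chart_image d)" "holm E (chart_inv d) (chart_image d)"
    using lift_chart_imm(1)[OF d(1)] by (auto simp: imm_def)
  obtain \<delta> T where T: "0 < \<delta>" "ball z \<delta> \<subseteq> U" "T holomorphic_on ball z \<delta>" "T z = snd d (\<sigma> z)" "T ` ball z \<delta> \<subseteq> chart_image d"
    "\<And>w. w \<in> ball z \<delta> \<Longrightarrow> \<sigma> w = chart_inv d (T w)"
    by (rule holm_reparametrization[OF h s(2) ci(1) l(8)[OF d(2)] l(5)[OF d(2), symmetric]]) (erule that, (assumption | blast)+)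
  have z: "z \<in> ball z \<delta>" using T(1) by simp
  have c: "thf E \<sigma> z = thf E (chart_inv d) (snd d (\<sigma> z)) * deriv T z"
    "omf E \<sigma> z = omf E (chart_inv d) (snd d (\<sigma> z)) * deriv T z"
    using holm_comp(3,4)[OF ci(2) T(3) open_ball T(5) T(6) z] T(4) by simp_all
  have nz: "deriv T z \<noteq> 0"
    by (rule imm_reparam_deriv_nz[OF imm_subset[OF s(1) open_ball T(2)] ci(2) T(3) open_ball T(5) T(6) z])
  show ?thesis
    unfolding ratio_def d_def[symmetric] Let_def canonical_forms_eq(1,2)[OF d] c using nz by simp
qed

text \<open>The derivative of \<theta> / \<omega> is the Wronskian divided by \<omega>^2, so the
  value is taken with multiplicity one. Both hypotheses are first carried over to the chart that
  \<open>value_multiplicity\<close> chooses.\<close>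

lemma value_multiplicity_1:
  assumes s: "imm E \<sigma> U" "z \<in> U" and o: "omf E \<sigma> z \<noteq> 0" and W: "wronskian_along E \<sigma> z \<noteq> 0"
  shows "value_multiplicity (lift_atlas C p) (ratio C p E) (\<sigma> z) = 1"
proof -
  define d where "d = some_chart (lift_atlas C p) (\<sigma> z)"
  have d: "d \<in> lift_atlas C p" "\<sigma> z \<in> fst d" using some_lift_chart by (auto simp: d_def)
  note l = lift_chart[OF d(1)]
  define w0 where "w0 = snd d (\<sigma> z)"
  have w0: "w0 \<in> chart_image d" "chart_inv d w0 = \<sigma> z" using l(5,8) d(2) by (auto simp: w0_def)
  have h: "holm E \<sigma> U" using s by (simp add: imm_def)
  have ci: "imm E (chart_inv d) (chart_image d)" "holm E (chart_inv d) (chart_image d)"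
    using lift_chart_imm(1)[OF d(1)] by (auto simp: imm_def)
  obtain \<delta> T where T: "0 < \<delta>" "ball z \<delta> \<subseteq> U" "T holomorphic_on ball z \<delta>" "T z = w0" "T ` ball z \<delta> \<subseteq> chart_image d"
    "\<And>w. w \<in> ball z \<delta> \<Longrightarrow> \<sigma> w = chart_inv d (T w)"
    by (rule holm_reparametrization[OF h s(2) ci(1) w0(1) w0(2)[symmetric]]) (erule that, (assumption | blast)+)
  have z: "z \<in> ball z \<delta>" using T(1) by simp
  have on: "omf E (chart_inv d) w0 \<noteq> 0"
    using holm_comp(4)[OF ci(2) T(3) open_ball T(5) T(6) z] T(4) o by auto
  have Wn: "wronskian_along E (chart_inv d) w0 \<noteq> 0"
    using wronskian_along_comp[OF ci(2) T(3) open_ball T(5) T(6) z] T(4) W by auto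
  let ?a = "thf E (chart_inv d)" and ?b = "omf E (chart_inv d)"
  define N where "N = chart_image d \<inter> ?b -` (- {0})"
  have N: "open N" unfolding N_def
    using l(2) holomorphic_thf_omf[OF ci(2)] by (intro continuous_open_preimage holomorphic_on_imp_continuous_on) auto
  have wN: "w0 \<in> N" using w0 on by (simp add: N_def)
  have r0: "ratio C p E (\<sigma> z) = Some (?a w0 / ?b w0)" using ratio_eq[OF ci(1) w0(1)] w0(2) on by simp
  define F where "F w = the (ratio C p E (chart_inv d w)) - the (ratio C p E (\<sigma> z))" for w
  have FN: "F w = ?a w / ?b w - ?a w0 / ?b w0" if "w \<in> N" for w
    using that ratio_eq[OF ci(1), of w] r0 by (simp add: F_def N_def)
  have qhol: "(\<lambda>w. ?a w / ?b w - ?a w0 / ?b w0) holomorphic_on N"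
    using holomorphic_thf_omf[OF ci(2)] by (intro holomorphic_intros) (auto simp: N_def intro: holomorphic_on_subset)
  have Fhol: "F holomorphic_on N" by (rule holomorphic_transform[OF qhol]) (simp add: FN)
  have "((\<lambda>w. ?a w / ?b w - ?a w0 / ?b w0) has_field_derivative wronskian_along E (chart_inv d) w0 / (?b w0 * ?b w0)) (at w0)"
    using DERIV_diff[OF DERIV_divide[OF holomorphic_derivI[OF holomorphic_thf_omf(1)[OF ci(2)] l(2) w0(1)]
        holomorphic_derivI[OF holomorphic_thf_omf(2)[OF ci(2)] l(2) w0(1)] on] DERIV_const, of "?a w0 / ?b w0"]
    by (simp add: wronskian_along_def)
  then have "(F has_field_derivative wronskian_along E (chart_inv d) w0 / (?b w0 * ?b w0)) (at w0)"
    by (rule has_field_derivative_transform_within_open[OF _ N wN]) (simp add: FN)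
  then have dF: "deriv F w0 \<noteq> 0" using DERIV_imp_deriv Wn on by fastforce
  have "zorder F w0 = 1"
  proof (rule zorder_zero_eqI[OF Fhol N wN])
    fix i :: nat assume "i < nat 1"
    then show "(deriv ^^ i) F w0 = 0" using FN[OF wN] by simp
  qed (use dF in auto)
  then show ?thesis
    unfolding value_multiplicity_def d_def[symmetric] Let_def w0_def[symmetric] F_def[abs_def, symmetric] by simp
qed

text \<open>At such a point \<theta> / \<omega> is locally injective with value a. Its inverse on a
  small disk about a, followed by \<sigma>, has the ratio as left inverse, and the image of the open
  disk is a simple island.\<close>

lemma simple_island_ex:
  assumes s: "imm E \<sigma> U" "z0 \<in> U" and a: "thf E \<sigma> z0 - a * omf E \<sigma> z0 = 0"
    and d: "deriv (thf E \<sigma>) z0 - a * deriv (omf E \<sigma>) z0 \<noteq> 0"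
  shows "\<exists>\<epsilon>>0. \<exists>V. simple_island (lift_atlas C p) (ratio C p E) {z. cmod (z - a) < \<epsilon>} V"
proof -
  have h: "holm E \<sigma> U" and U: "open U" using s by (auto simp: imm_def holm_def)
  let ?a = "thf E \<sigma>" and ?b = "omf E \<sigma>"
  have b0: "?b z0 \<noteq> 0" using s a by (auto simp: imm_def)
  define N where "N = U \<inter> ?b -` (- {0})"
  have N: "open N" unfolding N_def
    using U holomorphic_thf_omf[OF h] by (intro continuous_open_preimage holomorphic_on_imp_continuous_on) auto
  have zN: "z0 \<in> N" using s b0 by (simp add: N_def)
  define g where "g w = ?a w / ?b w" for w
  have ghol: "g holomorphic_on N"
    unfolding g_def[abs_def]
    using holomorphic_thf_omf[OF h] by (intro holomorphic_intros) (auto simp: N_def intro: holomorphic_on_subset)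
  have gder: "deriv g w = wronskian_along E \<sigma> w / (?b w * ?b w)" if "w \<in> N" for w
    unfolding g_def[abs_def] wronskian_along_def
    by (rule DERIV_imp_deriv, rule DERIV_divide[OF holomorphic_derivI[OF holomorphic_thf_omf(1)[OF h] U]
        holomorphic_derivI[OF holomorphic_thf_omf(2)[OF h] U]]) (use that in \<open>auto simp: N_def\<close>)
  have ga: "g z0 = a" using a b0 by (simp add: g_def field_simps)
  have "wronskian_along E \<sigma> z0 = (deriv ?a z0 - a * deriv ?b z0) * ?b z0" using a by (simp add: wronskian_along_def algebra_simps)
  then have "deriv g z0 \<noteq> 0" using gder[OF zN] d b0 by simp
  then obtain r where r: "0 < r" "ball z0 r \<subseteq> N" "open (g ` ball z0 r)" "inj_on g (ball z0 r)"
    by (rule has_complex_derivative_locally_invertible[OF ghol zN N]) (erule that, (assumption | blast)+)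
  obtain k where k: "k holomorphic_on (g ` ball z0 r)" "\<And>z. z \<in> ball z0 r \<Longrightarrow> deriv g z * deriv k (g z) = 1"
    "\<And>z. z \<in> ball z0 r \<Longrightarrow> k (g z) = z"
    using holomorphic_has_inverse[OF holomorphic_on_subset[OF ghol r(2)] open_ball r(4)] by metis
  have "a \<in> g ` ball z0 r" using ga r(1) by (auto intro!: image_eqI[of _ _ z0])
  \<comment> \<open>A closed disk is chosen so that its image under \<open>m\<close> is compact.
    This makes V relatively compact and, the image being closed, separates V from the rest of the
    preimage.\<close>
  then obtain \<epsilon> where \<epsilon>: "0 < \<epsilon>" "cball a \<epsilon> \<subseteq> g ` ball z0 r" using r(3) open_contains_cball by blast
  define m where "m v = \<sigma> (k v)" for v
  have kb: "k v \<in> ball z0 r" "g (k v) = v" if "v \<in> cball a \<epsilon>" for v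
    using \<epsilon>(2) k(3) that by (auto simp: subset_iff)
  have kN: "k v \<in> N" if "v \<in> cball a \<epsilon>" for v using kb(1)[OF that] r(2) by blast
  have rm: "ratio C p E (m v) = Some v" if v: "v \<in> cball a \<epsilon>" for v
    using ratio_eq[OF s(1), of "k v"] kN[OF v] kb(2)[OF v] by (simp add: m_def g_def N_def)
  have mcont: "continuous_on (cball a \<epsilon>) m"
    unfolding m_def[abs_def]
    by (rule continuous_on_compose2[OF holmD(2)[OF h] continuous_on_subset[OF holomorphic_on_imp_continuous_on[OF k(1)] \<epsilon>(2)]])
      (use kN in \<open>auto simp: N_def\<close>)
  have Deq: "{z. cmod (z - a) < \<epsilon>} = ball a \<epsilon>" by (auto simp: dist_norm norm_minus_commute)
  have sub: "ball a \<epsilon> \<subseteq> cball a \<epsilon>" by auto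
  define V where "V = m ` ball a \<epsilon>"
  have Kc: "compact (m ` cball a \<epsilon>)" by (rule compact_continuous_image[OF mcont compact_cball])
  have Kcl: "closed (m ` cball a \<epsilon>)" using Kc by (rule compact_imp_closed)
  have Vo: "open V"
  proof -
    have "open (ball z0 r \<inter> g -` ball a \<epsilon>)"
      by (rule continuous_open_preimage[OF continuous_on_subset[OF holomorphic_on_imp_continuous_on[OF ghol] r(2)]]) auto
    moreover have "k ` ball a \<epsilon> = ball z0 r \<inter> g -` ball a \<epsilon>"
    proof (intro equalityI subsetI)
      fix w assume "w \<in> ball z0 r \<inter> g -` ball a \<epsilon>"
      then show "w \<in> k ` ball a \<epsilon>" using k(3)[of w] by (intro image_eqI[of _ _ "g w"]) auto
    next
      fix w assume "w \<in> k ` ball a \<epsilon>"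
      then obtain v where v: "v \<in> ball a \<epsilon>" "w = k v" by blast
      then show "w \<in> ball z0 r \<inter> g -` ball a \<epsilon>" using kb[of v] by simp
    qed
    ultimately have "open (k ` ball a \<epsilon>)" by simp
    moreover have "k ` ball a \<epsilon> \<subseteq> U" using kN sub by (auto simp: N_def)
    ultimately have "open (\<sigma> ` k ` ball a \<epsilon>)" by (rule imm_open_map[OF s(1)])
    then show ?thesis by (simp add: V_def m_def image_image)
  qed
  let ?S = "ratio C p E -` (Some ` ball a \<epsilon>)"
  have VS: "V \<subseteq> ?S" using rm by (auto simp: V_def)
  have KS: "m ` cball a \<epsilon> \<inter> ?S \<subseteq> V"
  proof
    fix x assume "x \<in> m ` cball a \<epsilon> \<inter> ?S"
    then obtain v where v: "v \<in> cball a \<epsilon>" "x = m v" "ratio C p E x \<in> Some ` ball a \<epsilon>" by blast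
    then have "v \<in> ball a \<epsilon>" using rm[OF v(1)] by auto
    then show "x \<in> V" using v(2) by (auto simp: V_def)
  qed
  \<comment> \<open>V is open, and by \<open>KS\<close> it is also the part of the preimage that
    lies in the closed image of \<open>cball a \<epsilon>\<close>. So a connected subset of the
    preimage that contains V cannot leave it.\<close>
  have comp: "V \<in> components ?S"
    unfolding in_components_maximal
  proof (intro conjI allI impI)
    show "V \<noteq> {}" using \<epsilon>(1) by (simp add: V_def)
    show "connected V" unfolding V_def
      by (rule connected_continuous_image[OF continuous_on_subset[OF mcont sub] connected_ball])
    fix D assume D: "D \<noteq> {} \<and> V \<subseteq> D \<and> D \<subseteq> ?S \<and> connected D"
    have "D \<subseteq> V \<union> - (m ` cball a \<epsilon>)" using KS D by blast
    moreover have "V \<inter> - (m ` cball a \<epsilon>) \<inter> D = {}" using sub by (auto simp: V_def)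
    moreover have "V \<inter> D \<noteq> {}" using D \<open>V \<noteq> {}\<close> by blast
    ultimately have "- (m ` cball a \<epsilon>) \<inter> D = {}"
      using connectedD[OF _ Vo, of D "- (m ` cball a \<epsilon>)"] D Kcl by (auto simp: Int_assoc)
    then show "D = V" using D KS by blast
  qed (rule VS)
  \<comment> \<open>On V the ratio is a continuous inverse of \<open>m\<close>, so V is homeomorphic
    to a disk.\<close>
  have sc: "simply_connected V"
  proof (rule simply_connected_retraction_gen[where S = "ball a \<epsilon>" and h = m and k = "\<lambda>x. the (ratio C p E x)"])
    show "simply_connected (ball a \<epsilon>)" by (simp add: convex_imp_simply_connected)
    show "continuous_on (ball a \<epsilon>) m" by (rule continuous_on_subset[OF mcont sub])
    show "continuous_on V (\<lambda>x. the (ratio C p E x))"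
    proof (subst continuous_on_open_vimage[OF Vo], intro allI impI)
      fix B :: "complex set" assume B: "open B"
      have "(\<lambda>x. the (ratio C p E x)) -` B \<inter> V = \<sigma> ` (ball z0 r \<inter> g -` (B \<inter> ball a \<epsilon>))"
      proof (intro equalityI subsetI)
        fix x assume "x \<in> (\<lambda>x. the (ratio C p E x)) -` B \<inter> V"
        then obtain v where v: "v \<in> ball a \<epsilon>" "x = m v" "the (ratio C p E x) \<in> B" by (auto simp: V_def)
        then have "v \<in> B" using rm[of v] by simp
        then show "x \<in> \<sigma> ` (ball z0 r \<inter> g -` (B \<inter> ball a \<epsilon>))"
          using v kb[of v] unfolding m_def by (intro image_eqI[of _ _ "k v"]) auto
      next
        fix x assume "x \<in> \<sigma> ` (ball z0 r \<inter> g -` (B \<inter> ball a \<epsilon>))"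
        then obtain w where w: "w \<in> ball z0 r" "g w \<in> B" "g w \<in> ball a \<epsilon>" "x = \<sigma> w" by auto
        then have "x = m (g w)" using k(3)[OF w(1)] by (simp add: m_def)
        then show "x \<in> (\<lambda>x. the (ratio C p E x)) -` B \<inter> V" using w rm[of "g w"] by (auto simp: V_def)
      qed
      moreover have "open (\<sigma> ` (ball z0 r \<inter> g -` (B \<inter> ball a \<epsilon>)))"
      proof (rule imm_open_map[OF s(1)])
        show "open (ball z0 r \<inter> g -` (B \<inter> ball a \<epsilon>))"
          by (rule continuous_open_preimage[OF continuous_on_subset[OF holomorphic_on_imp_continuous_on[OF ghol] r(2)]]) (use B in auto)
      qed (use r(2) in \<open>auto simp: N_def\<close>)
      ultimately show "open ((\<lambda>x. the (ratio C p E x)) -` B \<inter> V)" by simp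
    qed
  qed (use rm in \<open>auto simp: V_def\<close>)
  have cc: "compact (closure V)"
  proof -
    have "closure V \<subseteq> m ` cball a \<epsilon>" by (rule closure_minimal[OF _ Kcl]) (use sub in \<open>auto simp: V_def\<close>)
    then have "closure V = m ` cball a \<epsilon> \<inter> closure V" by blast
    then show ?thesis using compact_Int_closed[OF Kc closed_closure, of V] by simp
  qed
  \<comment> \<open>Every value has exactly one preimage in V, and it is simple because
    \<open>g\<close> has nonzero derivative on the whole disk.\<close>
  have mult: "island_multiplicity (lift_atlas C p) (ratio C p E) (ball a \<epsilon>) V 1"
    unfolding island_multiplicity_def
  proof
    fix v assume v: "v \<in> ball a \<epsilon>"
    have eq: "{x \<in> V. ratio C p E x = Some v} = {m v}" using v rm by (auto simp: V_def)
    have vc: "v \<in> cball a \<epsilon>" using v by auto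
    have "deriv g (k v) \<noteq> 0" using k(2)[OF kb(1)[OF vc]] by auto
    then have "wronskian_along E \<sigma> (k v) \<noteq> 0" using gder[OF kN[OF vc]] by auto
    then have "value_multiplicity (lift_atlas C p) (ratio C p E) (m v) = 1"
      unfolding m_def using kN[OF vc] by (intro value_multiplicity_1[OF s(1)]) (auto simp: N_def)
    then show "finite {x \<in> V. ratio C p E x = Some v} \<and>
        sum (value_multiplicity (lift_atlas C p) (ratio C p E)) {x \<in> V. ratio C p E x = Some v} = 1"
      unfolding eq by simp
  qed
  have "simple_island (lift_atlas C p) (ratio C p E) {z. cmod (z - a) < \<epsilon>} V"
    unfolding Deq simple_island_def island_def by (intro conjI comp sc cc mult)
  then have "\<exists>V. simple_island (lift_atlas C p) (ratio C p E) {z. cmod (z - a) < \<epsilon>} V" by (rule exI)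
  with \<epsilon>(1) show ?thesis by (intro exI[of _ \<epsilon>] conjI)
qed

end

section \<open>The conformal metric on the base surface\<close>

text \<open>The speed of \<phi> in the metric |\<omega>|^2 + |\<theta>|^2, pulled back to the
  universal cover.\<close>

definition spd :: "('b \<Rightarrow> mat2) \<Rightarrow> (complex \<Rightarrow> 'b) \<Rightarrow> complex \<Rightarrow> real" where
  "spd E \<phi> z = sqrt ((cmod (omf E \<phi> z))\<^sup>2 + (cmod (thf E \<phi> z))\<^sup>2)"

text \<open>The matrix F^{-1} G is unitary and preserves \<open>e3\<close>. Sum and difference of
  the two resulting equations for each row show that it is diagonal with entries of modulus 1, and
  determinant 1 makes the second entry the conjugate of the first. This is the freedom of the lift
  over one point.\<close>

lemma unitary_diagonal:
  fixes F G :: mat2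
  assumes F: "det F = 1" and G: "det G = 1" and 1: "F ** adjoint_mat F = G ** adjoint_mat G"
    and 2: "F ** e3 ** adjoint_mat F = G ** e3 ** adjoint_mat G"
  defines "u \<equiv> F $ 2 $ 2 * G $ 1 $ 1 - F $ 1 $ 2 * G $ 2 $ 1"
  shows "cmod u = 1" "G $ i $ 1 = F $ i $ 1 * u" "G $ i $ 2 = F $ i $ 2 * cnj u"
proof -
  define U where "U = matrix_inv F ** G"
  note inv = det1_inverse[OF F]
  have FU: "F ** U = G" using inv(2) by (simp add: U_def matrix_mul_assoc)
  have adj1: "adjoint_mat (mat 1) = mat 1" by (simp add: mat2_eq_iff mat_def)
  have "U ** adjoint_mat U = matrix_inv F ** (G ** adjoint_mat G) ** adjoint_mat (matrix_inv F)"
    by (simp add: U_def adjoint_mult matrix_mul_assoc)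
  also have "\<dots> = (matrix_inv F ** F) ** adjoint_mat (matrix_inv F ** F)"
    unfolding 1[symmetric] by (simp add: adjoint_mult matrix_mul_assoc)
  finally have UU: "U ** adjoint_mat U = mat 1" by (simp add: inv(1) adj1)
  have "U ** e3 ** adjoint_mat U = matrix_inv F ** (G ** e3 ** adjoint_mat G) ** adjoint_mat (matrix_inv F)"
    by (simp add: U_def adjoint_mult matrix_mul_assoc)
  also have "\<dots> = (matrix_inv F ** F) ** e3 ** adjoint_mat (matrix_inv F ** F)"
    unfolding 2[symmetric] by (simp add: adjoint_mult matrix_mul_assoc)
  finally have Ue: "U ** e3 ** adjoint_mat U = e3" by (simp add: inv(1) adj1)
  have sq: "w * cnj w = of_real ((cmod w)\<^sup>2)" for w by (simp only: complex_norm_square)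
  have e: "of_real ((cmod (U $ i $ 1))\<^sup>2) + of_real ((cmod (U $ i $ 2))\<^sup>2) = (1::complex)"
    "of_real ((cmod (U $ i $ 1))\<^sup>2) - of_real ((cmod (U $ i $ 2))\<^sup>2) = e3 $ i $ i" for i
  proof -
    have "(U ** adjoint_mat U) $ i $ i = 1" unfolding UU by (simp add: mat_def)
    then show "of_real ((cmod (U $ i $ 1))\<^sup>2) + of_real ((cmod (U $ i $ 2))\<^sup>2) = (1::complex)"
      unfolding mat2_mult_nth adjoint_nth sq .
    have "(U ** e3 ** adjoint_mat U) $ i $ i = e3 $ i $ i" unfolding Ue ..
    then show "of_real ((cmod (U $ i $ 1))\<^sup>2) - of_real ((cmod (U $ i $ 2))\<^sup>2) = e3 $ i $ i"
      by (simp add: mat2_mult_nth e3_entries sq[symmetric] del: of_real_power)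
  qed
  have re: "(cmod (U $ i $ 1))\<^sup>2 + (cmod (U $ i $ 2))\<^sup>2 = 1" "(cmod (U $ i $ 1))\<^sup>2 - (cmod (U $ i $ 2))\<^sup>2 = Re (e3 $ i $ i)" for i
    using arg_cong[OF e(1)[of i], of Re] arg_cong[OF e(2)[of i], of Re] by simp_all
  have "(cmod (U $ 1 $ 2))\<^sup>2 = 0" "(cmod (U $ 1 $ 1))\<^sup>2 = 1" "(cmod (U $ 2 $ 1))\<^sup>2 = 0"
  proof -
    have "(cmod (U $ 1 $ 1))\<^sup>2 + (cmod (U $ 1 $ 2))\<^sup>2 = 1" "(cmod (U $ 1 $ 1))\<^sup>2 - (cmod (U $ 1 $ 2))\<^sup>2 = 1"
      "(cmod (U $ 2 $ 1))\<^sup>2 + (cmod (U $ 2 $ 2))\<^sup>2 = 1" "(cmod (U $ 2 $ 1))\<^sup>2 - (cmod (U $ 2 $ 2))\<^sup>2 = - 1"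
      using re[of 1] re[of 2] by (simp_all add: e3_entries)
    then show "(cmod (U $ 1 $ 2))\<^sup>2 = 0" "(cmod (U $ 1 $ 1))\<^sup>2 = 1" "(cmod (U $ 2 $ 1))\<^sup>2 = 0" by linarith+
  qed
  then have U: "U $ 1 $ 2 = 0" "cmod (U $ 1 $ 1) = 1" "U $ 2 $ 1 = 0"
    using norm_ge_zero[of "U $ 1 $ 1"] by (auto simp: power2_eq_1_iff)
  have u: "U $ 1 $ 1 = u" by (simp add: U_def inverse_mat2[OF F] mat2_mult_nth u_def)
  have "det U = 1" using F G FU det_mul[of F U] by simp
  then have "u * U $ 2 $ 2 = 1" using U u by (simp add: det_2)
  moreover have "u * cnj u = 1" using U(2) u sq[of u] by simp
  ultimately have u2: "U $ 2 $ 2 = cnj u"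
  proof -
    assume a: "u * U $ 2 $ 2 = 1" and b: "u * cnj u = 1"
    have "U $ 2 $ 2 = U $ 2 $ 2 * (u * cnj u)" by (simp add: b)
    also have "\<dots> = (u * U $ 2 $ 2) * cnj u" by (simp only: mult_ac)
    finally show ?thesis by (simp add: a)
  qed
  show "cmod u = 1" using U(2) u by simp
  show "G $ i $ 1 = F $ i $ 1 * u" "G $ i $ 2 = F $ i $ 2 * cnj u"
    unfolding FU[symmetric] by (simp_all add: mat2_mult_nth U u u2)
qed

context canonical_front
begin

lemma spd_comp:
  assumes \<sigma>: "holm E \<sigma> V" and T: "T holomorphic_on B" "open B" "T ` B \<subseteq> V"
    and eq: "\<And>z. z \<in> B \<Longrightarrow> \<phi> z = \<sigma> (T z)" and z: "z \<in> B"
  shows "spd E \<phi> z = spd E \<sigma> (T z) * cmod (deriv T z)"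
proof -
  have "(cmod (omf E \<phi> z))\<^sup>2 + (cmod (thf E \<phi> z))\<^sup>2 = ((cmod (omf E \<sigma> (T z)))\<^sup>2 + (cmod (thf E \<sigma> (T z)))\<^sup>2) * (cmod (deriv T z))\<^sup>2"
    using holm_comp(3,4)[OF \<sigma> T eq z] by (simp add: norm_mult power_mult_distrib algebra_simps)
  then show ?thesis by (simp add: spd_def real_sqrt_mult)
qed

text \<open>The values of \<open>E\<close> along the two curves differ by a diagonal factor with
  entries u and its conjugate. Here u is holomorphic of modulus 1, hence locally constant by the
  maximum principle, and the forms are multiplied by the constants u^2 and its conjugate, of modulus
  1.\<close>

lemma spd_fibre:
  assumes \<phi>: "holm E \<phi> U" and \<psi>: "holm E \<psi> U" and eq: "\<And>w. w \<in> U \<Longrightarrow> p (\<phi> w) = p (\<psi> w)" and z: "z \<in> U"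
  shows "spd E \<phi> z = spd E \<psi> z"
proof -
  define u where "u w = E (\<phi> w) $ 2 $ 2 * E (\<psi> w) $ 1 $ 1 - E (\<phi> w) $ 1 $ 2 * E (\<psi> w) $ 2 $ 1" for w
  have U: "cmod (u w) = 1" "E (\<psi> w) $ i $ 1 = E (\<phi> w) $ i $ 1 * u w" "E (\<psi> w) $ i $ 2 = E (\<phi> w) $ i $ 2 * cnj (u w)"
    if w: "w \<in> U" for w i
  proof -
    have "E (\<phi> w) ** adjoint_mat (E (\<phi> w)) = E (\<psi> w) ** adjoint_mat (E (\<psi> w))"
      "E (\<phi> w) ** e3 ** adjoint_mat (E (\<phi> w)) = E (\<psi> w) ** e3 ** adjoint_mat (E (\<psi> w))"
      unfolding f_eq[symmetric] n_eq[symmetric] eq[OF w] by (rule refl)+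
    note ud = unitary_diagonal[OF E_det E_det this]
    show "cmod (u w) = 1" "E (\<psi> w) $ i $ 1 = E (\<phi> w) $ i $ 1 * u w" "E (\<psi> w) $ i $ 2 = E (\<phi> w) $ i $ 2 * cnj (u w)"
      unfolding u_def by (rule ud(1), rule ud(2), rule ud(3))
  qed
  obtain r where r: "0 < r" "ball z r \<subseteq> U" using holmD(1)[OF \<phi>] z open_contains_ball by blast
  have "u holomorphic_on ball z r"
    unfolding u_def[abs_def]
    by (intro holomorphic_intros holomorphic_on_subset[OF holmD(3)[OF \<phi>] r(2)] holomorphic_on_subset[OF holmD(3)[OF \<psi>] r(2)])
  then have "u constant_on ball z r"
    by (rule maximum_modulus_principle[of _ _ "ball z r" z]) (use r U(1) in \<open>auto simp: subset_iff\<close>)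
  then obtain v0 where v0: "\<And>w. w \<in> ball z r \<Longrightarrow> u w = v0" unfolding constant_on_def by blast
  define v where "v = u z"
  have uv: "u w = v" if "w \<in> ball z r" for w using v0[OF that] v0[of z] r(1) by (simp add: v_def)
  have v: "cmod v = 1" "\<And>w i. w \<in> ball z r \<Longrightarrow> E (\<psi> w) $ i $ 1 = E (\<phi> w) $ i $ 1 * v"
    "\<And>w i. w \<in> ball z r \<Longrightarrow> E (\<psi> w) $ i $ 2 = E (\<phi> w) $ i $ 2 * cnj v"
    using U(1)[OF z] U(2,3) uv r(2) by (auto simp: v_def)
  have zb: "z \<in> ball z r" using r by simp
  have ev: "\<forall>\<^sub>F w in nhds z. w \<in> ball z r" by (rule eventually_nhds_in_open[OF open_ball zb])
  have fd: "(\<lambda>w. E (\<phi> w) $ i $ j) field_differentiable at z" for i j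
    by (rule holomorphic_on_imp_differentiable_at[OF holmD(3)[OF \<phi>] holmD(1)[OF \<phi>] z])
  have d1: "deriv (\<lambda>w. E (\<psi> w) $ i $ 1) z = deriv (\<lambda>w. E (\<phi> w) $ i $ 1) z * v" for i
  proof -
    have "deriv (\<lambda>w. E (\<psi> w) $ i $ 1) z = deriv (\<lambda>w. E (\<phi> w) $ i $ 1 * v) z"
      by (rule deriv_cong_ev[OF eventually_mono[OF ev] refl]) (rule v(2))
    then show ?thesis using fd by simp
  qed
  have d2: "deriv (\<lambda>w. E (\<psi> w) $ i $ 2) z = deriv (\<lambda>w. E (\<phi> w) $ i $ 2) z * cnj v" for i
  proof -
    have "deriv (\<lambda>w. E (\<psi> w) $ i $ 2) z = deriv (\<lambda>w. E (\<phi> w) $ i $ 2 * cnj v) z"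
      by (rule deriv_cong_ev[OF eventually_mono[OF ev] refl]) (rule v(3))
    then show ?thesis using fd by simp
  qed
  have "omf E \<psi> z = omf E \<phi> z * (v * v)" "thf E \<psi> z = thf E \<phi> z * (cnj v * cnj v)"
    by (simp_all add: omf_def thf_def d1 d2 v(2,3)[OF zb] algebra_simps)
  then show ?thesis using v(1) by (simp add: spd_def norm_mult)
qed

lemma lift_chart_p:
  assumes d: "d \<in> lift_atlas {c} p" and c: "c \<in> C"
  shows "d \<in> lift_atlas C p" "\<And>x. snd d x = snd c (p x)" "\<And>w. w \<in> chart_image d \<Longrightarrow> p (chart_inv d w) = chart_inv c w"
    "p ` fst d \<subseteq> fst c"
proof -
  show dC: "d \<in> lift_atlas C p" using d c lift_atlas_mono[of "{c}" C] by blast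
  have s: "snd d = snd c \<circ> p" "p ` fst d \<subseteq> fst c" using d by (auto simp: lift_atlas_iff)
  show "snd d x = snd c (p x)" for x by (simp add: s)
  show "p ` fst d \<subseteq> fst c" by fact
  fix w assume w: "w \<in> chart_image d"
  have "chart_inv d w \<in> fst d" "snd d (chart_inv d w) = w"
    by (rule lift_chart(7)[OF dC w], rule lift_chart(6)[OF dC w])
  then have "p (chart_inv d w) \<in> fst c" "snd c (p (chart_inv d w)) = w" using s by auto
  then show "p (chart_inv d w) = chart_inv c w" using base_chart(5)[OF c] by metis
qed

text \<open>\<open>ds11\<close> evaluates the metric at an arbitrary point of the fibre and in an
  arbitrary chart there; \<open>spd_fibre\<close> moves the evaluation to a chart around
  \<phi>(z).\<close>

lemma ds11_eq:
  assumes c: "c \<in> C" and \<phi>: "holm E \<phi> U" "z \<in> U" and q: "p (\<phi> z) \<in> fst c"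
  shows "ds11 p E c (p (\<phi> z)) * cmod (deriv (\<lambda>w. snd c (p (\<phi> w))) z) = spd E \<phi> z"
    "(\<lambda>w. snd c (p (\<phi> w))) field_differentiable at z"
proof -
  define x where "x = (SOME x. p x = p (\<phi> z))"
  have x: "p x = p (\<phi> z)" unfolding x_def by (rule someI) (rule refl)
  define d' where "d' = some_chart (lift_atlas {c} p) x"
  have "\<exists>d. d \<in> lift_atlas {c} p \<and> x \<in> fst d"
  proof -
    have "p x \<in> fst c" using x q by simp
    from lift_chart_ex[OF c this] show ?thesis by blast
  qed
  then have "d' \<in> lift_atlas {c} p \<and> x \<in> fst d'"
    unfolding d'_def some_chart_def by (rule someI_ex)
  then have d': "d' \<in> lift_atlas {c} p" "x \<in> fst d'" by auto
  obtain d where d: "d \<in> lift_atlas {c} p" "\<phi> z \<in> fst d" using lift_chart_ex[OF c q] by blast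
  note l = lift_chart[OF lift_chart_p(1)[OF d(1) c]] and l' = lift_chart[OF lift_chart_p(1)[OF d'(1) c]]
  have i: "imm E (chart_inv d) (chart_image d)" "holm E (chart_inv d) (chart_image d)" "holm E (chart_inv d') (chart_image d')"
    using lift_chart_imm(1)[OF lift_chart_p(1)[OF d(1) c]] lift_chart_imm(1)[OF lift_chart_p(1)[OF d'(1) c]] by (auto simp: imm_def)
  define w0 where "w0 = snd c (p (\<phi> z))"
  have w0: "w0 = snd d (\<phi> z)" "w0 = snd d' x" using lift_chart_p(2)[OF d(1) c] lift_chart_p(2)[OF d'(1) c] x by (auto simp: w0_def)
  have wi: "w0 \<in> chart_image d" "w0 \<in> chart_image d'" using w0 l(8)[OF d(2)] l'(8)[OF d'(2)] by auto
  let ?I = "chart_image d \<inter> chart_image d'"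
  have oI: "open ?I" using l(2) l'(2) by auto
  have same: "spd E (chart_inv d) w0 = spd E (chart_inv d') w0"
    by (rule spd_fibre[OF holm_subset[OF i(2) oI] holm_subset[OF i(3) oI]])
      (use lift_chart_p(3)[OF d(1) c] lift_chart_p(3)[OF d'(1) c] wi in auto)
  have ds: "ds11 p E c (p (\<phi> z)) = spd E (chart_inv d') w0"
    unfolding ds11_def x_def[symmetric] Let_def d'_def[symmetric] spd_def w0(2)
    by (simp add: canonical_forms_eq(1,2)[OF lift_chart_p(1)[OF d'(1) c] d'(2)])
  have e0: "\<phi> z = chart_inv d w0" using l(5)[OF d(2)] w0(1) by simp
  obtain \<delta> T where T: "0 < \<delta>" "ball z \<delta> \<subseteq> U" "T holomorphic_on ball z \<delta>" "T z = w0" "T ` ball z \<delta> \<subseteq> chart_image d"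
    "\<And>w. w \<in> ball z \<delta> \<Longrightarrow> \<phi> w = chart_inv d (T w)"
    by (rule holm_reparametrization[OF \<phi> i(1) wi(1) e0]) (erule that, (assumption | blast)+)
  have zb: "z \<in> ball z \<delta>" using T(1) by simp
  have Teq: "snd c (p (\<phi> w)) = T w" if w: "w \<in> ball z \<delta>" for w
  proof -
    have "T w \<in> chart_image d" using T(5) w by blast
    then show ?thesis using T(6)[OF w] lift_chart_p(2)[OF d(1) c, of "\<phi> w"] l(6)[of "T w"] by simp
  qed
  have Td: "(T has_field_derivative deriv T z) (at z)" by (rule holomorphic_derivI[OF T(3) open_ball zb])
  then have D: "((\<lambda>w. snd c (p (\<phi> w))) has_field_derivative deriv T z) (at z)"
    by (rule has_field_derivative_transform_within_open[OF _ open_ball zb]) (simp add: Teq)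
  then show "(\<lambda>w. snd c (p (\<phi> w))) field_differentiable at z" by (auto simp: field_differentiable_def)
  show "ds11 p E c (p (\<phi> z)) * cmod (deriv (\<lambda>w. snd c (p (\<phi> w))) z) = spd E \<phi> z"
    unfolding DERIV_imp_deriv[OF D] ds same[symmetric]
    using spd_comp[OF i(2) T(3) open_ball T(5) T(6) zb] T(4) by simp
qed

lemma ds11_nonneg: "0 \<le> ds11 p E c q"
  by (simp add: ds11_def Let_def)

lemma spd_pos: "\<lbrakk>imm E \<phi> U; z \<in> U\<rbrakk> \<Longrightarrow> 0 < spd E \<phi> z"
  by (auto simp: spd_def imm_def sum_power2_gt_zero_iff)

lemma continuous_on_spd: "holm E \<phi> U \<Longrightarrow> continuous_on U (spd E \<phi>)"
  unfolding spd_def[abs_def]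
  by (intro continuous_intros holomorphic_on_imp_continuous_on holomorphic_thf_omf)

text \<open>\<open>ds11\<close> chooses a fibre point separately for every point of the base.
  Locally, however, it is the speed of the inverse of one lifted chart, which makes its continuity
  and positivity visible.\<close>

lemma ds11_chart:
  assumes c: "c \<in> C" and w: "w \<in> chart_image c"
  obtains d r where "d \<in> lift_atlas {c} p" "0 < r" "ball w r \<subseteq> chart_image d" "ball w r \<subseteq> chart_image c"
    "\<And>v. v \<in> ball w r \<Longrightarrow> ds11 p E c (chart_inv c v) = spd E (chart_inv d) v"
proof -
  have q: "chart_inv c w \<in> fst c" "snd c (chart_inv c w) = w"
    by (rule base_chart(7)[OF c w], rule base_chart(6)[OF c w])
  have "chart_inv c w \<in> range p" using p_surj by simp
  then obtain x where x: "p x = chart_inv c w" by (metis imageE)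
  have "p x \<in> fst c" using x q(1) by simp
  then obtain d where d: "d \<in> lift_atlas {c} p" "x \<in> fst d" using lift_chart_ex[OF c, of x] by blast
  note lp = lift_chart_p[OF d(1) c]
  note l = lift_chart[OF lp(1)]
  have "w \<in> chart_image d" using l(8)[OF d(2)] lp(2)[of x] x q by simp
  then have "w \<in> chart_image d \<inter> chart_image c" using w by simp
  moreover have "open (chart_image d \<inter> chart_image c)" using l(2) base_chart(2)[OF c] by auto
  ultimately obtain r where r: "0 < r" "ball w r \<subseteq> chart_image d \<inter> chart_image c" using open_contains_ball by blast
  have h: "holm E (chart_inv d) (chart_image d)" using lift_chart_imm(1)[OF lp(1)] by (simp add: imm_def)
  show thesis
  proof (rule that[OF d(1) r(1)])
    show "ball w r \<subseteq> chart_image d" "ball w r \<subseteq> chart_image c" using r(2) by auto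
    fix v assume v: "v \<in> ball w r"
    then have vi: "v \<in> chart_image d" "v \<in> chart_image c" using r(2) by auto
    have pv: "p (chart_inv d u) = chart_inv c u" if "u \<in> chart_image d" for u using lp(3)[OF that] .
    have qf: "p (chart_inv d v) \<in> fst c" using pv[OF vi(1)] base_chart(7)[OF c vi(2)] by simp
    have "((\<lambda>u. u) has_field_derivative 1) (at v)" by (rule DERIV_ident)
    then have "((\<lambda>u. snd c (p (chart_inv d u))) has_field_derivative 1) (at v)"
      by (rule has_field_derivative_transform_within_open[OF _ open_ball v])
        (use r(2) pv base_chart(6)[OF c] in \<open>auto simp: subset_iff\<close>)
    then show "ds11 p E c (chart_inv c v) = spd E (chart_inv d) v"
      using ds11_eq(1)[OF c h vi(1) qf] pv[OF vi(1)] by (simp add: DERIV_imp_deriv)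
  qed
qed

lemma ds11_continuous_pos:
  assumes c: "c \<in> C"
  shows "continuous_on (chart_image c) (\<lambda>w. ds11 p E c (chart_inv c w))"
    "\<And>w. w \<in> chart_image c \<Longrightarrow> 0 < ds11 p E c (chart_inv c w)"
proof -
  have *: "isCont (\<lambda>w. ds11 p E c (chart_inv c w)) w \<and> 0 < ds11 p E c (chart_inv c w)" if w: "w \<in> chart_image c" for w
  proof -
    obtain d r where d: "d \<in> lift_atlas {c} p" "0 < r" "ball w r \<subseteq> chart_image d" "ball w r \<subseteq> chart_image c"
      "\<And>v. v \<in> ball w r \<Longrightarrow> ds11 p E c (chart_inv c v) = spd E (chart_inv d) v"
      by (rule ds11_chart[OF c w]) (erule that, (assumption | blast)+)
    have i: "imm E (chart_inv d) (ball w r)"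
      by (rule imm_subset[OF lift_chart_imm(1)[OF lift_chart_p(1)[OF d(1) c]] open_ball d(3)])
    have "continuous_on (ball w r) (\<lambda>v. ds11 p E c (chart_inv c v))"
      by (rule continuous_on_eq[OF continuous_on_spd]) (use i d(5) in \<open>auto simp: imm_def\<close>)
    then have "isCont (\<lambda>w. ds11 p E c (chart_inv c w)) w"
      using d(2) by (simp add: continuous_on_eq_continuous_at)
    then show ?thesis using spd_pos[OF i, of w] d(2,5) by simp
  qed
  show "continuous_on (chart_image c) (\<lambda>w. ds11 p E c (chart_inv c w))"
    using * by (auto intro: continuous_at_imp_continuous_on)
  show "0 < ds11 p E c (chart_inv c w)" if "w \<in> chart_image c" for w using *[OF that] by blast
qed

text \<open>The inverse of a chart lifted from \<open>c\<close> is a curve of speed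
  \<open>ds11 p E c\<close>; measuring the same curve in \<open>c0\<close> by \<open>ds11_eq\<close>
  gives the transformation rule.\<close>

lemma ds11_change:
  assumes c: "c \<in> C" "c0 \<in> C" and w: "w \<in> chart_image c" "chart_inv c w \<in> fst c0"
  shows "ds11 p E c (chart_inv c w) = ds11 p E c0 (chart_inv c w) * cmod (deriv (\<lambda>v. snd c0 (chart_inv c v)) w)"
    "(\<lambda>v. snd c0 (chart_inv c v)) field_differentiable at w"
proof -
  obtain d r where d: "d \<in> lift_atlas {c} p" "0 < r" "ball w r \<subseteq> chart_image d" "ball w r \<subseteq> chart_image c"
    "\<And>v. v \<in> ball w r \<Longrightarrow> ds11 p E c (chart_inv c v) = spd E (chart_inv d) v"
    by (rule ds11_chart[OF c(1) w(1)]) (erule that, (assumption | blast)+)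
  note lp = lift_chart_p[OF d(1) c(1)]
  have h: "holm E (chart_inv d) (chart_image d)" using lift_chart_imm(1)[OF lp(1)] by (simp add: imm_def)
  have wb: "w \<in> ball w r" using d(2) by simp
  then have wd: "w \<in> chart_image d" using d(3) by blast
  have qf: "p (chart_inv d w) \<in> fst c0" using lp(3)[OF wd] w(2) by simp
  note e = ds11_eq[OF c(2) h wd qf]
  have "((\<lambda>v. snd c0 (p (chart_inv d v))) has_field_derivative deriv (\<lambda>v. snd c0 (p (chart_inv d v))) w) (at w)"
    using e(2) by (simp add: DERIV_deriv_iff_field_differentiable)
  then have D: "((\<lambda>v. snd c0 (chart_inv c v)) has_field_derivative deriv (\<lambda>v. snd c0 (p (chart_inv d v))) w) (at w)"
    by (rule has_field_derivative_transform_within_open[OF _ open_ball wb]) (use lp(3) d(3) in \<open>auto simp: subset_iff\<close>)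
  show "ds11 p E c (chart_inv c w) = ds11 p E c0 (chart_inv c w) * cmod (deriv (\<lambda>v. snd c0 (chart_inv c v)) w)"
    using d(5)[OF wb] e(1) lp(3)[OF wd] DERIV_imp_deriv[OF D] by simp
  show "(\<lambda>v. snd c0 (chart_inv c v)) field_differentiable at w" using D by (auto simp: field_differentiable_def)
qed

section \<open>The length metric\<close>

abbreviation ds :: "'a chart \<Rightarrow> 'a \<Rightarrow> real" where "ds \<equiv> ds11 p E"
abbreviation joined :: "'a \<Rightarrow> 'a \<Rightarrow> real \<Rightarrow> bool" where "joined \<equiv> joined_with_length C ds"
abbreviation ldist :: "'a \<Rightarrow> 'a \<Rightarrow> real" where "ldist \<equiv> length_dist C ds"

lemma arc_integrand_continuous:
  assumes c: "c \<in> C" and \<gamma>: "\<gamma> C1_differentiable_on {a..b}" "\<gamma> ` {a..b} \<subseteq> chart_image c"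
  shows "continuous_on {a..b} (\<lambda>t. ds c (chart_inv c (\<gamma> t)) * norm (vector_derivative \<gamma> (at t)))"
proof -
  have 1: "continuous_on {a..b} (\<lambda>t. vector_derivative \<gamma> (at t))" and d: "\<And>t. t \<in> {a..b} \<Longrightarrow> \<gamma> differentiable at t"
    using \<gamma>(1) by (auto simp: C1_differentiable_on_eq)
  have "continuous_on {a..b} \<gamma>"
    using d differentiable_imp_continuous_within by (intro continuous_at_imp_continuous_on) blast
  then have "continuous_on {a..b} (\<lambda>t. ds c (chart_inv c (\<gamma> t)))"
    by (rule continuous_on_compose2[OF ds11_continuous_pos(1)[OF c]]) (rule \<gamma>(2))
  then show ?thesis by (intro continuous_intros 1)
qed

lemma arc_integral_nonneg:
  assumes "c \<in> C" "\<gamma> C1_differentiable_on {a..b}" "\<gamma> ` {a..b} \<subseteq> chart_image c"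
  shows "0 \<le> integral {a..b} (\<lambda>t. ds c (chart_inv c (\<gamma> t)) * norm (vector_derivative \<gamma> (at t)))"
  by (intro integral_nonneg integrable_continuous_interval arc_integrand_continuous[OF assms] mult_nonneg_nonneg ds11_nonneg norm_ge_zero)

lemma joined_nonneg: "joined x y L \<Longrightarrow> 0 \<le> L"
proof (induction rule: joined_with_length.induct)
  case (2 x c \<gamma> a L b)
  then show ?case using arc_integral_nonneg[of c \<gamma> a b] by linarith
qed simp

text \<open>The induction runs over the second path, because \<open>joined_with_length\<close> adds
  arcs at the end.\<close>

lemma joined_append: "\<lbrakk>joined y z L2; joined x y L1\<rbrakk> \<Longrightarrow> joined x z (L1 + L2)"
proof (induction arbitrary: x L1 rule: joined_with_length.induct)
  case (2 y c \<gamma> a L b)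
  then have "joined x (chart_inv c (\<gamma> a)) (L1 + L)" by blast
  from joined_with_length.intros(2)[OF this 2(2-5)] show ?case by (simp add: add.assoc)
qed simp

lemma joined_arc:
  assumes "c \<in> C" "a \<le> b" "\<gamma> C1_differentiable_on {a..b}" "\<gamma> ` {a..b} \<subseteq> chart_image c"
  shows "joined (chart_inv c (\<gamma> a)) (chart_inv c (\<gamma> b)) (integral {a..b} (\<lambda>t. ds c (chart_inv c (\<gamma> t)) * norm (vector_derivative \<gamma> (at t))))"
  using joined_with_length.intros(2)[OF joined_with_length.intros(1) assms] by simp

lemma joined_reverse_arc:
  assumes c: "c \<in> C" and ab: "a \<le> b" and \<gamma>: "\<gamma> C1_differentiable_on {a..b}" "\<gamma> ` {a..b} \<subseteq> chart_image c"
  shows "joined (chart_inv c (\<gamma> b)) (chart_inv c (\<gamma> a)) (integral {a..b} (\<lambda>t. ds c (chart_inv c (\<gamma> t)) * norm (vector_derivative \<gamma> (at t))))"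
proof -
  obtain D where D: "\<And>x. x \<in> {a..b} \<Longrightarrow> (\<gamma> has_vector_derivative D x) (at x)" "continuous_on {a..b} D"
    using \<gamma>(1) unfolding C1_differentiable_on_def by blast
  define \<delta> where "\<delta> t = \<gamma> (- t)" for t
  have vd: "(\<delta> has_vector_derivative - D (- t)) (at t)" if t: "t \<in> {- b..- a}" for t
  proof -
    have m: "((\<lambda>t::real. - t) has_vector_derivative - 1) (at t)"
      by (auto intro!: derivative_eq_intros)
    have "- t \<in> {a..b}" using t by auto
    from vector_diff_chain_at[OF m D(1)[OF this]] show ?thesis by (simp add: o_def \<delta>_def[abs_def])
  qed
  have "continuous_on {- b..- a} (\<lambda>t. - D (- t))"
  proof (rule continuous_on_minus)
    show "continuous_on {- b..- a} (\<lambda>t. D (- t))"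
    proof (rule continuous_on_compose2[OF D(2)])
      show "continuous_on {- b..- a} (\<lambda>t::real. - t)" by (rule continuous_on_minus[OF continuous_on_id])
      show "(\<lambda>t. - t) ` {- b..- a} \<subseteq> {a..b}" by (simp only: image_subset_iff atLeastAtMost_iff) simp
    qed
  qed
  then have C1: "\<delta> C1_differentiable_on {- b..- a}"
    unfolding C1_differentiable_on_def by (intro exI conjI ballI) (rule vd, assumption)
  have im: "\<delta> ` {- b..- a} \<subseteq> chart_image c"
  proof
    fix w assume "w \<in> \<delta> ` {- b..- a}"
    then obtain t where "t \<in> {- b..- a}" "w = \<gamma> (- t)" by (auto simp: \<delta>_def)
    then have "- t \<in> {a..b}" "w = \<gamma> (- t)" by auto
    then show "w \<in> chart_image c" using \<gamma>(2) by blast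
  qed
  have "integral {- b..- a} (\<lambda>t. ds c (chart_inv c (\<delta> t)) * norm (vector_derivative \<delta> (at t)))
      = integral {- b..- a} (\<lambda>t. ds c (chart_inv c (\<gamma> (- t))) * norm (vector_derivative \<gamma> (at (- t))))"
  proof (rule integral_cong)
    fix t assume t: "t \<in> {- b..- a}"
    then have "- t \<in> {a..b}" by auto
    then show "ds c (chart_inv c (\<delta> t)) * norm (vector_derivative \<delta> (at t)) = ds c (chart_inv c (\<gamma> (- t))) * norm (vector_derivative \<gamma> (at (- t)))"
      by (simp add: vector_derivative_at[OF vd[OF t]] vector_derivative_at[OF D(1)] \<delta>_def)
  qed
  also have "\<dots> = integral {a..b} (\<lambda>t. ds c (chart_inv c (\<gamma> t)) * norm (vector_derivative \<gamma> (at t)))"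
    using Henstock_Kurzweil_Integration.integral_reflect_real[where f = "\<lambda>t. ds c (chart_inv c (\<gamma> t)) * norm (vector_derivative \<gamma> (at t))"]
    by (simp only:)
  finally show ?thesis
    using joined_arc[OF c _ C1 im] ab unfolding \<delta>_def by simp
qed

lemma joined_sym: "joined x y L \<Longrightarrow> joined y x L"
proof (induction rule: joined_with_length.induct)
  case (1 x)
  show ?case by (rule joined_with_length.intros(1))
next
  case (2 x c \<gamma> a L b)
  from joined_append[OF 2(6) joined_reverse_arc[OF 2(2-5)]] show ?case by (simp add: add.commute)
qed

text \<open>By \<open>ds11_change\<close> the integrand of the length is the density of
  \<open>c0\<close> times the speed of the \<open>c0\<close>-coordinate. That density is at least m,
  and the displacement is the integral of the velocity.\<close>

lemma arc_displacement:
  assumes c: "c \<in> C" "c0 \<in> C" and ab: "a \<le> b" and \<gamma>: "\<gamma> C1_differentiable_on {a..b}" "\<gamma> ` {a..b} \<subseteq> chart_image c"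
    and m: "0 < m" "\<And>t. t \<in> {a..b} \<Longrightarrow> chart_inv c (\<gamma> t) \<in> fst c0 \<and> m \<le> ds c0 (chart_inv c (\<gamma> t))"
  shows "m * cmod (snd c0 (chart_inv c (\<gamma> b)) - snd c0 (chart_inv c (\<gamma> a)))
     \<le> integral {a..b} (\<lambda>t. ds c (chart_inv c (\<gamma> t)) * norm (vector_derivative \<gamma> (at t)))"
proof -
  let ?F = "\<lambda>t. ds c (chart_inv c (\<gamma> t)) * norm (vector_derivative \<gamma> (at t))"
  let ?\<tau> = "\<lambda>v. snd c0 (chart_inv c v)"
  let ?s = "\<lambda>t. vector_derivative \<gamma> (at t) * deriv ?\<tau> (\<gamma> t)"
  have gi: "\<gamma> t \<in> chart_image c" if "t \<in> {a..b}" for t using \<gamma>(2) that by blast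
  have "((\<lambda>t. ?\<tau> (\<gamma> t)) has_vector_derivative ?s t) (at t within {a..b})" if t: "t \<in> {a..b}" for t
  proof -
    have "\<gamma> differentiable at t" using \<gamma>(1) t by (simp add: C1_differentiable_on_eq)
    then have v: "(\<gamma> has_vector_derivative vector_derivative \<gamma> (at t)) (at t)" by (simp add: vector_derivative_works)
    have "(?\<tau> has_field_derivative deriv ?\<tau> (\<gamma> t)) (at (\<gamma> t))"
      using ds11_change(2)[OF c gi[OF t]] m(2)[OF t] by (simp add: DERIV_deriv_iff_field_differentiable)
    from field_vector_diff_chain_at[OF v this] show ?thesis
      by (simp add: o_def has_vector_derivative_at_within)
  qed
  then have fi: "(?s has_integral ?\<tau> (\<gamma> b) - ?\<tau> (\<gamma> a)) {a..b}"
    by (rule fundamental_theorem_of_calculus[OF ab])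
  have Fi: "?F integrable_on {a..b}"
    by (rule integrable_continuous_interval[OF arc_integrand_continuous[OF c(1) \<gamma>]])
  have "norm (integral {a..b} ?s) \<le> integral {a..b} (\<lambda>t. ?F t / m)"
  proof (rule integral_norm_bound_integral)
    show "?s integrable_on {a..b}" using fi by (rule has_integral_integrable)
    show "(\<lambda>t. ?F t / m) integrable_on {a..b}"
      using m(1) by (intro integrable_continuous_interval continuous_on_divide continuous_on_const arc_integrand_continuous[OF c(1) \<gamma>]) simp
    fix t assume t: "t \<in> {a..b}"
    have "m * norm (?s t) = norm (vector_derivative \<gamma> (at t)) * (m * norm (deriv ?\<tau> (\<gamma> t)))" by (simp add: norm_mult)
    also have "\<dots> \<le> norm (vector_derivative \<gamma> (at t)) * (ds c0 (chart_inv c (\<gamma> t)) * norm (deriv ?\<tau> (\<gamma> t)))"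
      using m(2)[OF t] by (intro mult_left_mono mult_right_mono) auto
    also have "\<dots> = ?F t" using ds11_change(1)[OF c gi[OF t]] m(2)[OF t] by simp
    finally show "norm (?s t) \<le> ?F t / m" using m(1) by (simp add: field_simps)
  qed
  then have "cmod (?\<tau> (\<gamma> b) - ?\<tau> (\<gamma> a)) \<le> integral {a..b} ?F / m"
    using integral_unique[OF fi] by simp
  then show ?thesis using m(1) by (simp add: field_simps)
qed

text \<open>On a small coordinate disk of radius r about \<open>y\<close> the density has a positive
  lower bound m, so a path that leaves the disk has length at least m r.\<close>

lemma short_path_stays:
  assumes N: "open N" "y \<in> N"
  shows "\<exists>\<delta>>0. \<forall>z L. joined y z L \<longrightarrow> L < \<delta> \<longrightarrow> z \<in> N"
proof -
  obtain c0 where c0: "c0 \<in> C" "y \<in> fst c0" using base_chart_ex by blast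
  note b0 = base_chart[OF c0(1)]
  define \<zeta> where "\<zeta> = snd c0 y"
  have "open (chart_image c0 \<inter> chart_inv c0 -` N)" by (rule continuous_open_preimage[OF b0(4,2) N(1)])
  moreover have "\<zeta> \<in> chart_image c0 \<inter> chart_inv c0 -` N"
    using b0(8)[OF c0(2)] b0(5)[OF c0(2)] N(2) by (simp add: \<zeta>_def)
  ultimately obtain r where r: "0 < r" "cball \<zeta> r \<subseteq> chart_image c0 \<inter> chart_inv c0 -` N"
    unfolding open_contains_cball by blast
  have cb: "cball \<zeta> r \<subseteq> chart_image c0" using r(2) by blast
  obtain m where m: "0 < m" "\<And>w. w \<in> cball \<zeta> r \<Longrightarrow> m \<le> ds c0 (chart_inv c0 w)"
  proof -
    have "cball \<zeta> r \<noteq> {}" using r(1) by simp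
    then obtain w0 where "w0 \<in> cball \<zeta> r" "\<And>w. w \<in> cball \<zeta> r \<Longrightarrow> ds c0 (chart_inv c0 w0) \<le> ds c0 (chart_inv c0 w)"
      using continuous_attains_inf[OF compact_cball _ continuous_on_subset[OF ds11_continuous_pos(1)[OF c0(1)] cb]] by blast
    moreover from this have "0 < ds c0 (chart_inv c0 w0)" using ds11_continuous_pos(2)[OF c0(1)] cb by blast
    ultimately show thesis using that by blast
  qed
  define B where "B = {q. q \<in> fst c0 \<and> cmod (snd c0 q - \<zeta>) < r}"
  have BN: "q \<in> N" and Bm: "m \<le> ds c0 q" and Bf: "q \<in> fst c0" if q: "q \<in> B" for q
  proof -
    have f: "q \<in> fst c0" "snd c0 q \<in> cball \<zeta> r" using q by (auto simp: B_def dist_norm norm_minus_commute)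
    then show "q \<in> N" "m \<le> ds c0 q" "q \<in> fst c0" using r(2) m(2)[OF f(2)] b0(5)[OF f(1)] by auto
  qed
  \<comment> \<open>The invariant for the induction over arcs: either the length m r is used up
    already, or the path still ends in the disk \<open>B\<close> and has paid for its
    displacement.\<close>
  have main: "m * r \<le> L \<or> (z \<in> B \<and> m * cmod (snd c0 z - \<zeta>) \<le> L)" if "joined y' z L" "y' = y" for y' z L
    using that
  proof (induction rule: joined_with_length.induct)
    case (1 x)
    then show ?case using c0(2) r(1) by (simp add: B_def \<zeta>_def)
  next
    case (2 x c \<gamma> a L b)
    let ?F = "\<lambda>t. ds c (chart_inv c (\<gamma> t)) * norm (vector_derivative \<gamma> (at t))"
    let ?I = "integral {a..b} ?F"
    let ?q = "\<lambda>t. chart_inv c (\<gamma> t)"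
    show ?case
    proof -
      note I0 = arc_integral_nonneg[OF 2(2,4,5)]
      have IH: "m * r \<le> L \<or> (?q a \<in> B \<and> m * cmod (snd c0 (?q a) - \<zeta>) \<le> L)" using 2(6,7) by blast
      have Fi: "?F integrable_on {a..b}"
        by (rule integrable_continuous_interval[OF arc_integrand_continuous[OF 2(2,4,5)]])
      have sub: "m * cmod (snd c0 (?q t) - \<zeta>) \<le> L + ?I"
        if IHa: "m * cmod (snd c0 (?q a) - \<zeta>) \<le> L" and t: "t \<in> {a..b}" and st: "\<And>s. s \<in> {a..t} \<Longrightarrow> ?q s \<in> B" for t
      proof -
        have ts: "{a..t} \<subseteq> {a..b}" using t by auto
        have "m * cmod (snd c0 (?q t) - snd c0 (?q a)) \<le> integral {a..t} ?F"
        proof (rule arc_displacement[OF 2(2) c0(1)])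
          show "\<gamma> C1_differentiable_on {a..t}" using 2(4) ts by (rule C1_differentiable_on_subset)
          show "\<gamma> ` {a..t} \<subseteq> chart_image c" using 2(5) ts by blast
        qed (use t m(1) st Bm Bf in auto)
        also have "\<dots> \<le> ?I"
          by (rule integral_subset_le[OF ts integrable_on_subinterval[OF Fi ts] Fi]) (simp add: ds11_nonneg)
        finally have "m * cmod (snd c0 (?q t) - snd c0 (?q a)) \<le> ?I" .
        moreover have "m * cmod (snd c0 (?q t) - \<zeta>) \<le> m * (cmod (snd c0 (?q t) - snd c0 (?q a)) + cmod (snd c0 (?q a) - \<zeta>))"
          using m(1) norm_triangle_ineq[of "snd c0 (?q t) - snd c0 (?q a)" "snd c0 (?q a) - \<zeta>"] by (intro mult_left_mono) auto
        ultimately show ?thesis using IHa by (simp add: distrib_left)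
      qed
      show "m * r \<le> L + ?I \<or> (?q b \<in> B \<and> m * cmod (snd c0 (?q b) - \<zeta>) \<le> L + ?I)"
      proof (cases "m * r \<le> L")
        case True
        then show ?thesis using I0 by linarith
      next
        case False
        then have qa: "?q a \<in> B" "m * cmod (snd c0 (?q a) - \<zeta>) \<le> L" using IH by auto
        show ?thesis
        proof (cases "\<forall>t\<in>{a..b}. ?q t \<in> B")
          case True
          then show ?thesis using sub[OF qa(2), of b] 2(3) by auto
        next
          case False
          have qc: "continuous_on {a..b} ?q"
          proof (rule continuous_on_compose2[OF base_chart(4)[OF 2(2)] _ 2(5)])
            show "continuous_on {a..b} \<gamma>"
              using 2(4) differentiable_imp_continuous_within
              by (intro continuous_at_imp_continuous_on) (auto simp: C1_differentiable_on_eq)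
          qed
          have Bo: "open B"
          proof -
            have "B = chart_inv c0 ` ball \<zeta> r"
            proof (intro equalityI subsetI)
              fix q assume "q \<in> B"
              then have "q \<in> fst c0" "snd c0 q \<in> ball \<zeta> r" by (auto simp: B_def dist_norm norm_minus_commute)
              then show "q \<in> chart_inv c0 ` ball \<zeta> r" using b0(5) by (metis image_eqI)
            next
              fix q assume "q \<in> chart_inv c0 ` ball \<zeta> r"
              then obtain w where w: "w \<in> ball \<zeta> r" "q = chart_inv c0 w" by blast
              then have "w \<in> chart_image c0" using cb by auto
              then show "q \<in> B" using w b0(6,7) by (simp add: B_def dist_norm norm_minus_commute)
            qed
            moreover have "fst c0 \<inter> snd c0 -` ball \<zeta> r = B" by (auto simp: B_def dist_norm norm_minus_commute)
            moreover have "open (fst c0 \<inter> snd c0 -` ball \<zeta> r)" by (rule continuous_open_preimage[OF b0(3,1)]) auto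
            ultimately show ?thesis by simp
          qed
          \<comment> \<open>The infimum of \<open>K\<close> is the first time at which the arc is
            outside \<open>B\<close>.\<close>
          define K where "K = {a..b} \<inter> ?q -` (- B)"
          have Kc: "closed K" unfolding K_def
            by (rule continuous_closed_preimage[OF qc]) (use Bo in auto)
          have Kne: "K \<noteq> {}" using False by (auto simp: K_def)
          have Kb: "bdd_below K" by (auto simp: K_def bdd_below_def)
          define \<tau> where "\<tau> = Inf K"
          have tK: "\<tau> \<in> K" unfolding \<tau>_def by (rule closed_contains_Inf[OF Kne Kb Kc])
          have tb: "\<tau> \<in> {a..b}" "?q \<tau> \<notin> B" using tK by (auto simp: K_def)
          have before: "?q s \<in> B" if "s \<in> {a..b}" "s < \<tau>" for s
          proof (rule ccontr)
            assume "?q s \<notin> B"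
            then have "s \<in> K" using that by (simp add: K_def)
            then have "\<tau> \<le> s" unfolding \<tau>_def using Kb by (rule cInf_lower)
            then show False using that by simp
          qed
          have at: "a < \<tau>" using tb qa(1) by (cases "a = \<tau>") auto
          \<comment> \<open>At the exit time the point may lie outside the domain of
            \<open>c0\<close> and have no coordinate, so the estimate is made before it and for r' <
            r. If the length were below m r', the arc before the exit would stay in the compact
            image of the closed disk of radius r', and so would the exit point, which would then be
            in \<open>B\<close>.\<close>
          have key: "m * r' \<le> L + ?I" if r': "r' < r" for r'
          proof (rule ccontr)
            assume c: "\<not> m * r' \<le> L + ?I"
            have small: "?q s \<in> chart_inv c0 ` cball \<zeta> r'" if s: "s \<in> {a..<\<tau>}" for s
            proof -
              have sb: "s \<in> {a..b}" using s tb(1) by auto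
              have "m * cmod (snd c0 (?q s) - \<zeta>) \<le> L + ?I"
                by (rule sub[OF qa(2) sb]) (use before s tb(1) in auto)
              then have "m * cmod (snd c0 (?q s) - \<zeta>) < m * r'" using c by linarith
              then have "cmod (snd c0 (?q s) - \<zeta>) < r'" using m(1) by simp
              moreover have "?q s \<in> fst c0" using Bf before[OF sb] s by simp
              ultimately show ?thesis using b0(5)[of "?q s"]
                by (intro image_eqI[of _ _ "snd c0 (?q s)"]) (auto simp: dist_norm norm_minus_commute)
            qed
            have "compact (chart_inv c0 ` cball \<zeta> r')"
              by (rule compact_continuous_image[OF continuous_on_subset[OF b0(4)] compact_cball]) (use cb r' in auto)
            then have cl: "closed (chart_inv c0 ` cball \<zeta> r')" by (rule compact_imp_closed)
            have "continuous_on {a..\<tau>} ?q" by (rule continuous_on_subset[OF qc]) (use tb in auto)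
            then have "closed ({a..\<tau>} \<inter> ?q -` (chart_inv c0 ` cball \<zeta> r'))" by (rule continuous_closed_preimage[OF _ closed_atLeastAtMost cl])
            moreover have "{a..<\<tau>} \<subseteq> {a..\<tau>} \<inter> ?q -` (chart_inv c0 ` cball \<zeta> r')" using small by auto
            ultimately have "closure {a..<\<tau>} \<subseteq> {a..\<tau>} \<inter> ?q -` (chart_inv c0 ` cball \<zeta> r')" by (metis closure_minimal)
            moreover have "\<tau> \<in> closure {a..<\<tau>}" using at by simp
            ultimately have "?q \<tau> \<in> chart_inv c0 ` cball \<zeta> r'" by blast
            then obtain w where w: "w \<in> cball \<zeta> r'" "?q \<tau> = chart_inv c0 w" by blast
            then have "w \<in> chart_image c0" "cmod (w - \<zeta>) < r" using cb r' by (auto simp: dist_norm norm_minus_commute subset_iff)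
            then have "?q \<tau> \<in> B" using w(2) b0(6,7) by (simp add: B_def)
            then show False using tb(2) by simp
          qed
          have "r' \<le> (L + ?I) / m" if "r' < r" for r'
            using key[OF that] by (simp only: pos_le_divide_eq[OF m(1)] mult.commute)
          then have "r \<le> (L + ?I) / m" by (rule dense_le)
          then have "m * r \<le> L + ?I" by (simp only: pos_le_divide_eq[OF m(1)] mult.commute)
          then show ?thesis by (rule disjI1)
        qed
      qed
    qed
  qed
  show ?thesis
  proof (intro exI[of _ "m * r"] conjI allI impI)
    show "0 < m * r" using m r by simp
    fix z L assume "joined y z L" "L < m * r"
    then show "z \<in> N" using main[of y z L] BN by auto
  qed
qed

lemma joined_in_ball:
  assumes c: "c \<in> C" and r: "ball \<zeta> r \<subseteq> chart_image c" and w: "w \<in> ball \<zeta> r" "v \<in> ball \<zeta> r"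
  shows "\<exists>L. joined (chart_inv c w) (chart_inv c v) L"
proof -
  define \<gamma> where "\<gamma> t = w + of_real t * (v - w)" for t :: real
  have vd: "(\<gamma> has_vector_derivative v - w) (at t)" for t
    using has_vector_derivative_along_line[of "\<lambda>z. z" 1 w t "v - w"] by (simp add: \<gamma>_def[abs_def])
  have C1: "\<gamma> C1_differentiable_on {0..1}"
    unfolding C1_differentiable_on_def using vd by (intro exI[of _ "\<lambda>_. v - w"]) auto
  have "\<gamma> t \<in> ball \<zeta> r" if "t \<in> {0..1}" for t
  proof -
    have "\<gamma> t = (1 - t) *\<^sub>R w + t *\<^sub>R v" by (simp add: \<gamma>_def scaleR_conv_of_real algebra_simps)
    then show ?thesis using convexD[OF convex_ball w, of "1 - t" t] that by simp
  qed
  then have im: "\<gamma> ` {0..1} \<subseteq> chart_image c" using r by blast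
  have "joined (chart_inv c (\<gamma> 0)) (chart_inv c (\<gamma> 1)) (integral {0..1} (\<lambda>t. ds c (chart_inv c (\<gamma> t)) * norm (vector_derivative \<gamma> (at t))))"
    by (rule joined_arc[OF c _ C1 im]) simp
  then show ?thesis by (auto simp: \<gamma>_def)
qed

lemma chart_ball_neighbourhood:
  fixes q :: 'a
  obtains U where "open U" "q \<in> U" "\<And>x y. \<lbrakk>x \<in> U; y \<in> U\<rbrakk> \<Longrightarrow> \<exists>L. joined x y L"
proof -
  obtain c where c: "c \<in> C" "q \<in> fst c" using base_chart_ex by blast
  note b = base_chart[OF c(1)]
  obtain r where r: "0 < r" "ball (snd c q) r \<subseteq> chart_image c"
    using b(2) b(8)[OF c(2)] unfolding open_contains_ball by blast
  show thesis
  proof (rule that[of "fst c \<inter> snd c -` ball (snd c q) r"])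
    show "open (fst c \<inter> snd c -` ball (snd c q) r)" by (rule continuous_open_preimage[OF b(3,1)]) simp
    show "q \<in> fst c \<inter> snd c -` ball (snd c q) r" using c r by simp
    fix x y assume x: "x \<in> fst c \<inter> snd c -` ball (snd c q) r" and y: "y \<in> fst c \<inter> snd c -` ball (snd c q) r"
    then have "\<exists>L. joined (chart_inv c (snd c x)) (chart_inv c (snd c y)) L"
      by (intro joined_in_ball[OF c(1) r(2)]) (simp_all del: mem_ball)
    then show "\<exists>L. joined x y L" using x y b(5) by simp
  qed
qed

text \<open>Any two points of a small coordinate disk can be joined, so the set of points reachable
  from x is open and closed in the connected base.\<close>

lemma joined_ex: "\<exists>L. joined x y L"
proof -
  define R where "R = {y. \<exists>L. joined x y L}"
  have "open R"
  proof (subst open_subopen, intro ballI)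
    fix q assume q: "q \<in> R"
    obtain U where U: "open U" "q \<in> U" "\<And>x y. \<lbrakk>x \<in> U; y \<in> U\<rbrakk> \<Longrightarrow> \<exists>L. joined x y L"
      by (rule chart_ball_neighbourhood[of q]) (erule that, (assumption | blast)+)
    have "U \<subseteq> R"
    proof
      fix v assume "v \<in> U"
      obtain L1 where L1: "joined x q L1" using q by (auto simp: R_def)
      obtain L2 where "joined q v L2" using U(3)[OF U(2) \<open>v \<in> U\<close>] by blast
      then show "v \<in> R" unfolding R_def using joined_append L1 by blast
    qed
    then show "\<exists>T. open T \<and> q \<in> T \<and> T \<subseteq> R" using U by blast
  qed
  moreover have "open (- R)"
  proof (subst open_subopen, intro ballI)
    fix q assume q: "q \<in> - R"
    obtain U where U: "open U" "q \<in> U" "\<And>x y. \<lbrakk>x \<in> U; y \<in> U\<rbrakk> \<Longrightarrow> \<exists>L. joined x y L"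
      by (rule chart_ball_neighbourhood[of q]) (erule that, (assumption | blast)+)
    have "U \<subseteq> - R"
    proof
      fix v assume v: "v \<in> U"
      show "v \<in> - R"
      proof
        assume "v \<in> R"
        then obtain L1 where L1: "joined x v L1" by (auto simp: R_def)
        obtain L2 where "joined v q L2" using U(3)[OF v U(2)] by blast
        then have "q \<in> R" unfolding R_def using joined_append L1 by blast
        then show False using q by simp
      qed
    qed
    then show "\<exists>T. open T \<and> q \<in> T \<and> T \<subseteq> - R" using U by blast
  qed
  moreover have xR: "x \<in> R" using joined_with_length.intros(1)[of C ds x] unfolding R_def by blast
  ultimately have "R \<inter> UNIV = {} \<or> - R \<inter> UNIV = {}" by (intro connectedD[OF conn_base]) auto
  then have "R = UNIV" using xR by blast
  then show ?thesis by (auto simp: R_def)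
qed

lemma ldist_le: "joined x y L \<Longrightarrow> ldist x y \<le> L"
  unfolding length_dist_def
  by (rule cInf_lower) (auto intro!: bdd_belowI[of _ 0] joined_nonneg)

lemma ldist_less:
  assumes "ldist x y < r"
  shows "\<exists>L. joined x y L \<and> L < r"
proof -
  have "{L. joined x y L} \<noteq> {}" using joined_ex by simp
  from cInf_lessD[OF this, of r] show ?thesis using assms by (simp add: length_dist_def)
qed

lemma ldist_nonneg: "0 \<le> ldist x y"
  unfolding length_dist_def using joined_ex joined_nonneg by (intro cInf_greatest) auto

lemma ldist_triangle: "ldist x z \<le> ldist x y + ldist y z"
proof (rule field_le_epsilon)
  fix e :: real assume e: "0 < e"
  obtain L1 where L1: "joined x y L1" "L1 < ldist x y + e / 2" using ldist_less[of x y "ldist x y + e / 2"] e by auto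
  obtain L2 where L2: "joined y z L2" "L2 < ldist y z + e / 2" using ldist_less[of y z "ldist y z + e / 2"] e by auto
  show "ldist x z \<le> ldist x y + ldist y z + e"
    using ldist_le[OF joined_append[OF L2(1) L1(1)]] L1(2) L2(2) by linarith
qed

lemma ldist_commute: "ldist x y = ldist y x"
  unfolding length_dist_def by (rule arg_cong[where f = Inf]) (auto intro: joined_sym)

text \<open>Turns convergence in the length metric into convergence in the topology of the
  surface.\<close>

lemma ldist_small_nhd:
  assumes "open N" "y \<in> N"
  shows "\<exists>\<delta>>0. \<forall>z. ldist y z < \<delta> \<longrightarrow> z \<in> N"
proof -
  obtain \<delta> where \<delta>: "0 < \<delta>" "\<And>z L. joined y z L \<Longrightarrow> L < \<delta> \<Longrightarrow> z \<in> N" using short_path_stays[OF assms] by blast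
  have "z \<in> N" if z: "ldist y z < \<delta>" for z
  proof -
    obtain L where "joined y z L" "L < \<delta>" using ldist_less[OF z] by blast
    then show ?thesis by (rule \<delta>(2))
  qed
  then show ?thesis using \<delta>(1) by blast
qed

text \<open>Distinct points have positive distance, because \<open>ldist_small_nhd\<close> applies
  to the complement of a point, which is open in a Hausdorff space.\<close>

sublocale ld: Metric_space "UNIV :: 'a set" ldist
proof
  show "0 \<le> ldist x y" "ldist x y = ldist y x" for x y using ldist_nonneg ldist_commute by auto
  show "ldist x z \<le> ldist x y + ldist y z" for x y z by (rule ldist_triangle)
  show "ldist x y = 0 \<longleftrightarrow> x = y" for x y
  proof
    assume d: "ldist x y = 0"
    show "x = y"
    proof (rule ccontr)
      assume ne: "x \<noteq> y"
      have "open (- {y})" "x \<in> - {y}" using ne by (auto intro: open_Compl)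
      then obtain \<delta> where \<delta>: "0 < \<delta>" "\<And>z. ldist x z < \<delta> \<Longrightarrow> z \<in> - {y}"
        using ldist_small_nhd[of "- {y}" x] by blast
      have "y \<in> - {y}" by (rule \<delta>(2)) (use d \<delta>(1) in simp)
      then show False by simp
    qed
  next
    assume "x = y"
    then show "ldist x y = 0" using ldist_le[OF joined_with_length.intros(1)[of C ds x]] ldist_nonneg[of x x] by simp
  qed
qed

section \<open>Radii of finite length and their limits\<close>

lemma flow_arc_length:
  assumes \<phi>: "holm E \<phi> U" and c: "c \<in> C" and ab: "a \<le> b" and e: "cmod e = 1"
    and U: "\<And>t. t \<in> {a..b} \<Longrightarrow> t *\<^sub>R e \<in> U \<and> p (\<phi> (t *\<^sub>R e)) \<in> fst c"
  shows "ldist (p (\<phi> (a *\<^sub>R e))) (p (\<phi> (b *\<^sub>R e))) \<le> integral {a..b} (\<lambda>t. spd E \<phi> (t *\<^sub>R e))"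
proof -
  define K where "K w = snd c (p (\<phi> w))" for w
  define \<gamma> where "\<gamma> t = K (0 + of_real t * e)" for t :: real
  define U' where "U' = U \<inter> (\<lambda>w. p (\<phi> w)) -` fst c"
  have "continuous_on U (\<lambda>w. p (\<phi> w))"
    by (rule continuous_on_compose2[OF p_cont[of UNIV] holmD(2)[OF \<phi>]]) simp
  then have U': "open U'" unfolding U'_def
    by (rule continuous_open_preimage[OF _ holmD(1)[OF \<phi>] base_chart(1)[OF c]])
  have Kd: "K field_differentiable at w" if "w \<in> U'" for w
    unfolding K_def[abs_def] using that by (intro ds11_eq(2)[OF c \<phi>]) (auto simp: U'_def)
  then have Khol: "K holomorphic_on U'"
    using U' by (simp add: holomorphic_on_open field_differentiable_def)
  have tU: "0 + of_real t * e \<in> U'" if "t \<in> {a..b}" for t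
    using U[OF that] by (simp add: U'_def scaleR_conv_of_real)
  have vd: "(\<gamma> has_vector_derivative deriv K (0 + of_real t * e) * e) (at t)" if t: "t \<in> {a..b}" for t
    unfolding \<gamma>_def[abs_def]
    by (rule has_vector_derivative_along_line[OF holomorphic_derivI[OF Khol U' tU[OF t]]])
  have "continuous_on {a..b} (\<lambda>t. deriv K (0 + of_real t * e) * e)"
    by (rule continuous_on_mult_right, rule continuous_on_compose2[OF holomorphic_on_imp_continuous_on[OF holomorphic_deriv[OF Khol U']]])
      (use tU in \<open>auto intro!: continuous_intros\<close>)
  then have C1: "\<gamma> C1_differentiable_on {a..b}"
    unfolding C1_differentiable_on_def by (intro exI conjI ballI) (rule vd, assumption)
  have inv: "chart_inv c (\<gamma> t) = p (\<phi> (t *\<^sub>R e))" and im: "\<gamma> t \<in> chart_image c" if "t \<in> {a..b}" for t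
    using base_chart(5,8)[OF c] U[OF that] by (simp_all add: \<gamma>_def K_def scaleR_conv_of_real)
  have "joined (chart_inv c (\<gamma> a)) (chart_inv c (\<gamma> b)) (integral {a..b} (\<lambda>t. ds c (chart_inv c (\<gamma> t)) * norm (vector_derivative \<gamma> (at t))))"
    by (rule joined_arc[OF c ab C1]) (auto simp only: image_subset_iff im)
  from ldist_le[OF this] have "ldist (p (\<phi> (a *\<^sub>R e))) (p (\<phi> (b *\<^sub>R e))) \<le> integral {a..b} (\<lambda>t. ds c (chart_inv c (\<gamma> t)) * norm (vector_derivative \<gamma> (at t)))"
    by (simp only: inv[of a] inv[of b] atLeastAtMost_iff ab order_refl simp_thms)
  also have "\<dots> = integral {a..b} (\<lambda>t. spd E \<phi> (t *\<^sub>R e))"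
  proof (rule integral_cong)
    fix t assume t: "t \<in> {a..b}"
    have tu: "t *\<^sub>R e \<in> U" "p (\<phi> (t *\<^sub>R e)) \<in> fst c" using U[OF t] by auto
    show "ds c (chart_inv c (\<gamma> t)) * norm (vector_derivative \<gamma> (at t)) = spd E \<phi> (t *\<^sub>R e)"
      unfolding inv[OF t] vector_derivative_at[OF vd[OF t]] using ds11_eq(1)[OF c \<phi> tu] e
      by (simp add: norm_mult K_def[abs_def] scaleR_conv_of_real)
  qed
  finally show ?thesis .
qed

text \<open>A radius need not lie in one chart. The bound by increments of a primitive
  \<open>G\<close> is additive, so Bolzano's bisection principle reduces it to short pieces, each
  inside one chart.\<close>

lemma flow_radial_length:
  assumes \<phi>: "holm E \<phi> U" and st: "s \<le> t" and e: "cmod e = 1"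
    and U: "\<And>x. x \<in> {s..t} \<Longrightarrow> x *\<^sub>R e \<in> U"
    and G: "\<And>x. x \<in> {s..t} \<Longrightarrow> (G has_real_derivative G' x) (at x)" "\<And>x. x \<in> {s..t} \<Longrightarrow> spd E \<phi> (x *\<^sub>R e) \<le> G' x"
  shows "ldist (p (\<phi> (s *\<^sub>R e))) (p (\<phi> (t *\<^sub>R e))) \<le> G t - G s"
proof -
  define Q where "Q a b \<longleftrightarrow> (s \<le> a \<longrightarrow> b \<le> t \<longrightarrow> a \<le> b \<longrightarrow> ldist (p (\<phi> (a *\<^sub>R e))) (p (\<phi> (b *\<^sub>R e))) \<le> G b - G a)" for a b
  have "Q s t"
    using st
  proof (induction rule: Bolzano)
    case (trans a b c)
    show ?case unfolding Q_def
    proof (intro impI)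
      assume "s \<le> a" "c \<le> t" "a \<le> c"
      then have "ldist (p (\<phi> (a *\<^sub>R e))) (p (\<phi> (b *\<^sub>R e))) \<le> G b - G a" "ldist (p (\<phi> (b *\<^sub>R e))) (p (\<phi> (c *\<^sub>R e))) \<le> G c - G b"
        using trans unfolding Q_def by simp_all
      then show "ldist (p (\<phi> (a *\<^sub>R e))) (p (\<phi> (c *\<^sub>R e))) \<le> G c - G a"
        using ldist_triangle[of "p (\<phi> (a *\<^sub>R e))" "p (\<phi> (c *\<^sub>R e))" "p (\<phi> (b *\<^sub>R e))"] by linarith
    qed
  next
    case (local x)
    then have xU: "x *\<^sub>R e \<in> U" using U by simp
    obtain c where c: "c \<in> C" "p (\<phi> (x *\<^sub>R e)) \<in> fst c" using base_chart_ex by blast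
    have "continuous_on U (\<lambda>w. p (\<phi> w))"
      by (rule continuous_on_compose2[OF p_cont[of UNIV] holmD(2)[OF \<phi>]]) simp
    then have oU: "open (U \<inter> (\<lambda>w. p (\<phi> w)) -` fst c)"
      by (rule continuous_open_preimage[OF _ holmD(1)[OF \<phi>] base_chart(1)[OF c(1)]])
    have xc: "x *\<^sub>R e \<in> U \<inter> (\<lambda>w. p (\<phi> w)) -` fst c" using xU c(2) by simp
    from bspec[OF iffD1[OF open_contains_ball oU] xc] obtain d where d: "0 < d" "ball (x *\<^sub>R e) d \<subseteq> U \<inter> (\<lambda>w. p (\<phi> w)) -` fst c"
      by blast
    show ?case
    proof (intro exI[of _ d] conjI allI impI d(1))
      fix a b assume ab: "a \<le> x \<and> x \<le> b \<and> b - a < d"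
      show "Q a b" unfolding Q_def
      proof (intro impI)
        assume sa: "s \<le> a" and bt: "b \<le> t" and "a \<le> b"
        have inU: "y *\<^sub>R e \<in> U \<and> p (\<phi> (y *\<^sub>R e)) \<in> fst c" if y: "y \<in> {a..b}" for y
        proof -
          have "dist (x *\<^sub>R e) (y *\<^sub>R e) = \<bar>x - y\<bar>" using e by (simp add: dist_norm flip: scaleR_diff_left)
          then have "dist (x *\<^sub>R e) (y *\<^sub>R e) < d" using ab y by (simp only: atLeastAtMost_iff) linarith
          then have "y *\<^sub>R e \<in> ball (x *\<^sub>R e) d" by (rule iffD2[OF mem_ball])
          then show ?thesis using d(2) by blast
        qed
        have "ldist (p (\<phi> (a *\<^sub>R e))) (p (\<phi> (b *\<^sub>R e))) \<le> integral {a..b} (\<lambda>t. spd E \<phi> (t *\<^sub>R e))"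
          by (rule flow_arc_length[OF \<phi> c(1) \<open>a \<le> b\<close> e inU])
        also have "\<dots> \<le> G b - G a"
        proof (rule has_integral_le[OF integrable_integral])
          show "(\<lambda>t. spd E \<phi> (t *\<^sub>R e)) integrable_on {a..b}"
            by (rule integrable_continuous_interval, rule continuous_on_compose2[OF continuous_on_spd[OF \<phi>]], intro continuous_intros) (use inU in blast)
          show "(G' has_integral G b - G a) {a..b}"
          proof (rule fundamental_theorem_of_calculus[OF \<open>a \<le> b\<close>])
            fix y assume "y \<in> {a..b}"
            then show "(G has_vector_derivative G' y) (at y within {a..b})"
              using G(1)[of y] sa bt by (simp add: has_real_derivative_iff_has_vector_derivative has_vector_derivative_at_within)
          qed
          show "spd E \<phi> (y *\<^sub>R e) \<le> G' y" if "y \<in> {a..b}" for y using G(2)[of y] that sa bt by auto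
        qed
        finally show "ldist (p (\<phi> (a *\<^sub>R e))) (p (\<phi> (b *\<^sub>R e))) \<le> G b - G a" .
      qed
    qed
  qed
  then show ?thesis using st by (simp add: Q_def)
qed

text \<open>The speed is at most a multiple of (R - t)^(-2/3), whose primitive - H tends to 0 at R.
  So the projected radius is Cauchy and converges in the base. Over an evenly covered neighbourhood
  of the limit the end of the radius is connected and stays in one sheet, through which the limit is
  lifted.\<close>

lemma complete_radial_limit:
  assumes wc: "weakly_complete C p E" and R: "0 < R" and \<phi>: "imm E \<phi> (ball 0 R)" and e: "cmod e = 1"
    and K: "\<And>t. \<lbrakk>0 \<le> t; t < R\<rbrakk> \<Longrightarrow> (cmod (thf E \<phi> (t *\<^sub>R e)) + cmod (omf E \<phi> (t *\<^sub>R e)))^3 * (R - t)\<^sup>2 \<le> K"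
  shows "\<exists>y. ((\<lambda>t. \<phi> (t *\<^sub>R e)) \<longlongrightarrow> y) (at_left R)"
proof -
  have \<phi>h: "holm E \<phi> (ball 0 R)" using \<phi> by (simp add: imm_def)
  define P where "P t = p (\<phi> (t *\<^sub>R e))" for t :: real
  \<comment> \<open>As K + 1 \<ge> 1, its cube is at least K; this spares a cube root in the bound
    for the speed.\<close>
  define \<kappa> where "\<kappa> = K + 1"
  define H where "H t = 3 * \<kappa> * (R - t) powr (1/3)" for t
  have "0 \<le> (cmod (thf E \<phi> (0 *\<^sub>R e)) + cmod (omf E \<phi> (0 *\<^sub>R e)))^3 * (R - 0)\<^sup>2" by simp
  then have K0: "0 \<le> K" using K[of 0] R by linarith
  then have \<kappa>: "0 < \<kappa>" "K \<le> \<kappa> ^ 3"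
    using self_le_power[of \<kappa> 3] by (auto simp: \<kappa>_def)
  have H0: "0 \<le> H t" for t using \<kappa>(1) by (simp add: H_def)
  have inB: "t *\<^sub>R e \<in> ball 0 R" if "0 \<le> t" "t < R" for t using that e by simp
  have bound: "spd E \<phi> (t *\<^sub>R e) \<le> \<kappa> * (R - t) powr (- 2/3)" if t: "0 \<le> t" "t < R" for t
  proof -
    let ?s = "cmod (thf E \<phi> (t *\<^sub>R e)) + cmod (omf E \<phi> (t *\<^sub>R e))"
    have "((R - t) powr (- 2/3)) ^ 3 = (R - t) powr (- 2)"
      using t by (simp add: powr_power)
    also have "\<dots> = 1 / (R - t)\<^sup>2" using t by (simp add: powr_minus divide_inverse)
    finally have h3: "(\<kappa> * (R - t) powr (- 2/3)) ^ 3 = \<kappa> ^ 3 / (R - t)\<^sup>2" by (simp add: power_mult_distrib)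
    have "?s ^ 3 * (R - t)\<^sup>2 \<le> \<kappa> ^ 3" using K[OF t] \<kappa>(2) by linarith
    then have "?s ^ 3 \<le> \<kappa> ^ 3 / (R - t)\<^sup>2" using t by (simp add: pos_le_divide_eq)
    then have "?s ^ Suc 2 \<le> (\<kappa> * (R - t) powr (- 2/3)) ^ Suc 2" using h3 by (simp add: numeral_3_eq_3)
    then have "?s \<le> \<kappa> * (R - t) powr (- 2/3)"
      by (rule power_le_imp_le_base) (use \<kappa>(1) in simp)
    moreover have "spd E \<phi> (t *\<^sub>R e) \<le> cmod (omf E \<phi> (t *\<^sub>R e)) + cmod (thf E \<phi> (t *\<^sub>R e))"
      unfolding spd_def by (rule sqrt_sum_squares_le_sum) simp_all
    ultimately show ?thesis by linarith
  qed
  have H': "((\<lambda>t. - H t) has_real_derivative \<kappa> * (R - t) powr (- 2/3)) (at t)" if "t < R" for t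
    unfolding H_def using that by (auto intro!: derivative_eq_intros)
  have D1: "ldist (P s) (P t) \<le> H s" if "0 \<le> s" "s \<le> t" "t < R" for s t
  proof -
    have "ldist (P s) (P t) \<le> - H t - - H s" unfolding P_def
    proof (rule flow_radial_length[OF \<phi>h that(2) e, where G' = "\<lambda>t. \<kappa> * (R - t) powr (- 2/3)"])
      fix x assume "x \<in> {s..t}"
      then have x: "0 \<le> x" "x < R" using that by auto
      show "x *\<^sub>R e \<in> ball 0 R" by (rule inB[OF x])
      show "((\<lambda>t. - H t) has_real_derivative \<kappa> * (R - x) powr (- 2/3)) (at x)" by (rule H'[OF x(2)])
      show "spd E \<phi> (x *\<^sub>R e) \<le> \<kappa> * (R - x) powr (- 2/3)" by (rule bound[OF x])
    qed
    then show ?thesis using H0[of t] by linarith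
  qed
  have D: "ldist (P s) (P t) \<le> H s + H t" if "0 \<le> s" "s < R" "0 \<le> t" "t < R" for s t
    using D1[of s t] D1[of t s] that H0[of s] H0[of t] ldist_commute[of "P s" "P t"] by linarith
  have lim: "(H \<longlongrightarrow> 0) (at_left R)"
  proof -
    have 1: "((\<lambda>t. R - t) \<longlongrightarrow> 0) (at_left R)" by (auto intro!: tendsto_eq_intros)
    have "((\<lambda>t. (R - t) powr (1/3)) \<longlongrightarrow> 0) (at_left R)"
      by (rule tendsto_zero_powrI[OF 1 tendsto_const]) (auto simp: eventually_at_filter)
    from tendsto_mult_left[OF this, of "3 * \<kappa>"] show ?thesis by (simp add: H_def[abs_def])
  qed
  have small: "\<exists>t0. 0 \<le> t0 \<and> t0 < R \<and> (\<forall>t. t0 < t \<longrightarrow> t < R \<longrightarrow> H t < \<delta>)" if \<delta>: "0 < \<delta>" for \<delta>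
  proof -
    have "\<forall>\<^sub>F t in at_left R. H t < \<delta>" using order_tendstoD(2)[OF lim \<delta>] .
    then obtain b where b: "b < R" "\<And>y. b < y \<Longrightarrow> y < R \<Longrightarrow> H y < \<delta>" unfolding eventually_at_left_field by blast
    then show ?thesis using R by (intro exI[of _ "max 0 b"]) auto
  qed
  \<comment> \<open>Completeness speaks of sequences, so the radius is sampled at parameters tending
    to R; \<open>D\<close> then transfers the limit to all t.\<close>
  define x where "x k = R * (1 - inverse (real (Suc k)))" for k
  have x: "0 \<le> x k" "x k < R" for k
    using R by (auto simp: x_def field_simps)
  have "x \<longlonglongrightarrow> R * (1 - 0)" unfolding x_def by (intro tendsto_intros LIMSEQ_inverse_real_of_nat)
  then have xlim: "x \<longlonglongrightarrow> R" by simp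
  have xsmall: "\<exists>N. \<forall>k\<ge>N. H (x k) < \<delta>" if \<delta>: "0 < \<delta>" for \<delta>
  proof -
    obtain t0 where t0: "0 \<le> t0" "t0 < R" "\<And>t. t0 < t \<Longrightarrow> t < R \<Longrightarrow> H t < \<delta>" using small[OF \<delta>] by blast
    have "\<forall>\<^sub>F k in sequentially. t0 < x k" using order_tendstoD(1)[OF xlim t0(2)] .
    then show ?thesis unfolding eventually_sequentially using t0(3) x(2) by blast
  qed
  have "ld.MCauchy (\<lambda>k. P (x k))"
    unfolding ld.MCauchy_def
  proof (intro conjI allI impI subset_UNIV)
    fix \<epsilon> :: real assume "0 < \<epsilon>"
    then obtain N where N: "\<And>k. N \<le> k \<Longrightarrow> H (x k) < \<epsilon> / 2" using xsmall[of "\<epsilon> / 2"] by auto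
    have "ldist (P (x k)) (P (x k')) < \<epsilon>" if "N \<le> k" "N \<le> k'" for k k'
      using D[OF x x, of k k'] N[OF that(1)] N[OF that(2)] by linarith
    then show "\<exists>N. \<forall>k k'. N \<le> k \<longrightarrow> N \<le> k' \<longrightarrow> ldist (P (x k)) (P (x k')) < \<epsilon>" by blast
  qed
  then obtain y where y: "limitin ld.mtopology (\<lambda>k. P (x k)) y sequentially"
    using wc unfolding weakly_complete_def ld.mcomplete_def by blast
  have near: "\<exists>t0. 0 \<le> t0 \<and> t0 < R \<and> (\<forall>t. t0 < t \<longrightarrow> t < R \<longrightarrow> ldist y (P t) < \<delta>)" if \<delta>: "0 < \<delta>" for \<delta>
  proof -
    have d3: "0 < \<delta> / 3" using \<delta> by simp
    obtain t0 where t0: "0 \<le> t0" "t0 < R" "\<And>t. t0 < t \<Longrightarrow> t < R \<Longrightarrow> H t < \<delta> / 3" using small[OF d3] by blast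
    obtain N1 where N1: "\<And>k. N1 \<le> k \<Longrightarrow> H (x k) < \<delta> / 3" using xsmall[OF d3] by blast
    obtain N2 where N2: "\<And>k. N2 \<le> k \<Longrightarrow> ldist (P (x k)) y < \<delta> / 3"
      using y d3 unfolding ld.limit_metric_sequentially by blast
    let ?k = "max N1 N2"
    have "ldist y (P t) < \<delta>" if t: "t0 < t" "t < R" for t
    proof -
      have "ldist (P (x ?k)) (P t) \<le> H (x ?k) + H t" by (rule D[OF x]) (use t t0 in auto)
      then show ?thesis
        using ldist_triangle[of y "P t" "P (x ?k)"] ldist_commute[of y "P (x ?k)"] N1[of ?k] N2[of ?k] t0(3)[OF t] by simp
    qed
    then show ?thesis using t0 by blast
  qed
  have near_open: "\<exists>t0. 0 \<le> t0 \<and> t0 < R \<and> (\<forall>t. t0 < t \<longrightarrow> t < R \<longrightarrow> P t \<in> N)" if N: "open N" "y \<in> N" for N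
  proof -
    obtain \<delta> where \<delta>: "0 < \<delta>" "\<forall>z. ldist y z < \<delta> \<longrightarrow> z \<in> N" using ldist_small_nhd[OF N] by blast
    then show ?thesis using near[OF \<delta>(1)] by blast
  qed
  have Plim: "(P \<longlongrightarrow> y) (at_left R)"
  proof (rule topological_tendstoI)
    fix N assume "open N" "y \<in> N"
    from near_open[OF this] show "\<forall>\<^sub>F t in at_left R. P t \<in> N" unfolding eventually_at_left_field by blast
  qed
  obtain T v where T: "y \<in> T" "openin (top_of_set UNIV) T" "\<Union>v = UNIV \<inter> p -` T"
      "\<forall>u\<in>v. openin (top_of_set UNIV) u" "pairwise disjnt v" "\<forall>u\<in>v. \<exists>q. homeomorphism u T p q"
    using p_covering unfolding covering_space_def by (meson UNIV_I)
  have oT: "open T" and ov: "\<And>u. u \<in> v \<Longrightarrow> open u" using T(2,4) by auto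
  obtain t0 where t0: "0 \<le> t0" "t0 < R" "\<And>t. t0 < t \<Longrightarrow> t < R \<Longrightarrow> P t \<in> T" using near_open[OF oT T(1)] by blast
  define S where "S = (\<lambda>t. \<phi> (t *\<^sub>R e)) ` {t0<..<R}"
  have "continuous_on {t0<..<R} (\<lambda>t. \<phi> (t *\<^sub>R e))"
    by (rule continuous_on_compose2[OF holmD(2)[OF \<phi>h]]) (use t0(1) e in \<open>auto intro!: continuous_intros\<close>)
  then have cS: "connected S" unfolding S_def by (rule connected_continuous_image) simp
  have SU: "S \<subseteq> \<Union>v" using t0(3) T(3) by (auto simp: S_def P_def)
  obtain t1 where t1: "t0 < t1" "t1 < R" using dense[OF t0(2)] by blast
  then have "\<phi> (t1 *\<^sub>R e) \<in> S" by (auto simp: S_def)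
  then obtain V where V: "V \<in> v" "\<phi> (t1 *\<^sub>R e) \<in> V" "V \<inter> S \<noteq> {}" using SU by blast
  \<comment> \<open>V and the union of the other sheets are disjoint open sets that cover the
    connected set \<open>S\<close>.\<close>
  have "V \<inter> \<Union>(v - {V}) \<inter> S = {}" using T(5) V(1) by (auto simp: pairwise_def disjnt_iff)
  then have "\<Union>(v - {V}) \<inter> S = {}"
    using connectedD[OF cS ov[OF V(1)], of "\<Union>(v - {V})"] V(3) SU ov by blast
  then have SV: "S \<subseteq> V" using SU by blast
  obtain q where q: "homeomorphism V T p q" using T(6) V(1) by blast
  have "((\<lambda>t. q (P t)) \<longlongrightarrow> q y) (at_left R)"
  proof (rule continuous_on_tendsto_compose[OF _ Plim T(1)])
    show "continuous_on T q" using q by (simp add: homeomorphism_def)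
    show "\<forall>\<^sub>F t in at_left R. P t \<in> T" using topological_tendstoD[OF Plim oT T(1)] .
  qed
  moreover have "\<forall>\<^sub>F t in at_left R. q (P t) = \<phi> (t *\<^sub>R e)"
    unfolding eventually_at_left_field
  proof (intro exI[of _ t0] conjI t0(2) allI impI)
    fix t assume "t0 < t" "t < R"
    then have "\<phi> (t *\<^sub>R e) \<in> V" using SV by (auto simp: S_def)
    then show "q (P t) = \<phi> (t *\<^sub>R e)" unfolding P_def by (rule homeomorphism_apply1[OF q])
  qed
  ultimately have "((\<lambda>t. \<phi> (t *\<^sub>R e)) \<longlongrightarrow> q y) (at_left R)" by (rule Lim_transform_eventually)
  then show ?thesis by (rule exI)
qed

end

theorem corollary3p3:
  fixes A C :: "'a::{t2_space, second_countable_topology} chart set"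
    and p :: "'b::t2_space \<Rightarrow> 'a"
    and f n :: "'a \<Rightarrow> mat2"
    and E :: "'b \<Rightarrow> mat2"
    and \<alpha> :: "nat \<Rightarrow> complex"
  assumes "connected (UNIV :: 'a set)"
    and "oriented_smooth_atlas A"
    and "flat_front A f n"
    and "universal_cover p"
    and "complex_structure_on A C"
    and "canonical_lift C p f n E"
    and "weakly_complete C p E"
    and "inj_on \<alpha> {1..7}"
  shows "\<exists>\<epsilon>>0. (\<forall>j\<in>{1..7}. \<nexists>U. simple_island (lift_atlas C p) (ratio C p E) {z. cmod (z - \<alpha> j) < \<epsilon>} U)
           \<longrightarrow> congruent_to_horosphere_or_cylinder f"
proof -
  interpret canonical_front C p f n E
    using assms(1,4,5,6) by unfold_locales (auto simp: complex_structure_on_def)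
  interpret complete_legendrian E
  proof
    show "\<exists>y. ((\<lambda>t. \<phi> (t *\<^sub>R e)) \<longlongrightarrow> y) (at_left R)"
      if "0 < R" "imm E \<phi> (ball 0 R)" "cmod e = 1"
        "\<And>t. \<lbrakk>0 \<le> t; t < R\<rbrakk> \<Longrightarrow> (cmod (thf E \<phi> (t *\<^sub>R e)) + cmod (omf E \<phi> (t *\<^sub>R e)))^3 * (R - t)\<^sup>2 \<le> K"
      for R \<phi> e K
      by (rule complete_radial_limit[OF assms(7) that])
  qed
  show ?thesis
  \<comment> \<open>With an unramified point the implication holds vacuously for the radius that is
    found. Otherwise its conclusion holds, and the value 1 of \<epsilon> at the end is
    arbitrary.\<close>
  proof (cases "\<exists>\<sigma> U z j. imm E \<sigma> U \<and> z \<in> U \<and> j \<in> {1..7} \<and> thf E \<sigma> z - \<alpha> j * omf E \<sigma> z = 0 \<and>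
      deriv (thf E \<sigma>) z - \<alpha> j * deriv (omf E \<sigma>) z \<noteq> 0")
    case True
    then obtain \<sigma> U z j where h: "imm E \<sigma> U" "z \<in> U" "j \<in> {1..7}" "thf E \<sigma> z - \<alpha> j * omf E \<sigma> z = 0"
      "deriv (thf E \<sigma>) z - \<alpha> j * deriv (omf E \<sigma>) z \<noteq> 0" by blast
    obtain \<epsilon> V where "0 < \<epsilon>" "simple_island (lift_atlas C p) (ratio C p E) {z. cmod (z - \<alpha> j) < \<epsilon>} V"
      using simple_island_ex[OF h(1,2,4,5)] by blast
    then show ?thesis using h(3) by blast
  next
    case False
    then have "\<not> nondegenerate" by (intro totally_ramified_imp_degenerate[OF assms(8)]) blast
    then obtain a b where ab: "a \<noteq> 0 \<or> b \<noteq> 0" "\<And>\<phi> U z. holm E \<phi> U \<Longrightarrow> z \<in> U \<Longrightarrow> thf E \<phi> z * b = omf E \<phi> z * a"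
      by (rule degenerate_imp_constant_ratio) (erule that, (assumption | blast)+)
    have "\<exists>\<phi>. surj \<phi> \<and> imm E \<phi> UNIV \<and> (\<forall>z. thf E \<phi> z = a \<and> omf E \<phi> z = b)"
      by (rule constant_ratio_entire[OF ab(1)]) (erule (1) ab(2))
    then obtain \<phi> where \<phi>: "surj \<phi>" "imm E \<phi> UNIV" "\<And>z. thf E \<phi> z = a" "\<And>z. omf E \<phi> z = b"
      by blast
    have \<phi>h: "holm E \<phi> UNIV" using \<phi>(2) by (simp add: imm_def)
    have der: "((\<lambda>w. E (\<phi> w) $ i $ j) has_field_derivative deriv (\<lambda>w. E (\<phi> w) $ i $ j) z) (at z)" for i j z
      by (rule holomorphic_derivI[OF holmD(3)[OF \<phi>h] open_UNIV UNIV_I])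
    have "congruent_to_horosphere_or_cylinder f"
    proof (rule congruent_of_constant_forms[of "\<lambda>z. E (\<phi> z)", OF E_det ab(1)])
      show "((\<lambda>z. E (\<phi> z) $ i $ 1) has_field_derivative E (\<phi> z) $ i $ 2 * b) (at z)" for i z
        using der[of i 1 z] unfolding legendrian_derivatives(1)[OF \<phi>h UNIV_I] \<phi>(4) .
      show "((\<lambda>z. E (\<phi> z) $ i $ 2) has_field_derivative E (\<phi> z) $ i $ 1 * a) (at z)" for i z
        using der[of i 2 z] unfolding legendrian_derivatives(2)[OF \<phi>h UNIV_I] \<phi>(3) .
      have "range f = range (\<lambda>z. f (p (\<phi> z)))"
        using p_surj \<phi>(1) by (metis (no_types, lifting) image_comp o_apply image_cong)
      then show "range f = range (\<lambda>z. E (\<phi> z) ** adjoint_mat (E (\<phi> z)))" by (simp add: f_eq)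
    qed
    then show ?thesis by (intro exI[of _ 1]) simp
  qed
qed

end
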